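(* Let $0<s<1$ and let $u\in\widetilde W_0^{s,2}(S)$ be a real valued function. Then $$\int_0^\infty\int_N|\nabla u(v,z,\rho)|^2\rho^{1-2s}\,dv\,dz\,d\rho\ \ge\ 2^{1-2s}\frac{\Gamma(1-s)}{\Gamma(s)}\,C_2(n,m,s)\int_Nu^2(v,z,0)\,w_s(v,z)\,dv\,dz,$$ where $w_s$ is the weight (homogeneous of degree $-2s$) given by $$w_s=\varphi_s\,\psi_s^{-1},\qquad \varphi_s(v,z)=|(v,z)|^{-(n+m+s)},\qquad \psi_s=C_1(n,m,s)\,\varphi_s\ast|\cdot|^{-Q+2s},$$ and $$C_2(n,m,s)=4^{2s}\,\frac{\Gamma\big(\frac{n+1+s}{2}\big)}{\Gamma\big(\frac{n+1-s}{2}\big)}\,\frac{\Gamma\big(\frac{n+m+s}{2}\big)}{\Gamma\big(\frac{n+m-s}{2}\big)} .$$ The constant is sharp, but equality is never achieved (by a nonzero $u$) in $\widetilde W_0^{s,2}(S)$.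
   Context: $N$ is an $H$-type group: a simply connected step two nilpotent Lie group whose Lie algebra $\mathfrak n=\mathfrak v\oplus\mathfrak z$ (orthogonal direct sum of Euclidean spaces, $\dim\mathfrak v=2n$, $\dim\mathfrak z=m$) has $\mathfrak z$ central, $[\mathfrak v,\mathfrak v]\subset\mathfrak z$, and for every unit vector $v\in\mathfrak v$ the map $\mathrm{ad}(v)$ is a surjective isometry from the orthogonal complement (in $\mathfrak v$) of $\ker \mathrm{ad}(v)$ onto $\mathfrak z$. Elements of $N$ are written $(v,z)$, with product $(v,z)(v',z')=(v+v',z+z'+\frac12[v,v'])$ and Haar measure $dv\,dz$. $X_1,\dots,X_{2n}$ and $Z_1,\dots,Z_m$ are the left-invariant vector fields corresponding to orthonormal bases of $\mathfrak v$ and $\mathfrak z$. The homogeneous dimension is $Q=2(n+m)$; the homogeneous norm is $|(v,z)|=(|v|^4+16|z|^2)^{1/4}$ (homogeneity is with respect to the dilations $(v,z)\mapsto(\delta v,\delta^2z)$). Convolution: $f\ast g(x)=\int_Nf(xy^{-1})g(y)\,dy$. The constant $$C_1(n,m,s)=\frac{4^m}{\pi^{n+m/2}}\frac{\Gamma(n+s)\Gamma\big(\frac{n+m+s}{2}\big)}{\Gamma(s)\Gamma\big(\frac{n+s}{2}\big)}.$$ Gradient: $\nabla u=(X_1u,\dots,X_{2n}u,\tfrac12\rho Z_1u,\dots,\tfrac12\rho Z_mu,\partial_\rho u)$. The space $\widetilde W_0^{s,2}(S)$ is the completion of $C_0^\infty(N\times\mathbb R)$ with respect to the norm $\|u\|_{(s)}^2=\int_0^\infty\int_N|\nabla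 u(v,z,\rho)|^2\rho^{1-2s}\,dv\,dz\,d\rho$; $u(v,z,0)$ denotes the boundary value (trace) at $\rho=0$. *)

theory Defs
  imports "HOL-Analysis.Analysis"
begin

text \<open>
  A simply connected step two nilpotent group is its Lie algebra \<open>\<v> \<oplus> \<z>\<close> with the product
  given by the Baker-Campbell-Hausdorff formula. The Euclidean spaces \<open>\<v>\<close> and \<open>\<z>\<close>
  are the types \<open>'v\<close> and \<open>'z\<close>; as \<open>\<z>\<close> is central, the Lie bracket of
  \<open>(v, z)\<close> and \<open>(v', z')\<close> is \<open>(0, br v v')\<close>, so that \<open>br\<close> determines the Lie algebra
  (the Jacobi identity holds automatically).
\<close>

definition H_type :: "('v::euclidean_space \<Rightarrow> 'v \<Rightarrow> 'z::euclidean_space) \<Rightarrow> bool" where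
  "H_type br \<longleftrightarrow>
     bilinear br \<and> (\<forall>v. br v v = 0) \<and>
     (\<forall>v. norm v = 1 \<longrightarrow>
        (\<forall>w \<in> orthogonal_comp {k. br v k = 0}. norm (br v w) = norm w) \<and>
        br v ` orthogonal_comp {k. br v k = 0} = UNIV)"

definition gmult :: "('v::euclidean_space \<Rightarrow> 'v \<Rightarrow> 'z::euclidean_space) \<Rightarrow> 'v \<times> 'z \<Rightarrow> 'v \<times> 'z \<Rightarrow> 'v \<times> 'z" where
  "gmult br x y = (fst x + fst y, snd x + snd y + (1/2) *\<^sub>R br (fst x) (fst y))"

definition ginv :: "'v::euclidean_space \<times> 'z::euclidean_space \<Rightarrow> 'v \<times> 'z" where
  "ginv x = (- fst x, - snd x)"

definition dil :: "real \<Rightarrow> 'v::euclidean_space \<times> 'z::euclidean_space \<Rightarrow> 'v \<times> 'z" where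
  "dil \<delta> x = (\<delta> *\<^sub>R fst x, \<delta>\<^sup>2 *\<^sub>R snd x)"

definition hnorm :: "'v::euclidean_space \<times> 'z::euclidean_space \<Rightarrow> real" where
  "hnorm x = (norm (fst x) ^ 4 + 16 * (norm (snd x))\<^sup>2) powr (1/4)"

definition gconv :: "('v::euclidean_space \<Rightarrow> 'v \<Rightarrow> 'z::euclidean_space) \<Rightarrow>
    ('v \<times> 'z \<Rightarrow> real) \<Rightarrow> ('v \<times> 'z \<Rightarrow> real) \<Rightarrow> 'v \<times> 'z \<Rightarrow> real" where
  "gconv br f g x = (\<integral>y. f (gmult br x (ginv y)) * g y \<partial>lborel)"

definition hdim :: "nat \<Rightarrow> nat \<Rightarrow> real" where
  "hdim n m = 2 * (real n + real m)"

definition C1 :: "nat \<Rightarrow> nat \<Rightarrow> real \<Rightarrow> real" where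
  "C1 n m s = 4 ^ m / pi powr (real n + real m / 2) *
     (Gamma (real n + s) * Gamma ((real n + real m + s) / 2)) /
     (Gamma s * Gamma ((real n + s) / 2))"

definition C2 :: "nat \<Rightarrow> nat \<Rightarrow> real \<Rightarrow> real" where
  "C2 n m s = 4 powr (2 * s) *
     (Gamma ((real n + 1 + s) / 2) / Gamma ((real n + 1 - s) / 2)) *
     (Gamma ((real n + real m + s) / 2) / Gamma ((real n + real m - s) / 2))"

definition phi :: "nat \<Rightarrow> nat \<Rightarrow> real \<Rightarrow> 'v::euclidean_space \<times> 'z::euclidean_space \<Rightarrow> real" where
  "phi n m s x = hnorm x powr (- (real n + real m + s))"

definition psi :: "('v::euclidean_space \<Rightarrow> 'v \<Rightarrow> 'z::euclidean_space) \<Rightarrow>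
    nat \<Rightarrow> nat \<Rightarrow> real \<Rightarrow> 'v \<times> 'z \<Rightarrow> real" where
  "psi br n m s x =
     C1 n m s * gconv br (phi n m s) (\<lambda>y. hnorm y powr (- hdim n m + 2 * s)) x"

definition weight :: "('v::euclidean_space \<Rightarrow> 'v \<Rightarrow> 'z::euclidean_space) \<Rightarrow>
    nat \<Rightarrow> nat \<Rightarrow> real \<Rightarrow> 'v \<times> 'z \<Rightarrow> real" where
  "weight br n m s x = phi n m s x / psi br n m s x"

primrec continuously_differentiable :: "nat \<Rightarrow> ('a::euclidean_space \<Rightarrow> real) \<Rightarrow> bool" where
  "continuously_differentiable 0 f = continuous_on UNIV f"
| "continuously_differentiable (Suc k) f =
     ((\<forall>x. f differentiable (at x)) \<and>
      (\<forall>i\<in>Basis. continuously_differentiable k (\<lambda>x. frechet_derivative f (at x) i)))"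

definition test_function :: "('a::euclidean_space \<Rightarrow> real) \<Rightarrow> bool" where
  "test_function f \<longleftrightarrow>
     (\<forall>k. continuously_differentiable k f) \<and> compact (closure {x. f x \<noteq> 0})"

text \<open>
  The left-invariant vector field on \<open>N\<close> corresponding to \<open>a\<close> in the Lie algebra, acting on
  functions on \<open>N \<times> \<real>\<close>; the exponential map is the identity in these coordinates.
\<close>

definition left_field :: "('v::euclidean_space \<Rightarrow> 'v \<Rightarrow> 'z::euclidean_space) \<Rightarrow> 'v \<times> 'z \<Rightarrow>
    (('v \<times> 'z) \<times> real \<Rightarrow> real) \<Rightarrow> ('v \<times> 'z) \<times> real \<Rightarrow> real" where
  "left_field br a u p = deriv (\<lambda>t. u (gmult br (fst p) (t *\<^sub>R a), snd p)) 0"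

text \<open>
  The list \<open>(X\<^sub>1 u, \<dots>, \<rho>/2 Z\<^sub>1 u, \<dots>, \<partial>\<^sub>\<rho> u)\<close> is read as the coordinates of a vector in
  \<open>(\<v> \<oplus> \<z>) \<oplus> \<real>\<close> with respect to the orthonormal bases, so that its length is the
  norm of that product space.
\<close>

definition grad :: "('v::euclidean_space \<Rightarrow> 'v \<Rightarrow> 'z::euclidean_space) \<Rightarrow>
    (('v \<times> 'z) \<times> real \<Rightarrow> real) \<Rightarrow> ('v \<times> 'z) \<times> real \<Rightarrow> ('v \<times> 'z) \<times> real" where
  "grad br u p =
     ((\<Sum>i\<in>Basis. left_field br (i, 0) u p *\<^sub>R i,
       \<Sum>j\<in>Basis. (1/2 * snd p * left_field br (0, j) u p) *\<^sub>R j),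
      deriv (\<lambda>t. u (fst p, t)) (snd p))"

definition energy :: "real \<Rightarrow>
    (('v::euclidean_space \<times> 'z::euclidean_space) \<times> real \<Rightarrow> ('v \<times> 'z) \<times> real) \<Rightarrow> ennreal" where
  "energy s G =
     (\<integral>\<^sup>+p\<in>{p. 0 < snd p}. ennreal ((norm (G p))\<^sup>2 * snd p powr (1 - 2 * s)) \<partial>lborel)"

text \<open>For \<open>0 < s < 1\<close> the energy of the gradient of a test function is finite, so
  \<open>enn2real\<close> loses nothing there.\<close>

definition snorm :: "('v::euclidean_space \<Rightarrow> 'v \<Rightarrow> 'z::euclidean_space) \<Rightarrow> real \<Rightarrow>
    (('v \<times> 'z) \<times> real \<Rightarrow> real) \<Rightarrow> real" where
  "snorm br s u = sqrt (enn2real (energy s (grad br u)))"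

text \<open>
  The completion is the set of classes of Cauchy sequences of test functions, two sequences being
  identified when the norm of their difference tends to 0. In particular a test function is
  identified with \<open>0\<close> when it is constant zero for \<open>\<rho> > 0\<close>.
\<close>

definition cauchy_seqs :: "('v::euclidean_space \<Rightarrow> 'v \<Rightarrow> 'z::euclidean_space) \<Rightarrow> real \<Rightarrow>
    (nat \<Rightarrow> ('v \<times> 'z) \<times> real \<Rightarrow> real) set" where
  "cauchy_seqs br s = {f. (\<forall>k. test_function (f k)) \<and>
     (\<forall>\<epsilon>>0. \<exists>M. \<forall>j\<ge>M. \<forall>k\<ge>M. snorm br s (\<lambda>p. f j p - f k p) < \<epsilon>)}"

definition null_rel :: "('v::euclidean_space \<Rightarrow> 'v \<Rightarrow> 'z::euclidean_space) \<Rightarrow> real \<Rightarrow>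
    ((nat \<Rightarrow> ('v \<times> 'z) \<times> real \<Rightarrow> real) \<times> (nat \<Rightarrow> ('v \<times> 'z) \<times> real \<Rightarrow> real)) set" where
  "null_rel br s = {(f, g). f \<in> cauchy_seqs br s \<and> g \<in> cauchy_seqs br s \<and>
     (\<lambda>k. snorm br s (\<lambda>p. f k p - g k p)) \<longlonglongrightarrow> 0}"

definition W0 :: "('v::euclidean_space \<Rightarrow> 'v \<Rightarrow> 'z::euclidean_space) \<Rightarrow> real \<Rightarrow>
    (nat \<Rightarrow> ('v \<times> 'z) \<times> real \<Rightarrow> real) set set" where
  "W0 br s = cauchy_seqs br s // null_rel br s"

definition W0_zero :: "('v::euclidean_space \<Rightarrow> 'v \<Rightarrow> 'z::euclidean_space) \<Rightarrow> real \<Rightarrow>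
    (nat \<Rightarrow> ('v \<times> 'z) \<times> real \<Rightarrow> real) set" where
  "W0_zero br s = null_rel br s `` {\<lambda>k p. 0}"

text \<open>
  Gradient and trace extend from test functions to the completion as limits: the gradient in
  \<open>L\<^sup>2\<close> with weight \<open>\<rho>\<^bsup>1-2s\<^esup>\<close>, the trace in \<open>L\<^sup>2\<close> on compact subsets of
  \<open>N\<close>. Both limits are determined up to null sets (the gradient only on \<open>\<rho> > 0\<close>); the
  trace is required to be the limit along every sequence representing \<open>u\<close>.
\<close>

definition is_gradient :: "('v::euclidean_space \<Rightarrow> 'v \<Rightarrow> 'z::euclidean_space) \<Rightarrow> real \<Rightarrow>
    (nat \<Rightarrow> ('v \<times> 'z) \<times> real \<Rightarrow> real) set \<Rightarrow>
    (('v \<times> 'z) \<times> real \<Rightarrow> ('v \<times> 'z) \<times> real) \<Rightarrow> bool" where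
  "is_gradient br s u G \<longleftrightarrow> G \<in> borel_measurable borel \<and>
     (\<forall>f\<in>u. (\<lambda>k. energy s (\<lambda>p. grad br (f k) p - G p)) \<longlonglongrightarrow> 0)"

definition W0_grad :: "('v::euclidean_space \<Rightarrow> 'v \<Rightarrow> 'z::euclidean_space) \<Rightarrow> real \<Rightarrow>
    (nat \<Rightarrow> ('v \<times> 'z) \<times> real \<Rightarrow> real) set \<Rightarrow> ('v \<times> 'z) \<times> real \<Rightarrow> ('v \<times> 'z) \<times> real" where
  "W0_grad br s u = (SOME G. is_gradient br s u G)"

definition is_trace ::
    "(nat \<Rightarrow> ('v::euclidean_space \<times> 'z::euclidean_space) \<times> real \<Rightarrow> real) set \<Rightarrow>
    ('v \<times> 'z \<Rightarrow> real) \<Rightarrow> bool" where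
  "is_trace u g \<longleftrightarrow> g \<in> borel_measurable borel \<and>
     (\<forall>f\<in>u. \<forall>K. compact K \<longrightarrow>
        (\<lambda>k. \<integral>\<^sup>+x\<in>K. ennreal ((f k (x, 0) - g x)\<^sup>2) \<partial>lborel) \<longlonglongrightarrow> 0)"

definition W0_trace ::
    "(nat \<Rightarrow> ('v::euclidean_space \<times> 'z::euclidean_space) \<times> real \<Rightarrow> real) set \<Rightarrow>
    'v \<times> 'z \<Rightarrow> real" where
  "W0_trace u = (SOME g. is_trace u g)"

end

theory Submission imports Defs "HOL-Probability.Probability" begin

text \<open>
The function \<open>K(v, z, \<rho>) = ((\<rho>\<^sup>2 + |v|\<^sup>2)\<^sup>2 + 16|z|\<^sup>2) powr (-(n + m - s)/2)\<close> solves the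
Euler-Lagrange equation of the energy for \<open>\<rho> > 0\<close>, and its weighted conormal derivative at \<open>\<rho> = 0\<close>
is a multiple \<open>c0\<close> of the Dirac mass. Hence a potential \<open>U = g * K\<close> with bounded compactly supported
density \<open>g\<close> satisfies \<open>\<integral> \<nabla>u \<bullet> \<nabla>U = c0 \<integral> g u(., 0)\<close> and has energy at most \<open>c0 \<integral> g U(., 0)\<close>, so that
\<open>E(u) \<ge> 2 c0 \<integral> g u(., 0) - c0 \<integral> g U(., 0)\<close>. Choosing \<open>g = \<phi> f\<close> with truncations \<open>f\<close> of \<open>u(., 0)/\<psi>\<close>
and symmetrising \<open>\<integral> g U(., 0)\<close> gives the inequality with the remainder
\<open>\<integral>\<integral> \<phi>(x) \<phi>(w) k(x, w) (f(x) - f(w))\<^sup>2\<close>. Equality therefore forces \<open>u(., 0)\<close> to be a multiple of \<open>\<psi>\<close>,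
which has infinite weighted norm because \<open>\<phi> \<psi>\<close> is homogeneous of degree \<open>-Q\<close>. For sharpness, test
with the potentials of \<open>\<phi>\<close> restricted to \<open>1 \<le> |x| < 2\<^sup>j\<close>: up to boundary effects both sides are \<open>j\<close> times
the contribution of one dyadic annulus.
\<close>

section \<open>Smooth functions and auxiliary integrals\<close>

text \<open>The obstacle is that nothing natural here is a test function: the kernel is singular at
  the identity, and traces in the completion are known only in L^2 on compact sets. Densities are
  therefore bounded with bounded support, so that they pair with traces; the kernel is regularised
  by \<open>\<rho>^2 + \<delta>^2\<close> in place of \<open>\<rho>^2\<close> and cut off at gauge
  radius \<open>L\<close>. The identity |grad(chi U)|^2 = grad(chi^2 U) . grad U + U^2 |grad chi|^2
  then evaluates the energy of a cut-off potential up to an error of order L^(-(Q - 2s)). The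
  exponent of \<open>\<phi>\<close> is (Q + 2s)/2. Convolution with the kernel of degree -(Q - 2s)
  raises the degree by 2s, so \<open>\<phi> \<psi>\<close> has the critical degree -Q, divergent at
  both ends by equal dyadic amounts; sharpness and the absence of extremals both come from this. The
  constant of the theorem is \<open>c0\<close> times the normalisation \<open>C1\<close> inside
  \<open>\<psi>\<close>; the Gamma quotients in \<open>c0\<close> come from integrating the flux
  profile of the kernel at height one. The H-type condition enters through |J_z v| = |z| |v|, where
  J_z v is defined by (J_z v) . w = z . [v, w].\<close>

definition flat :: "nat \<Rightarrow> real \<Rightarrow> real" where
  "flat k t = (if t > 0 then exp (- 1 / t) / t ^ k else 0)"

text \<open>A single term of the exponential series at \<open>1/t\<close>, the one of index
  \<open>k + 2\<close>, is at most \<open>exp (1/t)\<close>. It beats the pole \<open>t ^ k\<close>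
  and leaves a factor \<open>t^2\<close>, enough for a vanishing derivative at the origin.\<close>

lemma flat_bound: "\<bar>flat k t\<bar> \<le> fact (k + 2) * t\<^sup>2"
proof (cases "t > 0")
  case True
  have s: "(\<lambda>j. (1/t) ^ j /\<^sub>R fact j) sums exp (1/t)"
    by (rule exp_converges)
  have "sum (\<lambda>j. (1/t) ^ j /\<^sub>R fact j) {k+2} \<le> exp (1/t)"
    using sum_le_suminf[of "\<lambda>j. (1/t) ^ j /\<^sub>R fact j" "{k+2}"] s True
    by (auto simp: sums_iff)
  then have "1 \<le> fact (k+2) * (t ^ (k + 2) * exp (1/t))"
    using True by (simp add: power_one_over divide_simps mult_ac del: fact_Suc add_2_eq_Suc' power_Suc)
  then have "exp (- (1/t)) \<le> fact (k+2) * t ^ (k+2)"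
    by (simp add: exp_minus field_simps)
  then have "exp (- (1/t)) / t ^ k \<le> fact (k+2) * t\<^sup>2"
    using True by (simp add: divide_le_eq power_add mult_ac power2_eq_square)
  then show ?thesis using True by (simp add: flat_def)
qed (simp add: flat_def)

text \<open>The index carries the pole created by differentiating \<open>exp (-1/t)\<close>, so the
  family is closed under derivatives up to linear combinations and higher orders need no separate
  argument.\<close>

lemma flat_deriv: "(flat k has_real_derivative (flat (k + 2) t - k * flat (k + 1) t)) (at t)"
proof -
  consider "t > 0" | "t < 0" | "t = 0" by linarith
  then show ?thesis
  proof cases
    case 1
    have "((\<lambda>t. exp (- 1 / t) / t ^ k) has_real_derivative (flat (k + 2) t - k * flat (k + 1) t)) (at t)"
    proof -
      have d1: "((\<lambda>t. exp (- 1 / t)) has_real_derivative (exp (- 1 / t) / t ^ 2)) (at t)"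
        using 1 by (auto intro!: derivative_eq_intros simp: power2_eq_square)
      have d2: "((\<lambda>t. t ^ k) has_real_derivative (real k * t ^ (k - Suc 0))) (at t)"
        by (rule DERIV_pow)
      have "(exp (- 1 / t) / t ^ 2 * t ^ k - exp (- 1 / t) * (real k * t ^ (k - Suc 0))) / (t ^ k * t ^ k)
        = exp (- 1 / t) * ((t ^ k / t ^ 2 - real k * t ^ (k - Suc 0)) / (t ^ k * t ^ k))"
        by (simp add: right_diff_distrib)
      also have "(t ^ k / t ^ 2 - real k * t ^ (k - Suc 0)) / (t ^ k * t ^ k) = 1 / t ^ (k + 2) - real k / t ^ (k + 1)"
        using 1 by (cases k) (simp_all add: divide_simps power2_eq_square, simp add: algebra_simps)
      finally have "(exp (- 1 / t) / t ^ 2 * t ^ k - exp (- 1 / t) * (real k * t ^ (k - Suc 0))) / (t ^ k * t ^ k)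
        = flat (k + 2) t - k * flat (k + 1) t"
        using 1 by (simp add: flat_def right_diff_distrib)
      then show ?thesis using DERIV_divide[OF d1 d2] 1 by simp
    qed
    moreover have ev: "\<forall>\<^sub>F x in nhds t. exp (- 1 / x) / x ^ k = flat k x"
      using eventually_nhds_in_open[of "{0<..}" t] 1
      by (auto elim!: eventually_mono simp: flat_def)
    ultimately show ?thesis
      using DERIV_cong_ev[OF refl ev refl] by blast
  next
    case 2
    have "((\<lambda>t. 0) has_real_derivative (flat (k + 2) t - k * flat (k + 1) t)) (at t)"
      using 2 by (auto simp: flat_def)
    moreover have ev: "\<forall>\<^sub>F x in nhds t. 0 = flat k x"
      using eventually_nhds_in_open[of "{..<0}" t] 2
      by (auto elim!: eventually_mono simp: flat_def)
    ultimately show ?thesis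
      using DERIV_cong_ev[OF refl ev refl] by blast
  next
    case 3
    have "((\<lambda>h. (flat k (0 + h) - flat k 0) / h) \<longlongrightarrow> 0) (at 0)"
    proof (rule Lim_null_comparison)
      show "\<forall>\<^sub>F h in at 0. norm ((flat k (0 + h) - flat k 0) / h) \<le> fact (k+2) * \<bar>h\<bar>"
      proof (intro always_eventually allI)
        fix h :: real
        show "norm ((flat k (0 + h) - flat k 0) / h) \<le> fact (k+2) * \<bar>h\<bar>"
        proof (cases "h = 0")
          case False
          have "\<bar>flat k h\<bar> \<le> (fact (k+2) * \<bar>h\<bar>) * \<bar>h\<bar>"
            using flat_bound[of k h] by (simp only: power2_eq_square mult.assoc abs_mult_self_eq)
          then show ?thesis using False by (simp add: flat_def[of k 0] divide_le_eq del: fact_Suc add_2_eq_Suc')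
        qed simp
      qed
      show "((\<lambda>h. fact (k+2) * \<bar>h\<bar>) \<longlongrightarrow> (0::real)) (at 0)"
        by (auto intro!: tendsto_eq_intros)
    qed
    then show ?thesis using 3 by (simp add: DERIV_def flat_def)
  qed
qed

text \<open>A class of expressions closed under directional derivatives; smoothness of a concrete
  function is then a matter of exhibiting its expression. Powers are restricted to positive bases,
  which admits the regularised kernel and keeps out the singular one.\<close>

inductive_set smooth_alg :: "('a::euclidean_space \<Rightarrow> real) set" where
  const: "(\<lambda>_. c) \<in> smooth_alg"
| lin: "bounded_linear l \<Longrightarrow> l \<in> smooth_alg"
| add: "f \<in> smooth_alg \<Longrightarrow> g \<in> smooth_alg \<Longrightarrow> (\<lambda>x. f x + g x) \<in> smooth_alg"
| mult: "f \<in> smooth_alg \<Longrightarrow> g \<in> smooth_alg \<Longrightarrow> (\<lambda>x. f x * g x) \<in> smooth_alg"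
| powr: "f \<in> smooth_alg \<Longrightarrow> (\<And>x. f x > 0) \<Longrightarrow> (\<lambda>x. f x powr c) \<in> smooth_alg"
| flat: "f \<in> smooth_alg \<Longrightarrow> (\<lambda>x. flat k (f x)) \<in> smooth_alg"

lemma smooth_alg_deriv:
  "f \<in> smooth_alg \<Longrightarrow> \<exists>f'. (\<forall>x. (f has_derivative f' x) (at x)) \<and> (\<forall>d. (\<lambda>x. f' x d) \<in> smooth_alg)"
proof (induction rule: smooth_alg.induct)
  case (const c)
  show ?case by (intro exI[of _ "\<lambda>x d. 0"]) (auto intro: smooth_alg.const)
next
  case (lin l)
  then show ?case
    by (intro exI[of _ "\<lambda>x. l"]) (auto intro: smooth_alg.const bounded_linear_imp_has_derivative)
next
  case (add f g)
  then obtain f' g' where "\<forall>x. (f has_derivative f' x) (at x)" "\<forall>d. (\<lambda>x. f' x d) \<in> smooth_alg"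
    "\<forall>x. (g has_derivative g' x) (at x)" "\<forall>d. (\<lambda>x. g' x d) \<in> smooth_alg" by blast
  then show ?case
    by (intro exI[of _ "\<lambda>x d. f' x d + g' x d"]) (auto intro: smooth_alg.intros has_derivative_add)
next
  case (mult f g)
  then obtain f' g' where "\<forall>x. (f has_derivative f' x) (at x)" "\<forall>d. (\<lambda>x. f' x d) \<in> smooth_alg"
    "\<forall>x. (g has_derivative g' x) (at x)" "\<forall>d. (\<lambda>x. g' x d) \<in> smooth_alg" by blast
  then show ?case using mult.hyps
    by (intro exI[of _ "\<lambda>x d. f x * g' x d + f' x d * g x"])
       (auto intro!: smooth_alg.add smooth_alg.mult has_derivative_mult)
next
  case (powr f c)
  then obtain f' where f': "\<forall>x. (f has_derivative f' x) (at x)" "\<forall>d. (\<lambda>x. f' x d) \<in> smooth_alg" by blast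
  have "((\<lambda>x. f x powr c) has_derivative (\<lambda>d. (c * f x powr (c - 1)) * f' x d)) (at x)" for x
  proof -
    have "((\<lambda>t. t powr c) has_real_derivative (c * f x powr (c - 1))) (at (f x))"
      using powr.hyps(2)[of x] by (auto intro!: derivative_eq_intros simp: powr_diff field_simps)
    then have "((\<lambda>t. t powr c) has_derivative (*) (c * f x powr (c - 1))) (at (f x))"
      by (simp add: has_field_derivative_def)
    from diff_chain_at[OF f'(1)[rule_format] this] show ?thesis by (simp add: o_def)
  qed
  moreover have "(\<lambda>x. (c * f x powr (c - 1)) * f' x d) \<in> smooth_alg" for d
    by (intro smooth_alg.mult smooth_alg.const smooth_alg.powr powr.hyps f'(2)[rule_format])
  ultimately show ?case
    by (intro exI[of _ "\<lambda>x d. (c * f x powr (c - 1)) * f' x d"]) blast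
next
  case (flat f k)
  then obtain f' where f': "\<forall>x. (f has_derivative f' x) (at x)" "\<forall>d. (\<lambda>x. f' x d) \<in> smooth_alg" by blast
  have "((\<lambda>x. flat k (f x)) has_derivative (\<lambda>d. (flat (k + 2) (f x) + (- real k) * flat (k + 1) (f x)) * f' x d)) (at x)" for x
  proof -
    have "(flat k has_derivative (*) (flat (k + 2) (f x) + (- real k) * flat (k + 1) (f x))) (at (f x))"
      using flat_deriv[of k "f x"] by (simp add: has_field_derivative_def)
    from diff_chain_at[OF f'(1)[rule_format] this] show ?thesis by (simp add: o_def)
  qed
  moreover have "(\<lambda>x. (flat (k + 2) (f x) + (- real k) * flat (k + 1) (f x)) * f' x d) \<in> smooth_alg" for d
    by (intro smooth_alg.mult smooth_alg.add smooth_alg.const smooth_alg.flat flat.hyps f'(2)[rule_format])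
  ultimately show ?case
    by (intro exI[of _ "\<lambda>x d. (flat (k + 2) (f x) + (- real k) * flat (k + 1) (f x)) * f' x d"]) blast
qed

lemma smooth_alg_sum:
  "(\<And>i. i \<in> I \<Longrightarrow> f i \<in> smooth_alg) \<Longrightarrow> (\<lambda>x. \<Sum>i\<in>I. f i x) \<in> smooth_alg"
proof (induction I rule: infinite_finite_induct)
  case (insert i I)
  then show ?case using smooth_alg.add[of "f i" "\<lambda>x. \<Sum>i\<in>I. f i x"] by simp
qed (auto intro: smooth_alg.const)

lemma smooth_alg_diff:
  assumes "f \<in> smooth_alg" "g \<in> smooth_alg" shows "(\<lambda>x. f x - g x) \<in> smooth_alg"
  using smooth_alg.add[OF assms(1) smooth_alg.mult[OF smooth_alg.const[of "-1"] assms(2)]] by simp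

lemma smooth_alg_power: "f \<in> smooth_alg \<Longrightarrow> (\<lambda>x. f x ^ k) \<in> smooth_alg"
  by (induction k) (auto intro: smooth_alg.intros)

lemma smooth_alg_continuous: "f \<in> smooth_alg \<Longrightarrow> continuous_on UNIV f"
  using smooth_alg_deriv[of f] by (meson continuous_at_imp_continuous_on has_derivative_continuous)

text \<open>Induction on the order: the directional derivatives demanded at order
  \<open>Suc k\<close> lie in the class again. The principle is aimed at classes described by an
  integral rather than by an expression.\<close>

lemma continuously_differentiable_closed_class:
  assumes C: "\<And>f. f \<in> C \<Longrightarrow> \<exists>f'. (\<forall>x. (f has_derivative f' x) (at x)) \<and> (\<forall>d. (\<lambda>x. f' x d) \<in> C)"
  shows "f \<in> C \<Longrightarrow> continuously_differentiable k f"
proof (induction k arbitrary: f)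
  case 0
  then show ?case using C[OF 0] 
    by (metis continuous_at_imp_continuous_on continuously_differentiable.simps(1) has_derivative_continuous)
next
  case (Suc k)
  obtain f' where f': "\<forall>x. (f has_derivative f' x) (at x)" "\<forall>d. (\<lambda>x. f' x d) \<in> C" using C[OF Suc.prems] by blast
  then have "frechet_derivative f (at x) = f' x" for x by (metis frechet_derivative_at)
  then show ?case using f' Suc.IH by (auto simp: differentiable_def)
qed

section \<open>Differentiation under the integral sign\<close>

lemma integrable_continuous_mult:
  fixes f :: "'w::euclidean_space \<Rightarrow> 'b::{banach, second_countable_topology}"
  assumes "continuous_on UNIV f" "integrable lborel g" "compact W" "\<And>w. w \<notin> W \<Longrightarrow> g w = 0"
  shows "integrable lborel (\<lambda>w. (g w :: real) *\<^sub>R f w)"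
proof -
  have "compact (f ` W)"
    using assms by (meson compact_continuous_image continuous_on_subset subset_UNIV)
  then obtain B where B: "\<And>w. w \<in> W \<Longrightarrow> norm (f w) \<le> B"
    by (metis compact_imp_bounded bounded_iff imageI)
  have [measurable]: "f \<in> borel_measurable borel" by (rule borel_measurable_continuous_onI[OF assms(1)])
  have [measurable]: "g \<in> borel_measurable borel" using assms(2) by auto
  show ?thesis
  proof (rule Bochner_Integration.integrable_bound[of lborel "\<lambda>w. \<bar>B\<bar> * g w"])
    show "AE w in lborel. norm (g w *\<^sub>R f w) \<le> norm (\<bar>B\<bar> * g w)"
    proof (rule AE_I2)
      fix w show "norm (g w *\<^sub>R f w) \<le> norm (\<bar>B\<bar> * g w)"
        using B[of w] assms(4)[of w]
        by (cases "w \<in> W") (auto simp: abs_mult mult.commute[of "\<bar>B\<bar>"] intro!: mult_left_mono)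
    qed
  qed (use assms in auto)
qed

text \<open>The density \<open>g\<close> is merely integrable, so all regularity comes from
  \<open>F\<close>. On the compact set \<open>W \<times> cball p 1\<close> the partial gradient of
  \<open>F\<close> is uniformly continuous, which bounds the linearisation error by
  \<open>e' * norm (q - p)\<close> uniformly in \<open>w\<close>; integrating against the modulus of
  \<open>g\<close> costs the factor \<open>G\<close>.\<close>

lemma param_integral_has_derivative:
  fixes F :: "'w::euclidean_space \<times> 'p::euclidean_space \<Rightarrow> real"
  assumes F: "\<And>x. (F has_derivative F' x) (at x)" and cF': "\<And>d. continuous_on UNIV (\<lambda>x. F' x d)"
    and g: "integrable lborel g" "compact W" "\<And>w. w \<notin> W \<Longrightarrow> g w = 0"
  shows "((\<lambda>p. \<integral>w. g w * F (w, p) \<partial>lborel) has_derivative (\<lambda>d. \<integral>w. g w * F' (w, p) (0, d) \<partial>lborel)) (at p)"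
    and "bounded_linear (\<lambda>d. \<integral>w. g w * F' (w, p) (0, d) \<partial>lborel)"
proof -
  \<comment> \<open>Representing the partial derivative in the parameter by a vector turns the
    assumed continuity in each direction into continuity of one map into a Euclidean space.\<close>
  define \<Phi> where "\<Phi> x = (\<Sum>b\<in>Basis. F' x (0, b) *\<^sub>R b)" for x :: "'w \<times> 'p"
  have lin: "bounded_linear (F' x)" for x using F[of x] by (rule has_derivative_bounded_linear)
  have \<Phi>: "F' x (0, d) = \<Phi> x \<bullet> d" for x d
  proof -
    have "bounded_linear (\<lambda>d. F' x (0, d))"
      by (rule bounded_linear_compose[OF lin]) (simp add: bounded_linear_Pair bounded_linear_zero bounded_linear_ident)
    then have "linear (\<lambda>d. F' x (0, d))" by (rule bounded_linear.linear)
    from linear_sum[OF this, of "\<lambda>b. (d \<bullet> b) *\<^sub>R b" Basis] linear_scale[OF this]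
    have "F' x (0, d) = (\<Sum>b\<in>Basis. (d \<bullet> b) *\<^sub>R F' x (0, b))"
      by (simp add: euclidean_representation)
    also have "\<dots> = \<Phi> x \<bullet> d" unfolding \<Phi>_def inner_sum_left by (intro sum.cong refl) (simp add: inner_commute)
    finally show ?thesis .
  qed
  have c\<Phi>: "continuous_on UNIV \<Phi>" unfolding \<Phi>_def by (intro continuous_intros cF')
  have cF: "continuous_on UNIV F"
    using F by (meson continuous_at_imp_continuous_on has_derivative_continuous)
  have cFp: "continuous_on UNIV (\<lambda>w. F (w, q))" for q
    by (intro continuous_on_compose2[OF cF] continuous_intros) auto
  have c\<Phi>p: "continuous_on UNIV (\<lambda>w. \<Phi> (w, q))" for q
    by (intro continuous_on_compose2[OF c\<Phi>] continuous_intros) auto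
  note int = integrable_continuous_mult[OF _ g]
  have iF: "integrable lborel (\<lambda>w. g w * F (w, q))" for q using int[OF cFp[of q]] by simp
  have i\<Phi>: "integrable lborel (\<lambda>w. g w *\<^sub>R \<Phi> (w, q))" for q using int[OF c\<Phi>p] .
  have eq: "(\<integral>w. g w * F' (w, q) (0, d) \<partial>lborel) = (\<integral>w. g w *\<^sub>R \<Phi> (w, q) \<partial>lborel) \<bullet> d" for q d
    using integral_inner_left[OF i\<Phi>[of q], of d] by (simp add: \<Phi>)
  show bl: "bounded_linear (\<lambda>d. \<integral>w. g w * F' (w, p) (0, d) \<partial>lborel)"
    unfolding eq by (rule bounded_linear_inner_right)
  show "((\<lambda>p. \<integral>w. g w * F (w, p) \<partial>lborel) has_derivative (\<lambda>d. \<integral>w. g w * F' (w, p) (0, d) \<partial>lborel)) (at p)"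
    unfolding has_derivative_at_alt
  proof (intro conjI bl allI impI)
    fix e :: real assume "e > 0"
    define G where "G = (\<integral>w. \<bar>g w\<bar> \<partial>lborel)"
    have G: "G \<ge> 0" unfolding G_def by simp
    \<comment> \<open>The denominator \<open>1 + G\<close> stays positive when \<open>g\<close>
      vanishes almost everywhere.\<close>
    define e' where "e' = e / (1 + G)"
    have e': "e' > 0" using \<open>e > 0\<close> G by (simp add: e'_def)
    have "compact (W \<times> cball p 1)" by (intro compact_Times g compact_cball)
    then have "uniformly_continuous_on (W \<times> cball p 1) \<Phi>"
      by (intro compact_uniformly_continuous continuous_on_subset[OF c\<Phi>]) auto
    then obtain \<delta> where \<delta>: "\<delta> > 0"
      "\<And>x x'. x \<in> W \<times> cball p 1 \<Longrightarrow> x' \<in> W \<times> cball p 1 \<Longrightarrow> dist x' x < \<delta> \<Longrightarrow> dist (\<Phi> x') (\<Phi> x) < e'"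
      using e' unfolding uniformly_continuous_on_def by blast
    have *: "\<bar>F (w, q) - F (w, p) - F' (w, p) (0, q - p)\<bar> \<le> norm (q - p) * e'"
      if w: "w \<in> W" and q: "norm (q - p) < min \<delta> 1" for w q
    proof -
      have "norm (F (w, q) - F (w, p) - F' (w, p) (0, q - p)) \<le> norm (q - p) * e'"
      proof (rule differentiable_bound_linearization[where S = "ball p (min \<delta> 1)" and f = "\<lambda>q. F (w, q)" and f' = "\<lambda>q d. F' (w, q) (0, d)"])
        fix t :: real assume t: "t \<in> {0..1}"
        have "t * norm (q - p) \<le> 1 * norm (q - p)" using t by (intro mult_right_mono) auto
        then show "p + t *\<^sub>R (q - p) \<in> ball p (min \<delta> 1)" using q t by (auto simp: dist_norm)
      next
        fix x assume "x \<in> ball p (min \<delta> 1)"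
        have "((\<lambda>q. (w, q)) has_derivative (\<lambda>d. (0, d))) (at x within ball p (min \<delta> 1))"
          by (auto intro!: derivative_eq_intros)
        from has_derivative_compose[OF this F]
        show "((\<lambda>q. F (w, q)) has_derivative (\<lambda>d. F' (w, x) (0, d))) (at x within ball p (min \<delta> 1))" by simp
      next
        fix x assume x: "x \<in> ball p (min \<delta> 1)"
        have "dist (\<Phi> (w, x)) (\<Phi> (w, p)) < e'"
          using x w by (intro \<delta>(2)) (auto simp: dist_commute dist_Pair_Pair)
        then have n: "norm (\<Phi> (w, x) - \<Phi> (w, p)) \<le> e'" by (simp add: dist_norm)
        show "onorm ((\<lambda>d. F' (w, x) (0, d)) - (\<lambda>d. F' (w, p) (0, d))) \<le> e'"
        proof (rule onorm_le)
          fix d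
          have "\<bar>(\<Phi> (w, x) - \<Phi> (w, p)) \<bullet> d\<bar> \<le> norm (\<Phi> (w, x) - \<Phi> (w, p)) * norm d" by (rule Cauchy_Schwarz_ineq2)
          also have "\<dots> \<le> e' * norm d" using n by (rule mult_right_mono) simp
          finally show "norm (((\<lambda>d. F' (w, x) (0, d)) - (\<lambda>d. F' (w, p) (0, d))) d) \<le> e' * norm d"
            by (simp add: \<Phi> inner_diff_left)
        qed
      qed (use \<delta> in auto)
      then show ?thesis by simp
    qed
    show "\<exists>d>0. \<forall>y. norm (y - p) < d \<longrightarrow>
       norm ((\<integral>w. g w * F (w, y) \<partial>lborel) - (\<integral>w. g w * F (w, p) \<partial>lborel) - (\<integral>w. g w * F' (w, p) (0, y - p) \<partial>lborel)) \<le> e * norm (y - p)"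
    proof (intro exI[of _ "min \<delta> 1"] conjI allI impI)
      fix q assume q: "norm (q - p) < min \<delta> 1"
      have iF': "integrable lborel (\<lambda>w. g w * F' (w, p) (0, q - p))"
        using integrable_inner_left[OF i\<Phi>[of p], of "q - p"] by (simp add: \<Phi>)
      have "(\<integral>w. g w * F (w, q) \<partial>lborel) - (\<integral>w. g w * F (w, p) \<partial>lborel) - (\<integral>w. g w * F' (w, p) (0, q - p) \<partial>lborel)
        = (\<integral>w. g w * F (w, q) - g w * F (w, p) - g w * F' (w, p) (0, q - p) \<partial>lborel)"
        using iF iF' by simp
      also have "norm \<dots> \<le> (\<integral>w. norm (g w * F (w, q) - g w * F (w, p) - g w * F' (w, p) (0, q - p)) \<partial>lborel)"
        by (rule integral_norm_bound)
      also have "\<dots> \<le> (\<integral>w. (norm (q - p) * e') * \<bar>g w\<bar> \<partial>lborel)"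
      proof (rule integral_mono)
        fix w
        have "norm (g w * F (w, q) - g w * F (w, p) - g w * F' (w, p) (0, q - p)) = \<bar>F (w, q) - F (w, p) - F' (w, p) (0, q - p)\<bar> * \<bar>g w\<bar>"
          by (simp add: abs_mult[symmetric] algebra_simps)
        also have "\<dots> \<le> (norm (q - p) * e') * \<bar>g w\<bar>"
          using *[of w q] q g(3)[of w] by (cases "w \<in> W") (auto intro!: mult_right_mono)
        finally show "norm (g w * F (w, q) - g w * F (w, p) - g w * F' (w, p) (0, q - p)) \<le> (norm (q - p) * e') * \<bar>g w\<bar>" .
      qed (use iF iF' g in auto)
      also have "\<dots> = norm (q - p) * (e' * G)" by (simp add: G_def)
      also have "\<dots> \<le> norm (q - p) * e"
        using G \<open>e > 0\<close> by (intro mult_left_mono) (auto simp: e'_def field_simps)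
      finally show "norm ((\<integral>w. g w * F (w, q) \<partial>lborel) - (\<integral>w. g w * F (w, p) \<partial>lborel) - (\<integral>w. g w * F' (w, p) (0, q - p) \<partial>lborel)) \<le> e * norm (q - p)"
        by (simp add: mult.commute)
    qed (use \<delta> in auto)
  qed
qed

text \<open>The set of all such integrals is closed under directional derivatives in the parameter:
  the derivative falls on \<open>F\<close>, which stays in \<open>smooth_alg\<close>, and leaves
  \<open>g\<close> untouched.\<close>

lemma param_integral_smooth:
  fixes F :: "'w::euclidean_space \<times> 'p::euclidean_space \<Rightarrow> real"
  assumes F: "F \<in> smooth_alg" and g: "integrable lborel g" "compact W" "\<And>w. w \<notin> W \<Longrightarrow> g w = 0"
  shows "continuously_differentiable k (\<lambda>p. \<integral>w. g w * F (w, p) \<partial>lborel)"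
proof (rule continuously_differentiable_closed_class[where C = "{\<lambda>p. \<integral>w. g w * F (w, p) \<partial>lborel | F. F \<in> smooth_alg}"])
  fix f :: "'p \<Rightarrow> real" assume "f \<in> {\<lambda>p. \<integral>w. g w * F (w, p) \<partial>lborel | F. F \<in> smooth_alg}"
  then obtain F where f: "f = (\<lambda>p. \<integral>w. g w * F (w, p) \<partial>lborel)" and F: "(F :: 'w \<times> 'p \<Rightarrow> real) \<in> smooth_alg" by blast
  obtain F' where F': "\<And>x. (F has_derivative F' x) (at x)" "\<And>d. (\<lambda>x. F' x d) \<in> smooth_alg"
    using smooth_alg_deriv[OF F] by blast
  note D = param_integral_has_derivative(1)[OF F'(1) smooth_alg_continuous[OF F'(2)] g]
  have "(\<lambda>p. \<integral>w. g w * F' (w, p) (0, d) \<partial>lborel) \<in> {\<lambda>p. \<integral>w. g w * F (w, p) \<partial>lborel | F. F \<in> smooth_alg}" for d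
    by (rule CollectI, rule exI[of _ "\<lambda>x. F' x (0, d)"]) (simp add: F'(2))
  then show "\<exists>f'. (\<forall>x. (f has_derivative f' x) (at x)) \<and> (\<forall>d. (\<lambda>x. f' x d) \<in> {\<lambda>p. \<integral>w. g w * F (w, p) \<partial>lborel | F. F \<in> smooth_alg})"
    unfolding f using D by (intro exI[of _ "\<lambda>p d. \<integral>w. g w * F' (w, p) (0, d) \<partial>lborel"]) blast
qed (use F in blast)

text \<open>Increments whose squared norms decay like \<open>4^-j\<close> tolerate the extra weight
  \<open>2^j\<close>: the weighted series still has finite integral, hence is finite almost
  everywhere, and at such points the increments decay geometrically with ratio
  \<open>1 / sqrt 2\<close>.\<close>

lemma AE_convergent_of_fast_L2:
  fixes h :: "nat \<Rightarrow> 'a \<Rightarrow> 'b::euclidean_space"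
  assumes [measurable]: "\<And>j. h j \<in> borel_measurable M"
    and b: "\<And>j. (\<integral>\<^sup>+x. ennreal ((norm (h (Suc j) x - h j x))\<^sup>2) \<partial>M) \<le> ennreal (C * (1/4)^j)" and "C \<ge> 0"
  shows "AE x in M. convergent (\<lambda>j. h j x)"
proof -
  let ?d = "\<lambda>j x. 2^j * (norm (h (Suc j) x - h j x))\<^sup>2"
  have "(\<integral>\<^sup>+x. (\<Sum>j. ennreal (?d j x)) \<partial>M) = (\<Sum>j. \<integral>\<^sup>+x. ennreal (?d j x) \<partial>M)"
    by (rule nn_integral_suminf) measurable
  also have "\<dots> \<le> (\<Sum>j. ennreal (C * (1/2)^j))"
  proof (intro suminf_le allI)
    fix j
    have "(\<integral>\<^sup>+x. ennreal (?d j x) \<partial>M) = ennreal (2^j) * (\<integral>\<^sup>+x. ennreal ((norm (h (Suc j) x - h j x))\<^sup>2) \<partial>M)"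
      by (subst nn_integral_cmult[symmetric]) (auto simp: ennreal_mult)
    also have "\<dots> \<le> ennreal (2^j) * ennreal (C * (1/4)^j)" by (intro mult_left_mono b) auto
    also have "\<dots> = ennreal (2^j * (C * (1/4)^j))" using \<open>C \<ge> 0\<close> by (simp add: ennreal_mult)
    also have "2^j * (C * (1/4)^j) = C * (1/2)^j"
    proof -
      have "(4::real)^j = 2^j * 2^j" by (simp flip: power_mult_distrib)
      then show ?thesis by (simp add: power_divide)
    qed
    finally show "(\<integral>\<^sup>+x. ennreal (?d j x) \<partial>M) \<le> ennreal (C * (1/2)^j)" .
  qed auto
  also have "\<dots> < \<top>"
  proof -
    have s: "summable (\<lambda>j. C * (1/2::real)^j)" by (rule summable_mult[OF summable_geometric]) simp
    have "(\<Sum>j. ennreal (C * (1/2)^j)) \<noteq> \<top>"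
      by (rule ennreal_suminf_neq_top[OF s]) (use \<open>C \<ge> 0\<close> in simp)
    then show ?thesis by (rule top.not_eq_extremum[THEN iffD1])
  qed
  finally have "(\<integral>\<^sup>+x. (\<Sum>j. ennreal (?d j x)) \<partial>M) \<noteq> \<infinity>" by simp
  then have "AE x in M. (\<Sum>j. ennreal (?d j x)) \<noteq> \<infinity>"
    by (intro nn_integral_PInf_AE) auto
  then show ?thesis
  proof eventually_elim
    fix x assume *: "(\<Sum>j. ennreal (?d j x)) \<noteq> \<infinity>"
    define B where "B = enn2real (\<Sum>j. ennreal (?d j x))"
    have B: "ennreal B = (\<Sum>j. ennreal (?d j x))" "B \<ge> 0" using * by (auto simp: B_def top.not_eq_extremum[symmetric])
    have "ennreal (?d j x) \<le> ennreal B" for j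
    proof -
      have "sum (\<lambda>j. ennreal (?d j x)) {j} \<le> (\<Sum>j. ennreal (?d j x))"
        by (rule sum_le_suminf) (auto intro: summableI)
      then show ?thesis unfolding B(1) by simp
    qed
    then have dB: "?d j x \<le> B" for j using B(2) by (simp add: ennreal_le_iff)
    have "norm (h (Suc j) x - h j x) \<le> sqrt B * (1 / sqrt 2)^j" for j
    proof (rule power2_le_imp_le)
      have "(sqrt B * (1 / sqrt 2)^j)\<^sup>2 = B * (1/2)^j"
      proof -
        have "((1 / sqrt 2)^j)\<^sup>2 = ((1 / sqrt 2)\<^sup>2)^j" by (metis power_mult mult.commute)
        then show ?thesis using B(2) by (simp add: power_mult_distrib power_divide)
      qed
      moreover have "(norm (h (Suc j) x - h j x))\<^sup>2 \<le> B * (1/2)^j"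
        using dB[of j] by (simp add: power_divide pos_le_divide_eq mult.commute)
      ultimately show "(norm (h (Suc j) x - h j x))\<^sup>2 \<le> (sqrt B * (1 / sqrt 2)^j)\<^sup>2" by simp
    qed (use B in auto)
    moreover have "summable (\<lambda>j. sqrt B * (1 / sqrt 2)^j)"
      by (rule summable_mult[OF summable_geometric]) simp
    ultimately have "summable (\<lambda>j. h (Suc j) x - h j x)"
      using summable_comparison_test'[of "\<lambda>j. sqrt B * (1 / sqrt 2)^j" 0 "\<lambda>j. h (Suc j) x - h j x"] by blast
    then have "convergent (\<lambda>N. \<Sum>j<N. h (Suc j) x - h j x)" by (simp add: summable_iff_convergent)
    then have "convergent (\<lambda>N. h N x - h 0 x)" using sum_lessThan_telescope[of "\<lambda>j. h j x"] by simp
    then have "convergent (\<lambda>N. (h N x - h 0 x) + h 0 x)" by (rule convergent_add) (rule convergent_const)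
    then show "convergent (\<lambda>j. h j x)" by simp
  qed
qed

section \<open>Gaussian and Gamma integrals\<close>

lemma nn_integral_gaussian_real:
  assumes "t > 0"
  shows "(\<integral>\<^sup>+x. ennreal (exp (- t * x\<^sup>2)) \<partial>lborel) = ennreal (sqrt (pi / t))"
proof -
  define \<sigma> where "\<sigma> = 1 / sqrt (2 * t)"
  have \<sigma>: "\<sigma> > 0" "\<sigma>\<^sup>2 = 1 / (2 * t)" using assms by (auto simp: \<sigma>_def power_divide)
  have "(\<integral>\<^sup>+x. ennreal (exp (- t * x\<^sup>2)) \<partial>lborel) = (\<integral>\<^sup>+x. ennreal (sqrt (pi / t)) * ennreal (normal_density 0 \<sigma> x) \<partial>lborel)"
  proof (rule nn_integral_cong)
    fix x :: real
    have "sqrt (pi / t) * normal_density 0 \<sigma> x = exp (- t * x\<^sup>2)"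
      using assms by (simp add: normal_density_def \<sigma> field_simps)
    then show "ennreal (exp (- t * x\<^sup>2)) = ennreal (sqrt (pi / t)) * ennreal (normal_density 0 \<sigma> x)"
      using assms by (simp add: ennreal_mult[symmetric])
  qed
  also have "\<dots> = ennreal (sqrt (pi / t)) * (\<integral>\<^sup>+x. ennreal (normal_density 0 \<sigma> x) \<partial>lborel)"
    by (rule nn_integral_cmult) auto
  also have "(\<integral>\<^sup>+x. ennreal (normal_density 0 \<sigma> x) \<partial>lborel) = 1"
    using \<sigma>(1) by (subst nn_integral_eq_integral) auto
  finally show ?thesis by simp
qed

lemma nn_integral_gaussian:
  assumes "t > 0"
  shows "(\<integral>\<^sup>+(x::'a::euclidean_space). ennreal (exp (- t * (norm x)\<^sup>2)) \<partial>lborel) = ennreal ((pi / t) powr (DIM('a) / 2))"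
proof -
  have "ennreal (exp (- t * (norm x)\<^sup>2)) = (\<Prod>b\<in>Basis. ennreal (exp (- t * (x \<bullet> b)\<^sup>2)))" for x :: 'a
    unfolding power2_norm_eq_inner
    by (subst euclidean_inner) (simp add: prod_ennreal exp_sum[symmetric] sum_distrib_left power2_eq_square sum_negf)
  then have "(\<integral>\<^sup>+(x::'a). ennreal (exp (- t * (norm x)\<^sup>2)) \<partial>lborel) = (\<Prod>b\<in>(Basis::'a set). (\<integral>\<^sup>+x. ennreal (exp (- t * x\<^sup>2)) \<partial>lborel))"
    using nn_integral_lborel_prod[where f = "\<lambda>(b::'a) x. ennreal (exp (- t * x\<^sup>2))"] by simp
  also have "\<dots> = ennreal (sqrt (pi / t) ^ DIM('a))"
    using assms by (simp add: nn_integral_gaussian_real[simplified] ennreal_power)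
  also have "sqrt (pi / t) ^ DIM('a) = (pi / t) powr (DIM('a) / 2)"
    using assms by (simp add: powr_half_sqrt[symmetric] powr_realpow[symmetric] powr_powr)
  finally show ?thesis .
qed

lemma Gamma_scaled_nn_integral:
  assumes "b > (0::real)" "r > 0"
  shows "(\<integral>\<^sup>+t. ennreal (indicator {0..} t * t powr (b - 1) * exp (- r * t)) \<partial>lborel) = ennreal (Gamma b * r powr (- b))"
proof -
  have "ennreal (Gamma b) = (\<integral>\<^sup>+t. ennreal (indicator {0..} t * t powr (b - 1) / exp t) \<partial>lborel)"
    using Gamma_conv_nn_integral_real[OF assms(1)] .
  also have "\<dots> = ennreal r * (\<integral>\<^sup>+t. ennreal (indicator {0..} (r * t) * (r * t) powr (b - 1) / exp (r * t)) \<partial>lborel)"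
    using nn_integral_real_affine[where c = r and t = 0 and f = "\<lambda>t. ennreal (indicator {0..} t * t powr (b - 1) / exp t)"] assms by simp
  also have "\<dots> = (\<integral>\<^sup>+t. ennreal r * ennreal (indicator {0..} (r * t) * (r * t) powr (b - 1) / exp (r * t)) \<partial>lborel)"
    by (rule nn_integral_cmult[symmetric]) measurable
  also have "\<dots> = (\<integral>\<^sup>+t. ennreal (r powr b) * ennreal (indicator {0..} t * t powr (b - 1) * exp (- r * t)) \<partial>lborel)"
  proof (rule nn_integral_cong)
    fix t :: real
    have "r * (indicator {0..} (r * t) * (r * t) powr (b - 1) / exp (r * t)) = r powr b * (indicator {0..} t * t powr (b - 1) * exp (- r * t))"
      using assms by (auto simp: indicator_def powr_mult powr_diff exp_minus field_simps zero_le_mult_iff)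
    then show "ennreal r * ennreal (indicator {0..} (r * t) * (r * t) powr (b - 1) / exp (r * t))
      = ennreal (r powr b) * ennreal (indicator {0..} t * t powr (b - 1) * exp (- r * t))"
      using assms by (simp add: ennreal_mult[symmetric] del: mult_minus_left)
  qed
  also have "\<dots> = ennreal (r powr b) * (\<integral>\<^sup>+t. ennreal (indicator {0..} t * t powr (b - 1) * exp (- r * t)) \<partial>lborel)"
    by (rule nn_integral_cmult) measurable
  finally have *: "ennreal (Gamma b) = ennreal (r powr b) * (\<integral>\<^sup>+t. ennreal (indicator {0..} t * t powr (b - 1) * exp (- r * t)) \<partial>lborel)" .
  have "ennreal (r powr (-b)) * ennreal (Gamma b) = (ennreal (r powr (-b)) * ennreal (r powr b)) * (\<integral>\<^sup>+t. ennreal (indicator {0..} t * t powr (b - 1) * exp (- r * t)) \<partial>lborel)"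
    unfolding * by (simp add: mult.assoc)
  also have "ennreal (r powr (-b)) * ennreal (r powr b) = 1"
    using assms by (simp add: ennreal_mult[symmetric] powr_add[symmetric])
  finally show ?thesis using assms by (simp add: ennreal_mult' mult.commute Gamma_real_pos less_imp_le)
qed

text \<open>The power is written as a Gamma integral of exponentials, Tonelli exchanges the order,
  and the inner integral becomes Gaussian. It lowers the exponent \<open>b\<close> by half the
  dimension, and the assumption on \<open>b\<close> keeps the result positive.\<close>

lemma nn_integral_bessel_weight:
  assumes b: "b > real DIM('a) / 2"
  shows "(\<integral>\<^sup>+(x::'a::euclidean_space). ennreal ((1 + (norm x)\<^sup>2) powr (- b)) \<partial>lborel)
    = ennreal (pi powr (DIM('a) / 2) * Gamma (b - DIM('a) / 2) / Gamma b)"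
proof -
  let ?d = "real DIM('a) / 2"
  have b0: "b > 0" using b by (rule le_less_trans[rotated]) simp
  have G: "Gamma b > 0" using b0 by (rule Gamma_real_pos)
  have "ennreal (Gamma b) * (\<integral>\<^sup>+(x::'a). ennreal ((1 + (norm x)\<^sup>2) powr (- b)) \<partial>lborel)
    = (\<integral>\<^sup>+(x::'a). ennreal (Gamma b * (1 + (norm x)\<^sup>2) powr (- b)) \<partial>lborel)"
    using G by (subst nn_integral_cmult[symmetric]) (auto simp: ennreal_mult')
  also have "\<dots> = (\<integral>\<^sup>+(x::'a). (\<integral>\<^sup>+t. ennreal (indicator {0..} t * t powr (b - 1) * exp (- (1 + (norm x)\<^sup>2) * t)) \<partial>lborel) \<partial>lborel)"
  proof (rule nn_integral_cong)
    fix x :: 'a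
    have "1 + (norm x)\<^sup>2 > 0" by (simp add: add_pos_nonneg)
    from Gamma_scaled_nn_integral[OF b0 this]
    show "ennreal (Gamma b * (1 + (norm x)\<^sup>2) powr (- b)) = (\<integral>\<^sup>+t. ennreal (indicator {0..} t * t powr (b - 1) * exp (- (1 + (norm x)\<^sup>2) * t)) \<partial>lborel)"
      by (rule sym)
  qed
  also have "\<dots> = (\<integral>\<^sup>+t. (\<integral>\<^sup>+(x::'a). ennreal (indicator {0..} t * t powr (b - 1) * exp (- (1 + (norm x)\<^sup>2) * t)) \<partial>lborel) \<partial>lborel)"
    by (rule lborel_pair.Fubini') measurable
  also have "\<dots> = (\<integral>\<^sup>+t. ennreal (pi powr ?d) * ennreal (indicator {0..} t * t powr ((b - ?d) - 1) * exp (- 1 * t)) \<partial>lborel)"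
  proof (rule nn_integral_cong_AE, use AE_lborel_singleton[of "0::real"] in eventually_elim)
    fix t :: real assume "t \<noteq> 0"
    show "(\<integral>\<^sup>+(x::'a). ennreal (indicator {0..} t * t powr (b - 1) * exp (- (1 + (norm x)\<^sup>2) * t)) \<partial>lborel)
      = ennreal (pi powr ?d) * ennreal (indicator {0..} t * t powr ((b - ?d) - 1) * exp (- 1 * t))"
    proof (cases "t > 0")
      case True
      have "(\<integral>\<^sup>+(x::'a). ennreal (indicator {0..} t * t powr (b - 1) * exp (- (1 + (norm x)\<^sup>2) * t)) \<partial>lborel)
        = (\<integral>\<^sup>+(x::'a). ennreal (t powr (b - 1) * exp (- t)) * ennreal (exp (- t * (norm x)\<^sup>2)) \<partial>lborel)"
      proof (rule nn_integral_cong)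
        fix x :: 'a
        have "exp (- (1 + (norm x)\<^sup>2) * t) = exp (- t) * exp (- t * (norm x)\<^sup>2)"
          unfolding exp_add[symmetric] by (simp add: algebra_simps)
        then show "ennreal (indicator {0..} t * t powr (b - 1) * exp (- (1 + (norm x)\<^sup>2) * t)) = ennreal (t powr (b - 1) * exp (- t)) * ennreal (exp (- t * (norm x)\<^sup>2))"
          using True by (simp add: ennreal_mult'[symmetric] mult.assoc)
      qed
      also have "\<dots> = ennreal (t powr (b - 1) * exp (- t)) * ennreal ((pi / t) powr ?d)"
        using True by (subst nn_integral_cmult) (auto simp: nn_integral_gaussian[simplified])
      also have "\<dots> = ennreal (pi powr ?d * (t powr (b - ?d - 1) * exp (- t)))"
      proof -
        have "t powr (b - ?d - 1) = t powr (b - 1) / t powr ?d"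
          by (simp add: powr_diff[symmetric] algebra_simps)
        then have "t powr (b - 1) * exp (- t) * (pi / t) powr ?d = pi powr ?d * (t powr (b - ?d - 1) * exp (- t))"
          using True by (simp add: powr_divide)
        then show ?thesis by (subst ennreal_mult'[symmetric]) auto
      qed
      finally show ?thesis using True by (simp add: ennreal_mult'[symmetric])
    qed (use \<open>t \<noteq> 0\<close> in auto)
  qed
  also have "\<dots> = ennreal (pi powr ?d) * (\<integral>\<^sup>+t. ennreal (indicator {0..} t * t powr ((b - ?d) - 1) * exp (- 1 * t)) \<partial>lborel)"
    by (rule nn_integral_cmult) measurable
  also have "\<dots> = ennreal (pi powr ?d) * ennreal (Gamma (b - ?d) * 1 powr (- (b - ?d)))"
    using b by (subst Gamma_scaled_nn_integral) auto
  finally have *: "ennreal (Gamma b) * (\<integral>\<^sup>+(x::'a). ennreal ((1 + (norm x)\<^sup>2) powr (- b)) \<partial>lborel) = ennreal (pi powr ?d * Gamma (b - ?d))"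
    by (simp add: ennreal_mult')
  have "(\<integral>\<^sup>+(x::'a). ennreal ((1 + (norm x)\<^sup>2) powr (- b)) \<partial>lborel)
    = ennreal (inverse (Gamma b)) * (ennreal (Gamma b) * (\<integral>\<^sup>+(x::'a). ennreal ((1 + (norm x)\<^sup>2) powr (- b)) \<partial>lborel))"
  proof -
    have "ennreal (inverse (Gamma b)) * ennreal (Gamma b) = 1"
      using G by (subst ennreal_mult'[symmetric]) auto
    then show ?thesis by (simp only: mult.assoc[symmetric] mult_1_left)
  qed
  also have "\<dots> = ennreal (pi powr ?d * Gamma (b - ?d) / Gamma b)"
    unfolding * using G by (subst ennreal_mult'[symmetric]) (auto simp: field_simps)
  finally show ?thesis .
qed

section \<open>H-type groups\<close>

lemma hnorm_pow4: "hnorm x ^ 4 = norm (fst x) ^ 4 + 16 * (norm (snd x))\<^sup>2"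
proof -
  have "(e powr (1/4)) ^ 4 = e" if "0 \<le> e" for e :: real
    using that by (cases "e = 0") (auto simp: powr_power)
  then show ?thesis unfolding hnorm_def by simp
qed

lemma hnorm_nonneg [simp]: "0 \<le> hnorm x" by (simp add: hnorm_def)

lemma hnorm_zero_iff [simp]: "hnorm x = 0 \<longleftrightarrow> x = 0"
proof -
  have "hnorm x = 0 \<longleftrightarrow> norm (fst x) ^ 4 + 16 * (norm (snd x))\<^sup>2 = 0" by (simp add: hnorm_def)
  also have "\<dots> \<longleftrightarrow> norm (fst x) ^ 4 = 0 \<and> (norm (snd x))\<^sup>2 = 0"
    by (subst add_nonneg_eq_0_iff) auto
  also have "\<dots> \<longleftrightarrow> x = 0" by (cases x) (auto simp: zero_prod_def)
  finally show ?thesis .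
qed

lemma hnorm_pos [simp]: "0 < hnorm x \<longleftrightarrow> x \<noteq> 0"
  using hnorm_nonneg[of x] hnorm_zero_iff[of x] by linarith

lemma hnorm_continuous: "continuous_on UNIV (hnorm :: 'v::euclidean_space \<times> 'z::euclidean_space \<Rightarrow> real)"
  unfolding hnorm_def by (intro continuous_on_powr' continuous_intros) auto

lemma borel_measurable_fst_snd [measurable (raw)]:
  fixes f :: "'a \<Rightarrow> 'b::euclidean_space \<times> 'c::euclidean_space"
  assumes "f \<in> borel_measurable M"
  shows "(\<lambda>x. fst (f x)) \<in> borel_measurable M" "(\<lambda>x. snd (f x)) \<in> borel_measurable M"
  by (rule measurable_compose[OF assms], intro borel_measurable_continuous_onI continuous_intros)+

lemma hnorm_measurable [measurable]: "(hnorm :: 'v::euclidean_space \<times> 'z::euclidean_space \<Rightarrow> real) \<in> borel_measurable borel"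
  by (rule borel_measurable_continuous_onI[OF hnorm_continuous])

lemma fst_le_hnorm: "norm (fst x) \<le> hnorm x"
proof (rule power_le_imp_le_base[of _ 3])
  show "norm (fst x) ^ Suc 3 \<le> hnorm x ^ Suc 3" using hnorm_pow4[of x] by simp
qed simp

lemma snd_le_hnorm: "4 * norm (snd x) \<le> (hnorm x)\<^sup>2"
proof (rule power2_le_imp_le)
  have "((hnorm x)\<^sup>2)\<^sup>2 = hnorm x ^ 4" by (simp flip: power_mult)
  then show "(4 * norm (snd x))\<^sup>2 \<le> ((hnorm x)\<^sup>2)\<^sup>2" using hnorm_pow4[of x] by (simp add: power_mult_distrib)
qed simp

lemma hnorm_ginv [simp]: "hnorm (ginv x) = hnorm x" by (simp add: hnorm_def ginv_def)

lemma hnorm_dil: assumes "\<delta> \<ge> 0" shows "hnorm (dil \<delta> x) = \<delta> * hnorm x"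
proof (rule power_eq_imp_eq_base[of _ 4])
  show "hnorm (dil \<delta> x) ^ 4 = (\<delta> * hnorm x) ^ 4"
    using assms by (simp add: hnorm_pow4 power_mult_distrib dil_def algebra_simps flip: power_mult)
qed (use assms in auto)

lemma norm_le_hnorm: "norm x \<le> hnorm x + (hnorm x)\<^sup>2"
proof -
  have "norm x \<le> norm (fst x) + norm (snd x)" by (metis norm_Pair_le prod.collapse)
  then show ?thesis using fst_le_hnorm[of x] snd_le_hnorm[of x] norm_ge_zero[of "snd x"] by linarith
qed

lemma hnorm_le_norm: "hnorm x ^ 4 \<le> norm x ^ 4 + 16 * (norm x)\<^sup>2"
  unfolding hnorm_pow4
  using norm_fst_le[of "fst x" "snd x"] norm_snd_le[of "snd x" "fst x"]
  by (intro add_mono power_mono mult_left_mono) auto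

lemma bounded_hnorm_ball: "bounded {x :: 'v::euclidean_space \<times> 'z::euclidean_space. hnorm x \<le> R}"
proof (rule boundedI)
  fix x :: "'v \<times> 'z" assume "x \<in> {x. hnorm x \<le> R}"
  then have "hnorm x \<le> R" by simp
  then show "norm x \<le> R + R\<^sup>2"
    using norm_le_hnorm[of x] power_mono[of "hnorm x" R 2] by auto
qed

lemma compact_hnorm_ball: "compact {x :: 'v::euclidean_space \<times> 'z::euclidean_space. hnorm x \<le> R}"
  unfolding compact_eq_bounded_closed
  by (intro conjI bounded_hnorm_ball closed_Collect_le hnorm_continuous continuous_on_const)

lemma bounded_imp_hnorm_bounded:
  assumes "bounded (K :: ('v::euclidean_space \<times> 'z::euclidean_space) set)"
  obtains R where "R > 0" "\<And>x. x \<in> K \<Longrightarrow> hnorm x \<le> R"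
proof -
  obtain B where B: "\<And>x. x \<in> K \<Longrightarrow> norm x \<le> B" using assms by (auto simp: bounded_iff)
  show ?thesis
  proof (rule that[of "1 + \<bar>B\<bar> ^ 4 + 16 * B\<^sup>2"])
    fix x assume "x \<in> K"
    then have nb: "norm x \<le> \<bar>B\<bar>" using B[of x] by linarith
    have "norm x ^ 4 \<le> \<bar>B\<bar> ^ 4" "(norm x)\<^sup>2 \<le> \<bar>B\<bar>\<^sup>2"
      using power_mono[OF nb, of 4] power_mono[OF nb, of 2] by simp_all
    then have *: "hnorm x ^ 4 \<le> \<bar>B\<bar> ^ 4 + 16 * B\<^sup>2"
      using hnorm_le_norm[of x] by auto
    show "hnorm x \<le> 1 + \<bar>B\<bar> ^ 4 + 16 * B\<^sup>2"
    \<comment> \<open>Above 1 the fourth power dominates \<open>hnorm x\<close> itself; below 1 the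
      summand 1 in the radius suffices.\<close>
    proof (cases "hnorm x \<le> 1")
      case True
      have "0 \<le> \<bar>B\<bar> ^ 4" "0 \<le> B\<^sup>2" by simp_all
      then show ?thesis using True by linarith
    next
      case False
      then have "hnorm x ^ 1 \<le> hnorm x ^ 4" by (intro power_increasing) auto
      then show ?thesis using * by simp
    qed
  qed (simp add: add_pos_nonneg)
qed

locale h_type =
  fixes br :: "'v::euclidean_space \<Rightarrow> 'v \<Rightarrow> 'z::euclidean_space" and n m :: nat and s :: real
  assumes H: "H_type br" and dimv: "DIM('v) = 2 * n" and dimz: "DIM('z) = m"
    and s0: "0 < s" and s1: "s < 1"
begin

lemma bil: "bilinear br" and br_self [simp]: "br v v = 0"
  using H by (auto simp: H_type_def)

lemma br_simps [simp]: "br (x + y) z = br x z + br y z" "br z (x + y) = br z x + br z y"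
  "br (c *\<^sub>R x) z = c *\<^sub>R br x z" "br z (c *\<^sub>R x) = c *\<^sub>R br z x"
  "br (- x) z = - br x z" "br z (- x) = - br z x" "br 0 z = 0" "br z 0 = 0"
  "br (x - y) z = br x z - br y z" "br z (x - y) = br z x - br z y"
  using bil by (auto simp: bilinear_ladd bilinear_radd bilinear_lmul bilinear_rmul bilinear_lneg bilinear_rneg
    bilinear_lzero bilinear_rzero bilinear_lsub bilinear_rsub)

lemma br_anti: "br x y = - br y x"
proof -
  have "br (x + y) (x + y) = br x x + br y x + (br x y + br y y)" by (simp del: br_self add: algebra_simps)
  then show ?thesis by (simp add: eq_neg_iff_add_eq_0 add.commute)
qed

lemma br_bounded_bilinear: "bounded_bilinear br"
  using bil bilinear_conv_bounded_bilinear by blast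

lemma n_pos: "n \<ge> 1" and m_pos: "m \<ge> 1"
  using dimv dimz DIM_positive[where 'a='v] DIM_positive[where 'a='z] by linarith+

abbreviation hball :: "real \<Rightarrow> ('v \<times> 'z) set" where "hball R \<equiv> {x. hnorm x \<le> R}"

abbreviation gm where "gm \<equiv> gmult br"

lemma gm_assoc: "gm (gm x y) z = gm x (gm y z)"
  by (simp add: gmult_def algebra_simps)

lemma gm_0 [simp]: "gm 0 x = x" "gm x 0 = x" by (auto simp: gmult_def)

lemma gm_inv [simp]: "gm (ginv x) x = 0" "gm x (ginv x) = 0"
  by (auto simp: gmult_def ginv_def zero_prod_def)

lemma gm_inv_cancel [simp]: "gm (ginv x) (gm x y) = y" "gm x (gm (ginv x) y) = y"
  "gm (gm y x) (ginv x) = y" "gm (gm y (ginv x)) x = y"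
  by (simp_all flip: gm_assoc) (simp_all add: gm_assoc)

lemma ginv_ginv [simp]: "ginv (ginv x) = x" by (simp add: ginv_def)

lemma ginv_gm: "ginv (gm x y) = gm (ginv y) (ginv x)"
  by (simp add: gmult_def ginv_def br_anti[of "fst x" "fst y"])

lemma hnorm_sym: "hnorm (gm (ginv x) y) = hnorm (gm (ginv y) x)"
  using hnorm_ginv[of "gm (ginv x) y"] by (simp add: ginv_gm)

lemma dil_gm: "dil d (gm x y) = gm (dil d x) (dil d y)"
  by (simp add: dil_def gmult_def algebra_simps power2_eq_square)

lemma dil_ginv: "dil d (ginv x) = ginv (dil d x)"
  by (simp add: dil_def ginv_def)

lemma br_cont [continuous_intros]:
  "continuous_on S f \<Longrightarrow> continuous_on S g \<Longrightarrow> continuous_on S (\<lambda>x. br (f x) (g x))"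
  by (rule bounded_bilinear.continuous_on[OF br_bounded_bilinear])

lemma gm_cont [continuous_intros]:
  "continuous_on S f \<Longrightarrow> continuous_on S g \<Longrightarrow> continuous_on S (\<lambda>x. gm (f x) (g x))"
  unfolding gmult_def by (intro continuous_intros)

lemma ginv_cont [continuous_intros]:
  "continuous_on S f \<Longrightarrow> continuous_on S (\<lambda>x. ginv (f x :: 'v \<times> 'z))"
  unfolding ginv_def by (intro continuous_intros)

lemma br_meas [measurable]: "(\<lambda>x. br (fst x) (snd x)) \<in> borel_measurable borel"
  by (intro borel_measurable_continuous_onI continuous_intros)

lemma br_meas' [measurable (raw)]:
  "f \<in> borel_measurable M \<Longrightarrow> g \<in> borel_measurable M \<Longrightarrow> (\<lambda>x. br (f x) (g x)) \<in> borel_measurable M"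
  using measurable_compose[of "\<lambda>x. (f x, g x)" M borel, OF _ br_meas] by (simp add: borel_prod[symmetric])

lemma gm_meas [measurable (raw)]:
  "f \<in> borel_measurable M \<Longrightarrow> g \<in> borel_measurable M \<Longrightarrow> (\<lambda>x. gm (f x) (g x)) \<in> borel_measurable M"
  by (rule measurable_compose[of "\<lambda>x. (f x, g x)" M borel "\<lambda>p. gm (fst p) (snd p)", simplified])
     (auto intro!: borel_measurable_Pair borel_measurable_continuous_onI continuous_intros)

lemma ginv_meas [measurable (raw)]:
  "f \<in> borel_measurable M \<Longrightarrow> (\<lambda>x. ginv (f x :: 'v \<times> 'z)) \<in> borel_measurable M"
  by (rule measurable_compose[of f M borel ginv]) (auto intro!: borel_measurable_continuous_onI continuous_intros)

lemma dil_meas [measurable (raw)]: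
  "f \<in> borel_measurable M \<Longrightarrow> (\<lambda>x. dil d (f x :: 'v \<times> 'z)) \<in> borel_measurable M"
  by (rule measurable_compose[of f M borel "dil d"]) (auto simp: dil_def intro!: borel_measurable_continuous_onI continuous_intros)

text \<open>For a unit vector \<open>e\<close> the vector \<open>q\<close> is the image of
  \<open>z\<close> under the adjoint of \<open>br e\<close>, and it is orthogonal to the kernel.
  Since \<open>br e\<close> maps that complement isometrically onto the centre, its adjoint is its
  inverse there and preserves norms. In the usual notation this is |J_z v| = |z| |v|, the form in
  which the H-type condition is used from here on.\<close>

lemma sum_br_sq: "(\<Sum>i\<in>Basis. (z \<bullet> br v i)\<^sup>2) = (norm z)\<^sup>2 * (norm v)\<^sup>2"
proof (cases "v = 0")
  case False
  define e where "e = (1 / norm v) *\<^sub>R v"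
  have e: "norm e = 1" "v = norm v *\<^sub>R e" using False by (auto simp: e_def)
  let ?C = "orthogonal_comp {k. br e k = 0}"
  have iso: "\<And>w. w \<in> ?C \<Longrightarrow> norm (br e w) = norm w" and sur: "br e ` ?C = UNIV"
    using H e(1) unfolding H_type_def by blast+
  define q where "q = (\<Sum>i\<in>Basis. (z \<bullet> br e i) *\<^sub>R i)"
  have q: "q \<bullet> w = z \<bullet> br e w" for w
  proof -
    have "br e w = (\<Sum>i\<in>Basis. (w \<bullet> i) *\<^sub>R br e i)"
      using bil by (subst euclidean_representation[of w, symmetric])
        (simp add: bilinear_def linear_sum linear_scale)
    then show ?thesis by (simp add: q_def inner_sum_left inner_sum_right mult.commute inner_commute)
  qed
  have "q \<in> ?C" unfolding orthogonal_comp_def orthogonal_def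
    using q by (auto simp: inner_commute[of _ q])
  obtain w where w: "w \<in> ?C" "br e w = z" using sur by (metis UNIV_I imageE)
  have "subspace ?C" by (rule subspace_orthogonal_comp)
  then have "q + w \<in> ?C" using \<open>q \<in> ?C\<close> w by (simp add: subspace_add)
  \<comment> \<open>Polarisation: the isometry is given for norms, and the inner product of
    \<open>q\<close> with a preimage \<open>w\<close> of \<open>z\<close> is recovered from
    \<open>q + w\<close>.\<close>
  from iso[OF this] have "(norm (br e q + br e w))\<^sup>2 = (norm (q + w))\<^sup>2" by simp
  moreover have "br e q \<bullet> br e q = q \<bullet> q" "br e w \<bullet> br e w = w \<bullet> w"
    using iso[OF \<open>q \<in> ?C\<close>] iso[OF w(1)] by (simp_all flip: power2_norm_eq_inner)
  ultimately have "br e q \<bullet> br e w = q \<bullet> w"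
    unfolding power2_norm_eq_inner inner_add_left inner_add_right inner_commute[of w q] inner_commute[of "br e w" "br e q"]
    by linarith
  moreover have "br e q \<bullet> z = q \<bullet> q" using q[of q] by (simp add: inner_commute)
  moreover have "q \<bullet> w = z \<bullet> z" using q[of w] w by simp
  ultimately have qq: "q \<bullet> q = z \<bullet> z" using w by simp
  have "q \<bullet> q = (\<Sum>i\<in>Basis. (z \<bullet> br e i)\<^sup>2)"
    using q by (subst euclidean_inner) (simp add: power2_eq_square)
  moreover have "(\<Sum>i\<in>Basis. (z \<bullet> br v i)\<^sup>2) = (norm v)\<^sup>2 * (\<Sum>i\<in>Basis. (z \<bullet> br e i)\<^sup>2)"
    by (subst e(2)) (simp add: power_mult_distrib sum_distrib_left)
  ultimately show ?thesis using qq by (simp add: power2_norm_eq_inner mult.commute)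
qed simp

text \<open>Summing \<open>sum_br_sq\<close> over an orthonormal basis of the centre produces its
  dimension as a factor.\<close>

lemma sum_br_norm: "(\<Sum>i\<in>Basis. (norm (br v i))\<^sup>2) = m * (norm v)\<^sup>2"
proof -
  have "(\<Sum>i\<in>Basis. (norm (br v i))\<^sup>2) = (\<Sum>i\<in>Basis. \<Sum>j\<in>Basis. (j \<bullet> br v i)\<^sup>2)"
    unfolding power2_norm_eq_inner
    by (intro sum.cong refl) (subst euclidean_inner, simp add: power2_eq_square inner_commute)
  also have "\<dots> = (\<Sum>j\<in>Basis. \<Sum>i\<in>Basis. (j \<bullet> br v i)\<^sup>2)" by (rule sum.swap)
  also have "\<dots> = m * (norm v)\<^sup>2" using dimz by (simp add: sum_br_sq)
  finally show ?thesis .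
qed

text \<open>Testing \<open>br v w\<close> against itself replaces it by a vector \<open>q\<close>
  paired with \<open>w\<close>, and \<open>sum_br_sq\<close> gives \<open>q\<close> the norm
  \<open>norm (br v w) * norm v\<close>; Cauchy-Schwarz closes the estimate with constant
  one.\<close>

lemma norm_br_le: "norm (br v w) \<le> norm v * norm w"
proof -
  let ?z = "br v w"
  have "?z = (\<Sum>i\<in>Basis. (w \<bullet> i) *\<^sub>R br v i)"
    using bil by (subst euclidean_representation[of w, symmetric])
      (simp add: bilinear_def linear_sum linear_scale)
  then have *: "(norm ?z)\<^sup>2 = (\<Sum>i\<in>Basis. (?z \<bullet> br v i) * (w \<bullet> i))"
    by (metis (no_types, lifting) power2_norm_eq_inner inner_sum_right inner_scaleR_right mult.commute sum.cong)
  define q where "q = (\<Sum>i\<in>Basis. (?z \<bullet> br v i) *\<^sub>R i)"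
  have "(norm ?z)\<^sup>2 = q \<bullet> w" unfolding * q_def inner_sum_left
    by (intro sum.cong refl) (simp add: inner_commute)
  also have "\<dots> \<le> norm q * norm w" by (rule norm_cauchy_schwarz)
  also have "norm q = norm ?z * norm v"
  proof -
    have "(norm q)\<^sup>2 = (\<Sum>i\<in>Basis. (?z \<bullet> br v i)\<^sup>2)"
      unfolding power2_norm_eq_inner[of q] by (subst euclidean_inner) (simp add: q_def power2_eq_square)
    then have "(norm q)\<^sup>2 = (norm ?z * norm v)\<^sup>2" unfolding sum_br_sq power_mult_distrib .
    then show ?thesis by (rule power2_eq_imp_eq) auto
  qed
  finally have "norm ?z * norm ?z \<le> norm ?z * (norm v * norm w)" by (simp add: power2_eq_square mult.assoc)
  then show ?thesis by (cases "?z = 0") auto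
qed

text \<open>Both coordinates are bounded by \<open>h = hnorm x + hnorm y\<close> separately, the
  central one because \<open>norm_br_le\<close> has constant one and the cross term then completes a
  square. Together they produce at most 2 h^4, well inside the (2 h)^4 allowed.\<close>

lemma hnorm_gm_le: "hnorm (gm x y) \<le> 2 * (hnorm x + hnorm y)"
proof -
  let ?h = "hnorm x + hnorm y"
  have h: "0 \<le> ?h" by (simp add: add_nonneg_nonneg)
  have "norm (fst (gm x y)) \<le> ?h"
    using norm_triangle_ineq[of "fst x" "fst y"] fst_le_hnorm[of x] fst_le_hnorm[of y] by (simp add: gmult_def)
  then have 1: "norm (fst (gm x y)) ^ 4 \<le> ?h ^ 4" by (intro power_mono) auto
  have "norm (br (fst x) (fst y)) \<le> hnorm x * hnorm y"
    using norm_br_le[of "fst x" "fst y"] mult_mono[OF fst_le_hnorm[of x] fst_le_hnorm[of y]] by auto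
  then have "4 * norm (snd (gm x y)) \<le> (hnorm x)\<^sup>2 + (hnorm y)\<^sup>2 + 2 * (hnorm x * hnorm y)"
    using norm_triangle_ineq[of "snd x + snd y" "(1/2) *\<^sub>R br (fst x) (fst y)"] norm_triangle_ineq[of "snd x" "snd y"]
      snd_le_hnorm[of x] snd_le_hnorm[of y] by (simp add: gmult_def)
  also have "\<dots> = ?h\<^sup>2" by (simp add: power2_sum)
  finally have "(4 * norm (snd (gm x y)))\<^sup>2 \<le> (?h\<^sup>2)\<^sup>2" by (intro power_mono) auto
  then have 2: "16 * (norm (snd (gm x y)))\<^sup>2 \<le> ?h ^ 4" by (simp add: power_mult_distrib flip: power_mult)
  have "0 \<le> ?h ^ 4" using h by simp
  then have "hnorm (gm x y) ^ 4 \<le> 16 * ?h ^ 4" using 1 2 unfolding hnorm_pow4[of "gm x y"] by linarith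
  also have "\<dots> = (2 * ?h) ^ 4" unfolding power_mult_distrib by simp
  finally show ?thesis using h by (subst (asm) power_mono_iff) auto
qed

lemma hnorm_quasi: "hnorm x / 2 - hnorm w \<le> hnorm (gm (ginv w) x)"
  using hnorm_gm_le[of w "gm (ginv w) x"] by simp

section \<open>Invariance and scaling of the Haar measure\<close>

lemma nn_integral_lborel_pair:
  assumes [measurable]: "f \<in> borel_measurable (borel :: ('a::euclidean_space \<times> 'b::euclidean_space) measure)"
  shows "(\<integral>\<^sup>+x. f x \<partial>lborel) = (\<integral>\<^sup>+v. (\<integral>\<^sup>+z. f (v, z) \<partial>lborel) \<partial>lborel)"
  using lborel.nn_integral_fst[of f lborel] by (simp add: lborel_prod)

lemma nn_integral_translate:
  assumes [measurable]: "f \<in> borel_measurable (borel :: 'a::euclidean_space measure)"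
  shows "(\<integral>\<^sup>+x. f (c + x) \<partial>lborel) = (\<integral>\<^sup>+x. f x \<partial>lborel)"
  by (subst (2) lborel_distr_plus[of c, symmetric]) (simp add: nn_integral_distr)

text \<open>For fixed \<open>v\<close> the bracket is a constant shift of \<open>z\<close>, so two
  Euclidean translations suffice. With the version for right multiplication this expresses
  unimodularity in exponential coordinates.\<close>

lemma nn_integral_gm_left:
  assumes [measurable]: "f \<in> borel_measurable borel"
  shows "(\<integral>\<^sup>+x. f (gm w x) \<partial>lborel) = (\<integral>\<^sup>+x. f x \<partial>lborel)"
proof -
  have "(\<integral>\<^sup>+x. f (gm w x) \<partial>lborel) = (\<integral>\<^sup>+v. (\<integral>\<^sup>+z. f (fst w + v, (snd w + (1/2) *\<^sub>R br (fst w) v) + z) \<partial>lborel) \<partial>lborel)"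
    by (subst nn_integral_lborel_pair) (auto simp: gmult_def add_ac)
  also have "\<dots> = (\<integral>\<^sup>+v. (\<integral>\<^sup>+z. f (fst w + v, z) \<partial>lborel) \<partial>lborel)"
    by (intro nn_integral_cong nn_integral_translate) measurable
  also have "\<dots> = (\<integral>\<^sup>+v. (\<integral>\<^sup>+z. f (v, z) \<partial>lborel) \<partial>lborel)"
    by (rule nn_integral_translate[of "\<lambda>v. \<integral>\<^sup>+z. f (v, z) \<partial>lborel"]) measurable
  also have "\<dots> = (\<integral>\<^sup>+x. f x \<partial>lborel)" by (rule nn_integral_lborel_pair[symmetric]) simp
  finally show ?thesis .
qed

lemma nn_integral_gm_right:
  assumes [measurable]: "f \<in> borel_measurable borel"
  shows "(\<integral>\<^sup>+x. f (gm x w) \<partial>lborel) = (\<integral>\<^sup>+x. f x \<partial>lborel)"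
proof -
  have "(\<integral>\<^sup>+x. f (gm x w) \<partial>lborel) = (\<integral>\<^sup>+v. (\<integral>\<^sup>+z. f (fst w + v, (snd w + (1/2) *\<^sub>R br v (fst w)) + z) \<partial>lborel) \<partial>lborel)"
    by (subst nn_integral_lborel_pair) (auto simp: gmult_def add_ac)
  also have "\<dots> = (\<integral>\<^sup>+v. (\<integral>\<^sup>+z. f (fst w + v, z) \<partial>lborel) \<partial>lborel)"
    by (intro nn_integral_cong nn_integral_translate) measurable
  also have "\<dots> = (\<integral>\<^sup>+v. (\<integral>\<^sup>+z. f (v, z) \<partial>lborel) \<partial>lborel)"
    by (rule nn_integral_translate[of "\<lambda>v. \<integral>\<^sup>+z. f (v, z) \<partial>lborel"]) measurable
  also have "\<dots> = (\<integral>\<^sup>+x. f x \<partial>lborel)" by (rule nn_integral_lborel_pair[symmetric]) simp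
  finally show ?thesis .
qed

lemma nn_integral_ginv:
  assumes [measurable]: "(f :: 'v \<times> 'z \<Rightarrow> ennreal) \<in> borel_measurable borel"
  shows "(\<integral>\<^sup>+x. f (ginv x) \<partial>lborel) = (\<integral>\<^sup>+x. f x \<partial>lborel)"
proof -
  have e: "(\<lambda>x. 0 + (-1) *\<^sub>R x) = (ginv :: 'v \<times> 'z \<Rightarrow> _)" by (auto simp: ginv_def prod_eq_iff)
  have L: "(lborel :: ('v \<times> 'z) measure) = distr lborel borel ginv"
    using lborel_affine[of "-1" "0 :: 'v \<times> 'z"] unfolding e by (simp add: density_1)
  have "(\<integral>\<^sup>+x. f x \<partial>lborel) = (\<integral>\<^sup>+x. f x \<partial>distr lborel borel ginv)"
    using L by simp
  also have "\<dots> = (\<integral>\<^sup>+x. f (ginv x) \<partial>lborel)"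
    by (simp add: nn_integral_distr)
  finally show ?thesis by simp
qed

abbreviation Q where "Q \<equiv> hdim n m"

text \<open>In the product basis the dilation is diagonal with \<open>2 * n\<close> entries
  \<open>d\<close> and \<open>m\<close> entries \<open>d^2\<close>, whose product is
  \<open>d powr Q\<close>.\<close>

lemma lborel_dil:
  assumes d: "d > 0"
  shows "(lborel :: ('v \<times> 'z) measure) = density (distr lborel borel (dil d)) (\<lambda>_. ennreal (d powr Q))"
proof -
  define c where "c j = (if snd j = 0 then d else d\<^sup>2)" for j :: "'v \<times> 'z"
  have e: "0 + (\<Sum>j\<in>Basis. (c j * (x \<bullet> j)) *\<^sub>R j) = dil d x" for x :: "'v \<times> 'z"
  proof -
    have "(\<Sum>j\<in>Basis. (c j * (x \<bullet> j)) *\<^sub>R j) = (\<Sum>i\<in>Basis. (d * (fst x \<bullet> i)) *\<^sub>R (i, 0)) + (\<Sum>i\<in>Basis. (d\<^sup>2 * (snd x \<bullet> i)) *\<^sub>R (0, i))"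
      unfolding Basis_prod_def
      by (subst sum.union_disjoint)
         (auto simp: c_def sum.reindex inj_on_def inner_prod_def intro!: arg_cong2[where f = "(+)"] sum.cong)
    also have "\<dots> = (d *\<^sub>R (\<Sum>i\<in>Basis. (fst x \<bullet> i) *\<^sub>R i), d\<^sup>2 *\<^sub>R (\<Sum>i\<in>Basis. (snd x \<bullet> i) *\<^sub>R i))"
      by (simp add: prod_eq_iff fst_sum snd_sum scaleR_sum_right)
    finally show ?thesis by (simp add: euclidean_representation dil_def)
  qed
  have p: "(\<Prod>j\<in>(Basis :: ('v \<times> 'z) set). \<bar>c j\<bar>) = d powr Q"
  proof -
    have "(\<Prod>j\<in>(Basis :: ('v \<times> 'z) set). \<bar>c j\<bar>) = (\<Prod>i\<in>(Basis::'v set). d) * (\<Prod>i\<in>(Basis::'z set). d\<^sup>2)"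
      unfolding Basis_prod_def using d
      by (subst prod.union_disjoint) (auto simp: c_def prod.reindex inj_on_def intro!: arg_cong2[where f = "(*)"] prod.cong,
          rule trans[OF prod.cong[OF refl, where h = "\<lambda>_. d\<^sup>2"]], auto)
    also have "\<dots> = d ^ (2 * n + 2 * m)"
      by (simp only: dimv dimz prod_constant power_add power_mult)
    also have "\<dots> = d powr (real (2 * n + 2 * m))"
      using d by (rule powr_realpow[symmetric])
    also have "real (2 * n + 2 * m) = Q" by (simp add: hdim_def)
    finally show ?thesis .
  qed
  have c0: "c j \<noteq> 0" for j using d by (simp add: c_def)
  show ?thesis
    using lborel_affine_euclidean[of c "0 :: 'v \<times> 'z", OF c0] unfolding e prod_ennreal[OF abs_ge_zero] p .
qed

lemma nn_integral_dil:
  assumes [measurable]: "(f :: 'v \<times> 'z \<Rightarrow> ennreal) \<in> borel_measurable borel" and d: "d > 0"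
  shows "(\<integral>\<^sup>+x. f x \<partial>lborel) = ennreal (d powr Q) * (\<integral>\<^sup>+x. f (dil d x) \<partial>lborel)"
proof -
  have "(\<integral>\<^sup>+x. f x \<partial>lborel) = (\<integral>\<^sup>+x. f x \<partial>density (distr lborel borel (dil d)) (\<lambda>_. ennreal (d powr Q)))"
    by (subst lborel_dil[OF d]) simp
  also have "\<dots> = ennreal (d powr Q) * (\<integral>\<^sup>+x. f (dil d x) \<partial>lborel)"
    by (simp add: nn_integral_density nn_integral_distr nn_integral_cmult)
  finally show ?thesis .
qed

lemma integral_dil:
  assumes [measurable]: "(f :: 'v \<times> 'z \<Rightarrow> real) \<in> borel_measurable borel" and d: "d > 0"
  shows "(\<integral>x. f x \<partial>lborel) = d powr Q * (\<integral>x. f (dil d x) \<partial>lborel)"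
proof -
  have "(\<integral>x. f x \<partial>lborel) = (\<integral>x. f x \<partial>density (distr lborel borel (dil d)) (\<lambda>_. ennreal (d powr Q)))"
    by (subst lborel_dil[OF d]) simp
  also have "\<dots> = d powr Q * (\<integral>x. f (dil d x) \<partial>lborel)"
    by (simp add: integral_density integral_distr)
  finally show ?thesis .
qed

lemma lborel_preserving:
  fixes T :: "'a::euclidean_space \<Rightarrow> 'a"
  assumes [measurable]: "T \<in> borel_measurable borel"
    and T: "\<And>f :: 'a \<Rightarrow> ennreal. f \<in> borel_measurable borel \<Longrightarrow> (\<integral>\<^sup>+x. f (T x) \<partial>lborel) = (\<integral>\<^sup>+x. f x \<partial>lborel)"
  shows "distr lborel borel T = lborel"
proof (rule measure_eqI)
  fix A assume "A \<in> sets (distr lborel borel T)"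
  then have [measurable]: "A \<in> sets borel" by simp
  have "emeasure (distr lborel borel T) A = (\<integral>\<^sup>+x. indicator A x \<partial>distr lborel borel T)"
    by (simp add: nn_integral_indicator)
  also have "\<dots> = (\<integral>\<^sup>+x. indicator A (T x) \<partial>lborel)" by (rule nn_integral_distr) measurable
  also have "\<dots> = (\<integral>\<^sup>+x. indicator A x \<partial>lborel)" by (rule T) measurable
  finally show "emeasure (distr lborel borel T) A = emeasure lborel A" by (simp add: nn_integral_indicator)
qed simp

lemma distr_gm: "distr lborel borel (gm w) = lborel" "distr lborel borel (\<lambda>x. gm x w) = lborel"
proof -
  show "distr lborel borel (gm w) = lborel" by (rule lborel_preserving[OF _ nn_integral_gm_left]) measurable
  show "distr lborel borel (\<lambda>x. gm x w) = lborel" by (rule lborel_preserving[OF _ nn_integral_gm_right]) measurable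
qed

lemma integral_gm:
  fixes f :: "'v \<times> 'z \<Rightarrow> 'b::{banach, second_countable_topology}"
  assumes [measurable]: "f \<in> borel_measurable borel"
  shows "(\<integral>x. f (gm w x) \<partial>lborel) = (\<integral>x. f x \<partial>lborel)" "(\<integral>x. f (gm x w) \<partial>lborel) = (\<integral>x. f x \<partial>lborel)"
  using integral_distr[of "gm w" lborel borel f] integral_distr[of "\<lambda>x. gm x w" lborel borel f] by (simp_all add: distr_gm)

lemma integrable_gm:
  fixes f :: "'v \<times> 'z \<Rightarrow> 'b::{banach, second_countable_topology}"
  assumes "integrable lborel f"
  shows "integrable lborel (\<lambda>x. f (gm w x))" "integrable lborel (\<lambda>x. f (gm x w))"
  using assms integrable_distr[of "gm w" lborel borel f] integrable_distr[of "\<lambda>x. gm x w" lborel borel f] by (simp_all add: distr_gm)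

end

section \<open>The homogeneous kernel\<close>

lemma hnorm_0 [simp]: "hnorm 0 = 0" by simp

lemma powr_pow4: "0 \<le> x \<Longrightarrow> (x ^ 4) powr y = x powr (4 * y)" for x :: real
proof -
  assume "0 \<le> x"
  then have "x ^ 4 = x powr 4" by (cases "x = 0") auto
  then show ?thesis by (simp only: powr_powr)
qed

context h_type begin

lemma Q_pos: "Q > 0" "Q \<ge> 4" using n_pos m_pos by (auto simp: hdim_def)

section \<open>Integrability of powers of the gauge\<close>

lemma emeasure_hball_finite: "emeasure lborel {x :: 'v \<times> 'z. hnorm x < r} < \<infinity>"
  by (rule emeasure_bounded_finite, rule bounded_subset[OF bounded_hnorm_ball[of r]]) auto

lemma emeasure_hball:
  assumes "r > 0"
  shows "emeasure lborel {x :: 'v \<times> 'z. hnorm x < r} = ennreal (r powr Q * measure lborel {x :: 'v \<times> 'z. hnorm x < 1})"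
proof -
  have "emeasure lborel {x :: 'v \<times> 'z. hnorm x < r} = (\<integral>\<^sup>+x. indicator {x :: 'v \<times> 'z. hnorm x < r} x \<partial>lborel)"
    by (rule nn_integral_indicator[symmetric]) measurable
  also have "\<dots> = ennreal (r powr Q) * (\<integral>\<^sup>+x. indicator {x :: 'v \<times> 'z. hnorm x < r} (dil r x) \<partial>lborel)"
    by (rule nn_integral_dil) (use assms in measurable)
  also have "(\<integral>\<^sup>+x. indicator {x :: 'v \<times> 'z. hnorm x < r} (dil r x) \<partial>lborel) = (\<integral>\<^sup>+x. indicator {x :: 'v \<times> 'z. hnorm x < 1} x \<partial>lborel)"
    using assms by (intro nn_integral_cong) (auto simp: indicator_def hnorm_dil)
  also have "\<dots> = emeasure lborel {x :: 'v \<times> 'z. hnorm x < 1}"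
    by (rule nn_integral_indicator) measurable
  also have "\<dots> = ennreal (measure lborel {x :: 'v \<times> 'z. hnorm x < 1})"
    using emeasure_hball_finite[of 1] by (intro emeasure_eq_ennreal_measure) auto
  finally show ?thesis by (simp only: ennreal_mult'[OF powr_ge_zero])
qed

lemma le_suminf_ennreal: "f j \<le> (\<Sum>i. f i :: ennreal)"
  using sum_le_suminf[of f "{j}"] by (simp add: summableI)

lemma dyadic_sum_finite:
  assumes "q < 1" "q > 0" "c \<ge> 0"
  shows "(\<Sum>j. ennreal (c * q ^ j)) < \<infinity>"
proof -
  have "summable (\<lambda>j. c * q ^ j)" by (rule summable_mult[OF summable_geometric]) (use assms in auto)
  then have "(\<Sum>j. ennreal (c * q ^ j)) \<noteq> \<top>"
    by (rule ennreal_suminf_neq_top) (use assms in auto)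
  then show ?thesis unfolding infinity_ennreal_def by (rule top.not_eq_extremum[THEN iffD1])
qed

text \<open>Dyadic decomposition toward the origin: on \<open>2^-(j+1) \<le> hnorm x < 2^-j\<close>
  the integrand is at most \<open>2^((j+1) b)\<close> and the volume is of order
  \<open>2^(-j Q)\<close>, which gives a geometric series of ratio \<open>2^(b - Q)\<close>.\<close>

lemma nn_integral_hnorm_near:
  assumes b: "b \<ge> 0" "b < Q"
  shows "(\<integral>\<^sup>+(x :: 'v \<times> 'z). ennreal (indicator {x. hnorm x < 1} x * hnorm x powr (- b)) \<partial>lborel) < \<infinity>"
proof -
  let ?V = "measure lborel {x :: 'v \<times> 'z. hnorm x < 1}"
  have "(\<integral>\<^sup>+(x :: 'v \<times> 'z). ennreal (indicator {x. hnorm x < 1} x * hnorm x powr (- b)) \<partial>lborel)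
    \<le> (\<integral>\<^sup>+(x :: 'v \<times> 'z). (\<Sum>j. ennreal (2 powr ((real j + 1) * b)) * indicator {x. hnorm x < 2 powr (- real j)} x) \<partial>lborel)"
  proof (rule nn_integral_mono)
    fix x :: "'v \<times> 'z"
    show "ennreal (indicator {x. hnorm x < 1} x * hnorm x powr (- b)) \<le> (\<Sum>j. ennreal (2 powr ((real j + 1) * b)) * indicator {x. hnorm x < 2 powr (- real j)} x)"
    proof (cases "x \<noteq> 0 \<and> hnorm x < 1")
      case True
      then have hx: "hnorm x > 0" "hnorm x < 1" by auto
      obtain k :: nat where "(1/2) ^ k < hnorm x" using real_arch_pow_inv[OF hx(1), of "1/2"] by auto
      then have ex: "2 powr (- (real k + 1)) \<le> hnorm x"
      proof -
        have "2 powr (- (real k + 1)) \<le> 2 powr (- real k)" by simp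
        also have "\<dots> = (1/2) ^ k" by (simp add: powr_minus powr_realpow power_one_over inverse_eq_divide)
        finally show ?thesis using \<open>(1/2) ^ k < hnorm x\<close> by simp
      qed
      define j where "j = (LEAST k. 2 powr (- (real k + 1)) \<le> hnorm x)"
      have j1: "2 powr (- (real j + 1)) \<le> hnorm x" unfolding j_def by (rule LeastI) (rule ex)
      have j2: "hnorm x < 2 powr (- real j)"
      proof (cases j)
        case (Suc i)
        then have "\<not> 2 powr (- (real i + 1)) \<le> hnorm x" using not_less_Least[of i "\<lambda>k. 2 powr (- (real k + 1)) \<le> hnorm x"] by (simp add: j_def)
        then show ?thesis using Suc by (simp add: add.commute)
      qed (use hx in simp)
      have "hnorm x powr (- b) \<le> (2 powr (- (real j + 1))) powr (- b)"
        using b hx j1 by (intro powr_mono2') auto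
      also have "\<dots> = 2 powr ((real j + 1) * b)" by (simp add: powr_powr algebra_simps)
      finally have "ennreal (indicator {x. hnorm x < 1} x * hnorm x powr (- b)) \<le> ennreal (2 powr ((real j + 1) * b)) * indicator {x. hnorm x < 2 powr (- real j)} x"
        using hx j2 by (simp add: ennreal_leI)
      also have "\<dots> \<le> (\<Sum>j. ennreal (2 powr ((real j + 1) * b)) * indicator {x. hnorm x < 2 powr (- real j)} x)"
        by (rule le_suminf_ennreal)
      finally show ?thesis .
    qed auto
  qed
  also have "\<dots> = (\<Sum>j. \<integral>\<^sup>+(x :: 'v \<times> 'z). ennreal (2 powr ((real j + 1) * b)) * indicator {x. hnorm x < 2 powr (- real j)} x \<partial>lborel)"
    by (rule nn_integral_suminf) measurable
  also have "\<dots> = (\<Sum>j. ennreal ((2 powr b * ?V) * (2 powr (b - Q)) ^ j))"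
  proof (rule suminf_cong)
    fix j
    have "(\<integral>\<^sup>+(x :: 'v \<times> 'z). ennreal (2 powr ((real j + 1) * b)) * indicator {x. hnorm x < 2 powr (- real j)} x \<partial>lborel)
      = ennreal (2 powr ((real j + 1) * b)) * ennreal ((2 powr (- real j)) powr Q * ?V)"
      by (subst nn_integral_cmult_indicator) (simp_all add: emeasure_hball)
    also have "\<dots> = ennreal ((2 powr b * ?V) * (2 powr (b - Q)) ^ j)"
      by (subst ennreal_mult'[symmetric])
         (auto simp: powr_powr powr_realpow[symmetric] powr_add[symmetric] algebra_simps)
    finally show "(\<integral>\<^sup>+(x :: 'v \<times> 'z). ennreal (2 powr ((real j + 1) * b)) * indicator {x. hnorm x < 2 powr (- real j)} x \<partial>lborel)
      = ennreal ((2 powr b * ?V) * (2 powr (b - Q)) ^ j)" .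
  qed
  also have "\<dots> < \<infinity>"
  proof (rule dyadic_sum_finite)
    show "2 powr (b - Q) < 1" using b by (simp add: powr_less_one)
  qed auto
  finally show ?thesis .
qed

text \<open>The decomposition runs outward over \<open>2^j \<le> hnorm x < 2^(j+1)\<close>, with
  ratio \<open>2^(Q - b)\<close>.\<close>

lemma nn_integral_hnorm_far:
  assumes b: "b > Q"
  shows "(\<integral>\<^sup>+(x :: 'v \<times> 'z). ennreal (indicator {x. hnorm x \<ge> 1} x * hnorm x powr (- b)) \<partial>lborel) < \<infinity>"
proof -
  let ?V = "measure lborel {x :: 'v \<times> 'z. hnorm x < 1}"
  have b0: "b > 0" using b Q_pos by linarith
  have "(\<integral>\<^sup>+(x :: 'v \<times> 'z). ennreal (indicator {x. hnorm x \<ge> 1} x * hnorm x powr (- b)) \<partial>lborel)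
    \<le> (\<integral>\<^sup>+(x :: 'v \<times> 'z). (\<Sum>j. ennreal (2 powr (- real j * b)) * indicator {x. hnorm x < 2 powr (real j + 1)} x) \<partial>lborel)"
  proof (rule nn_integral_mono)
    fix x :: "'v \<times> 'z"
    show "ennreal (indicator {x. hnorm x \<ge> 1} x * hnorm x powr (- b)) \<le> (\<Sum>j. ennreal (2 powr (- real j * b)) * indicator {x. hnorm x < 2 powr (real j + 1)} x)"
    proof (cases "hnorm x \<ge> 1")
      case True
      obtain k :: nat where k: "hnorm x < 2 ^ k" using real_arch_pow[of 2 "hnorm x"] by auto
      have ex: "hnorm x < 2 powr (real k + 1)"
      proof -
        have "(2::real) ^ k = 2 powr (real k)" by (simp add: powr_realpow)
        also have "\<dots> \<le> 2 powr (real k + 1)" by simp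
        finally show ?thesis using k by simp
      qed
      define j where "j = (LEAST k. hnorm x < 2 powr (real k + 1))"
      have j1: "hnorm x < 2 powr (real j + 1)" unfolding j_def by (rule LeastI) (rule ex)
      have j2: "2 powr (real j) \<le> hnorm x"
      proof (cases j)
        case (Suc i)
        then have "\<not> hnorm x < 2 powr (real i + 1)" using not_less_Least[of i "\<lambda>k. hnorm x < 2 powr (real k + 1)"] by (simp add: j_def)
        then show ?thesis using Suc by (simp add: add.commute)
      qed (use True in simp)
      have "hnorm x powr (- b) \<le> (2 powr (real j)) powr (- b)"
        using b0 j2 by (intro powr_mono2') auto
      also have "\<dots> = 2 powr (- real j * b)" by (simp add: powr_powr)
      finally have "ennreal (indicator {x. hnorm x \<ge> 1} x * hnorm x powr (- b)) \<le> ennreal (2 powr (- real j * b)) * indicator {x. hnorm x < 2 powr (real j + 1)} x"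
        using True j1 by (simp add: ennreal_leI)
      also have "\<dots> \<le> (\<Sum>j. ennreal (2 powr (- real j * b)) * indicator {x. hnorm x < 2 powr (real j + 1)} x)"
        by (rule le_suminf_ennreal)
      finally show ?thesis .
    qed auto
  qed
  also have "\<dots> = (\<Sum>j. \<integral>\<^sup>+(x :: 'v \<times> 'z). ennreal (2 powr (- real j * b)) * indicator {x. hnorm x < 2 powr (real j + 1)} x \<partial>lborel)"
    by (rule nn_integral_suminf) measurable
  also have "\<dots> = (\<Sum>j. ennreal ((2 powr Q * ?V) * (2 powr (Q - b)) ^ j))"
  proof (rule suminf_cong)
    fix j
    have "(\<integral>\<^sup>+(x :: 'v \<times> 'z). ennreal (2 powr (- real j * b)) * indicator {x. hnorm x < 2 powr (real j + 1)} x \<partial>lborel)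
      = ennreal (2 powr (- real j * b)) * ennreal ((2 powr (real j + 1)) powr Q * ?V)"
      by (subst nn_integral_cmult_indicator) (simp_all add: emeasure_hball)
    also have "\<dots> = ennreal ((2 powr Q * ?V) * (2 powr (Q - b)) ^ j)"
      by (subst ennreal_mult'[symmetric])
         (auto simp: powr_powr powr_realpow[symmetric] powr_add[symmetric] algebra_simps)
    finally show "(\<integral>\<^sup>+(x :: 'v \<times> 'z). ennreal (2 powr (- real j * b)) * indicator {x. hnorm x < 2 powr (real j + 1)} x \<partial>lborel)
      = ennreal ((2 powr Q * ?V) * (2 powr (Q - b)) ^ j)" .
  qed
  also have "\<dots> < \<infinity>"
  proof (rule dyadic_sum_finite)
    show "2 powr (Q - b) < 1" using b by (simp add: powr_less_one)
  qed auto
  finally show ?thesis .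
qed

lemma nn_integral_hnorm_translate:
  assumes [measurable]: "f \<in> borel_measurable borel"
  shows "(\<integral>\<^sup>+w. f (hnorm (gm (ginv w) x)) \<partial>lborel) = (\<integral>\<^sup>+(y :: 'v \<times> 'z). f (hnorm y) \<partial>lborel)"
  using nn_integral_gm_left[of "\<lambda>y. f (hnorm y)" "ginv x"] by (simp add: hnorm_sym[of _ x])

text \<open>The integral is split at distance 1 from \<open>x\<close>. Invariance of the measure
  carries the near part to the origin, where it no longer depends on \<open>x\<close>; in the far
  part the power is at most 1 and the volume of the ball of radius \<open>R\<close> remains.\<close>

lemma riesz_unif_bound:
  assumes b: "0 \<le> b" "b < Q"
  obtains C where "C > 0"
    "\<And>x. (\<integral>\<^sup>+w. ennreal (indicator (hball R) w * hnorm (gm (ginv w) x) powr (- b)) \<partial>lborel) \<le> ennreal C"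
proof -
  let ?I1 = "\<integral>\<^sup>+(x :: 'v \<times> 'z). ennreal (indicator {x. hnorm x < 1} x * hnorm x powr (- b)) \<partial>lborel"
  let ?I2 = "\<integral>\<^sup>+(w :: 'v \<times> 'z). indicator (hball R) w \<partial>lborel"
  have "?I2 = emeasure lborel (hball R)" by (rule nn_integral_indicator) measurable
  also have "\<dots> < \<infinity>" by (rule emeasure_bounded_finite[OF bounded_hnorm_ball])
  finally have "?I1 + ?I2 < \<infinity>" using nn_integral_hnorm_near[OF b] by simp
  then obtain C where C: "?I1 + ?I2 = ennreal C" "C \<ge> 0" by (cases "?I1 + ?I2") auto
  have "(\<integral>\<^sup>+w. ennreal (indicator (hball R) w * hnorm (gm (ginv w) x) powr (- b)) \<partial>lborel) \<le> ennreal (C + 1)" for x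
  proof -
    have "(\<integral>\<^sup>+w. ennreal (indicator (hball R) w * hnorm (gm (ginv w) x) powr (- b)) \<partial>lborel)
      \<le> (\<integral>\<^sup>+w. ennreal (indicator {..<1} (hnorm (gm (ginv w) x)) * hnorm (gm (ginv w) x) powr (- b)) + indicator (hball R) w \<partial>lborel)"
    proof (rule nn_integral_mono)
      fix w
      show "ennreal (indicator (hball R) w * hnorm (gm (ginv w) x) powr (- b))
        \<le> ennreal (indicator {..<1} (hnorm (gm (ginv w) x)) * hnorm (gm (ginv w) x) powr (- b)) + indicator (hball R) w"
      proof (cases "hnorm (gm (ginv w) x) < 1")
        case False
        then have "hnorm (gm (ginv w) x) powr (- b) \<le> 1" using b powr_mono2'[of "-b" 1 "hnorm (gm (ginv w) x)"] by auto
        then show ?thesis using False by (auto simp: indicator_def)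
      qed (auto simp: indicator_def)
    qed
    also have "\<dots> = (\<integral>\<^sup>+w. ennreal (indicator {..<1} (hnorm (gm (ginv w) x)) * hnorm (gm (ginv w) x) powr (- b)) \<partial>lborel) + ?I2"
      by (rule nn_integral_add) measurable
    also have "(\<integral>\<^sup>+w. ennreal (indicator {..<1} (hnorm (gm (ginv w) x)) * hnorm (gm (ginv w) x) powr (- b)) \<partial>lborel)
      = (\<integral>\<^sup>+(y :: 'v \<times> 'z). ennreal (indicator {..<1} (hnorm y) * hnorm y powr (- b)) \<partial>lborel)"
      by (rule nn_integral_hnorm_translate[of "\<lambda>r. ennreal (indicator {..<1} r * r powr (- b))"]) measurable
    also have "\<dots> = ?I1" by (intro nn_integral_cong) (auto simp: indicator_def)
    finally have "(\<integral>\<^sup>+w. ennreal (indicator (hball R) w * hnorm (gm (ginv w) x) powr (- b)) \<partial>lborel) \<le> ennreal C"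
      using C by simp
    also have "\<dots> \<le> ennreal (C + 1)" by (rule ennreal_leI) simp
    finally show ?thesis .
  qed
  then show ?thesis using that[of "C + 1"] C(2) by simp
qed

section \<open>The extension kernel and its gradient\<close>

definition a where "a = (real n + real m - s) / 2"

lemma a_pos: "a > 0" using n_pos m_pos s1 by (simp add: a_def)

lemma four_a: "4 * a = Q - 2 * s" by (simp add: a_def hdim_def)

text \<open>The parameter \<open>\<tau>\<close> stands for the squared height, or for that square
  plus a regularisation \<open>\<delta>^2\<close>; keeping it free lets one set of formulas serve
  the singular and the regularised kernel. At \<open>\<tau> = 0\<close> the value is the fourth
  power of the gauge, and \<open>4 * a = Q - 2 * s\<close> makes \<open>KK 0\<close> the homogeneous
  kernel in the convolution behind \<open>psi\<close>.\<close>

definition DD :: "real \<Rightarrow> 'v \<times> 'z \<Rightarrow> real" where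
  "DD \<tau> x = (\<tau> + (norm (fst x))\<^sup>2)\<^sup>2 + 16 * (norm (snd x))\<^sup>2"

definition KK :: "real \<Rightarrow> 'v \<times> 'z \<Rightarrow> real" where "KK \<tau> x = DD \<tau> x powr (- a)"

text \<open>The operator J_z applied to \<open>v\<close>: the vector whose inner product with any
  \<open>w\<close> is that of \<open>z\<close> with \<open>br v w\<close>.\<close>

definition Jt :: "'v \<Rightarrow> 'z \<Rightarrow> 'v" where "Jt v z = (\<Sum>i\<in>Basis. (z \<bullet> br v i) *\<^sub>R i)"

text \<open>The gradient, in the sense of \<open>grad\<close>, of the function that sends
  \<open>(x, \<rho>)\<close> to \<open>DD (\<rho>^2 + c) x\<close>, taken at
  \<open>\<tau> = \<rho>^2 + c\<close>. The central entries contain the factor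
  \<open>\<rho> / 2\<close> that \<open>grad\<close> puts in front of the central fields.
  \<open>KG\<close> is the corresponding gradient of \<open>KK\<close>.\<close>

definition GD :: "real \<Rightarrow> real \<Rightarrow> 'v \<times> 'z \<Rightarrow> ('v \<times> 'z) \<times> real" where
  "GD \<tau> \<rho> x = (((4 * (\<tau> + (norm (fst x))\<^sup>2)) *\<^sub>R fst x + 16 *\<^sub>R Jt (fst x) (snd x), (16 * \<rho>) *\<^sub>R snd x),
     4 * (\<tau> + (norm (fst x))\<^sup>2) * \<rho>)"

definition KG :: "real \<Rightarrow> real \<Rightarrow> 'v \<times> 'z \<Rightarrow> ('v \<times> 'z) \<times> real" where
  "KG \<tau> \<rho> x = (- a * DD \<tau> x powr (- a - 1)) *\<^sub>R GD \<tau> \<rho> x"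

lemma DD_nonneg [simp]: "0 \<le> DD \<tau> x" by (simp add: DD_def)

lemma DD_0: "DD 0 x = hnorm x ^ 4" by (simp add: DD_def hnorm_pow4 flip: power_mult)

lemma DD_mono: "0 \<le> \<tau> \<Longrightarrow> \<tau> \<le> \<tau>' \<Longrightarrow> DD \<tau> x \<le> DD \<tau>' x"
  unfolding DD_def by (intro add_mono power_mono) auto

lemma DD_ge_hnorm: "0 \<le> \<tau> \<Longrightarrow> hnorm x ^ 4 \<le> DD \<tau> x" using DD_mono[of 0 \<tau> x] by (simp add: DD_0)

lemma DD_ge_sq: "(\<tau> + (norm (fst x))\<^sup>2)\<^sup>2 \<le> DD \<tau> x" by (simp add: DD_def)

lemma DD_ge_tau: "0 \<le> \<tau> \<Longrightarrow> \<tau>\<^sup>2 \<le> DD \<tau> x"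
proof -
  assume "0 \<le> \<tau>"
  then have "\<tau>\<^sup>2 \<le> (\<tau> + (norm (fst x))\<^sup>2)\<^sup>2" by (intro power_mono) auto
  then show ?thesis using DD_ge_sq[of \<tau> x] by linarith
qed

lemma DD_pos: "\<tau> > 0 \<or> \<tau> \<ge> 0 \<and> x \<noteq> 0 \<Longrightarrow> DD \<tau> x > 0"
proof (elim disjE conjE)
  assume "\<tau> > 0"
  then show ?thesis using DD_ge_tau[of \<tau> x] zero_less_power[of \<tau> 2] by linarith
next
  assume "\<tau> \<ge> 0" "x \<noteq> 0"
  moreover from this have "0 < hnorm x ^ 4" by (intro zero_less_power) simp
  ultimately show ?thesis using DD_ge_hnorm[of \<tau> x] by linarith
qed

lemma DD_dil: "d \<ge> 0 \<Longrightarrow> DD (d\<^sup>2 * \<tau>) (dil d x) = d ^ 4 * DD \<tau> x"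
proof -
  assume "d \<ge> 0"
  then have "d\<^sup>2 * \<tau> + (norm (fst (dil d x)))\<^sup>2 = d\<^sup>2 * (\<tau> + (norm (fst x))\<^sup>2)" "norm (snd (dil d x)) = d\<^sup>2 * norm (snd x)"
    by (simp_all add: dil_def power_mult_distrib distrib_left)
  then have "DD (d\<^sup>2 * \<tau>) (dil d x) = (d\<^sup>2)\<^sup>2 * (\<tau> + (norm (fst x))\<^sup>2)\<^sup>2 + 16 * ((d\<^sup>2)\<^sup>2 * (norm (snd x))\<^sup>2)"
    by (simp only: DD_def power_mult_distrib)
  moreover have "(d\<^sup>2)\<^sup>2 = d ^ 4" by (simp flip: power_mult)
  ultimately show ?thesis by (simp only: DD_def) (simp add: distrib_left)
qed

lemma Jt_cont [continuous_intros]: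
  "continuous_on S f \<Longrightarrow> continuous_on S g \<Longrightarrow> continuous_on S (\<lambda>x. Jt (f x) (g x))"
  unfolding Jt_def by (intro continuous_intros)

lemma DD_cont [continuous_intros]:
  "continuous_on S f \<Longrightarrow> continuous_on S g \<Longrightarrow> continuous_on S (\<lambda>x. DD (f x) (g x))"
  unfolding DD_def by (intro continuous_intros)

lemma GD_cont [continuous_intros]:
  "continuous_on S f \<Longrightarrow> continuous_on S g \<Longrightarrow> continuous_on S h \<Longrightarrow> continuous_on S (\<lambda>x. GD (f x) (g x) (h x))"
  unfolding GD_def by (intro continuous_intros)

lemma DD_meas [measurable (raw)]:
  "f \<in> borel_measurable M \<Longrightarrow> g \<in> borel_measurable M \<Longrightarrow> (\<lambda>x. DD (f x) (g x)) \<in> borel_measurable M"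
  by (rule measurable_compose[of "\<lambda>x. (f x, g x)" M borel "\<lambda>p. DD (fst p) (snd p)", simplified])
     (auto intro!: borel_measurable_Pair borel_measurable_continuous_onI continuous_intros)

lemma KK_meas [measurable (raw)]:
  "f \<in> borel_measurable M \<Longrightarrow> g \<in> borel_measurable M \<Longrightarrow> (\<lambda>x. KK (f x) (g x)) \<in> borel_measurable M"
  unfolding KK_def by measurable

lemma GD_meas [measurable (raw)]:
  "f \<in> borel_measurable M \<Longrightarrow> g \<in> borel_measurable M \<Longrightarrow> h \<in> borel_measurable M \<Longrightarrow> (\<lambda>x. GD (f x) (g x) (h x)) \<in> borel_measurable M"
  by (rule measurable_compose[of "\<lambda>x. (f x, g x, h x)" M borel "\<lambda>p. GD (fst p) (fst (snd p)) (snd (snd p))", simplified])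
     (auto intro!: borel_measurable_Pair borel_measurable_continuous_onI continuous_intros)

lemma KG_meas [measurable (raw)]:
  "f \<in> borel_measurable M \<Longrightarrow> g \<in> borel_measurable M \<Longrightarrow> h \<in> borel_measurable M \<Longrightarrow> (\<lambda>x. KG (f x) (g x) (h x)) \<in> borel_measurable M"
  unfolding KG_def by (intro borel_measurable_scaleR GD_meas) measurable

lemma KK_nonneg [simp]: "0 \<le> KK \<tau> x" by (simp add: KK_def)

lemma KK_0: "KK 0 x = hnorm x powr (- Q + 2 * s)"
proof -
  have "hnorm x ^ 4 = hnorm x powr 4" by (cases "x = 0") auto
  then have "KK 0 x = hnorm x powr (- (4 * a))" by (simp only: KK_def DD_0 powr_powr) simp
  then show ?thesis by (simp add: four_a)
qed

lemma KK_le: "x \<noteq> 0 \<Longrightarrow> 0 \<le> \<tau> \<Longrightarrow> KK \<tau> x \<le> KK 0 x"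
  unfolding KK_def using DD_pos[of 0 x] DD_mono[of 0 \<tau> x] a_pos by (intro powr_mono2') auto

text \<open>The squared length is exactly \<open>16 * (\<rho>^2 + |v|^2) * DD \<tau> x\<close>: J_z
  v is orthogonal to \<open>v\<close> because [v, v] = 0, and |J_z v| = |z| |v| lets the four terms
  recombine into \<open>DD\<close>. The hypothesis then replaces \<open>\<rho>^2\<close> by
  \<open>\<tau>\<close>.\<close>

lemma GD_norm: "\<rho>\<^sup>2 \<le> \<tau> \<Longrightarrow> (norm (GD \<tau> \<rho> x))\<^sup>2 \<le> 16 * (\<tau> + (norm (fst x))\<^sup>2) * DD \<tau> x"
proof -
  obtain v z where x: "x = (v, z)" by (cases x)
  define A where "A = \<tau> + (norm v)\<^sup>2"
  have vJ: "v \<bullet> Jt v z = 0"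
  proof -
    have "v \<bullet> Jt v z = z \<bullet> br v (\<Sum>i\<in>Basis. (v \<bullet> i) *\<^sub>R i)"
      using bil unfolding Jt_def bilinear_def
      by (simp add: linear_sum linear_scale inner_sum_right mult.commute)
    then show ?thesis by (simp add: euclidean_representation)
  qed
  have JJ: "Jt v z \<bullet> Jt v z = (norm z)\<^sup>2 * (norm v)\<^sup>2"
  proof -
    have "Jt v z \<bullet> i = z \<bullet> br v i" if "i \<in> Basis" for i using that by (simp add: Jt_def)
    then show ?thesis using sum_br_sq[of z v] by (subst euclidean_inner) (simp add: power2_eq_square)
  qed
  have "(norm (GD \<tau> \<rho> x))\<^sup>2 = 16 * A\<^sup>2 * (norm v)\<^sup>2 + 256 * ((norm z)\<^sup>2 * (norm v)\<^sup>2) + 256 * \<rho>\<^sup>2 * (norm z)\<^sup>2 + 16 * A\<^sup>2 * \<rho>\<^sup>2"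
    unfolding power2_norm_eq_inner[of "GD \<tau> \<rho> x"]
    unfolding x GD_def fst_conv snd_conv A_def[symmetric] inner_Pair
    using JJ by (simp add: inner_add_left inner_add_right vJ inner_commute[of "Jt v z" v] power2_norm_eq_inner)
       (simp add: power2_eq_square algebra_simps)
  then have e: "(norm (GD \<tau> \<rho> x))\<^sup>2 = 16 * (\<rho>\<^sup>2 + (norm (fst x))\<^sup>2) * DD \<tau> x"
    by (simp add: x DD_def A_def[symmetric] algebra_simps)
  assume "\<rho>\<^sup>2 \<le> \<tau>"
  then show "(norm (GD \<tau> \<rho> x))\<^sup>2 \<le> 16 * (\<tau> + (norm (fst x))\<^sup>2) * DD \<tau> x"
    unfolding e by (intro mult_right_mono) auto
qed

lemma GD_norm_le: "\<rho>\<^sup>2 \<le> \<tau> \<Longrightarrow> norm (GD \<tau> \<rho> x) \<le> 4 * DD \<tau> x powr (3/4)"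
proof (rule power2_le_imp_le)
  assume r: "\<rho>\<^sup>2 \<le> \<tau>"
  then have t: "\<tau> \<ge> 0" by (meson order_trans zero_le_power2)
  have "(\<tau> + (norm (fst x))\<^sup>2) \<le> DD \<tau> x powr (1/2)"
    using DD_ge_sq[of \<tau> x] real_le_rsqrt by (simp add: powr_half_sqrt)
  then have "16 * (\<tau> + (norm (fst x))\<^sup>2) * DD \<tau> x \<le> 16 * DD \<tau> x powr (1/2) * DD \<tau> x"
    by (intro mult_right_mono) auto
  also have "\<dots> = (4 * DD \<tau> x powr (3/4))\<^sup>2"
    by (cases "DD \<tau> x = 0") (auto simp: power_mult_distrib powr_power powr_mult_base mult.commute)
  finally show "(norm (GD \<tau> \<rho> x))\<^sup>2 \<le> (4 * DD \<tau> x powr (3/4))\<^sup>2" using GD_norm[OF r, of x] by linarith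
qed simp

lemma KG_norm_le: "\<rho>\<^sup>2 \<le> \<tau> \<Longrightarrow> norm (KG \<tau> \<rho> x) \<le> 4 * a * DD \<tau> x powr (- a - 1/4)"
proof -
  assume r: "\<rho>\<^sup>2 \<le> \<tau>"
  have "norm (KG \<tau> \<rho> x) = a * DD \<tau> x powr (- a - 1) * norm (GD \<tau> \<rho> x)"
    using a_pos by (simp add: KG_def)
  also have "\<dots> \<le> a * DD \<tau> x powr (- a - 1) * (4 * DD \<tau> x powr (3/4))"
    using a_pos by (intro mult_left_mono GD_norm_le r) auto
  also have "\<dots> = 4 * a * (DD \<tau> x powr (- a - 1) * DD \<tau> x powr (3/4))" by simp
  also have "DD \<tau> x powr (- a - 1) * DD \<tau> x powr (3/4) = DD \<tau> x powr (- a - 1/4)"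
    unfolding powr_add[symmetric] by (rule arg_cong[where f = "\<lambda>t. _ powr t"]) simp
  finally show ?thesis .
qed

text \<open>The exponent splits the decay of the kernel between \<open>N\<close> and the half-line so that
  both factors are locally integrable against \<open>\<rho> powr (1 - 2 * s)\<close>.\<close>
definition \<kappa> where "\<kappa> = max (s/2) (2 * s - 1)"

text \<open>Each bound has its own purpose: \<open>0 < \<kappa>\<close> makes
  \<open>hnorm x powr (- (Q - \<kappa>))\<close> locally integrable, \<open>\<kappa> < 1\<close>
  does the same for one kernel gradient times the weight in height, \<open>\<kappa> < s\<close> for
  a squared one, and \<open>2 * s - 1 \<le> \<kappa>\<close> keeps the exponent of
  \<open>\<rho>\<close> nonpositive.\<close>

lemma kappa: "0 < \<kappa>" "\<kappa> < s" "2 * s - 1 \<le> \<kappa>" "\<kappa> < 1" "\<kappa> < Q"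
  using s0 s1 Q_pos by (auto simp: \<kappa>_def)

text \<open>The exponent \<open>- a - 1/4\<close> is split into \<open>- (Q - \<kappa>) / 4\<close>,
  spent through \<open>hnorm x ^ 4 \<le> DD\<close>, and \<open>(2 s - 1 - \<kappa>) / 4\<close>,
  spent through \<open>\<rho> ^ 4 \<le> DD\<close>. Neither part is positive, so both replacements
  go in the right direction.\<close>

lemma KG_bound:
  assumes "0 < \<rho>" "\<rho>\<^sup>2 \<le> \<tau>" "x \<noteq> 0"
  shows "norm (KG \<tau> \<rho> x) \<le> 4 * a * (hnorm x powr (- (Q - \<kappa>)) * \<rho> powr (2 * s - 1 - \<kappa>))"
proof -
  let ?d = "DD \<tau> x"
  have t: "\<tau> > 0" using assms zero_less_power[of \<rho> 2] by linarith
  have d: "?d > 0" using DD_pos t by auto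
  have "?d powr (- a - 1/4) = ?d powr (- (Q - \<kappa>) / 4) * ?d powr ((2 * s - 1 - \<kappa>) / 4)"
    unfolding powr_add[symmetric]
    by (rule arg_cong[where f = "\<lambda>t. _ powr t"]) (use four_a in \<open>simp add: field_simps\<close>)
  also have "\<dots> \<le> hnorm x powr (- (Q - \<kappa>)) * \<rho> powr (2 * s - 1 - \<kappa>)"
  proof (rule mult_mono)
    have "?d powr (- (Q - \<kappa>) / 4) \<le> (hnorm x ^ 4) powr (- (Q - \<kappa>) / 4)"
      using assms kappa DD_ge_hnorm[of \<tau> x] t by (intro powr_mono2') auto
    also have "\<dots> = hnorm x powr (- (Q - \<kappa>))"
      unfolding powr_pow4[OF hnorm_nonneg] by (rule arg_cong[where f = "\<lambda>t. _ powr t"]) (simp add: field_simps)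
    finally show "?d powr (- (Q - \<kappa>) / 4) \<le> hnorm x powr (- (Q - \<kappa>))" .
    have "\<rho> ^ 4 = (\<rho>\<^sup>2)\<^sup>2" by (simp flip: power_mult)
    also have "\<dots> \<le> \<tau>\<^sup>2" using assms by (intro power_mono) auto
    finally have "\<rho> ^ 4 \<le> ?d" using DD_ge_tau[of \<tau> x] t by linarith
    then have "?d powr ((2 * s - 1 - \<kappa>) / 4) \<le> (\<rho> ^ 4) powr ((2 * s - 1 - \<kappa>) / 4)"
      using assms kappa by (intro powr_mono2') auto
    also have "\<dots> = \<rho> powr (2 * s - 1 - \<kappa>)"
      unfolding powr_pow4[OF less_imp_le[OF assms(1)]] by (rule arg_cong[where f = "\<lambda>t. _ powr t"]) (simp add: field_simps)
    finally show "?d powr ((2 * s - 1 - \<kappa>) / 4) \<le> \<rho> powr (2 * s - 1 - \<kappa>)" .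
  qed auto
  finally have "4 * a * ?d powr (- a - 1/4) \<le> 4 * a * (hnorm x powr (- (Q - \<kappa>)) * \<rho> powr (2 * s - 1 - \<kappa>))"
    using a_pos by (intro mult_left_mono) auto
  then show ?thesis using KG_norm_le[OF assms(2), of x] by linarith
qed

section \<open>Derivatives of the kernel along one-parameter subgroups\<close>

lemma deriv_gm_shift:
  fixes F :: "'v \<times> 'z \<Rightarrow> real"
  assumes "\<And>y. ((\<lambda>t. F (gm y (t *\<^sub>R d))) has_real_derivative F' y) (at 0)"
  shows "((\<lambda>t. F (gm x (t *\<^sub>R d))) has_real_derivative F' (gm x (t *\<^sub>R d))) (at t)"
proof -
  have e: "gm x ((h + t) *\<^sub>R d) = gm (gm x (t *\<^sub>R d)) (h *\<^sub>R d)" for h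
    by (simp add: gmult_def algebra_simps scaleR_add_left)
  have "((\<lambda>h. F (gm x ((h + t) *\<^sub>R d))) has_real_derivative F' (gm x (t *\<^sub>R d))) (at 0)"
    unfolding e by (rule assms)
  then show ?thesis using DERIV_shift[of "\<lambda>t. F (gm x (t *\<^sub>R d))" "F' (gm x (t *\<^sub>R d))" 0 t] by simp
qed

lemma integrable_cont_supp:
  fixes f :: "'v \<times> 'z \<Rightarrow> real"
  assumes "continuous_on UNIV f" "\<And>x. hnorm x > R \<Longrightarrow> f x = 0"
  shows "integrable lborel f"
proof -
  let ?B = "hball R"
  have "integrable lborel (\<lambda>x. indicator ?B x *\<^sub>R f x)"
    by (rule borel_integrable_compact[OF compact_hnorm_ball]) (rule continuous_on_subset[OF assms(1)], simp)
  moreover have "(\<lambda>x. indicator ?B x *\<^sub>R f x) = f" using assms(2) by (force simp: indicator_def)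
  ultimately show ?thesis by simp
qed

text \<open>The flow of a left-invariant field is right translation, which preserves the measure.
  Averaging \<open>F'\<close> along the flow over unit time leaves its integral unchanged, while at
  each \<open>x\<close> the average is \<open>F (gm x d) - F x\<close>, whose integral is zero. This
  is integration by parts on the group.\<close>

lemma integral_left_field_zero:
  fixes F :: "'v \<times> 'z \<Rightarrow> real"
  assumes D: "\<And>x. ((\<lambda>t. F (gm x (t *\<^sub>R d))) has_real_derivative F' x) (at 0)"
    and cF': "continuous_on UNIV F'" and cF: "continuous_on UNIV F"
    and supp: "\<And>x. hnorm x > R \<Longrightarrow> F x = 0" "\<And>x. hnorm x > R \<Longrightarrow> F' x = 0"
  shows "(\<integral>x. F' x \<partial>lborel) = 0"
proof -
  have iF: "integrable lborel F" by (rule integrable_cont_supp[OF cF supp(1)])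
  have iF': "integrable lborel F'" by (rule integrable_cont_supp[OF cF' supp(2)])
  have [measurable]: "F \<in> borel_measurable borel" "F' \<in> borel_measurable borel"
    using cF cF' by (auto intro: borel_measurable_continuous_onI)
  define f where "f t x = indicator {0..1} t * F' (gm x (t *\<^sub>R d))" for t :: real and x
  have [measurable]: "(\<lambda>p. f (fst p) (snd p)) \<in> borel_measurable (borel :: (real \<times> 'v \<times> 'z) measure)"
    unfolding f_def by measurable
  have mf: "case_prod f \<in> borel_measurable (lborel \<Otimes>\<^sub>M lborel)"
    by (subst lborel_prod) (simp add: case_prod_beta')
  have int_t: "integrable lborel (\<lambda>x. f t x)" for t
    unfolding f_def using integrable_gm(2)[OF iF'] by simp
  have fi: "integrable (lborel \<Otimes>\<^sub>M lborel) (case_prod f)"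
  proof (rule lborel_pair.Fubini_integrable[OF mf])
    have "(\<integral>x. norm (f t x) \<partial>lborel) = indicator {0..1} t * (\<integral>x. \<bar>F' x\<bar> \<partial>lborel)" for t
      using integral_gm(2)[of "\<lambda>x. \<bar>F' x\<bar>" "t *\<^sub>R d"] by (simp add: f_def abs_mult)
    then show "integrable lborel (\<lambda>t. \<integral>x. norm (case (t, x) of (t, x) \<Rightarrow> f t x) \<partial>lborel)" by simp
  qed (use int_t in simp)
  have ftc: "(\<integral>t. f t x \<partial>lborel) = F (gm x d) - F x" for x
  proof -
    have "(\<integral>t. F' (gm x (t *\<^sub>R d)) * indicator {0..1} t \<partial>lborel) = F (gm x (1 *\<^sub>R d)) - F (gm x (0 *\<^sub>R d))"
    proof (rule integral_FTC_Icc_real)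
      fix t :: real
      show "((\<lambda>t. F (gm x (t *\<^sub>R d))) has_real_derivative F' (gm x (t *\<^sub>R d))) (at t)"
        by (rule deriv_gm_shift[OF D])
      have "continuous_on UNIV (\<lambda>t. F' (gm x (t *\<^sub>R d)))"
        by (intro continuous_on_compose2[OF cF'] continuous_intros) auto
      then show "isCont (\<lambda>t. F' (gm x (t *\<^sub>R d))) t" by (simp add: continuous_on_eq_continuous_at)
    qed simp
    then show ?thesis by (simp add: f_def mult.commute)
  qed
  have "(\<integral>x. F' x \<partial>lborel) = (\<integral>t. indicator {0..1} t * (\<integral>x. F' x \<partial>lborel) \<partial>(lborel :: real measure))" by simp
  also have "\<dots> = (\<integral>t. (\<integral>x. f t x \<partial>lborel) \<partial>lborel)"
    using integral_gm(2)[of F'] by (simp add: f_def)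
  also have "\<dots> = (\<integral>x. (\<integral>t. f t x \<partial>lborel) \<partial>lborel)"
    by (rule lborel_pair.Fubini_integral[OF fi, symmetric])
  also have "\<dots> = (\<integral>x. F (gm x d) \<partial>lborel) - (\<integral>x. F x \<partial>lborel)"
    unfolding ftc by (rule Bochner_Integration.integral_diff) (use integrable_gm(2)[OF iF] iF in auto)
  also have "\<dots> = 0" using integral_gm(2)[of F] by simp
  finally show ?thesis .
qed

text \<open>Closed form of the left-invariant field of \<open>d\<close> applied to
  \<open>DD \<tau>\<close>; \<open>XXD\<close> is the field applied twice. \<open>KX\<close> and
  \<open>KXX\<close> are the same derivatives of the kernel. The operator is a sum of squares of
  fields, so second derivatives in a single direction are enough.\<close>

definition XD :: "real \<Rightarrow> 'v \<times> 'z \<Rightarrow> 'v \<times> 'z \<Rightarrow> real" where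
  "XD \<tau> d x = 4 * (\<tau> + (norm (fst x))\<^sup>2) * (fst x \<bullet> fst d) + 16 * (snd x \<bullet> br (fst x) (fst d)) + 32 * (snd x \<bullet> snd d)"

definition XXD :: "real \<Rightarrow> 'v \<times> 'z \<Rightarrow> 'v \<times> 'z \<Rightarrow> real" where
  "XXD \<tau> d x = 8 * (fst x \<bullet> fst d)\<^sup>2 + 4 * (\<tau> + (norm (fst x))\<^sup>2) * (norm (fst d))\<^sup>2
    + 8 * (norm (br (fst x) (fst d)))\<^sup>2 + 32 * (br (fst x) (fst d) \<bullet> snd d) + 32 * (norm (snd d))\<^sup>2"

definition KX :: "real \<Rightarrow> 'v \<times> 'z \<Rightarrow> 'v \<times> 'z \<Rightarrow> real" where
  "KX \<tau> d x = - a * DD \<tau> x powr (- a - 1) * XD \<tau> d x"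

definition KXX :: "real \<Rightarrow> 'v \<times> 'z \<Rightarrow> 'v \<times> 'z \<Rightarrow> real" where
  "KXX \<tau> d x = - a * ((- a - 1) * DD \<tau> x powr (- a - 2) * (XD \<tau> d x)\<^sup>2 + DD \<tau> x powr (- a - 1) * XXD \<tau> d x)"

lemma norm_sq_line: "(norm (v + t *\<^sub>R w))\<^sup>2 = (norm v)\<^sup>2 + 2 * t * (v \<bullet> w) + t\<^sup>2 * (norm w)\<^sup>2"
  for v w :: "'b::real_inner"
  unfolding power2_norm_eq_inner
  by (simp add: inner_add_left inner_add_right inner_commute algebra_simps power2_eq_square)

lemma DD_deriv: "((\<lambda>t. DD \<tau> (gm x (t *\<^sub>R d))) has_real_derivative XD \<tau> d x) (at 0)"
proof -
  have e: "DD \<tau> (gm x (t *\<^sub>R d)) = (\<tau> + ((norm (fst x))\<^sup>2 + 2 * t * (fst x \<bullet> fst d) + t\<^sup>2 * (norm (fst d))\<^sup>2))\<^sup>2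
     + 16 * ((norm (snd x))\<^sup>2 + 2 * t * (snd x \<bullet> (snd d + (1/2) *\<^sub>R br (fst x) (fst d))) + t\<^sup>2 * (norm (snd d + (1/2) *\<^sub>R br (fst x) (fst d)))\<^sup>2)" for t
    unfolding DD_def norm_sq_line[symmetric] by (simp add: gmult_def algebra_simps)
  show ?thesis unfolding e XD_def
    by (auto intro!: derivative_eq_intros simp: inner_add_right algebra_simps)
qed

lemma XD_deriv: "((\<lambda>t. XD \<tau> d (gm x (t *\<^sub>R d))) has_real_derivative XXD \<tau> d x) (at 0)"
proof -
  have e: "XD \<tau> d (gm x (t *\<^sub>R d)) = 4 * (\<tau> + ((norm (fst x))\<^sup>2 + 2 * t * (fst x \<bullet> fst d) + t\<^sup>2 * (norm (fst d))\<^sup>2)) * (fst x \<bullet> fst d + t * (norm (fst d))\<^sup>2)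
     + 16 * (snd x \<bullet> br (fst x) (fst d) + t * ((snd d + (1/2) *\<^sub>R br (fst x) (fst d)) \<bullet> br (fst x) (fst d)))
     + 32 * (snd x \<bullet> snd d + t * ((snd d + (1/2) *\<^sub>R br (fst x) (fst d)) \<bullet> snd d))" for t
    unfolding XD_def norm_sq_line[symmetric]
    by (simp add: gmult_def inner_add_left power2_norm_eq_inner[of "fst d"] algebra_simps)
  show ?thesis unfolding e XXD_def
    by (auto intro!: derivative_eq_intros simp: inner_add_left inner_commute dot_square_norm[unfolded power2_eq_square] power2_eq_square algebra_simps)
qed

lemma DD_powr_deriv:
  assumes "DD \<tau> x > 0"
  shows "((\<lambda>t. DD \<tau> (gm x (t *\<^sub>R d)) powr c) has_real_derivative c * DD \<tau> x powr (c - 1) * XD \<tau> d x) (at 0)"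
proof -
  have "((\<lambda>t. t powr c) has_real_derivative c * DD \<tau> x powr (c - 1)) (at (DD \<tau> x))"
    by (rule has_real_derivative_powr[OF assms])
  then have "((\<lambda>t. t powr c) has_real_derivative c * DD \<tau> x powr (c - 1)) (at (DD \<tau> (gm x (0 *\<^sub>R d))))" by simp
  from DERIV_chain2[OF this DD_deriv] show ?thesis by simp
qed

lemma KX_deriv:
  assumes "DD \<tau> x > 0"
  shows "((\<lambda>t. KX \<tau> d (gm x (t *\<^sub>R d))) has_real_derivative KXX \<tau> d x) (at 0)"
proof -
  have "((\<lambda>t. (- a) * (DD \<tau> (gm x (t *\<^sub>R d)) powr (- a - 1) * XD \<tau> d (gm x (t *\<^sub>R d)))) has_real_derivative
     (- a) * (((- a - 1) * DD \<tau> x powr (- a - 1 - 1) * XD \<tau> d x) * XD \<tau> d (gm x (0 *\<^sub>R d)) + XXD \<tau> d x * DD \<tau> (gm x (0 *\<^sub>R d)) powr (- a - 1))) (at 0)"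
    by (intro DERIV_cmult DERIV_mult DD_powr_deriv assms XD_deriv)
  moreover have "- a - 1 - 1 = - a - 2" by simp
  ultimately show ?thesis unfolding KX_def KXX_def
    by (simp only: scaleR_zero_left gm_0 power2_eq_square mult_ac)
qed

lemma XD_cont [continuous_intros]: "continuous_on S f \<Longrightarrow> continuous_on S g \<Longrightarrow> continuous_on S (\<lambda>x. XD (f x) d (g x))"
  unfolding XD_def by (intro continuous_intros)

lemma XXD_cont [continuous_intros]: "continuous_on S f \<Longrightarrow> continuous_on S g \<Longrightarrow> continuous_on S (\<lambda>x. XXD (f x) d (g x))"
  unfolding XXD_def by (intro continuous_intros)

lemma DD_powr_cont:
  assumes "continuous_on S f" "continuous_on S g" "\<And>x. x \<in> S \<Longrightarrow> f x > 0"
  shows "continuous_on S (\<lambda>x. DD (f x) (g x) powr c)"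
proof (intro continuous_on_powr continuous_intros assms ballI)
  fix x assume "x \<in> S"
  then show "DD (f x) (g x) \<noteq> 0" using DD_pos[of "f x" "g x"] assms(3)[of x] by auto
qed

lemma KX_cont:
  assumes "continuous_on S f" "continuous_on S g" "\<And>x. x \<in> S \<Longrightarrow> f x > 0"
  shows "continuous_on S (\<lambda>x. KX (f x) d (g x))"
  unfolding KX_def by (intro continuous_intros DD_powr_cont assms)

lemma KXX_cont:
  assumes "continuous_on S f" "continuous_on S g" "\<And>x. x \<in> S \<Longrightarrow> f x > 0"
  shows "continuous_on S (\<lambda>x. KXX (f x) d (g x))"
  unfolding KXX_def by (intro continuous_intros DD_powr_cont assms)

lemma KG_cont:
  assumes "continuous_on S f" "continuous_on S h" "continuous_on S g" "\<And>x. x \<in> S \<Longrightarrow> f x > 0"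
  shows "continuous_on S (\<lambda>x. KG (f x) (h x) (g x))"
  unfolding KG_def by (intro continuous_intros DD_powr_cont assms)

text \<open>The height derivative, in closed form, of the function \<open>J\<close> defined next.
  \<open>J\<close> is \<open>\<rho> powr (1 - 2 * s)\<close> times the height derivative of the
  kernel, so its behaviour as \<open>\<rho>\<close> tends to 0 is the conormal flux.\<close>

definition Jd :: "real \<Rightarrow> 'v \<times> 'z \<Rightarrow> real" where
  "Jd \<rho> x = \<rho> powr (1 - 2 * s) * ((1 - 2 * s) * (- a * DD (\<rho>\<^sup>2) x powr (- a - 1) * (4 * (\<rho>\<^sup>2 + (norm (fst x))\<^sup>2)))
     + (- a) * ((- a - 1) * DD (\<rho>\<^sup>2) x powr (- a - 2) * (4 * (\<rho>\<^sup>2 + (norm (fst x))\<^sup>2) * \<rho>)\<^sup>2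
        + DD (\<rho>\<^sup>2) x powr (- a - 1) * (4 * (\<rho>\<^sup>2 + (norm (fst x))\<^sup>2) + 8 * \<rho>\<^sup>2)))"

definition J :: "real \<Rightarrow> 'v \<times> 'z \<Rightarrow> real" where
  "J \<rho> x = \<rho> powr (1 - 2 * s) * (- a * DD (\<rho>\<^sup>2) x powr (- a - 1) * (4 * (\<rho>\<^sup>2 + (norm (fst x))\<^sup>2) * \<rho>))"

lemma DD_rho_deriv: "((\<lambda>\<rho>. DD (\<rho>\<^sup>2) x) has_real_derivative 4 * (\<rho>\<^sup>2 + (norm (fst x))\<^sup>2) * \<rho>) (at \<rho>)"
  unfolding DD_def by (auto intro!: derivative_eq_intros simp: algebra_simps)

lemma DD_rho_powr_deriv:
  assumes "\<rho> > 0"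
  shows "((\<lambda>\<rho>. DD (\<rho>\<^sup>2) x powr c) has_real_derivative c * DD (\<rho>\<^sup>2) x powr (c - 1) * (4 * (\<rho>\<^sup>2 + (norm (fst x))\<^sup>2) * \<rho>)) (at \<rho>)"
proof -
  have "((\<lambda>t. t powr c) has_real_derivative c * DD (\<rho>\<^sup>2) x powr (c - 1)) (at (DD (\<rho>\<^sup>2) x))"
    by (rule has_real_derivative_powr) (use assms DD_pos[of "\<rho>\<^sup>2" x] in auto)
  from DERIV_chain2[OF this DD_rho_deriv] show ?thesis by simp
qed

lemma J_deriv:
  assumes "\<rho> > 0"
  shows "((\<lambda>\<rho>. J \<rho> x) has_real_derivative Jd \<rho> x) (at \<rho>)"
proof -
  define A where "A r = 4 * (r\<^sup>2 + (norm (fst x))\<^sup>2)" for r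
  have p: "((\<lambda>\<rho>. \<rho> powr (1 - 2 * s)) has_real_derivative (1 - 2 * s) * \<rho> powr (1 - 2 * s - 1)) (at \<rho>)"
    by (rule has_real_derivative_powr[OF assms])
  have q: "((\<lambda>\<rho>. A \<rho> * \<rho>) has_real_derivative (A \<rho> + 8 * \<rho>\<^sup>2)) (at \<rho>)"
    unfolding A_def by (auto intro!: derivative_eq_intros simp: power2_eq_square algebra_simps)
  have d: "((\<lambda>\<rho>. \<rho> powr (1 - 2 * s) * ((- a) * (DD (\<rho>\<^sup>2) x powr (- a - 1) * (A \<rho> * \<rho>)))) has_real_derivative
     (1 - 2 * s) * \<rho> powr (1 - 2 * s - 1) * ((- a) * (DD (\<rho>\<^sup>2) x powr (- a - 1) * (A \<rho> * \<rho>)))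
     + (- a) * (((- a - 1) * DD (\<rho>\<^sup>2) x powr (- a - 1 - 1) * (4 * (\<rho>\<^sup>2 + (norm (fst x))\<^sup>2) * \<rho>)) * (A \<rho> * \<rho>) + (A \<rho> + 8 * \<rho>\<^sup>2) * DD (\<rho>\<^sup>2) x powr (- a - 1)) * \<rho> powr (1 - 2 * s)) (at \<rho>)"
    by (intro DERIV_mult p DERIV_cmult DD_rho_powr_deriv assms q)
  have a2: "- a - 1 - 1 = - a - 2" by simp
  have pe: "\<rho> powr (1 - 2 * s - 1) * \<rho> = \<rho> powr (1 - 2 * s)"
  proof -
    have "\<rho> * \<rho> powr (1 - 2 * s - 1) = \<rho> powr (1 + (1 - 2 * s - 1))" using assms by (intro powr_mult_base) simp
    also have "1 + (1 - 2 * s - 1) = 1 - 2 * s" by simp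
    finally show ?thesis by (simp only: mult.commute)
  qed
  have e1: "(\<lambda>\<rho>. J \<rho> x) = (\<lambda>\<rho>. \<rho> powr (1 - 2 * s) * ((- a) * (DD (\<rho>\<^sup>2) x powr (- a - 1) * (A \<rho> * \<rho>))))"
    by (simp add: J_def A_def fun_eq_iff)
  have e2: "(1 - 2 * s) * \<rho> powr (1 - 2 * s - 1) * ((- a) * (DD (\<rho>\<^sup>2) x powr (- a - 1) * (A \<rho> * \<rho>)))
    = (1 - 2 * s) * \<rho> powr (1 - 2 * s) * ((- a) * (DD (\<rho>\<^sup>2) x powr (- a - 1) * A \<rho>))"
    unfolding pe[symmetric] by (simp only: mult_ac)
  show ?thesis
    using d unfolding e1 e2 a2
    by (rule DERIV_cong) (simp add: Jd_def A_def power2_eq_square algebra_simps)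
qed

text \<open>With \<open>A = \<rho>^2 + |v|^2\<close> the basis sums collapse by
  \<open>sum_br_sq\<close> and \<open>sum_br_norm\<close> to expressions in \<open>A\<close>,
  \<open>D\<close> and \<open>\<tau>\<close>. What remains is a multiple of
  \<open>n + m - s - 2 a\<close>, and this is the condition that singles out the exponent
  \<open>a\<close>.\<close>

lemma pde:
  assumes r: "\<rho> > 0"
  shows "\<rho> powr (1 - 2 * s) * ((\<Sum>i\<in>Basis. KXX (\<rho>\<^sup>2) (i, 0) x) + \<rho>\<^sup>2 / 4 * (\<Sum>j\<in>Basis. KXX (\<rho>\<^sup>2) (0, j) x)) + Jd \<rho> x = 0"
proof -
  obtain v z where x: "x = (v, z)" by (cases x)
  define \<tau> where "\<tau> = \<rho>\<^sup>2"
  define A where "A = \<tau> + (norm v)\<^sup>2"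
  define D where "D = DD \<tau> x"
  define E1 E2 where "E1 = D powr (- a - 1)" and "E2 = D powr (- a - 2)"
  have D0: "D > 0" using r DD_pos[of \<tau> x] by (simp add: D_def \<tau>_def)
  have De: "D = A\<^sup>2 + 16 * (norm z)\<^sup>2" by (simp add: D_def DD_def x A_def)
  have E12: "E1 = D * E2"
  proof -
    have "D * E2 = D powr (1 + (- a - 2))" unfolding E2_def using D0 by (intro powr_mult_base) simp
    also have "1 + (- a - 2) = - a - 1" by simp
    finally show ?thesis by (simp only: E1_def)
  qed
  have vsum: "(\<Sum>i\<in>Basis. (v \<bullet> i)\<^sup>2) = (norm v)\<^sup>2"
    unfolding power2_norm_eq_inner by (subst euclidean_inner) (simp add: power2_eq_square)
  have zsum: "(\<Sum>i\<in>Basis. (z \<bullet> i)\<^sup>2) = (norm z)\<^sup>2"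
    unfolding power2_norm_eq_inner by (subst euclidean_inner) (simp add: power2_eq_square)
  \<comment> \<open>The mixed term is the inner product of \<open>v\<close> with J_z v, zero because
    [v, v] = 0.\<close>
  have cross: "(\<Sum>i\<in>Basis. (v \<bullet> i) * (z \<bullet> br v i)) = 0"
  proof -
    have "(\<Sum>i\<in>Basis. (v \<bullet> i) * (z \<bullet> br v i)) = z \<bullet> br v (\<Sum>i\<in>Basis. (v \<bullet> i) *\<^sub>R i)"
      using bil unfolding bilinear_def by (simp add: linear_sum linear_scale inner_sum_right)
    then show ?thesis by (simp add: euclidean_representation)
  qed
  have s1: "(\<Sum>i\<in>Basis. (XD \<tau> (i, 0) x)\<^sup>2) = 16 * (norm v)\<^sup>2 * D"
  proof -
    have "(\<Sum>i\<in>Basis. (XD \<tau> (i, 0) x)\<^sup>2) = (\<Sum>i\<in>Basis. 16 * A\<^sup>2 * (v \<bullet> i)\<^sup>2 + 128 * A * ((v \<bullet> i) * (z \<bullet> br v i)) + 256 * (z \<bullet> br v i)\<^sup>2)"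
      unfolding XD_def x fst_conv snd_conv A_def[symmetric]
      by (intro sum.cong refl) (simp add: power2_eq_square algebra_simps)
    also have "\<dots> = 16 * A\<^sup>2 * (norm v)\<^sup>2 + 128 * A * 0 + 256 * ((norm z)\<^sup>2 * (norm v)\<^sup>2)"
      by (simp only: sum.distrib sum_distrib_left[symmetric] vsum cross sum_br_sq)
    finally show ?thesis by (simp add: De algebra_simps)
  qed
  have s2: "(\<Sum>i\<in>Basis. XXD \<tau> (i, 0) x) = 8 * (norm v)\<^sup>2 + 8 * real n * A + 8 * real m * (norm v)\<^sup>2"
  proof -
    have "(\<Sum>i\<in>Basis. XXD \<tau> (i, 0) x) = (\<Sum>i\<in>Basis. 8 * (v \<bullet> i)\<^sup>2 + 4 * A + 8 * (norm (br v i))\<^sup>2)"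
      by (intro sum.cong refl) (simp add: XXD_def x A_def[symmetric])
    also have "\<dots> = 8 * (norm v)\<^sup>2 + 4 * A * (2 * real n) + 8 * (m * (norm v)\<^sup>2)"
      by (simp only: sum.distrib sum_distrib_left[symmetric] vsum sum_br_norm sum_constant dimv) simp
    finally show ?thesis by simp
  qed
  have s3: "(\<Sum>j\<in>Basis. (XD \<tau> (0, j) x)\<^sup>2) = 1024 * (norm z)\<^sup>2"
    by (simp add: XD_def x power_mult_distrib sum_distrib_left[symmetric] zsum)
  have s4: "(\<Sum>j\<in>Basis. XXD \<tau> (0, j) x) = 32 * real m"
    by (simp add: XXD_def x dimz)
  have K: "(\<Sum>i\<in>I. KXX \<tau> (f i) x) = - a * ((- a - 1) * E2 * (\<Sum>i\<in>I. (XD \<tau> (f i) x)\<^sup>2) + E1 * (\<Sum>i\<in>I. XXD \<tau> (f i) x))" for I and f :: "'c \<Rightarrow> 'v \<times> 'z"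
    by (simp only: KXX_def D_def[symmetric] E1_def[symmetric] E2_def[symmetric] sum_distrib_left[symmetric] sum.distrib)
  have K1: "(\<Sum>i\<in>Basis. KXX \<tau> (i, 0) x) = - a * ((- a - 1) * E2 * (16 * (norm v)\<^sup>2 * D) + E1 * (8 * (norm v)\<^sup>2 + 8 * real n * A + 8 * real m * (norm v)\<^sup>2))"
    using K[of "\<lambda>i. (i, 0)" Basis] s1 s2 by simp
  have K2: "(\<Sum>j\<in>Basis. KXX \<tau> (0, j) x) = - a * ((- a - 1) * E2 * (1024 * (norm z)\<^sup>2) + E1 * (32 * real m))"
    using K[of "\<lambda>j. (0, j)" Basis] s3 s4 by simp
  have J: "Jd \<rho> x = \<rho> powr (1 - 2 * s) * (- a * ((1 - 2 * s) * E1 * (4 * A) + ((- a - 1) * E2 * (16 * A\<^sup>2 * \<tau>) + E1 * (4 * A + 8 * \<tau>))))"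
  proof -
    have nv: "norm (fst x) = norm v" by (simp add: x)
    show ?thesis
      unfolding Jd_def \<tau>_def[symmetric] nv A_def[symmetric] D_def[symmetric] E1_def[symmetric] E2_def[symmetric]
      by (simp add: power_mult_distrib \<tau>_def algebra_simps)
  qed
  have a2: "2 * a = real n + real m - s" by (simp add: a_def)
  have v2: "(norm v)\<^sup>2 = A - \<tau>" by (simp add: A_def)
  have z2: "16 * (norm z)\<^sup>2 = D - A\<^sup>2" by (simp add: De)
  have "(- a * ((- a - 1) * E2 * (16 * (norm v)\<^sup>2 * D) + E1 * (8 * (norm v)\<^sup>2 + 8 * real n * A + 8 * real m * (norm v)\<^sup>2)))
     + \<tau> / 4 * (- a * ((- a - 1) * E2 * (64 * (16 * (norm z)\<^sup>2)) + E1 * (32 * real m)))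
     + (- a * ((1 - 2 * s) * E1 * (4 * A) + ((- a - 1) * E2 * (16 * A\<^sup>2 * \<tau>) + E1 * (4 * A + 8 * \<tau>))))
    = - a * E2 * (8 * A * D) * ((real n + real m - s) - 2 * a)"
    unfolding v2 z2 E12 by (simp add: field_simps power2_eq_square)
  then have "(\<Sum>i\<in>Basis. KXX \<tau> (i, 0) x) + \<tau> / 4 * (\<Sum>j\<in>Basis. KXX \<tau> (0, j) x)
     + (- a * ((1 - 2 * s) * E1 * (4 * A) + ((- a - 1) * E2 * (16 * A\<^sup>2 * \<tau>) + E1 * (4 * A + 8 * \<tau>)))) = 0"
    unfolding K1 K2 a2[symmetric] by simp
  then show ?thesis unfolding J \<tau>_def[symmetric] distrib_left[symmetric] by simp
qed

end

section \<open>Gradients of compactly supported functions\<close>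

text \<open>The common ground of test functions, their differences and their left translates: the
  regularity that integration by parts uses, with an explicit radius bounding the support both in
  \<open>N\<close> and in height.\<close>

definition C1c :: "(('v::euclidean_space \<times> 'z::euclidean_space) \<times> real \<Rightarrow> real) \<Rightarrow> real \<Rightarrow> bool" where
  "C1c h R \<longleftrightarrow> (\<forall>p. h differentiable (at p)) \<and>
     (\<forall>d. continuous_on UNIV (\<lambda>p. frechet_derivative h (at p) d)) \<and>
     R > 0 \<and> (\<forall>x \<rho>. hnorm x > R \<or> \<bar>\<rho>\<bar> > R \<longrightarrow> h (x, \<rho>) = 0)"

lemma frechet_derivative_zero_on_open:
  fixes h :: "'a::euclidean_space \<Rightarrow> real"
  assumes "open S" "p \<in> S" "\<And>q. q \<in> S \<Longrightarrow> h q = 0"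
  shows "frechet_derivative h (at p) = (\<lambda>d. 0)"
proof -
  have "(h has_derivative (\<lambda>d. 0)) (at p)"
    by (rule has_derivative_transform_within_open[OF _ assms(1,2), of "\<lambda>_. 0"]) (auto simp: assms(3))
  then show ?thesis by (metis frechet_derivative_at)
qed

context h_type begin

text \<open>At the point \<open>(v, z)\<close> the left-invariant field is the constant direction
  \<open>d\<close> corrected by half the bracket of \<open>v\<close> with the horizontal part of
  \<open>d\<close>. Expressing it through the Frechet derivative gives joint continuity and the
  support property directly.\<close>

definition hX :: "(('v \<times> 'z) \<times> real \<Rightarrow> real) \<Rightarrow> 'v \<times> 'z \<Rightarrow> ('v \<times> 'z) \<times> real \<Rightarrow> real" where
  "hX h d p = frechet_derivative h (at p) ((fst d, snd d + (1/2) *\<^sub>R br (fst (fst p)) (fst d)), 0)"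

definition hR :: "(('v \<times> 'z) \<times> real \<Rightarrow> real) \<Rightarrow> ('v \<times> 'z) \<times> real \<Rightarrow> real" where
  "hR h p = frechet_derivative h (at p) (0, 1)"

lemma hX_deriv:
  assumes "h differentiable (at p)"
  shows "((\<lambda>t. h (gm (fst p) (t *\<^sub>R d), snd p)) has_real_derivative hX h d p) (at 0)"
proof -
  have D: "(h has_derivative frechet_derivative h (at p)) (at p)"
    using assms frechet_derivative_works by blast
  let ?w = "((fst d, snd d + (1/2) *\<^sub>R br (fst (fst p)) (fst d)), 0 :: real)"
  have e: "(gm (fst p) (t *\<^sub>R d), snd p) = p + t *\<^sub>R ?w" for t
    by (simp add: gmult_def prod_eq_iff algebra_simps)
  have "((\<lambda>t. p + t *\<^sub>R ?w) has_derivative (\<lambda>t. t *\<^sub>R ?w)) (at 0)"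
    by (rule has_derivative_eq_rhs, rule derivative_intros, rule derivative_intros, rule derivative_intros) (auto intro!: derivative_intros)
  moreover have "(h has_derivative frechet_derivative h (at p)) (at (p + 0 *\<^sub>R ?w))"
    using D by (simp only: scaleR_zero_left add_0_right)
  ultimately have "((\<lambda>t. h (p + t *\<^sub>R ?w)) has_derivative (\<lambda>t. frechet_derivative h (at p) (t *\<^sub>R ?w))) (at 0)"
    by (rule has_derivative_compose)
  moreover have "frechet_derivative h (at p) (t *\<^sub>R ?w) = hX h d p * t" for t
    unfolding hX_def linear_scale[OF has_derivative_linear[OF D]] by simp
  ultimately show ?thesis unfolding e has_field_derivative_def by simp
qed

lemma hR_deriv:
  assumes "h differentiable (at (x, \<rho>))"
  shows "((\<lambda>t. h (x, t)) has_real_derivative hR h (x, \<rho>)) (at \<rho>)"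
proof -
  have D: "(h has_derivative frechet_derivative h (at (x, \<rho>))) (at (x, \<rho>))"
    using assms frechet_derivative_works by blast
  have "((\<lambda>t. (x, t)) has_derivative (\<lambda>t. (0, t))) (at \<rho>)" by (auto intro!: derivative_eq_intros)
  from has_derivative_compose[OF this D]
  have "((\<lambda>t. h (x, t)) has_derivative (\<lambda>t. frechet_derivative h (at (x, \<rho>)) (0, t))) (at \<rho>)" .
  moreover have "frechet_derivative h (at (x, \<rho>)) (0, t) = hR h (x, \<rho>) * t" for t
    using linear_scale[OF has_derivative_linear[OF D], of t "(0, 1)"] by (simp add: hR_def mult.commute)
  ultimately show ?thesis unfolding has_field_derivative_def by simp
qed

lemma left_field_hX: "h differentiable (at p) \<Longrightarrow> left_field br d h p = hX h d p"
  unfolding left_field_def by (rule DERIV_imp_deriv[OF hX_deriv])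

lemma grad_eq:
  assumes "h differentiable (at p)"
  shows "grad br h p = ((\<Sum>i\<in>Basis. hX h (i, 0) p *\<^sub>R i, \<Sum>j\<in>Basis. (1/2 * snd p * hX h (0, j) p) *\<^sub>R j), hR h p)"
proof -
  have "deriv (\<lambda>t. h (fst p, t)) (snd p) = hR h p"
    using hR_deriv[of h "fst p" "snd p"] assms by (auto intro: DERIV_imp_deriv)
  then show ?thesis by (simp add: grad_def left_field_hX[OF assms])
qed

lemma frechet_split:
  fixes h :: "('v \<times> 'z) \<times> real \<Rightarrow> real"
  assumes "h differentiable (at p)"
  shows "frechet_derivative h (at p) ((u, w), r) = frechet_derivative h (at p) ((u, 0), 0) + frechet_derivative h (at p) ((0, w), 0) + r * frechet_derivative h (at p) (0, 1)"
proof -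
  have L: "linear (frechet_derivative h (at p))"
    using assms frechet_derivative_works has_derivative_linear by blast
  have "((u, w), r) = ((u, 0), 0) + (((0, w), 0) + r *\<^sub>R (0, 1 :: real))" by (simp add: zero_prod_def)
  then show ?thesis by (simp only: linear_add[OF L] linear_scale[OF L]) simp
qed

lemma frechet_basis:
  fixes h :: "('v \<times> 'z) \<times> real \<Rightarrow> real"
  assumes "h differentiable (at p)"
  shows "frechet_derivative h (at p) ((u, w), 0) = (\<Sum>i\<in>Basis. (u \<bullet> i) * frechet_derivative h (at p) ((i, 0), 0)) + (\<Sum>j\<in>Basis. (w \<bullet> j) * frechet_derivative h (at p) ((0, j), 0))"
proof -
  have L: "linear (frechet_derivative h (at p))"
    using assms frechet_derivative_works has_derivative_linear by blast
  have "((u, w), 0 :: real) = (\<Sum>i\<in>Basis. (u \<bullet> i) *\<^sub>R ((i, 0), 0)) + (\<Sum>j\<in>Basis. (w \<bullet> j) *\<^sub>R ((0, j), 0))"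
    by (simp add: prod_eq_iff fst_sum snd_sum euclidean_representation)
  then show ?thesis by (simp only: linear_add[OF L] linear_sum[OF L] linear_scale[OF L]) simp
qed

lemma C1cD:
  fixes h :: "('v \<times> 'z) \<times> real \<Rightarrow> real"
  assumes "C1c h R"
  shows "h differentiable (at p)" "continuous_on UNIV (\<lambda>p. frechet_derivative h (at p) d)"
    "R > 0" "hnorm x > R \<or> \<bar>\<rho>\<bar> > R \<Longrightarrow> h (x, \<rho>) = 0" "continuous_on UNIV h"
proof -
  show d: "\<And>p. h differentiable (at p)" and "continuous_on UNIV (\<lambda>p. frechet_derivative h (at p) d)"
    and "R > 0" and "hnorm x > R \<or> \<bar>\<rho>\<bar> > R \<Longrightarrow> h (x, \<rho>) = 0"
    using assms unfolding C1c_def by blast+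
  show "continuous_on UNIV h"
    by (intro continuous_at_imp_continuous_on ballI differentiable_imp_continuous_within d)
qed

lemma C1c_frechet_supp:
  fixes h :: "('v \<times> 'z) \<times> real \<Rightarrow> real"
  assumes "C1c h R" "hnorm x > R \<or> \<bar>\<rho>\<bar> > R"
  shows "frechet_derivative h (at (x, \<rho>)) d = 0"
proof -
  let ?S = "{p :: ('v \<times> 'z) \<times> real. hnorm (fst p) > R} \<union> {p. \<bar>snd p\<bar> > R}"
  have "continuous_on UNIV (\<lambda>p :: ('v \<times> 'z) \<times> real. hnorm (fst p))"
    by (intro continuous_on_compose2[OF hnorm_continuous] continuous_intros) auto
  then have "open ?S" by (intro open_Un open_Collect_less continuous_intros)
  from frechet_derivative_zero_on_open[OF this, of "(x, \<rho>)" h] show ?thesis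
    using assms C1cD(4)[OF assms(1)] by auto
qed

lemma hX_cont: assumes "C1c h R" shows "continuous_on UNIV (hX h d)"
proof -
  have "hX h d = (\<lambda>p. frechet_derivative h (at p) ((fst d, 0), 0) + (\<Sum>j\<in>Basis. ((snd d + (1/2) *\<^sub>R br (fst (fst p)) (fst d)) \<bullet> j) * frechet_derivative h (at p) ((0, j), 0)))"
  proof
    fix p
    show "hX h d p = frechet_derivative h (at p) ((fst d, 0), 0) + (\<Sum>j\<in>Basis. ((snd d + (1/2) *\<^sub>R br (fst (fst p)) (fst d)) \<bullet> j) * frechet_derivative h (at p) ((0, j), 0))"
      unfolding hX_def
      using frechet_basis[OF C1cD(1)[OF assms], of p 0 "snd d + (1/2) *\<^sub>R br (fst (fst p)) (fst d)"]
        frechet_split[OF C1cD(1)[OF assms], of p "fst d" "snd d + (1/2) *\<^sub>R br (fst (fst p)) (fst d)" 0]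
      by simp
  qed
  then show ?thesis by (simp only:) (intro continuous_intros C1cD(2)[OF assms])
qed

lemma hR_cont: "C1c h R \<Longrightarrow> continuous_on UNIV (hR h)"
  unfolding hR_def by (rule C1cD(2))

lemma h_supp: assumes "C1c h R" "hnorm x > R \<or> \<bar>\<rho>\<bar> > R"
  shows "hX h d (x, \<rho>) = 0" "hR h (x, \<rho>) = 0"
  using C1c_frechet_supp[OF assms] by (auto simp: hX_def hR_def)

lemma grad_cont: assumes "C1c h R" shows "continuous_on UNIV (grad br h)"
proof -
  have "grad br h = (\<lambda>p. ((\<Sum>i\<in>Basis. hX h (i, 0) p *\<^sub>R i, \<Sum>j\<in>Basis. (1/2 * snd p * hX h (0, j) p) *\<^sub>R j), hR h p))"
    using grad_eq[OF C1cD(1)[OF assms]] by blast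
  then show ?thesis
    by (simp only:) (intro continuous_intros hX_cont[OF assms] hR_cont[OF assms])
qed

lemma grad_supp: assumes "C1c h R" "hnorm x > R \<or> \<bar>\<rho>\<bar> > R"
  shows "grad br h (x, \<rho>) = 0"
  unfolding grad_eq[OF C1cD(1)[OF assms(1)]] by (simp add: h_supp[OF assms] zero_prod_def)

lemma compact_cyl: "compact ((hball R) \<times> {r..r' :: real})"
  by (intro compact_Times compact_hnorm_ball compact_Icc)

lemma grad_bounded: assumes "C1c h R"
  obtains B where "B > 0" "\<And>p. norm (grad br h p) \<le> B" "\<And>p. \<bar>h p\<bar> \<le> B"
proof -
  let ?S = "hball R \<times> {- R..R}"
  have "compact (grad br h ` ?S)" "compact (h ` ?S)"
    by (intro compact_continuous_image compact_cyl continuous_on_subset[OF grad_cont[OF assms]] continuous_on_subset[OF C1cD(5)[OF assms]]; simp)+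
  then have "bounded (grad br h ` ?S)" "bounded (h ` ?S)" by (auto intro: compact_imp_bounded)
  then obtain B1 B2 where "\<forall>y\<in>grad br h ` ?S. norm y \<le> B1" "\<forall>y\<in>h ` ?S. norm y \<le> B2"
    unfolding bounded_iff by blast
  then have B: "\<And>p. p \<in> ?S \<Longrightarrow> norm (grad br h p) \<le> B1" "\<And>p. p \<in> ?S \<Longrightarrow> \<bar>h p\<bar> \<le> B2"
    using imageI[of _ ?S "grad br h"] imageI[of _ ?S h] by (blast, metis real_norm_def)
  show ?thesis
  proof (rule that[of "\<bar>B1\<bar> + \<bar>B2\<bar> + 1"])
    fix p :: "('v \<times> 'z) \<times> real"
    obtain x \<rho> where p: "p = (x, \<rho>)" by (cases p)
    show "norm (grad br h p) \<le> \<bar>B1\<bar> + \<bar>B2\<bar> + 1" "\<bar>h p\<bar> \<le> \<bar>B1\<bar> + \<bar>B2\<bar> + 1"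
    proof -
      have "norm (grad br h p) \<le> \<bar>B1\<bar> + \<bar>B2\<bar> + 1 \<and> \<bar>h p\<bar> \<le> \<bar>B1\<bar> + \<bar>B2\<bar> + 1"
      proof (cases "hnorm x > R \<or> \<bar>\<rho>\<bar> > R")
        case True
        then show ?thesis using grad_supp[OF assms True] C1cD(4)[OF assms True] by (simp add: p)
      next
        case False
        then have "p \<in> ?S" by (auto simp: p)
        from B[OF this] show ?thesis by linarith
      qed
      then show "norm (grad br h p) \<le> \<bar>B1\<bar> + \<bar>B2\<bar> + 1" "\<bar>h p\<bar> \<le> \<bar>B1\<bar> + \<bar>B2\<bar> + 1" by blast+
    qed
  qed simp
qed

text \<open>Extended by zero to nonpositive heights, so that integrals over the half-space become
  integrals over the full product, where Fubini and the translation lemmas apply.\<close>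

definition wt :: "real \<Rightarrow> real" where "wt \<rho> = indicator {0<..} \<rho> * \<rho> powr (1 - 2 * s)"

lemma wt_meas [measurable]: "wt \<in> borel_measurable borel" unfolding wt_def by measurable

lemma wt_nonneg [simp]: "0 \<le> wt \<rho>" by (simp add: wt_def)

lemma nn_integral_powr_0:
  assumes "b > -1" "R > 0"
  shows "(\<integral>\<^sup>+\<rho>. ennreal (indicator {0<..R} \<rho> * \<rho> powr b) \<partial>lborel) < \<infinity>"
proof -
  have "(\<integral>\<^sup>+\<rho>. ennreal (indicator {0<..R} \<rho> * \<rho> powr b) \<partial>lborel) = (\<integral>\<^sup>+\<rho>. ennreal (\<rho> powr b * indicator {0..R} \<rho>) \<partial>lborel)"
    by (intro nn_integral_cong) (auto simp: indicator_def)
  also have "\<dots> = ennreal (R powr (b + 1) / (b + 1))"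
  proof (rule nn_integral_has_integral_lborel)
    show "((\<lambda>\<rho>. \<rho> powr b * indicator {0..R} \<rho>) has_integral R powr (b + 1) / (b + 1)) UNIV"
    proof -
      have "((\<lambda>\<rho>. if \<rho> \<in> {0..R} then \<rho> powr b else 0) has_integral R powr (b + 1) / (b + 1)) UNIV"
        unfolding has_integral_restrict_UNIV using has_integral_powr_from_0[of b R] assms by simp
      moreover have "(\<lambda>\<rho>. if \<rho> \<in> {0..R} then \<rho> powr b else 0) = (\<lambda>\<rho>. \<rho> powr b * indicator {0..R} \<rho>)"
        by (auto simp: indicator_def)
      ultimately show ?thesis by simp
    qed
  qed auto
  finally show ?thesis by simp
qed

lemma nn_integral_prod:
  assumes [measurable]: "f \<in> borel_measurable (borel :: ('a::euclidean_space) measure)" "g \<in> borel_measurable (borel :: ('b::euclidean_space) measure)"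
  shows "(\<integral>\<^sup>+p. f (fst p) * g (snd p) \<partial>lborel) = (\<integral>\<^sup>+x. f x \<partial>lborel) * (\<integral>\<^sup>+y. g y \<partial>lborel)"
proof -
  have "(\<integral>\<^sup>+p. f (fst p) * g (snd p) \<partial>lborel) = (\<integral>\<^sup>+x. (\<integral>\<^sup>+y. f x * g y \<partial>lborel) \<partial>lborel)"
    by (subst nn_integral_lborel_pair) auto
  then show ?thesis by (simp add: nn_integral_cmult nn_integral_multc)
qed

lemma AE_lborel_fst:
  assumes [measurable]: "Measurable.pred (borel :: 'a::euclidean_space measure) P" and P: "AE x in lborel. P x"
  shows "AE p in (lborel :: ('a \<times> 'b::euclidean_space) measure). P (fst p)"
proof -
  have "(\<integral>\<^sup>+x. indicator {x. \<not> P x} x \<partial>lborel) = 0"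
    using P by (subst nn_integral_0_iff_AE) (auto elim!: eventually_mono)
  then have "(\<integral>\<^sup>+p. indicator {x. \<not> P x} (fst p) * 1 \<partial>(lborel :: ('a \<times> 'b) measure)) = 0"
    by (subst nn_integral_prod) auto
  then have "AE p in (lborel :: ('a \<times> 'b) measure). indicator {x. \<not> P x} (fst p) * (1::ennreal) = 0"
    by (subst (asm) nn_integral_0_iff_AE) auto
  then show ?thesis by eventually_elim (auto simp: indicator_def split: if_splits)
qed

text \<open>The gradient of \<open>h\<close> is bounded and \<open>KG_bound\<close> controls the
  other factor. The weight turns \<open>\<rho> powr (2 s - 1 - \<kappa>)\<close> into
  \<open>\<rho> powr (- \<kappa>)\<close>, and the majorant is a product function on the support
  cylinder.\<close>

lemma kernel_pairing_integrable:
  assumes h: "C1c h R"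
  shows "integrable lborel (\<lambda>p. wt (snd p) * (grad br h p \<bullet> KG ((snd p)\<^sup>2) (snd p) (fst p)))"
proof -
  obtain B where B: "B > 0" "\<And>p. norm (grad br h p) \<le> B" using grad_bounded[OF h] by metis
  have R: "R > 0" using C1cD(3)[OF h] .
  have [measurable]: "grad br h \<in> borel_measurable borel" by (rule borel_measurable_continuous_onI[OF grad_cont[OF h]])
  obtain C where C: "\<And>x. (\<integral>\<^sup>+w. ennreal (indicator (hball R) w * hnorm (gm (ginv w) x) powr (- (Q - \<kappa>))) \<partial>lborel) \<le> ennreal C"
  proof -
    have "0 \<le> Q - \<kappa>" "Q - \<kappa> < Q" using kappa by auto
    from riesz_unif_bound[OF this, of R] show ?thesis using that by blast
  qed
  have "(\<integral>\<^sup>+p. ennreal (norm (wt (snd p) * (grad br h p \<bullet> KG ((snd p)\<^sup>2) (snd p) (fst p)))) \<partial>lborel)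
     \<le> (\<integral>\<^sup>+p. ennreal (B * (4 * a)) * (ennreal (indicator (hball R) (fst p) * hnorm (fst p) powr (- (Q - \<kappa>))) * ennreal (indicator {0<..R} (snd p) * (snd p) powr (- \<kappa>))) \<partial>lborel)"
  proof (rule nn_integral_mono_AE)
    have "AE p in (lborel :: (('v \<times> 'z) \<times> real) measure). fst p \<noteq> 0"
      by (rule AE_lborel_fst[OF _ AE_lborel_singleton]) measurable
    then show "AE p in lborel. ennreal (norm (wt (snd p) * (grad br h p \<bullet> KG ((snd p)\<^sup>2) (snd p) (fst p))))
      \<le> ennreal (B * (4 * a)) * (ennreal (indicator (hball R) (fst p) * hnorm (fst p) powr (- (Q - \<kappa>))) * ennreal (indicator {0<..R} (snd p) * (snd p) powr (- \<kappa>)))"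
    proof eventually_elim
      fix p :: "('v \<times> 'z) \<times> real" assume p0: "fst p \<noteq> 0"
      obtain x \<rho> where p: "p = (x, \<rho>)" by (cases p)
      show "ennreal (norm (wt (snd p) * (grad br h p \<bullet> KG ((snd p)\<^sup>2) (snd p) (fst p))))
      \<le> ennreal (B * (4 * a)) * (ennreal (indicator (hball R) (fst p) * hnorm (fst p) powr (- (Q - \<kappa>))) * ennreal (indicator {0<..R} (snd p) * (snd p) powr (- \<kappa>)))"
      proof (cases "\<rho> > 0 \<and> hnorm x \<le> R \<and> \<rho> \<le> R")
        case True
        have "\<bar>grad br h p \<bullet> KG (\<rho>\<^sup>2) \<rho> x\<bar> \<le> norm (grad br h p) * norm (KG (\<rho>\<^sup>2) \<rho> x)" by (rule Cauchy_Schwarz_ineq2)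
        also have "\<dots> \<le> B * (4 * a * (hnorm x powr (- (Q - \<kappa>)) * \<rho> powr (2 * s - 1 - \<kappa>)))"
          using B a_pos p0 True by (intro mult_mono KG_bound) (auto simp: p)
        finally have "\<rho> powr (1 - 2 * s) * \<bar>grad br h p \<bullet> KG (\<rho>\<^sup>2) \<rho> x\<bar> \<le> \<rho> powr (1 - 2 * s) * (B * (4 * a * (hnorm x powr (- (Q - \<kappa>)) * \<rho> powr (2 * s - 1 - \<kappa>))))"
          by (rule mult_left_mono) simp
        also have "\<dots> = B * (4 * a) * (hnorm x powr (- (Q - \<kappa>)) * (\<rho> powr (1 - 2 * s) * \<rho> powr (2 * s - 1 - \<kappa>)))" by simp
        also have "\<rho> powr (1 - 2 * s) * \<rho> powr (2 * s - 1 - \<kappa>) = \<rho> powr (- \<kappa>)" by (simp add: powr_add[symmetric])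
        finally show ?thesis using True B a_pos
          by (simp add: p wt_def abs_mult ennreal_mult'[symmetric] ennreal_leI)
      next
        case False
        then have "wt \<rho> * (grad br h p \<bullet> KG (\<rho>\<^sup>2) \<rho> x) = 0"
          using grad_supp[OF h, of x \<rho>] by (cases "\<rho> > 0") (auto simp: p wt_def not_le)
        then show ?thesis by (simp only: p fst_conv snd_conv) simp
      qed
    qed
  qed
  also have "\<dots> = ennreal (B * (4 * a)) * ((\<integral>\<^sup>+x. ennreal (indicator (hball R) x * hnorm x powr (- (Q - \<kappa>))) \<partial>lborel) * (\<integral>\<^sup>+\<rho>. ennreal (indicator {0<..R} \<rho> * \<rho> powr (- \<kappa>)) \<partial>lborel))"
    by (subst nn_integral_cmult, measurable, subst nn_integral_prod) auto
  also have "\<dots> < \<infinity>"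
  proof -
    have "(\<integral>\<^sup>+x. ennreal (indicator (hball R) x * hnorm x powr (- (Q - \<kappa>))) \<partial>lborel) \<le> ennreal C"
      using C[of 0] by simp
    then have "(\<integral>\<^sup>+x. ennreal (indicator (hball R) x * hnorm x powr (- (Q - \<kappa>))) \<partial>lborel) < \<top>"
      by (rule le_less_trans) simp
    moreover have "(\<integral>\<^sup>+\<rho>. ennreal (indicator {0<..R} \<rho> * \<rho> powr (- \<kappa>)) \<partial>lborel) < \<top>"
      using nn_integral_powr_0[of "- \<kappa>" R] kappa R by simp
    ultimately show ?thesis by (simp only: ennreal_mult_less_top infinity_ennreal_def) simp
  qed
  finally show ?thesis by (intro integrableI_bounded) auto
qed

text \<open>The factor \<open>\<rho>^2 / 4\<close> collects one \<open>\<rho> / 2\<close> from the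
  gradient of \<open>h\<close> and one from that of the kernel; it matches the coefficient of the
  central second derivatives in \<open>pde\<close>.\<close>

lemma grad_inner_KG:
  assumes h: "C1c h R"
  shows "grad br h (x, \<rho>) \<bullet> KG (\<rho>\<^sup>2) \<rho> x = (\<Sum>i\<in>Basis. hX h (i, 0) (x, \<rho>) * KX (\<rho>\<^sup>2) (i, 0) x)
     + \<rho>\<^sup>2 / 4 * (\<Sum>j\<in>Basis. hX h (0, j) (x, \<rho>) * KX (\<rho>\<^sup>2) (0, j) x)
     + hR h (x, \<rho>) * (- a * DD (\<rho>\<^sup>2) x powr (- a - 1) * (4 * (\<rho>\<^sup>2 + (norm (fst x))\<^sup>2) * \<rho>))"
proof -
  let ?E = "- a * DD (\<rho>\<^sup>2) x powr (- a - 1)"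
  have Ji: "Jt (fst x) (snd x) \<bullet> i = snd x \<bullet> br (fst x) i" if "i \<in> Basis" for i using that by (simp add: Jt_def)
  have 1: "(\<Sum>i\<in>Basis. hX h (i, 0) (x, \<rho>) *\<^sub>R i) \<bullet> fst (fst (KG (\<rho>\<^sup>2) \<rho> x)) = (\<Sum>i\<in>Basis. hX h (i, 0) (x, \<rho>) * KX (\<rho>\<^sup>2) (i, 0) x)"
  proof -
    have "i \<bullet> fst (fst (KG (\<rho>\<^sup>2) \<rho> x)) = KX (\<rho>\<^sup>2) (i, 0) x" if "i \<in> Basis" for i
      using Ji[OF that] by (simp add: KG_def GD_def KX_def XD_def inner_add_right inner_commute[of i])
    then show ?thesis unfolding inner_sum_left by (intro sum.cong refl) simp
  qed
  have 2: "(\<Sum>j\<in>Basis. (1/2 * \<rho> * hX h (0, j) (x, \<rho>)) *\<^sub>R j) \<bullet> snd (fst (KG (\<rho>\<^sup>2) \<rho> x)) = \<rho>\<^sup>2 / 4 * (\<Sum>j\<in>Basis. hX h (0, j) (x, \<rho>) * KX (\<rho>\<^sup>2) (0, j) x)"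
  proof -
    have t: "j \<bullet> snd (fst (KG (\<rho>\<^sup>2) \<rho> x)) = \<rho> / 2 * KX (\<rho>\<^sup>2) (0, j) x" for j
    proof -
      have t1: "snd (fst (KG (\<rho>\<^sup>2) \<rho> x)) = (- a * DD (\<rho>\<^sup>2) x powr (- a - 1) * (16 * \<rho>)) *\<^sub>R snd x"
        by (simp add: KG_def GD_def)
      have t2: "KX (\<rho>\<^sup>2) (0, j) x = - a * DD (\<rho>\<^sup>2) x powr (- a - 1) * (32 * (j \<bullet> snd x))"
        by (simp add: KX_def XD_def inner_commute[of "snd x"])
      show ?thesis unfolding t1 t2 inner_scaleR_right by simp
    qed
    have "((1/2 * \<rho> * hX h (0, j) (x, \<rho>)) *\<^sub>R j) \<bullet> snd (fst (KG (\<rho>\<^sup>2) \<rho> x)) = \<rho>\<^sup>2 / 4 * (hX h (0, j) (x, \<rho>) * KX (\<rho>\<^sup>2) (0, j) x)" for j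
      by (subst inner_scaleR_left, subst t) (simp add: power2_eq_square)
    then show ?thesis unfolding inner_sum_left sum_distrib_left
      by (intro sum.cong refl)
  qed
  have 3: "snd (KG (\<rho>\<^sup>2) \<rho> x) = - a * DD (\<rho>\<^sup>2) x powr (- a - 1) * (4 * (\<rho>\<^sup>2 + (norm (fst x))\<^sup>2) * \<rho>)"
    by (simp add: KG_def GD_def)
  show ?thesis
    unfolding grad_eq[OF C1cD(1)[OF h]] inner_prod_def fst_conv snd_conv 1 2 3 inner_real_def ..
qed

end

section \<open>The flux constant\<close>

lemma lborel_fubini:
  fixes f :: "'a::euclidean_space \<times> 'b::euclidean_space \<Rightarrow> real"
  assumes "integrable lborel f"
  shows "(\<integral>p. f p \<partial>lborel) = (\<integral>x. (\<integral>y. f (x, y) \<partial>lborel) \<partial>lborel)"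
    "(\<integral>p. f p \<partial>lborel) = (\<integral>y. (\<integral>x. f (x, y) \<partial>lborel) \<partial>lborel)"
proof -
  have i: "integrable (lborel \<Otimes>\<^sub>M lborel) (\<lambda>(x, y). f (x, y))" using assms by (simp add: lborel_prod)
  show "(\<integral>p. f p \<partial>lborel) = (\<integral>x. (\<integral>y. f (x, y) \<partial>lborel) \<partial>lborel)"
    using lborel_pair.integral_fst[OF i] by (simp add: lborel_prod)
  show "(\<integral>p. f p \<partial>lborel) = (\<integral>y. (\<integral>x. f (x, y) \<partial>lborel) \<partial>lborel)"
    using lborel_pair.integral_snd[OF i] by (simp add: lborel_prod)
qed

lemma nn_integral_scale:
  assumes [measurable]: "f \<in> borel_measurable (borel :: 'a::euclidean_space measure)" and "c > 0"
  shows "(\<integral>\<^sup>+x. f x \<partial>lborel) = ennreal (c ^ DIM('a)) * (\<integral>\<^sup>+x. f (c *\<^sub>R x) \<partial>lborel)"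
proof -
  have L: "(lborel :: 'a measure) = density (distr lborel borel (\<lambda>x. 0 + c *\<^sub>R x)) (\<lambda>_. ennreal (\<bar>c\<bar> ^ DIM('a)))"
    using lborel_affine[of c "0::'a"] assms(2) by simp
  have "(\<integral>\<^sup>+x. f x \<partial>lborel) = (\<integral>\<^sup>+x. f x \<partial>density (distr lborel borel (\<lambda>x. 0 + c *\<^sub>R x)) (\<lambda>_. ennreal (\<bar>c\<bar> ^ DIM('a))))"
    by (subst L) simp
  also have "\<dots> = ennreal (c ^ DIM('a)) * (\<integral>\<^sup>+x. f (c *\<^sub>R x) \<partial>lborel)"
    using assms(2) by (simp add: nn_integral_density nn_integral_distr nn_integral_cmult)
  finally show ?thesis .
qed

lemma ennreal_mult3:
  "0 \<le> x \<Longrightarrow> 0 \<le> y \<Longrightarrow> 0 \<le> z \<Longrightarrow> ennreal x * (ennreal y * ennreal z) = ennreal (x * (y * z))"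
  by (simp add: ennreal_mult)

text \<open>Transferred from the complex Legendre formula; the halved argument is the form in which
  the Gamma factors of \<open>c0\<close> and \<open>C1\<close> meet it.\<close>

lemma Gamma_duplication:
  assumes "x > (0::real)"
  shows "Gamma (x / 2) * Gamma ((x + 1) / 2) = 2 powr (1 - x) * sqrt pi * Gamma x"
proof -
  have nz: "complex_of_real y \<notin> \<int>\<^sub>\<le>\<^sub>0" if "y > 0" for y :: real
    using that by (auto simp: of_real_in_nonpos_Ints_iff dest: nonpos_Ints_nonpos)
  have a: "complex_of_real (x / 2) + 1 / 2 = of_real (x / 2 + 1 / 2)"
    "(1 - complex_of_real x) * of_real (ln 2) = of_real ((1 - x) * ln 2)" "2 * complex_of_real (x / 2) = of_real x" by simp_all
  have "complex_of_real (x / 2) + 1 / 2 \<notin> \<int>\<^sub>\<le>\<^sub>0" unfolding a using assms by (intro nz) simp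
  from Gamma_legendre_duplication[OF nz this] assms
  have "Gamma (x / 2) * Gamma (x / 2 + 1 / 2) = exp ((1 - x) * ln 2) * sqrt pi * Gamma x"
    unfolding a Gamma_complex_of_real exp_of_real of_real_mult[symmetric] of_real_eq_iff by simp
  moreover have "x / 2 + 1 / 2 = (x + 1) / 2" by (simp add: add_divide_distrib)
  ultimately show ?thesis by (simp add: powr_def)
qed

context h_type begin

text \<open>The flux profile: minus the weighted height derivative \<open>J\<close> of the kernel at
  height one. Homogeneity turns the flux at any height into a rescaling of it, so the fluxes form an
  approximate identity of total mass \<open>c0\<close>.\<close>

definition PP :: "'v \<times> 'z \<Rightarrow> real" where
  "PP x = 4 * a * (1 + (norm (fst x))\<^sup>2) * DD 1 x powr (- a - 1)"

definition c0 :: real where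
  "c0 = 4 * a * (1/4) ^ m * (pi powr (real m / 2) * Gamma (a + 1 - real m / 2) / Gamma (a + 1))
    * (pi powr real n * Gamma (1 - s) / Gamma (real n + 1 - s))"

lemma c0_pos: "c0 > 0"
proof -
  have "a + 1 - real m / 2 > 0" "a + 1 > 0" "real n + 1 - s > 0" "1 - s > 0"
    using s1 a_pos n_pos by (auto simp: a_def field_simps)
  then show ?thesis unfolding c0_def using a_pos by (intro mult_pos_pos divide_pos_pos Gamma_real_pos) auto
qed

lemma PP_nonneg [simp]: "0 \<le> PP x" using a_pos by (simp add: PP_def add_nonneg_nonneg)

lemma PP_meas [measurable]: "PP \<in> borel_measurable borel" unfolding PP_def by measurable

text \<open>Scaling \<open>z\<close> by \<open>A / 4\<close> with \<open>A = 1 + |v|^2\<close> turns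
  \<open>DD 1\<close> into \<open>A^2 (1 + |z|^2)\<close> and separates the variables. The factors
  of \<open>c0\<close> are \<open>4 a\<close>, the part \<open>(1/4)^m\<close> of the Jacobian, the
  integral in \<open>z\<close> with exponent \<open>a + 1\<close>, and the one in \<open>v\<close>
  with exponent \<open>n + 1 - s\<close>.\<close>

lemma nn_integral_PP: "(\<integral>\<^sup>+x. ennreal (PP x) \<partial>lborel) = ennreal c0"
proof -
  let ?Iz = "pi powr (real m / 2) * Gamma (a + 1 - real m / 2) / Gamma (a + 1)"
  let ?Iv = "pi powr real n * Gamma (1 - s) / Gamma (real n + 1 - s)"
  have Iz: "(\<integral>\<^sup>+(z::'z). ennreal ((1 + (norm z)\<^sup>2) powr (- (a + 1))) \<partial>lborel) = ennreal ?Iz"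
  proof -
    have "real n \<ge> 1" using n_pos by simp
    then have "real DIM('z) / 2 < a + 1" using s1 unfolding dimz a_def by (simp add: add_divide_distrib diff_divide_distrib)
    from nn_integral_bessel_weight[OF this] show ?thesis unfolding dimz .
  qed
  have Iv: "(\<integral>\<^sup>+(v::'v). ennreal ((1 + (norm v)\<^sup>2) powr (- (real n + 1 - s))) \<partial>lborel) = ennreal ?Iv"
    using nn_integral_bessel_weight[where 'a='v, of "real n + 1 - s"] dimv s1 by simp
  have rn: "real n \<ge> 1" using n_pos by simp
  have "a + 1 - real m / 2 > 0" using s1 rn by (simp add: a_def add_divide_distrib diff_divide_distrib)
  then have pz: "?Iz \<ge> 0" using a_pos
    by (intro divide_nonneg_nonneg mult_nonneg_nonneg less_imp_le[OF Gamma_real_pos]) simp_all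
  have inner: "(\<integral>\<^sup>+z. ennreal (PP (v, z)) \<partial>lborel) = ennreal (4 * a * (1/4) ^ m * ?Iz) * ennreal ((1 + (norm v)\<^sup>2) powr (- (real n + 1 - s)))" for v :: 'v
  proof -
    define A where "A = 1 + (norm v)\<^sup>2"
    have A: "A > 0" by (simp add: A_def add_pos_nonneg)
    have P: "PP (v, (A / 4) *\<^sub>R z) = 4 * a * (A * A powr (- 2 * a - 2)) * (1 + (norm z)\<^sup>2) powr (- (a + 1))" for z :: 'z
    proof -
      have "DD 1 (v, (A / 4) *\<^sub>R z) = A\<^sup>2 * (1 + (norm z)\<^sup>2)"
        using A by (simp add: DD_def A_def[symmetric] power_mult_distrib power_divide algebra_simps)
      moreover have "(A\<^sup>2) powr (- a - 1) = A powr (- 2 * a - 2)"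
      proof -
        have "A\<^sup>2 = A powr 2" using A by simp
        then show ?thesis by (simp only: powr_powr) (simp add: algebra_simps)
      qed
      moreover have "(A\<^sup>2 * (1 + (norm z)\<^sup>2)) powr (- a - 1) = (A\<^sup>2) powr (- a - 1) * (1 + (norm z)\<^sup>2) powr (- a - 1)"
        by (rule powr_mult)
      ultimately have "PP (v, (A / 4) *\<^sub>R z) = 4 * a * (A * A powr (- 2 * a - 2)) * (1 + (norm z)\<^sup>2) powr (- a - 1)"
        by (simp add: PP_def A_def[symmetric])
      also have "- a - 1 = - (a + 1)" by simp
      finally show ?thesis .
    qed
    have e: "(A / 4) ^ m * (4 * a * (A * A powr (- 2 * a - 2)) * ?Iz) = 4 * a * (1/4) ^ m * ?Iz * A powr (- (real n + 1 - s))"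
    proof -
      have "A ^ m * (A * A powr (- 2 * a - 2)) = A powr (real m + (1 + (- 2 * a - 2)))"
        using A by (simp only: powr_add powr_realpow powr_one)
      also have "real m + (1 + (- 2 * a - 2)) = - (real n + 1 - s)"
      proof -
        have "2 * a = real n + real m - s" by (simp add: a_def)
        then show ?thesis by linarith
      qed
      finally have "A ^ m * (A * A powr (- 2 * a - 2)) = A powr (- (real n + 1 - s))" .
      then have "4 * a * (1/4) ^ m * ?Iz * A powr (- (real n + 1 - s)) = 4 * a * (1/4) ^ m * ?Iz * (A ^ m * (A * A powr (- 2 * a - 2)))"
        by (simp only:)
      also have "\<dots> = ((1/4) ^ m * A ^ m) * (4 * a * (A * A powr (- 2 * a - 2)) * ?Iz)" by (simp only: mult_ac)
      also have "(1/4) ^ m * A ^ m = (A / 4) ^ m" by (simp add: power_divide)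
      finally show ?thesis by (rule sym)
    qed
    have "(\<integral>\<^sup>+z. ennreal (PP (v, z)) \<partial>lborel) = ennreal ((A / 4) ^ m) * (\<integral>\<^sup>+z. ennreal (PP (v, (A / 4) *\<^sub>R z)) \<partial>lborel)"
      using nn_integral_scale[of "\<lambda>z. ennreal (PP (v, z))" "A / 4"] A dimz by simp
    also have "(\<integral>\<^sup>+z. ennreal (PP (v, (A / 4) *\<^sub>R z)) \<partial>lborel)
       = (\<integral>\<^sup>+(z::'z). ennreal (4 * a * (A * A powr (- 2 * a - 2))) * ennreal ((1 + (norm z)\<^sup>2) powr (- (a + 1))) \<partial>lborel)"
    proof (rule nn_integral_cong)
      fix z :: 'z
      have "0 \<le> 4 * a * (A * A powr (- 2 * a - 2))" using A a_pos by auto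
      then show "ennreal (PP (v, (A / 4) *\<^sub>R z)) = ennreal (4 * a * (A * A powr (- 2 * a - 2))) * ennreal ((1 + (norm z)\<^sup>2) powr (- (a + 1)))"
        unfolding P by (rule ennreal_mult) simp
    qed
    also have "\<dots> = ennreal (4 * a * (A * A powr (- 2 * a - 2))) * ennreal ?Iz"
      unfolding Iz[symmetric] by (rule nn_integral_cmult) measurable
    also have "ennreal ((A / 4) ^ m) * \<dots> = ennreal ((A / 4) ^ m * (4 * a * (A * A powr (- 2 * a - 2)) * ?Iz))"
    proof -
      have "0 \<le> (A / 4) ^ m" "0 \<le> 4 * a * (A * A powr (- 2 * a - 2))" using A a_pos by auto
      then show ?thesis using pz by (rule ennreal_mult3)
    qed
    also have "\<dots> = ennreal (4 * a * (1/4) ^ m * ?Iz) * ennreal (A powr (- (real n + 1 - s)))"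
    proof -
      have "0 \<le> 4 * a * (1/4) ^ m" using a_pos by simp
      then have "0 \<le> 4 * a * (1/4) ^ m * ?Iz" using pz by (rule mult_nonneg_nonneg)
      then show ?thesis unfolding e by (rule ennreal_mult) simp
    qed
    finally show ?thesis by (simp only: A_def)
  qed
  have "(\<integral>\<^sup>+x. ennreal (PP x) \<partial>lborel) = (\<integral>\<^sup>+(v::'v). ennreal (4 * a * (1/4) ^ m * ?Iz) * ennreal ((1 + (norm v)\<^sup>2) powr (- (real n + 1 - s))) \<partial>lborel)"
    by (subst nn_integral_lborel_pair, measurable) (simp only: inner)
  also have "\<dots> = ennreal (4 * a * (1/4) ^ m * ?Iz) * ennreal ?Iv"
    unfolding Iv[symmetric] by (rule nn_integral_cmult) measurable
  also have "\<dots> = ennreal c0"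
  proof -
    have "0 \<le> 4 * a * (1/4) ^ m" using a_pos by simp
    then have "0 \<le> 4 * a * (1/4) ^ m * ?Iz" using pz by (rule mult_nonneg_nonneg)
    then show ?thesis unfolding c0_def by (rule ennreal_mult'[symmetric])
  qed
  finally show ?thesis .
qed

lemma PP_integrable: "integrable lborel PP" and integral_PP: "(\<integral>x. PP x \<partial>lborel) = c0"
proof -
  show "integrable lborel PP"
    by (rule integrableI_nonneg) (auto simp: nn_integral_PP)
  show "(\<integral>x. PP x \<partial>lborel) = c0"
    using integral_eq_nn_integral[of PP lborel] c0_pos by (simp add: nn_integral_PP)
qed

lemma C1_pos: "C1 n m s > 0"
  unfolding C1_def using s0 n_pos by (intro mult_pos_pos divide_pos_pos Gamma_real_pos) auto

text \<open>Once \<open>Gamma (x + 1) = x * Gamma x\<close> has removed the shifts, duplication at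
  \<open>n + s\<close> and at \<open>n - s\<close> trades the values at \<open>n + s\<close>,
  \<open>(n + s)/2\<close>, \<open>n - s\<close>, \<open>(n - s)/2\<close> for those at
  \<open>(n + 1 + s)/2\<close> and \<open>(n + 1 - s)/2\<close> in \<open>C2\<close>. The powers of
  2 left over give \<open>2 powr (1 - 2 s) * 4 powr (2 s)\<close>, and the powers of 4 and of pi
  cancel.\<close>

lemma c0_C1: "c0 * C1 n m s = 2 powr (1 - 2 * s) * (Gamma (1 - s) / Gamma s) * C2 n m s"
proof -
  define N M where "N = real n" and "M = real m"
  have N: "N - s > 0" "N + s > 0" "N + M - s > 0" "N + M + s > 0" using n_pos m_pos s0 s1 by (auto simp: N_def M_def)
  have d1: "Gamma ((N + s) / 2) * Gamma ((N + 1 + s) / 2) = 2 powr (1 - (N + s)) * sqrt pi * Gamma (N + s)"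
    using Gamma_duplication[of "N + s"] N by (simp add: add_ac)
  have d2: "Gamma ((N - s) / 2) * Gamma ((N + 1 - s) / 2) = 2 powr (1 - (N - s)) * sqrt pi * Gamma (N - s)"
    using Gamma_duplication[of "N - s"] N by (simp add: algebra_simps)
  have g: "Gamma (x + 1) = x * Gamma x" if "x > 0" for x :: real
    using Gamma_plus1[of x] that nonpos_Ints_nonpos[of x] by fastforce
  have e1: "a + 1 - real m / 2 = (N - s) / 2 + 1" "a + 1 = (N + M - s) / 2 + 1" "real n + 1 - s = (N - s) + 1"
    by (simp_all add: a_def N_def M_def field_simps)
  have G1: "Gamma (a + 1 - real m / 2) = (N - s) / 2 * Gamma ((N - s) / 2)" unfolding e1(1) using N by (intro g) simp
  have G2: "Gamma (a + 1) = a * Gamma ((N + M - s) / 2)" unfolding e1(2) using g[of "(N + M - s) / 2"] N by (simp add: a_def N_def M_def)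
  have G3: "Gamma (real n + 1 - s) = (N - s) * Gamma (N - s)" unfolding e1(3) using N by (intro g) simp
  define gs g1s where "gs = Gamma s" and "g1s = Gamma (1 - s)"
  define p1 p2 p3 where "p1 = Gamma (N + s)" and "p2 = Gamma ((N + s) / 2)" and "p3 = Gamma ((N + 1 + s) / 2)"
  define q1 q2 q3 where "q1 = Gamma (N - s)" and "q2 = Gamma ((N - s) / 2)" and "q3 = Gamma ((N + 1 - s) / 2)"
  define r1 r2 where "r1 = Gamma ((N + M + s) / 2)" and "r2 = Gamma ((N + M - s) / 2)"
  define X where "X = pi powr (N + M / 2)"
  have pos: "gs > 0" "g1s > 0" "p1 > 0" "p2 > 0" "p3 > 0" "q1 > 0" "q2 > 0" "q3 > 0" "r1 > 0" "r2 > 0" "X > 0"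
    unfolding gs_def g1s_def p1_def p2_def p3_def q1_def q2_def q3_def r1_def r2_def X_def
    using N s0 s1 by (auto intro!: Gamma_real_pos)
  have pp: "pi powr (real m / 2) * pi powr real n = X" by (simp add: X_def N_def M_def powr_add mult.commute)
  have c0e: "c0 = 2 * (1/4) ^ m * X * g1s * q2 / (q1 * r2)"
  proof -
    have "c0 = 4 * a * (1/4) ^ m * (pi powr (real m / 2) * ((N - s) / 2 * q2) / (a * r2)) * (pi powr real n * g1s / ((N - s) * q1))"
      unfolding c0_def G1 G2 G3 q2_def r2_def g1s_def q1_def ..
    also have "\<dots> = 2 * (1/4) ^ m * (pi powr (real m / 2) * pi powr real n) * g1s * q2 / (q1 * r2)"
    proof -
      have "4 * a * (1/4) ^ m * (pi powr (real m / 2) * (Y / 2 * q2) / (a * r2)) * (pi powr real n * g1s / (Y * q1))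
        = 2 * (1/4) ^ m * (pi powr (real m / 2) * pi powr real n) * g1s * q2 / (q1 * r2)" if "Y > 0" for Y
        using that a_pos by (simp add: field_simps)
      from this[OF N(1)] show ?thesis .
    qed
    finally show ?thesis unfolding pp .
  qed
  have C1e: "C1 n m s = 4 ^ m / X * (p1 * r1) / (gs * p2)"
    by (simp add: C1_def X_def p1_def r1_def gs_def p2_def N_def M_def)
  have C2e: "C2 n m s = 4 powr (2 * s) * (p3 / q3) * (r1 / r2)"
    by (simp add: C2_def p3_def q3_def r1_def r2_def N_def M_def)
  have D1: "p2 * p3 = 2 powr (1 - (N + s)) * sqrt pi * p1" using d1 by (simp add: p1_def p2_def p3_def)
  have D2: "q2 * q3 = 2 powr (1 - (N - s)) * sqrt pi * q1" using d2 by (simp add: q1_def q2_def q3_def)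
  have "4 powr (2 * s) = (2 powr 2) powr (2 * s)" by simp
  then have f4: "4 powr (2 * s) = 2 powr (4 * s)" by (simp only: powr_powr) simp
  have e4: "(1/4::real) ^ m * 4 ^ m = 1" by (simp flip: power_mult_distrib)
  have tw: "2 * 2 powr (1 - (N - s)) = 2 powr (1 - 2 * s) * 2 powr (4 * s) * 2 powr (1 - (N + s))"
    by (simp add: powr_mult_base powr_add[symmetric])
  have key: "2 * (q2 * q3) * p1 = 2 powr (1 - 2 * s) * 2 powr (4 * s) * (p2 * p3) * q1"
    unfolding D1 D2 using tw by (simp add: mult_ac)
  have "c0 * C1 n m s = ((1/4) ^ m * 4 ^ m) * (2 * g1s * q2 * p1 * r1 / (q1 * r2 * gs * p2))"
    unfolding c0e C1e using pos by (simp add: field_simps)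
  also have "\<dots> = (2 * (q2 * q3) * p1) * (g1s * r1 / (q1 * r2 * gs * p2 * q3))"
    unfolding e4 using pos by (simp add: field_simps)
  also have "\<dots> = 2 powr (1 - 2 * s) * (g1s / gs) * (4 powr (2 * s) * (p3 / q3) * (r1 / r2))"
    unfolding key f4 using pos by (simp add: field_simps)
  finally show ?thesis unfolding C2e g1s_def gs_def .
qed

section \<open>Pairing a gradient with the kernel\<close>

lemma slice_cont: "continuous_on UNIV f \<Longrightarrow> continuous_on UNIV (\<lambda>x. f (x, \<rho>))"
  for f :: "('v \<times> 'z) \<times> real \<Rightarrow> 'b::topological_space"
  by (rule continuous_on_compose2[of UNIV f]) (simp_all add: continuous_on_Pair)

lemma J_cont: "continuous_on {p. snd p > 0} (\<lambda>p. J (snd p) (fst p))"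
  and Jd_cont: "continuous_on {p. snd p > 0} (\<lambda>p. Jd (snd p) (fst p))"
proof -
  let ?S = "{p :: ('v \<times> 'z) \<times> real. snd p > 0}"
  have A: "continuous_on ?S (\<lambda>p. snd p powr c)" for c
    by (rule continuous_on_powr) (auto intro!: continuous_on_snd continuous_on_id continuous_on_const)
  have B: "continuous_on ?S (\<lambda>p. DD ((snd p)\<^sup>2) (fst p) powr c)" for c
    by (rule DD_powr_cont) (auto intro!: continuous_intros)
  note cs = A B continuous_on_mult continuous_on_add continuous_on_power continuous_on_norm continuous_on_fst
    continuous_on_snd continuous_on_const continuous_on_id
  show "continuous_on ?S (\<lambda>p. J (snd p) (fst p))" unfolding J_def by (intro cs)
  show "continuous_on ?S (\<lambda>p. Jd (snd p) (fst p))" unfolding Jd_def by (intro cs)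
qed

text \<open>At fixed positive height the kernel is smooth, so each left-invariant derivative of
  \<open>h\<close> can be moved to it. \<open>pde\<close> replaces the resulting second order terms
  by \<open>Jd\<close>, and the integrand becomes the height derivative of
  \<open>h * J\<close>.\<close>

lemma slice_identity:
  assumes h: "C1c h R" and r: "\<rho> > 0"
  shows "(\<integral>x. wt \<rho> * (grad br h (x, \<rho>) \<bullet> KG (\<rho>\<^sup>2) \<rho> x) \<partial>lborel)
    = (\<integral>x. hR h (x, \<rho>) * J \<rho> x + h (x, \<rho>) * Jd \<rho> x \<partial>lborel)"
proof -
  let ?t = "\<rho>\<^sup>2"
  have t: "?t > 0" using r by simp
  let ?h = "\<lambda>x. h (x, \<rho>)"
  have ch: "continuous_on UNIV ?h" by (rule slice_cont[OF C1cD(5)[OF h]])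
  have cX: "continuous_on UNIV (\<lambda>x. hX h d (x, \<rho>))" for d by (rule slice_cont[OF hX_cont[OF h]])
  have cR: "continuous_on UNIV (\<lambda>x. hR h (x, \<rho>))" by (rule slice_cont[OF hR_cont[OF h]])
  have cK: "continuous_on UNIV (\<lambda>x. KX ?t d x)" "continuous_on UNIV (\<lambda>x. KXX ?t d x)" for d
    by (intro KX_cont KXX_cont continuous_intros; use t in simp)+
  have supp: "h (x, \<rho>) = 0" "hX h d (x, \<rho>) = 0" "hR h (x, \<rho>) = 0" if "hnorm x > R" for x d
    using that C1cD(4)[OF h, of x \<rho>] h_supp[OF h, of x \<rho>] by auto
  have i1: "integrable lborel (\<lambda>x. hX h d (x, \<rho>) * KX ?t d x)" for d
    by (rule integrable_cont_supp[of _ R]) (auto intro!: continuous_intros cX cK simp: supp)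
  have i2: "integrable lborel (\<lambda>x. h (x, \<rho>) * KXX ?t d x)" for d
    by (rule integrable_cont_supp[of _ R]) (auto intro!: continuous_intros ch cK simp: supp)
  define k where "k x = - a * DD ?t x powr (- a - 1) * (4 * (?t + (norm (fst x))\<^sup>2) * \<rho>)" for x
  have ck: "continuous_on UNIV k" unfolding k_def by (intro continuous_intros DD_powr_cont; use t in simp)
  have i3: "integrable lborel (\<lambda>x. hR h (x, \<rho>) * k x)"
    by (rule integrable_cont_supp[of _ R]) (auto intro!: continuous_intros cR ck simp: supp)
  define I1 where "I1 d = (\<integral>x. hX h d (x, \<rho>) * KX ?t d x \<partial>lborel)" for d
  define I2 where "I2 d = (\<integral>x. h (x, \<rho>) * KXX ?t d x \<partial>lborel)" for d
  have byparts: "I1 d = - I2 d" for d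
  proof -
    have "(\<integral>x. hX h d (x, \<rho>) * KX ?t d x + h (x, \<rho>) * KXX ?t d x \<partial>lborel) = 0"
    proof (rule integral_left_field_zero[where F = "\<lambda>x. h (x, \<rho>) * KX ?t d x" and d = d and R = R])
      fix x
      have "((\<lambda>t. h (gm x (t *\<^sub>R d), \<rho>)) has_real_derivative hX h d (x, \<rho>)) (at 0)"
        using hX_deriv[OF C1cD(1)[OF h], of "(x, \<rho>)" d] by simp
      from DERIV_mult[OF this KX_deriv[of ?t x d]] t DD_pos[of ?t x]
      show "((\<lambda>t. h (gm x (t *\<^sub>R d), \<rho>) * KX ?t d (gm x (t *\<^sub>R d))) has_real_derivative
        hX h d (x, \<rho>) * KX ?t d x + h (x, \<rho>) * KXX ?t d x) (at 0)" by (simp add: mult_ac)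
    qed (auto intro!: continuous_intros cX cK ch simp: supp)
    then show ?thesis using i1[of d] i2[of d] by (simp add: I1_def I2_def)
  qed
  have e1: "(\<integral>x. grad br h (x, \<rho>) \<bullet> KG ?t \<rho> x \<partial>lborel)
    = (\<Sum>i\<in>Basis. I1 (i, 0)) + ?t / 4 * (\<Sum>j\<in>Basis. I1 (0, j)) + (\<integral>x. hR h (x, \<rho>) * k x \<partial>lborel)"
    unfolding grad_inner_KG[OF h] k_def[symmetric] I1_def
    using i1 i3 by simp
  have k: "wt \<rho> * k x = J \<rho> x" for x using r by (simp add: wt_def k_def J_def)
  have Jd: "Jd \<rho> x = - wt \<rho> * ((\<Sum>i\<in>Basis. KXX ?t (i, 0) x) + ?t / 4 * (\<Sum>j\<in>Basis. KXX ?t (0, j) x))" for x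
    using pde[OF r, of x] r by (simp add: wt_def)
  have hJd: "h (x, \<rho>) * Jd \<rho> x = - wt \<rho> * ((\<Sum>i\<in>Basis. h (x, \<rho>) * KXX ?t (i, 0) x) + ?t / 4 * (\<Sum>j\<in>Basis. h (x, \<rho>) * KXX ?t (0, j) x))" for x
  proof -
    have alg: "y * (- W * (A + t / 4 * B)) = - W * (y * A + t / 4 * (y * B))" for y W A B t :: real
      by (simp add: algebra_simps)
    show ?thesis unfolding Jd sum_distrib_left[symmetric] by (rule alg)
  qed
  have e2: "(\<integral>x. h (x, \<rho>) * Jd \<rho> x \<partial>lborel) = - wt \<rho> * ((\<Sum>i\<in>Basis. I2 (i, 0)) + ?t / 4 * (\<Sum>j\<in>Basis. I2 (0, j)))"
    unfolding I2_def hJd using i2 by simp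
  have i4: "integrable lborel (\<lambda>x. h (x, \<rho>) * Jd \<rho> x)"
    unfolding hJd using i2 by simp
  have kk: "hR h (x, \<rho>) * J \<rho> x = wt \<rho> * (hR h (x, \<rho>) * k x)" for x
    unfolding k[symmetric] by (rule mult.left_commute)
  have i5: "integrable lborel (\<lambda>x. hR h (x, \<rho>) * J \<rho> x)"
    unfolding kk using i3 by simp
  have e3: "(\<integral>x. hR h (x, \<rho>) * J \<rho> x \<partial>lborel) = wt \<rho> * (\<integral>x. hR h (x, \<rho>) * k x \<partial>lborel)"
    unfolding kk by simp
  have "(\<integral>x. wt \<rho> * (grad br h (x, \<rho>) \<bullet> KG ?t \<rho> x) \<partial>lborel) = wt \<rho> * (\<integral>x. grad br h (x, \<rho>) \<bullet> KG ?t \<rho> x \<partial>lborel)"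
    by simp
  also have "\<dots> = (\<integral>x. hR h (x, \<rho>) * J \<rho> x \<partial>lborel) + (\<integral>x. h (x, \<rho>) * Jd \<rho> x \<partial>lborel)"
  proof -
    have alg: "W * (- A + t / 4 * (- B) + C) = W * C + (- W) * (A + t / 4 * B)" for W A B C t :: real
      by (simp add: algebra_simps)
    show ?thesis unfolding e1 e2 e3 byparts sum_negf by (rule alg)
  qed
  also have "\<dots> = (\<integral>x. hR h (x, \<rho>) * J \<rho> x + h (x, \<rho>) * Jd \<rho> x \<partial>lborel)"
    using i4 i5 by simp
  finally show ?thesis .
qed

text \<open>Fubini with the height as inner variable reduces the slab to boundary values of
  \<open>h * J\<close>. The upper limit \<open>R + 1\<close> lies outside the support, leaving the
  flux through height \<open>\<epsilon>\<close>.\<close>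

lemma truncated_identity:
  assumes h: "C1c h R" and e: "0 < \<epsilon>" "\<epsilon> < R + 1"
  shows "(\<integral>p. indicator {\<epsilon>..R+1} (snd p) * (wt (snd p) * (grad br h p \<bullet> KG ((snd p)\<^sup>2) (snd p) (fst p))) \<partial>lborel)
    = (\<integral>x. - (h (x, \<epsilon>) * J \<epsilon> x) \<partial>lborel)"
proof -
  let ?T = "hball R \<times> {\<epsilon>..R+1}"
  define q where "q p = wt (snd p) * (grad br h p \<bullet> KG ((snd p)\<^sup>2) (snd p) (fst p))" for p
  define r where "r p = hR h p * J (snd p) (fst p) + h p * Jd (snd p) (fst p)" for p
  have T0: "snd p > 0" if "p \<in> ?T" for p using that e by auto
  have cq: "continuous_on ?T q"
  proof -
    have "continuous_on ?T (\<lambda>p. (snd p) powr (1 - 2 * s) * (grad br h p \<bullet> KG ((snd p)\<^sup>2) (snd p) (fst p)))"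
      by (intro continuous_intros KG_cont continuous_on_subset[OF grad_cont[OF h]]) (use T0 in force)+
    then show ?thesis by (rule continuous_on_eq) (use e in \<open>auto simp: q_def wt_def\<close>)
  qed
  have cr: "continuous_on ?T r"
    unfolding r_def
    by (intro continuous_intros continuous_on_subset[OF hR_cont[OF h]] continuous_on_subset[OF C1cD(5)[OF h]]
        continuous_on_subset[OF J_cont] continuous_on_subset[OF Jd_cont]) (use T0 in auto)
  have q0: "q (x, \<rho>) = 0" and r0: "r (x, \<rho>) = 0" if "hnorm x > R" for x \<rho>
    using that grad_supp[OF h, of x \<rho>] h_supp[OF h, of x \<rho>] C1cD(4)[OF h, of x \<rho>] by (auto simp: q_def r_def)
  have iq: "indicator ?T p * q p = indicator {\<epsilon>..R+1} (snd p) * q p" for p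
    using q0[of "fst p" "snd p"] by (cases p) (auto simp: indicator_def)
  have ir: "indicator ?T p * r p = indicator {\<epsilon>..R+1} (snd p) * r p" for p
    using r0[of "fst p" "snd p"] by (cases p) (auto simp: indicator_def)
  have int_q: "integrable lborel (\<lambda>p. indicator {\<epsilon>..R+1} (snd p) * q p)"
    using borel_integrable_compact[OF compact_cyl cq] by (simp add: iq)
  have int_r: "integrable lborel (\<lambda>p. indicator {\<epsilon>..R+1} (snd p) * r p)"
    using borel_integrable_compact[OF compact_cyl cr] by (simp add: ir)
  have "(\<integral>p. indicator {\<epsilon>..R+1} (snd p) * q p \<partial>lborel) = (\<integral>\<rho>. (\<integral>x. indicator {\<epsilon>..R+1} \<rho> * q (x, \<rho>) \<partial>lborel) \<partial>lborel)"
    using lborel_fubini(2)[OF int_q] by simp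
  also have "\<dots> = (\<integral>\<rho>. (\<integral>x. indicator {\<epsilon>..R+1} \<rho> * r (x, \<rho>) \<partial>lborel) \<partial>lborel)"
  proof (rule Bochner_Integration.integral_cong[OF refl])
    fix \<rho> :: real
    show "(\<integral>x. indicator {\<epsilon>..R+1} \<rho> * q (x, \<rho>) \<partial>lborel) = (\<integral>x. indicator {\<epsilon>..R+1} \<rho> * r (x, \<rho>) \<partial>lborel)"
    proof (cases "\<rho> \<in> {\<epsilon>..R+1}")
      case True
      then have "\<rho> > 0" using e by auto
      then show ?thesis using slice_identity[OF h, of \<rho>] True by (simp add: q_def r_def)
    qed simp
  qed
  also have "\<dots> = (\<integral>p. indicator {\<epsilon>..R+1} (snd p) * r p \<partial>lborel)"
    using lborel_fubini(2)[OF int_r] by simp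
  also have "\<dots> = (\<integral>x. (\<integral>\<rho>. indicator {\<epsilon>..R+1} \<rho> * r (x, \<rho>) \<partial>lborel) \<partial>lborel)"
    using lborel_fubini(1)[OF int_r] by simp
  also have "\<dots> = (\<integral>x. - (h (x, \<epsilon>) * J \<epsilon> x) \<partial>lborel)"
  proof (rule Bochner_Integration.integral_cong[OF refl])
    fix x :: "'v \<times> 'z"
    have "(\<integral>\<rho>. r (x, \<rho>) * indicator {\<epsilon>..R+1} \<rho> \<partial>lborel) = h (x, R + 1) * J (R + 1) x - h (x, \<epsilon>) * J \<epsilon> x"
    proof (rule integral_FTC_Icc_real)
      fix \<rho> assume "\<epsilon> \<le> \<rho>" "\<rho> \<le> R + 1"
      then have r: "\<rho> > 0" using e by simp
      show "((\<lambda>\<rho>. h (x, \<rho>) * J \<rho> x) has_real_derivative r (x, \<rho>)) (at \<rho>)"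
      proof -
        have "((\<lambda>\<rho>. h (x, \<rho>)) has_real_derivative hR h (x, \<rho>)) (at \<rho>)" by (rule hR_deriv[OF C1cD(1)[OF h]])
        from DERIV_mult[OF this J_deriv[OF r, of x]] show ?thesis by (simp add: r_def mult.commute)
      qed
      have "continuous_on {0<..} (\<lambda>\<rho>. r (x, \<rho>))"
      proof -
        have "continuous_on {p. snd p > 0} r"
          unfolding r_def
          by (intro continuous_intros continuous_on_subset[OF hR_cont[OF h]] continuous_on_subset[OF C1cD(5)[OF h]]
            J_cont Jd_cont) auto
        then show ?thesis by (rule continuous_on_compose2) (auto intro!: continuous_intros)
      qed
      then show "isCont (\<lambda>\<rho>. r (x, \<rho>)) \<rho>" using r by (simp add: continuous_on_eq_continuous_at)
    qed (use e in simp)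
    moreover have "h (x, R + 1) = 0" using C1cD(3)[OF h] C1cD(4)[OF h, of x "R + 1"] by simp
    ultimately show "(\<integral>\<rho>. indicator {\<epsilon>..R+1} \<rho> * r (x, \<rho>) \<partial>lborel) = - (h (x, \<epsilon>) * J \<epsilon> x)"
      by (simp add: mult.commute)
  qed
  finally show ?thesis by (simp add: q_def)
qed

text \<open>The exponents \<open>Q\<close>, \<open>1 - 2 s\<close>, \<open>- 4 (a + 1)\<close> and
  \<open>3\<close> cancel, so the flux has the same mass at every height.\<close>

lemma J_dil:
  assumes "d > 0"
  shows "d powr Q * J d (dil d y) = - PP y"
proof -
  have e: "d\<^sup>2 + (norm (fst (dil d y)))\<^sup>2 = d\<^sup>2 * (1 + (norm (fst y))\<^sup>2)"
    using assms by (simp add: dil_def power_mult_distrib algebra_simps)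
  have D: "DD (d\<^sup>2) (dil d y) = d ^ 4 * DD 1 y" using DD_dil[of d 1 y] assms by simp
  have "(d ^ 4 * DD 1 y) powr (- a - 1) = d powr (4 * (- a - 1)) * DD 1 y powr (- a - 1)"
    using assms by (simp add: powr_mult powr_pow4)
  moreover have "d\<^sup>2 * d = d powr 3"
  proof -
    have "d powr 3 = d ^ 3" using assms by simp
    then show ?thesis by (simp add: power2_eq_square power3_eq_cube)
  qed
  ultimately have "d powr Q * J d (dil d y) = (d powr Q * d powr (1 - 2 * s) * d powr (4 * (- a - 1)) * d powr 3) * (- PP y)"
    unfolding J_def D e PP_def by (simp add: mult_ac)
  also have "d powr Q * d powr (1 - 2 * s) * d powr (4 * (- a - 1)) * d powr 3 = d powr (Q + (1 - 2 * s) + 4 * (- a - 1) + 3)"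
    by (simp only: powr_add)
  also have "Q + (1 - 2 * s) + 4 * (- a - 1) + 3 = 0" using four_a by (simp add: algebra_simps)
  finally show ?thesis using assms by simp
qed

text \<open>Both sides of \<open>truncated_identity\<close> converge as the height tends to 0: the
  left by integrability of the pairing, the right because a dilation turns the flux into the fixed
  density \<open>PP\<close>, tested against values of \<open>h\<close> that tend to
  \<open>h (0, 0)\<close>.\<close>

lemma kernel_identity_0:
  assumes h: "C1c h R"
  shows "(\<integral>p. wt (snd p) * (grad br h p \<bullet> KG ((snd p)\<^sup>2) (snd p) (fst p)) \<partial>lborel) = c0 * h (0, 0)"
proof -
  define q where "q p = wt (snd p) * (grad br h p \<bullet> KG ((snd p)\<^sup>2) (snd p) (fst p))" for p
  have iq: "integrable lborel q" unfolding q_def by (rule kernel_pairing_integrable[OF h])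
  define \<epsilon> where "\<epsilon> k = 1 / (real k + 1)" for k :: nat
  have e: "0 < \<epsilon> k" "\<epsilon> k < R + 1" for k
  proof -
    show "0 < \<epsilon> k" by (simp add: \<epsilon>_def)
    have "\<epsilon> k \<le> 1" by (simp add: \<epsilon>_def)
    then show "\<epsilon> k < R + 1" using C1cD(3)[OF h] by linarith
  qed
  have e0: "\<epsilon> \<longlonglongrightarrow> 0" unfolding \<epsilon>_def using LIMSEQ_inverse_real_of_nat by (simp add: inverse_eq_divide add.commute)
  have l1: "(\<lambda>k. \<integral>p. indicator {\<epsilon> k..R+1} (snd p) * q p \<partial>lborel) \<longlonglongrightarrow> (\<integral>p. q p \<partial>lborel)"
  proof (rule integral_dominated_convergence[where w = "\<lambda>p. \<bar>q p\<bar>"])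
    show "AE p in lborel. (\<lambda>k. indicator {\<epsilon> k..R+1} (snd p) * q p) \<longlonglongrightarrow> q p"
    proof (rule AE_I2)
      fix p :: "('v \<times> 'z) \<times> real"
      show "(\<lambda>k. indicator {\<epsilon> k..R+1} (snd p) * q p) \<longlonglongrightarrow> q p"
      proof (cases "snd p > 0 \<and> snd p \<le> R + 1")
        case True
        then have "\<forall>\<^sub>F k in sequentially. \<epsilon> k < snd p" using e0 by (intro order_tendstoD) auto
        then have "\<forall>\<^sub>F k in sequentially. indicator {\<epsilon> k..R+1} (snd p) * q p = q p"
          by eventually_elim (use True in \<open>auto simp: indicator_def\<close>)
        then show ?thesis by (rule tendsto_eventually)
      next
        case False
        then have "wt (snd p) = 0 \<or> \<bar>snd p\<bar> > R" by (auto simp: wt_def)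
        then have "q p = 0" using grad_supp[OF h, of "fst p" "snd p"] by (auto simp: q_def)
        then show ?thesis by simp
      qed
    qed
    show "AE p in lborel. norm (indicator {\<epsilon> k..R+1} (snd p) * q p) \<le> \<bar>q p\<bar>" for k
      by (rule AE_I2) (auto simp: indicator_def)
  qed (use iq in auto)
  have [measurable]: "h \<in> borel_measurable borel" by (rule borel_measurable_continuous_onI[OF C1cD(5)[OF h]])
  have ms: "(\<lambda>x. h (x, t)) \<in> borel_measurable borel" for t
    by (rule borel_measurable_continuous_onI[OF slice_cont[OF C1cD(5)[OF h]]])
  have [measurable]: "(\<lambda>x. J t x) \<in> borel_measurable borel" for t unfolding J_def by measurable
  have e2: "(\<integral>x. - (h (x, \<epsilon> k) * J (\<epsilon> k) x) \<partial>lborel) = (\<integral>y. h (dil (\<epsilon> k) y, \<epsilon> k) * PP y \<partial>lborel)" for k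
  proof -
    have "(\<integral>x. - (h (x, \<epsilon> k) * J (\<epsilon> k) x) \<partial>lborel) = \<epsilon> k powr Q * (\<integral>y. - (h (dil (\<epsilon> k) y, \<epsilon> k) * J (\<epsilon> k) (dil (\<epsilon> k) y)) \<partial>lborel)"
      using ms[of "\<epsilon> k"] by (intro integral_dil e) measurable
    also have "\<dots> = (\<integral>y. h (dil (\<epsilon> k) y, \<epsilon> k) * - (\<epsilon> k powr Q * J (\<epsilon> k) (dil (\<epsilon> k) y)) \<partial>lborel)"
      by (subst integral_mult_right_zero[symmetric]) (simp add: mult_ac)
    finally show ?thesis unfolding J_dil[OF e(1)] by simp
  qed
  obtain B where B: "B > 0" "\<And>p. norm (grad br h p) \<le> B" "\<And>p. \<bar>h p\<bar> \<le> B" using grad_bounded[OF h] by blast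
  have l2: "(\<lambda>k. \<integral>y. h (dil (\<epsilon> k) y, \<epsilon> k) * PP y \<partial>lborel) \<longlonglongrightarrow> (\<integral>y. h (0, 0) * PP y \<partial>lborel)"
  proof (rule integral_dominated_convergence[where w = "\<lambda>y. B * PP y"])
    show "AE y in lborel. (\<lambda>k. h (dil (\<epsilon> k) y, \<epsilon> k) * PP y) \<longlonglongrightarrow> h (0, 0) * PP y"
    proof (rule AE_I2, intro tendsto_mult tendsto_const)
      fix y :: "'v \<times> 'z"
      have "(\<lambda>k. (dil (\<epsilon> k) y, \<epsilon> k)) \<longlonglongrightarrow> (0, 0)"
      proof (rule tendsto_Pair[OF _ e0])
        have "(\<lambda>k. (\<epsilon> k *\<^sub>R fst y, (\<epsilon> k)\<^sup>2 *\<^sub>R snd y)) \<longlonglongrightarrow> (0 *\<^sub>R fst y, 0\<^sup>2 *\<^sub>R snd y)"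
          by (intro tendsto_intros e0)
        then show "(\<lambda>k. dil (\<epsilon> k) y) \<longlonglongrightarrow> 0" by (simp add: dil_def zero_prod_def)
      qed
      moreover have "isCont h (0, 0)" using C1cD(5)[OF h] unfolding continuous_on_eq_continuous_at[OF open_UNIV] by blast
      ultimately show "(\<lambda>k. h (dil (\<epsilon> k) y, \<epsilon> k)) \<longlonglongrightarrow> h (0, 0)" by (rule isCont_tendsto_compose[rotated])
    qed
    show "AE y in lborel. norm (h (dil (\<epsilon> k) y, \<epsilon> k) * PP y) \<le> B * PP y" for k
      by (rule AE_I2) (use B(3)[of "(dil (\<epsilon> k) _, \<epsilon> k)"] in \<open>simp add: abs_mult mult_right_mono\<close>)
    show "(\<lambda>y. h (dil (\<epsilon> k) y, \<epsilon> k) * PP y) \<in> borel_measurable lborel" for k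
    proof -
      have [measurable]: "(\<lambda>y. h (dil (\<epsilon> k) y, \<epsilon> k)) \<in> borel_measurable borel"
        using measurable_compose[OF _ ms[of "\<epsilon> k"], of "dil (\<epsilon> k)" borel] by measurable
      show ?thesis by measurable
    qed
  qed (use PP_integrable in auto)
  have "(\<lambda>k. \<integral>p. indicator {\<epsilon> k..R+1} (snd p) * q p \<partial>lborel) \<longlonglongrightarrow> c0 * h (0, 0)"
    using l2 unfolding q_def truncated_identity[OF h e] e2 by (simp add: integral_PP mult.commute)
  then show ?thesis using l1 LIMSEQ_unique unfolding q_def by blast
qed

lemma nn_integral_left_translate_P:
  assumes [measurable]: "f \<in> borel_measurable (borel :: (('v \<times> 'z) \<times> real) measure)"
  shows "(\<integral>\<^sup>+p. f (gm w (fst p), snd p) \<partial>lborel) = (\<integral>\<^sup>+p. f p \<partial>lborel)"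
proof -
  have "(\<integral>\<^sup>+p. f (gm w (fst p), snd p) \<partial>lborel) = (\<integral>\<^sup>+x. (\<integral>\<^sup>+\<rho>. f (gm w x, \<rho>) \<partial>lborel) \<partial>lborel)"
    by (subst nn_integral_lborel_pair) auto
  also have "\<dots> = (\<integral>\<^sup>+x. (\<integral>\<^sup>+\<rho>. f (x, \<rho>) \<partial>lborel) \<partial>lborel)"
    by (rule nn_integral_gm_left[of "\<lambda>x. \<integral>\<^sup>+\<rho>. f (x, \<rho>) \<partial>lborel"]) measurable
  also have "\<dots> = (\<integral>\<^sup>+p. f p \<partial>lborel)" by (rule nn_integral_lborel_pair[symmetric]) simp
  finally show ?thesis .
qed

lemma integral_left_translate_P:
  fixes f :: "('v \<times> 'z) \<times> real \<Rightarrow> real"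
  assumes [measurable]: "f \<in> borel_measurable borel"
  shows "(\<integral>p. f (gm w (fst p), snd p) \<partial>lborel) = (\<integral>p. f p \<partial>lborel)"
proof -
  have "distr lborel borel (\<lambda>p :: ('v \<times> 'z) \<times> real. (gm w (fst p), snd p)) = lborel"
    by (rule lborel_preserving[OF _ nn_integral_left_translate_P]) measurable
  then show ?thesis using integral_distr[of "\<lambda>p :: ('v \<times> 'z) \<times> real. (gm w (fst p), snd p)" lborel borel f] by simp
qed

text \<open>The gradient is built from left-invariant fields and thus commutes with left
  translation; this moves the pole of the kernel from the identity to an arbitrary point. The new
  radius comes from the quasi-triangle inequality.\<close>

lemma C1c_translate:
  assumes h: "C1c h R"
  shows "C1c (\<lambda>p. h (gm w (fst p), snd p)) (2 * (hnorm w + R))"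
    and "grad br (\<lambda>p. h (gm w (fst p), snd p)) = (\<lambda>p. grad br h (gm w (fst p), snd p))"
proof -
  define L where "L d = ((fst (fst d), snd (fst d) + (1/2) *\<^sub>R br (fst w) (fst (fst d))), snd d)" for d :: "('v \<times> 'z) \<times> real"
  have blL: "bounded_linear L"
    unfolding L_def linear_conv_bounded_linear[symmetric] by (intro linearI) (auto simp: algebra_simps)
  have T: "(gm w (fst p), snd p) = (w, 0) + L p" for p by (simp add: L_def gmult_def prod_eq_iff algebra_simps)
  have dT: "((\<lambda>p. (gm w (fst p), snd p)) has_derivative L) (at p)" for p
    unfolding T using bounded_linear_imp_has_derivative[OF blL] by (auto intro!: derivative_eq_intros)
  have D: "((\<lambda>p. h (gm w (fst p), snd p)) has_derivative (\<lambda>d. frechet_derivative h (at (gm w (fst p), snd p)) (L d))) (at p)" for p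
    by (rule has_derivative_compose[OF dT]) (use C1cD(1)[OF h] frechet_derivative_works in blast)
  have F: "frechet_derivative (\<lambda>p. h (gm w (fst p), snd p)) (at p) = (\<lambda>d. frechet_derivative h (at (gm w (fst p), snd p)) (L d))" for p
    using frechet_derivative_at[OF D] by simp
  show "C1c (\<lambda>p. h (gm w (fst p), snd p)) (2 * (hnorm w + R))"
    unfolding C1c_def
  proof (intro conjI allI impI)
    show "(\<lambda>p. h (gm w (fst p), snd p)) differentiable (at p)" for p using D differentiable_def by blast
    show "continuous_on UNIV (\<lambda>p. frechet_derivative (\<lambda>p. h (gm w (fst p), snd p)) (at p) d)" for d
      unfolding F by (rule continuous_on_compose2[OF C1cD(2)[OF h]]) (auto intro!: continuous_intros)
    show "2 * (hnorm w + R) > 0" using add_nonneg_pos[OF hnorm_nonneg C1cD(3)[OF h], of w] by simp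
    fix x :: "'v \<times> 'z" and \<rho> :: real assume "hnorm x > 2 * (hnorm w + R) \<or> \<bar>\<rho>\<bar> > 2 * (hnorm w + R)"
    then have "hnorm (gm w x) > R \<or> \<bar>\<rho>\<bar> > R"
    proof
      assume "hnorm x > 2 * (hnorm w + R)"
      then show ?thesis using hnorm_quasi[of x "ginv w"] by simp
    next
      assume "\<bar>\<rho>\<bar> > 2 * (hnorm w + R)"
      then have "\<bar>\<rho>\<bar> > R" using hnorm_nonneg[of w] C1cD(3)[OF h] unfolding distrib_left by linarith
      then show ?thesis by (rule disjI2)
    qed
    then show "h (gm w (fst (x, \<rho>)), snd (x, \<rho>)) = 0" using C1cD(4)[OF h] by simp
  qed
  show "grad br (\<lambda>p. h (gm w (fst p), snd p)) = (\<lambda>p. grad br h (gm w (fst p), snd p))"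
    by (simp add: grad_def left_field_def gm_assoc fun_eq_iff)
qed

lemma kernel_identity:
  assumes h: "C1c h R"
  shows "(\<integral>p. wt (snd p) * (grad br h p \<bullet> KG ((snd p)\<^sup>2) (snd p) (gm (ginv w) (fst p))) \<partial>lborel) = c0 * h (w, 0)"
proof -
  have [measurable]: "grad br h \<in> borel_measurable borel" by (rule borel_measurable_continuous_onI[OF grad_cont[OF h]])
  have "(\<integral>p. wt (snd p) * (grad br h p \<bullet> KG ((snd p)\<^sup>2) (snd p) (gm (ginv w) (fst p))) \<partial>lborel)
    = (\<integral>p. wt (snd p) * (grad br h (gm w (fst p), snd p) \<bullet> KG ((snd p)\<^sup>2) (snd p) (fst p)) \<partial>lborel)"
    by (subst integral_left_translate_P[symmetric, of _ w]) auto
  also have "\<dots> = c0 * h (w, 0)"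
    using kernel_identity_0[OF C1c_translate(1)[OF h, of w]] unfolding C1c_translate(2)[OF h, of w] by simp
  finally show ?thesis .
qed

section \<open>Potentials\<close>

text \<open>Regular enough for the potentials to be bounded, and a class against which a trace known
  only in local L^2 can be integrated.\<close>

definition nice :: "('v \<times> 'z \<Rightarrow> real) \<Rightarrow> real \<Rightarrow> real \<Rightarrow> bool" where
  "nice g R B \<longleftrightarrow> g \<in> borel_measurable borel \<and> R > 0 \<and> B > 0 \<and> (\<forall>x. \<bar>g x\<bar> \<le> B) \<and> (\<forall>x. hnorm x > R \<longrightarrow> g x = 0)"

definition UU :: "('v \<times> 'z \<Rightarrow> real) \<Rightarrow> real \<Rightarrow> 'v \<times> 'z \<Rightarrow> real" where
  "UU g \<tau> x = (\<integral>w. g w * KK \<tau> (gm (ginv w) x) \<partial>lborel)"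

text \<open>The gradient of the potential, formed under the integral. It is identified with
  \<open>grad\<close> of a potential at \<open>\<tau> = \<rho>^2 + \<delta>^2\<close> with
  \<open>\<delta> > 0\<close>; at \<open>\<tau> = \<rho>^2\<close> it stands as an object of its
  own, whose pairing with gradients is known.\<close>

definition VV :: "('v \<times> 'z \<Rightarrow> real) \<Rightarrow> real \<Rightarrow> real \<Rightarrow> 'v \<times> 'z \<Rightarrow> ('v \<times> 'z) \<times> real" where
  "VV g \<tau> \<rho> x = (\<integral>w. g w *\<^sub>R KG \<tau> \<rho> (gm (ginv w) x) \<partial>lborel)"

abbreviation ex where "ex \<equiv> 2 * s - 1 - \<kappa>"

lemma niceD: assumes "nice g R B"
  shows "g \<in> borel_measurable borel" "R > 0" "B > 0" "\<bar>g x\<bar> \<le> B" "hnorm x > R \<Longrightarrow> g x = 0"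
  using assms unfolding nice_def by blast+

lemma nice_integrable: assumes "nice g R B" shows "integrable lborel g"
proof (rule Bochner_Integration.integrable_bound)
  show "integrable lborel (\<lambda>x :: 'v \<times> 'z. indicator (hball R) x *\<^sub>R B)"
    by (rule borel_integrable_compact[OF compact_hnorm_ball continuous_on_const])
  show "g \<in> borel_measurable lborel" using niceD(1)[OF assms] by simp
  show "AE x in lborel. norm (g x) \<le> norm (indicator (hball R) x *\<^sub>R B)"
  proof (rule AE_I2)
    fix x show "norm (g x) \<le> norm (indicator (hball R) x *\<^sub>R B)"
      using niceD(3)[OF assms] niceD(4)[OF assms, of x] niceD(5)[OF assms, of x] by (cases "hnorm x \<le> R") auto
  qed
qed

lemma AE_gm_nonzero: "AE w in lborel. gm (ginv w) x \<noteq> 0"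
  using AE_lborel_singleton[of x]
proof eventually_elim
  fix w assume "w \<noteq> x"
  then show "gm (ginv w) x \<noteq> 0" by (metis gm_inv_cancel(2) gm_0(2))
qed

lemma potential_bound:
  assumes g: "nice g R B" and b: "0 \<le> b" "b < Q"
  obtains C where "C > 0" "\<And>x. (\<integral>\<^sup>+w. ennreal (\<bar>g w\<bar> * hnorm (gm (ginv w) x) powr (- b)) \<partial>lborel) \<le> ennreal C"
proof -
  obtain C where C: "C > 0" "\<And>x. (\<integral>\<^sup>+w. ennreal (indicator (hball R) w * hnorm (gm (ginv w) x) powr (- b)) \<partial>lborel) \<le> ennreal C"
    by (rule riesz_unif_bound[OF b]) blast
  have [measurable]: "g \<in> borel_measurable borel" by (rule niceD(1)[OF g])
  show ?thesis
  proof (rule that[of "B * C"])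
    show "B * C > 0" using C(1) niceD(3)[OF g] by simp
    fix x
    have "(\<integral>\<^sup>+w. ennreal (\<bar>g w\<bar> * hnorm (gm (ginv w) x) powr (- b)) \<partial>lborel)
      \<le> (\<integral>\<^sup>+w. ennreal B * ennreal (indicator (hball R) w * hnorm (gm (ginv w) x) powr (- b)) \<partial>lborel)"
    proof (rule nn_integral_mono)
      fix w
      have "\<bar>g w\<bar> * hnorm (gm (ginv w) x) powr (- b) \<le> B * (indicator (hball R) w * hnorm (gm (ginv w) x) powr (- b))"
        using niceD(4)[OF g, of w] niceD(5)[OF g, of w] by (cases "hnorm w \<le> R") (auto intro: mult_right_mono)
      then show "ennreal (\<bar>g w\<bar> * hnorm (gm (ginv w) x) powr (- b)) \<le> ennreal B * ennreal (indicator (hball R) w * hnorm (gm (ginv w) x) powr (- b))"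
        using niceD(3)[OF g] by (subst ennreal_mult'[symmetric]) (auto intro: ennreal_leI)
    qed
    also have "\<dots> = ennreal B * (\<integral>\<^sup>+w. ennreal (indicator (hball R) w * hnorm (gm (ginv w) x) powr (- b)) \<partial>lborel)"
      by (rule nn_integral_cmult) measurable
    also have "\<dots> \<le> ennreal B * ennreal C" by (rule mult_left_mono[OF C(2)]) simp
    also have "\<dots> = ennreal (B * C)" using niceD(3)[OF g] by (intro ennreal_mult'[symmetric]) simp
    finally show "(\<integral>\<^sup>+w. ennreal (\<bar>g w\<bar> * hnorm (gm (ginv w) x) powr (- b)) \<partial>lborel) \<le> ennreal (B * C)" .
  qed
qed

text \<open>Regularising lowers the kernel, so the bound for the singular kernel of degree
  \<open>- (Q - 2 s)\<close> is uniform in \<open>\<tau>\<close> as well as in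
  \<open>x\<close>.\<close>

lemma UU_bound:
  assumes g: "nice g R B"
  obtains C where "C > 0"
    "\<forall>x \<tau>. \<tau> \<ge> 0 \<longrightarrow> integrable lborel (\<lambda>w. g w * KK \<tau> (gm (ginv w) x))"
    "\<forall>x \<tau>. \<tau> \<ge> 0 \<longrightarrow> \<bar>UU g \<tau> x\<bar> \<le> C"
proof -
  have q: "0 \<le> Q - 2 * s" "Q - 2 * s < Q" using Q_pos s0 s1 by auto
  obtain C where C: "C > 0" "\<And>x. (\<integral>\<^sup>+w. ennreal (\<bar>g w\<bar> * hnorm (gm (ginv w) x) powr (- (Q - 2 * s))) \<partial>lborel) \<le> ennreal C"
    by (rule potential_bound[OF g q]) blast
  have [measurable]: "g \<in> borel_measurable borel" by (rule niceD(1)[OF g])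
  have 1: "(\<integral>\<^sup>+w. ennreal (\<bar>g w\<bar> * KK \<tau> (gm (ginv w) x)) \<partial>lborel) \<le> ennreal C" if "\<tau> \<ge> 0" for x \<tau>
  proof -
    have "(\<integral>\<^sup>+w. ennreal (\<bar>g w\<bar> * KK \<tau> (gm (ginv w) x)) \<partial>lborel) \<le> (\<integral>\<^sup>+w. ennreal (\<bar>g w\<bar> * hnorm (gm (ginv w) x) powr (- (Q - 2 * s))) \<partial>lborel)"
    proof (rule nn_integral_mono_AE, use AE_gm_nonzero[of x] in eventually_elim)
      fix w assume "gm (ginv w) x \<noteq> 0"
      then have "KK \<tau> (gm (ginv w) x) \<le> hnorm (gm (ginv w) x) powr (- (Q - 2 * s))"
        using KK_le[of "gm (ginv w) x" \<tau>] that by (simp add: KK_0)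
      then show "ennreal (\<bar>g w\<bar> * KK \<tau> (gm (ginv w) x)) \<le> ennreal (\<bar>g w\<bar> * hnorm (gm (ginv w) x) powr (- (Q - 2 * s)))"
        by (intro ennreal_leI mult_left_mono) auto
    qed
    then show ?thesis using C(2)[of x] by (rule order_trans)
  qed
  have nrm: "norm (g w * KK \<tau> y) = \<bar>g w\<bar> * KK \<tau> y" for w \<tau> y by (simp add: abs_mult)
  have 2: "integrable lborel (\<lambda>w. g w * KK \<tau> (gm (ginv w) x))" if "\<tau> \<ge> 0" for x \<tau>
    by (rule integrableI_bounded, measurable) (use le_less_trans[OF 1[OF that, of x]] in \<open>simp only: nrm, simp\<close>)
  have 3: "\<bar>UU g \<tau> x\<bar> \<le> C" if "\<tau> \<ge> 0" for x \<tau>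
  proof -
    have "ennreal (norm (UU g \<tau> x)) \<le> (\<integral>\<^sup>+w. ennreal (norm (g w * KK \<tau> (gm (ginv w) x))) \<partial>lborel)"
      unfolding UU_def by (rule integral_norm_bound_ennreal[OF 2[OF that]])
    also have "\<dots> \<le> ennreal C" unfolding nrm by (rule 1[OF that])
    finally show ?thesis using C(1) by simp
  qed
  show ?thesis by (rule that[OF C(1)]) (intro allI impI 2 3; assumption)+
qed

lemma UU_integrable:
  assumes "nice g R B" "\<tau> \<ge> 0" shows "integrable lborel (\<lambda>w. g w * KK \<tau> (gm (ginv w) x))"
  by (rule UU_bound[OF assms(1)]) (use assms(2) in blast)

text \<open>The constant is uniform in \<open>x\<close> and \<open>\<tau>\<close>; the singular
  behaviour sits in the factor \<open>\<rho> powr ex\<close>, whose square is locally integrable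
  against the weight because \<open>\<kappa> < s\<close>.\<close>

lemma VV_bound:
  assumes g: "nice g R B"
  obtains C where "C > 0"
    "\<forall>x \<rho> \<tau>. 0 < \<rho> \<longrightarrow> \<rho>\<^sup>2 \<le> \<tau> \<longrightarrow> (\<integral>\<^sup>+w. ennreal (\<bar>g w\<bar> * norm (KG \<tau> \<rho> (gm (ginv w) x))) \<partial>lborel) \<le> ennreal (C * \<rho> powr ex)"
    "\<forall>x \<rho> \<tau>. 0 < \<rho> \<longrightarrow> \<rho>\<^sup>2 \<le> \<tau> \<longrightarrow> integrable lborel (\<lambda>w. g w *\<^sub>R KG \<tau> \<rho> (gm (ginv w) x))"
    "\<forall>x \<rho> \<tau>. 0 < \<rho> \<longrightarrow> \<rho>\<^sup>2 \<le> \<tau> \<longrightarrow> norm (VV g \<tau> \<rho> x) \<le> C * \<rho> powr ex"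
proof -
  have q: "0 \<le> Q - \<kappa>" "Q - \<kappa> < Q" using kappa by auto
  obtain C where C: "C > 0" "\<And>x. (\<integral>\<^sup>+w. ennreal (\<bar>g w\<bar> * hnorm (gm (ginv w) x) powr (- (Q - \<kappa>))) \<partial>lborel) \<le> ennreal C"
    by (rule potential_bound[OF g q]) blast
  have [measurable]: "g \<in> borel_measurable borel" by (rule niceD(1)[OF g])
  have 1: "(\<integral>\<^sup>+w. ennreal (\<bar>g w\<bar> * norm (KG \<tau> \<rho> (gm (ginv w) x))) \<partial>lborel) \<le> ennreal (4 * a * C * \<rho> powr ex)"
    if "0 < \<rho>" "\<rho>\<^sup>2 \<le> \<tau>" for x \<rho> \<tau>
  proof -
    have "(\<integral>\<^sup>+w. ennreal (\<bar>g w\<bar> * norm (KG \<tau> \<rho> (gm (ginv w) x))) \<partial>lborel)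
      \<le> (\<integral>\<^sup>+w. ennreal (4 * a * \<rho> powr ex) * ennreal (\<bar>g w\<bar> * hnorm (gm (ginv w) x) powr (- (Q - \<kappa>))) \<partial>lborel)"
    proof (rule nn_integral_mono_AE, use AE_gm_nonzero[of x] in eventually_elim)
      fix w assume "gm (ginv w) x \<noteq> 0"
      from mult_left_mono[OF KG_bound[OF that this], of "\<bar>g w\<bar>"]
      have "\<bar>g w\<bar> * norm (KG \<tau> \<rho> (gm (ginv w) x)) \<le> \<bar>g w\<bar> * (4 * a * (hnorm (gm (ginv w) x) powr (- (Q - \<kappa>)) * \<rho> powr ex))"
        by simp
      also have "\<dots> = 4 * a * \<rho> powr ex * (\<bar>g w\<bar> * hnorm (gm (ginv w) x) powr (- (Q - \<kappa>)))"
        by (simp only: mult_ac)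
      finally show "ennreal (\<bar>g w\<bar> * norm (KG \<tau> \<rho> (gm (ginv w) x))) \<le> ennreal (4 * a * \<rho> powr ex) * ennreal (\<bar>g w\<bar> * hnorm (gm (ginv w) x) powr (- (Q - \<kappa>)))"
        using a_pos by (subst ennreal_mult'[symmetric]) (auto intro: ennreal_leI)
    qed
    also have "\<dots> = ennreal (4 * a * \<rho> powr ex) * (\<integral>\<^sup>+w. ennreal (\<bar>g w\<bar> * hnorm (gm (ginv w) x) powr (- (Q - \<kappa>))) \<partial>lborel)"
      by (rule nn_integral_cmult) measurable
    also have "\<dots> \<le> ennreal (4 * a * \<rho> powr ex) * ennreal C" by (rule mult_left_mono[OF C(2)]) simp
    also have "\<dots> = ennreal (4 * a * \<rho> powr ex * C)" using a_pos by (intro ennreal_mult'[symmetric]) simp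
    also have "4 * a * \<rho> powr ex * C = 4 * a * C * \<rho> powr ex" by simp
    finally show ?thesis .
  qed
  have nrm: "norm (g w *\<^sub>R KG \<tau> \<rho> y) = \<bar>g w\<bar> * norm (KG \<tau> \<rho> y)" for w \<tau> \<rho> y by simp
  have 2: "integrable lborel (\<lambda>w. g w *\<^sub>R KG \<tau> \<rho> (gm (ginv w) x))" if "0 < \<rho>" "\<rho>\<^sup>2 \<le> \<tau>" for x \<rho> \<tau>
    by (rule integrableI_bounded, measurable) (use le_less_trans[OF 1[OF that, of x]] in \<open>simp only: nrm, simp\<close>)
  have 3: "norm (VV g \<tau> \<rho> x) \<le> 4 * a * C * \<rho> powr ex" if "0 < \<rho>" "\<rho>\<^sup>2 \<le> \<tau>" for x \<rho> \<tau>
  proof -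
    have "ennreal (norm (VV g \<tau> \<rho> x)) \<le> (\<integral>\<^sup>+w. ennreal (norm (g w *\<^sub>R KG \<tau> \<rho> (gm (ginv w) x))) \<partial>lborel)"
      unfolding VV_def by (rule integral_norm_bound_ennreal[OF 2[OF that]])
    also have "\<dots> \<le> ennreal (4 * a * C * \<rho> powr ex)" unfolding nrm by (rule 1[OF that])
    finally show ?thesis using C(1) a_pos by simp
  qed
  have "4 * a * C > 0" using a_pos C(1) by simp
  then show ?thesis by (rule that) (intro allI impI 1 2 3; assumption)+
qed

lemma UU_meas [measurable (raw)]:
  assumes [measurable]: "g \<in> borel_measurable borel" "f \<in> borel_measurable M" "h \<in> borel_measurable M"
  shows "(\<lambda>p. UU g (f p) (h p)) \<in> borel_measurable M"
proof -
  have "(\<lambda>p. UU g (fst p) (snd p)) \<in> borel_measurable borel"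
    unfolding UU_def by measurable
  from measurable_compose[OF borel_measurable_Pair[OF assms(2,3)] this] show ?thesis by simp
qed

lemma VV_meas [measurable (raw)]:
  assumes [measurable]: "g \<in> borel_measurable borel" "f \<in> borel_measurable M" "k \<in> borel_measurable M" "h \<in> borel_measurable M"
  shows "(\<lambda>p. VV g (f p) (k p) (h p)) \<in> borel_measurable M"
proof -
  have "(\<lambda>p. VV g (fst p) (fst (snd p)) (snd (snd p))) \<in> borel_measurable borel"
    unfolding VV_def by measurable
  from measurable_compose[OF borel_measurable_Pair[OF assms(2) borel_measurable_Pair[OF assms(3,4)]] this] show ?thesis by simp
qed

lemma cyl_integrable:
  assumes "b > -1" "R > 0"
  shows "integrable lborel (\<lambda>p :: ('v \<times> 'z) \<times> real. indicator (hball R) (fst p) * (indicator {0<..R} (snd p) * (snd p) powr b))"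
proof (rule integrableI_nonneg)
  let ?A = "\<integral>\<^sup>+x. ennreal (indicator (hball R) x) \<partial>lborel"
  let ?I = "\<integral>\<^sup>+\<rho>. ennreal (indicator {0<..R} \<rho> * \<rho> powr b) \<partial>lborel"
  have 1: "(\<integral>\<^sup>+p. ennreal (indicator (hball R) (fst p) * (indicator {0<..R} (snd p) * (snd p) powr b)) \<partial>lborel)
    = (\<integral>\<^sup>+p. ennreal (indicator (hball R) (fst p)) * ennreal (indicator {0<..R} (snd p) * (snd p) powr b) \<partial>lborel)"
    by (rule nn_integral_cong, rule ennreal_mult') simp
  have 2: "(\<integral>\<^sup>+p. ennreal (indicator (hball R) (fst p)) * ennreal (indicator {0<..R} (snd p) * (snd p) powr b) \<partial>lborel) = ?A * ?I"
    by (rule nn_integral_prod[where f = "\<lambda>x. ennreal (indicator (hball R) x)" and g = "\<lambda>\<rho>. ennreal (indicator {0<..R} \<rho> * \<rho> powr b)"]) measurable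
  have "?A = emeasure lborel (hball R)"
    unfolding ennreal_indicator by (rule nn_integral_indicator) measurable
  then have 3: "?A < \<top>"
    by (simp only: emeasure_bounded_finite[OF bounded_hnorm_ball, unfolded infinity_ennreal_def])
  have 4: "?I < \<top>"
    by (rule nn_integral_powr_0[OF assms, unfolded infinity_ennreal_def])
  show "(\<integral>\<^sup>+p. ennreal (indicator (hball R) (fst p) * (indicator {0<..R} (snd p) * (snd p) powr b)) \<partial>lborel) < \<infinity>"
    unfolding 1 2 infinity_ennreal_def
    by (rule ennreal_mult_less_top[THEN iffD2, OF disjI2[OF disjI2[OF conjI[OF 3 4]]]])
  show "(\<lambda>p :: ('v \<times> 'z) \<times> real. indicator (hball R) (fst p) * (indicator {0<..R} (snd p) * (snd p) powr b)) \<in> borel_measurable lborel"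
    by measurable
  show "AE p in (lborel :: (('v \<times> 'z) \<times> real) measure). 0 \<le> (indicator (hball R) (fst p) :: real) * (indicator {0<..R} (snd p) * (snd p) powr b)"
    by (rule AE_I2) simp
qed

text \<open>\<open>kernel_identity\<close> at each source point \<open>w\<close> is integrated
  against \<open>g\<close>. The exchange of integrals rests on a majorant of order
  \<open>\<rho> powr (- \<kappa>)\<close> on the support cylinder of \<open>h\<close>.\<close>

lemma potential_pairing:
  assumes h: "C1c h R'" and g: "nice g R B"
  shows "(\<integral>p. wt (snd p) * (grad br h p \<bullet> VV g ((snd p)\<^sup>2) (snd p) (fst p)) \<partial>lborel) = c0 * (\<integral>w. g w * h (w, 0) \<partial>lborel)"
    and "integrable lborel (\<lambda>p. wt (snd p) * (grad br h p \<bullet> VV g ((snd p)\<^sup>2) (snd p) (fst p)))"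
proof -
  obtain C where C: "C > 0"
    "\<forall>x \<rho> \<tau>. 0 < \<rho> \<longrightarrow> \<rho>\<^sup>2 \<le> \<tau> \<longrightarrow> (\<integral>\<^sup>+w. ennreal (\<bar>g w\<bar> * norm (KG \<tau> \<rho> (gm (ginv w) x))) \<partial>lborel) \<le> ennreal (C * \<rho> powr ex)"
    "\<forall>x \<rho> \<tau>. 0 < \<rho> \<longrightarrow> \<rho>\<^sup>2 \<le> \<tau> \<longrightarrow> integrable lborel (\<lambda>w. g w *\<^sub>R KG \<tau> \<rho> (gm (ginv w) x))"
    "\<forall>x \<rho> \<tau>. 0 < \<rho> \<longrightarrow> \<rho>\<^sup>2 \<le> \<tau> \<longrightarrow> norm (VV g \<tau> \<rho> x) \<le> C * \<rho> powr ex"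
    by (rule VV_bound[OF g])
  obtain Bh where Bh: "Bh > 0" "\<And>p. norm (grad br h p) \<le> Bh" by (rule grad_bounded[OF h]) blast
  have R': "R' > 0" using C1cD(3)[OF h] .
  have [measurable]: "g \<in> borel_measurable borel" by (rule niceD(1)[OF g])
  have [measurable]: "grad br h \<in> borel_measurable borel" by (rule borel_measurable_continuous_onI[OF grad_cont[OF h]])
  define F where "F p w = wt (snd p) * (grad br h p \<bullet> (g w *\<^sub>R KG ((snd p)\<^sup>2) (snd p) (gm (ginv w) (fst p))))" for p w
  have mF: "(\<lambda>q. F (fst q) (snd q)) \<in> borel_measurable borel" unfolding F_def by measurable
  have dom: "(\<integral>\<^sup>+w. ennreal (norm (F p w)) \<partial>lborel) \<le> ennreal (Bh * C * (indicator (hball R') (fst p) * (indicator {0<..R'} (snd p) * (snd p) powr (- \<kappa>))))" for p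
  proof -
    obtain x \<rho> where p: "p = (x, \<rho>)" by (cases p)
    show ?thesis
    proof (cases "\<rho> > 0 \<and> hnorm x \<le> R' \<and> \<rho> \<le> R'")
      case True
      have "(\<integral>\<^sup>+w. ennreal (norm (F p w)) \<partial>lborel) \<le> (\<integral>\<^sup>+w. ennreal (wt \<rho> * Bh) * ennreal (\<bar>g w\<bar> * norm (KG (\<rho>\<^sup>2) \<rho> (gm (ginv w) x))) \<partial>lborel)"
      proof (rule nn_integral_mono)
        fix w
        have "\<bar>grad br h p \<bullet> (g w *\<^sub>R KG (\<rho>\<^sup>2) \<rho> (gm (ginv w) x))\<bar> \<le> norm (grad br h p) * norm (g w *\<^sub>R KG (\<rho>\<^sup>2) \<rho> (gm (ginv w) x))"
          by (rule Cauchy_Schwarz_ineq2)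
        also have "\<dots> \<le> Bh * norm (g w *\<^sub>R KG (\<rho>\<^sup>2) \<rho> (gm (ginv w) x))" by (intro mult_right_mono Bh) simp
        finally have "wt \<rho> * \<bar>grad br h p \<bullet> (g w *\<^sub>R KG (\<rho>\<^sup>2) \<rho> (gm (ginv w) x))\<bar> \<le> wt \<rho> * (Bh * norm (g w *\<^sub>R KG (\<rho>\<^sup>2) \<rho> (gm (ginv w) x)))"
          by (rule mult_left_mono) simp
        then have "norm (F p w) \<le> wt \<rho> * Bh * (\<bar>g w\<bar> * norm (KG (\<rho>\<^sup>2) \<rho> (gm (ginv w) x)))"
          by (simp add: F_def p abs_mult mult.assoc)
        then show "ennreal (norm (F p w)) \<le> ennreal (wt \<rho> * Bh) * ennreal (\<bar>g w\<bar> * norm (KG (\<rho>\<^sup>2) \<rho> (gm (ginv w) x)))"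
          using Bh(1) by (subst ennreal_mult'[symmetric]) (auto intro: ennreal_leI)
      qed
      also have "\<dots> = ennreal (wt \<rho> * Bh) * (\<integral>\<^sup>+w. ennreal (\<bar>g w\<bar> * norm (KG (\<rho>\<^sup>2) \<rho> (gm (ginv w) x))) \<partial>lborel)"
        by (rule nn_integral_cmult) measurable
      also have "\<dots> \<le> ennreal (wt \<rho> * Bh) * ennreal (C * \<rho> powr ex)" by (rule mult_left_mono[OF C(2)[rule_format]]) (use True in auto)
      also have "\<dots> = ennreal ((wt \<rho> * Bh) * (C * \<rho> powr ex))" using Bh(1) by (intro ennreal_mult'[symmetric]) simp
      also have "(wt \<rho> * Bh) * (C * \<rho> powr ex) = Bh * C * (\<rho> powr (1 - 2 * s) * \<rho> powr ex)" using True by (simp add: wt_def)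
      also have "\<rho> powr (1 - 2 * s) * \<rho> powr ex = \<rho> powr (- \<kappa>)" by (simp add: powr_add[symmetric])
      finally show ?thesis using True by (simp add: p)
    next
      case False
      then have "wt \<rho> = 0 \<or> hnorm x > R' \<or> \<bar>\<rho>\<bar> > R'" by (auto simp: wt_def)
      then have "wt \<rho> = 0 \<or> grad br h p = 0" using grad_supp[OF h, of x \<rho>] unfolding p by blast
      then have "F p w = 0" for w by (auto simp: F_def p)
      then show ?thesis by simp
    qed
  qed
  have iF: "integrable lborel (\<lambda>q. F (fst q) (snd q))"
  proof (rule integrableI_bounded)
    have "(\<integral>\<^sup>+q. ennreal (norm (F (fst q) (snd q))) \<partial>lborel) = (\<integral>\<^sup>+p. (\<integral>\<^sup>+w. ennreal (norm (F p w)) \<partial>lborel) \<partial>lborel)"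
      using mF by (subst nn_integral_lborel_pair) auto
    also have "\<dots> \<le> (\<integral>\<^sup>+(p :: ('v \<times> 'z) \<times> real). ennreal (Bh * C * (indicator (hball R') (fst p) * (indicator {0<..R'} (snd p) * (snd p) powr (- \<kappa>)))) \<partial>lborel)"
      by (rule nn_integral_mono) (rule dom)
    also have "\<dots> < \<infinity>"
    proof -
      have "integrable lborel (\<lambda>p :: ('v \<times> 'z) \<times> real. Bh * C * (indicator (hball R') (fst p) * (indicator {0<..R'} (snd p) * (snd p) powr (- \<kappa>))))"
        using cyl_integrable[of "- \<kappa>" R'] kappa R' by (intro integrable_mult_right) auto
      from nn_integral_eq_integral[OF this AE_I2] show ?thesis using Bh(1) C(1) by simp
    qed
    finally show "(\<integral>\<^sup>+q. ennreal (norm (F (fst q) (snd q))) \<partial>lborel) < \<infinity>" .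
  qed (use mF in simp)
  have Fw: "(\<integral>w. F p w \<partial>lborel) = wt (snd p) * (grad br h p \<bullet> VV g ((snd p)\<^sup>2) (snd p) (fst p))" for p
  proof (cases "snd p > 0")
    case True
    have "(\<integral>w. grad br h p \<bullet> (g w *\<^sub>R KG ((snd p)\<^sup>2) (snd p) (gm (ginv w) (fst p))) \<partial>lborel) = grad br h p \<bullet> VV g ((snd p)\<^sup>2) (snd p) (fst p)"
      unfolding VV_def by (rule integral_inner_right) (use C(3)[rule_format, OF True] in simp)
    then show ?thesis unfolding F_def by simp
  qed (simp add: F_def wt_def)
  have Fp: "(\<integral>p. F p w \<partial>lborel) = c0 * (g w * h (w, 0))" for w
  proof -
    have "(\<integral>p. F p w \<partial>lborel) = (\<integral>p. g w * (wt (snd p) * (grad br h p \<bullet> KG ((snd p)\<^sup>2) (snd p) (gm (ginv w) (fst p)))) \<partial>lborel)"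
      unfolding F_def inner_scaleR_right by (simp only: mult.left_commute)
    also have "\<dots> = g w * (c0 * h (w, 0))" unfolding integral_mult_right_zero kernel_identity[OF h, of w] ..
    finally show ?thesis by simp
  qed
  have "(\<integral>p. (\<integral>w. F p w \<partial>lborel) \<partial>lborel) = (\<integral>w. (\<integral>p. F p w \<partial>lborel) \<partial>lborel)"
    using lborel_fubini(1)[OF iF] lborel_fubini(2)[OF iF] by simp
  then show "(\<integral>p. wt (snd p) * (grad br h p \<bullet> VV g ((snd p)\<^sup>2) (snd p) (fst p)) \<partial>lborel) = c0 * (\<integral>w. g w * h (w, 0) \<partial>lborel)"
    unfolding Fw Fp by simp
  show "integrable lborel (\<lambda>p. wt (snd p) * (grad br h p \<bullet> VV g ((snd p)\<^sup>2) (snd p) (fst p)))"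
  proof (rule integrableI_bounded)
    show "(\<lambda>p. wt (snd p) * (grad br h p \<bullet> VV g ((snd p)\<^sup>2) (snd p) (fst p))) \<in> borel_measurable lborel" by measurable
    have "(\<integral>\<^sup>+p. ennreal (norm (wt (snd p) * (grad br h p \<bullet> VV g ((snd p)\<^sup>2) (snd p) (fst p)))) \<partial>lborel) \<le> (\<integral>\<^sup>+p. (\<integral>\<^sup>+w. ennreal (norm (F p w)) \<partial>lborel) \<partial>lborel)"
    proof (rule nn_integral_mono)
      fix p
      show "ennreal (norm (wt (snd p) * (grad br h p \<bullet> VV g ((snd p)\<^sup>2) (snd p) (fst p)))) \<le> (\<integral>\<^sup>+w. ennreal (norm (F p w)) \<partial>lborel)"
      \<comment> \<open>Where the inner function fails to be integrable its Bochner integral is 0 by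
        convention, and the bound holds trivially.\<close>
      proof (cases "integrable lborel (F p)")
        case True
        then show ?thesis unfolding Fw[symmetric] by (rule integral_norm_bound_ennreal)
      next
        case False
        then show ?thesis unfolding Fw[symmetric] by (simp add: not_integrable_integral_eq)
      qed
    qed
    also have "\<dots> = (\<integral>\<^sup>+q. ennreal (norm (F (fst q) (snd q))) \<partial>lborel)"
      using mF by (subst nn_integral_lborel_pair) auto
    also have "\<dots> < \<infinity>" using iF by (simp add: integrable_iff_bounded)
    finally show "(\<integral>\<^sup>+p. ennreal (norm (wt (snd p) * (grad br h p \<bullet> VV g ((snd p)\<^sup>2) (snd p) (fst p)))) \<partial>lborel) < \<infinity>" .
  qed
qed

end

section \<open>Cut-off potentials as test functions\<close>

text \<open>The usual smooth step. The quotient is written as \<open>powr (- 1)\<close> of a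
  positive denominator so that the rules of \<open>smooth_alg\<close> cover it.\<close>

definition eta :: "real \<Rightarrow> real" where
  "eta t = flat 0 (2 - t) * (flat 0 (2 - t) + flat 0 (t - 1)) powr (- 1)"

lemma flat0: "0 \<le> flat 0 t" "t > 0 \<Longrightarrow> 0 < flat 0 t" "t \<le> 0 \<Longrightarrow> flat 0 t = 0"
  by (auto simp: flat_def)

lemma eta_denom: "flat 0 (2 - t) + flat 0 (t - 1) > 0"
proof (cases "t < 2")
  case True
  then show ?thesis using flat0(2)[of "2 - t"] flat0(1)[of "t - 1"] by linarith
next
  case False
  then show ?thesis using flat0(2)[of "t - 1"] flat0(1)[of "2 - t"] by linarith
qed

lemma eta_eq: "eta t = flat 0 (2 - t) / (flat 0 (2 - t) + flat 0 (t - 1))"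
  using eta_denom[of t] by (simp add: eta_def powr_minus divide_inverse)

lemma eta_bounds: "0 \<le> eta t" "eta t \<le> 1" "t \<le> 1 \<Longrightarrow> eta t = 1" "t \<ge> 2 \<Longrightarrow> eta t = 0"
  using eta_denom[of t] flat0(1)[of "2 - t"] flat0(1)[of "t - 1"] flat0(3)[of "t - 1"] flat0(3)[of "2 - t"]
  by (auto simp: eta_eq divide_le_eq_1)

lemma smooth_alg_eta: assumes "f \<in> smooth_alg" shows "(\<lambda>x. eta (f x)) \<in> smooth_alg"
proof -
  have 1: "(\<lambda>x. 2 - f x) \<in> smooth_alg" by (rule smooth_alg_diff[OF smooth_alg.const assms])
  have 2: "(\<lambda>x. f x - 1) \<in> smooth_alg" by (rule smooth_alg_diff[OF assms smooth_alg.const])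
  show ?thesis unfolding eta_def
    by (rule smooth_alg.mult[OF smooth_alg.flat[OF 1] smooth_alg.powr[OF smooth_alg.add[OF smooth_alg.flat[OF 1] smooth_alg.flat[OF 2]] eta_denom]])
qed

lemma eta_deriv_ex:
  "\<exists>e'. (\<forall>t. (eta has_real_derivative e' t) (at t)) \<and> continuous_on UNIV e'"
proof -
  have "eta \<in> smooth_alg" using smooth_alg_eta[OF smooth_alg.lin[OF bounded_linear_ident]] .
  then obtain f' where f': "\<forall>x. (eta has_derivative f' x) (at x)" "\<forall>d. (\<lambda>x. f' x d) \<in> smooth_alg"
    using smooth_alg_deriv by blast
  have e: "f' x d = f' x 1 * d" for x d
    using linear_scale[OF has_derivative_linear[OF f'(1)[rule_format, of x]], of d 1] by (simp add: mult.commute)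
  have "(eta has_real_derivative f' t 1) (at t)" for t
  proof -
    have "f' t = (*) (f' t 1)" by (intro ext) (rule e)
    then show ?thesis using f'(1)[rule_format, of t] by (simp add: has_field_derivative_def)
  qed
  moreover have "continuous_on UNIV (\<lambda>t. f' t 1)" using smooth_alg_continuous f'(2) by blast
  ultimately show ?thesis by (intro exI[of _ "\<lambda>t. f' t 1"]) blast
qed

definition eta' :: "real \<Rightarrow> real" where
  "eta' = (SOME e'. (\<forall>t. (eta has_real_derivative e' t) (at t)) \<and> continuous_on UNIV e')"

lemma eta'_deriv: "(eta has_real_derivative eta' t) (at t)" and eta'_cont: "continuous_on UNIV eta'"
  using someI_ex[OF eta_deriv_ex] unfolding eta'_def[symmetric] by blast+

lemma eta'_zero: assumes "t < 1 \<or> t > 2" shows "eta' t = 0"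
proof -
  obtain S :: "real set" and c where S: "open S" "t \<in> S" "\<And>x. x \<in> S \<Longrightarrow> eta x = c"
  proof (cases "t < 1")
    case True
    then show ?thesis using that[of "{..<1}" 1] eta_bounds(3) by auto
  next
    case False
    then show ?thesis using that[of "{2<..}" 0] eta_bounds(4) assms by auto
  qed
  have "\<forall>\<^sub>F x in nhds t. eta x = c" using eventually_nhds_in_open[OF S(1,2)] by eventually_elim (rule S(3))
  then have "(eta has_real_derivative 0) (at t) \<longleftrightarrow> ((\<lambda>_. c) has_real_derivative 0) (at t)"
    by (intro DERIV_cong_ev) auto
  then show ?thesis using DERIV_unique[OF eta'_deriv] by auto
qed

lemma eta'_bounded: obtains B where "B > 0" "\<forall>t. \<bar>eta' t\<bar> \<le> B"
proof -
  have "compact (eta' ` {1..2})" by (intro compact_continuous_image continuous_on_subset[OF eta'_cont]) auto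
  then obtain B where B: "\<forall>y\<in>eta' ` {1..2}. norm y \<le> B" using compact_imp_bounded bounded_iff by metis
  have "\<bar>eta' t\<bar> \<le> \<bar>B\<bar> + 1" for t
  proof (cases "t < 1 \<or> t > 2")
    case True then show ?thesis using eta'_zero[OF True] by simp
  next
    case False
    then have "eta' t \<in> eta' ` {1..2}" by auto
    then have "norm (eta' t) \<le> B" using B by blast
    then show ?thesis by simp
  qed
  then show ?thesis using that[of "\<bar>B\<bar> + 1"] by simp
qed

lemma frechet_derivative_sum_Basis:
  fixes f :: "'a::euclidean_space \<Rightarrow> real"
  assumes "f differentiable (at x)"
  shows "frechet_derivative f (at x) d = (\<Sum>i\<in>Basis. (d \<bullet> i) * frechet_derivative f (at x) i)"
proof -
  have L: "linear (frechet_derivative f (at x))" using assms frechet_derivative_works has_derivative_linear by blast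
  have "frechet_derivative f (at x) (\<Sum>i\<in>Basis. (d \<bullet> i) *\<^sub>R i) = (\<Sum>i\<in>Basis. (d \<bullet> i) * frechet_derivative f (at x) i)"
    unfolding linear_sum[OF L] linear_scale[OF L] by simp
  then show ?thesis by (simp only: euclidean_representation)
qed

lemma test_function_C1c:
  fixes f :: "('v::euclidean_space \<times> 'z::euclidean_space) \<times> real \<Rightarrow> real"
  assumes "test_function f" shows "\<exists>R. C1c f R"
proof -
  have "continuously_differentiable (Suc 0) f" using assms unfolding test_function_def by blast
  then have d: "\<And>x. f differentiable (at x)" and c: "\<And>i. i \<in> Basis \<Longrightarrow> continuous_on UNIV (\<lambda>x. frechet_derivative f (at x) i)"
    unfolding continuously_differentiable.simps by blast+
  have c': "continuous_on UNIV (\<lambda>x. frechet_derivative f (at x) d)" for d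
  proof -
    have e: "(\<lambda>x. frechet_derivative f (at x) d) = (\<lambda>x. \<Sum>i\<in>Basis. (d \<bullet> i) * frechet_derivative f (at x) i)"
      by (rule ext) (rule frechet_derivative_sum_Basis[OF d])
    show ?thesis by (subst e) (intro continuous_intros c)
  qed
  have "bounded {x. f x \<noteq> 0}" using assms unfolding test_function_def compact_closure by blast
  then have b1: "bounded (fst ` {x. f x \<noteq> 0})" and b2: "bounded (snd ` {x. f x \<noteq> 0})" by (auto intro: bounded_fst bounded_snd)
  obtain R where R: "R > 0" "\<And>x. x \<in> fst ` {x. f x \<noteq> 0} \<Longrightarrow> hnorm x \<le> R"
    by (rule bounded_imp_hnorm_bounded[OF b1]) blast
  obtain R' where R': "\<And>x. x \<in> snd ` {x. f x \<noteq> 0} \<Longrightarrow> norm x \<le> R'" using b2 unfolding bounded_iff by blast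
  have "C1c f (max R R')"
    unfolding C1c_def
  proof (intro conjI allI impI d c')
    show "max R R' > 0" using R(1) by simp
    fix x :: "'v \<times> 'z" and \<rho> :: real assume *: "hnorm x > max R R' \<or> \<bar>\<rho>\<bar> > max R R'"
    show "f (x, \<rho>) = 0"
    proof (rule ccontr)
      assume "f (x, \<rho>) \<noteq> 0"
      then have "(x, \<rho>) \<in> {x. f x \<noteq> 0}" by simp
      from imageI[OF this, of fst] imageI[OF this, of snd]
      have "hnorm x \<le> R" "norm \<rho> \<le> R'" by (simp_all only: fst_conv snd_conv R(2) R')
      then show False using * by auto
    qed
  qed
  then show ?thesis by blast
qed

lemma smooth_alg_normsq:
  fixes f :: "'a::euclidean_space \<Rightarrow> 'b::euclidean_space"
  assumes "\<And>b. b \<in> Basis \<Longrightarrow> (\<lambda>x. f x \<bullet> b) \<in> smooth_alg"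
  shows "(\<lambda>x. (norm (f x))\<^sup>2) \<in> smooth_alg"
proof -
  have e: "(norm (f x))\<^sup>2 = (\<Sum>b\<in>Basis. (f x \<bullet> b) * (f x \<bullet> b))" for x
    unfolding power2_norm_eq_inner by (rule euclidean_inner)
  show ?thesis unfolding e by (intro smooth_alg_sum smooth_alg.mult assms)
qed

context h_type begin

lemma smooth_alg_br:
  fixes f g :: "'a::euclidean_space \<Rightarrow> 'v"
  assumes f: "\<And>b. b \<in> Basis \<Longrightarrow> (\<lambda>x. f x \<bullet> b) \<in> smooth_alg" and g: "\<And>b. b \<in> Basis \<Longrightarrow> (\<lambda>x. g x \<bullet> b) \<in> smooth_alg"
  shows "(\<lambda>x. br (f x) (g x) \<bullet> c) \<in> smooth_alg"
proof -
  have L1: "linear (\<lambda>x. br x y)" and L2: "linear (br x)" for x y using bil unfolding bilinear_def by auto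
  have e: "br (f x) (g x) \<bullet> c = (\<Sum>i\<in>Basis. \<Sum>j\<in>Basis. ((f x \<bullet> i) * (g x \<bullet> j)) * (br i j \<bullet> c))" for x
  proof -
    have "br (f x) (g x) = br (\<Sum>i\<in>Basis. (f x \<bullet> i) *\<^sub>R i) (\<Sum>j\<in>Basis. (g x \<bullet> j) *\<^sub>R j)" by (simp only: euclidean_representation)
    also have "\<dots> = (\<Sum>i\<in>Basis. \<Sum>j\<in>Basis. (f x \<bullet> i) *\<^sub>R (g x \<bullet> j) *\<^sub>R br i j)"
      unfolding linear_sum[OF L1] linear_sum[OF L2] by (subst sum.swap) (simp add: mult.commute)
    finally show ?thesis by (simp add: inner_sum_left mult.assoc)
  qed
  show ?thesis unfolding e by (intro smooth_alg_sum smooth_alg.mult smooth_alg.const f g)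
qed

text \<open>Smoothness holds jointly in the source point, the field point and the height, the form
  that differentiation under the integral asks for; in coordinates the bracket is polynomial, hence
  so is \<open>DD\<close>.\<close>

lemma smooth_alg_DD:
  "(\<lambda>q :: ('v \<times> 'z) \<times> (('v \<times> 'z) \<times> real). DD ((snd (snd q))\<^sup>2 + c) (gm (ginv (fst q)) (fst (snd q)))) \<in> smooth_alg"
proof -
  have lin: "f \<in> smooth_alg" if "linear f" for f :: "('v \<times> 'z) \<times> (('v \<times> 'z) \<times> real) \<Rightarrow> real"
    using that smooth_alg.lin linear_conv_bounded_linear by blast
  have r: "(\<lambda>q :: ('v \<times> 'z) \<times> (('v \<times> 'z) \<times> real). snd (snd q)) \<in> smooth_alg" by (rule lin) (intro linearI; simp)
  have 1: "(\<lambda>q :: ('v \<times> 'z) \<times> (('v \<times> 'z) \<times> real). fst (gm (ginv (fst q)) (fst (snd q))) \<bullet> b) \<in> smooth_alg" for b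
    by (rule lin) (intro linearI; simp add: gmult_def ginv_def inner_add_left inner_diff_left algebra_simps)
  have 2: "(\<lambda>q :: ('v \<times> 'z) \<times> (('v \<times> 'z) \<times> real). snd (gm (ginv (fst q)) (fst (snd q))) \<bullet> b) \<in> smooth_alg" for b
  proof -
    have e: "snd (gm (ginv (fst q)) (fst (snd q))) \<bullet> b = (snd (fst (snd q)) - snd (fst q)) \<bullet> b + (1/2) * (br (- fst (fst q)) (fst (fst (snd q))) \<bullet> b)"
      for q :: "('v \<times> 'z) \<times> (('v \<times> 'z) \<times> real)"
      by (simp add: gmult_def ginv_def inner_add_left inner_diff_left)
    have A: "(\<lambda>q :: ('v \<times> 'z) \<times> (('v \<times> 'z) \<times> real). (snd (fst (snd q)) - snd (fst q)) \<bullet> b) \<in> smooth_alg"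
      by (rule lin) (intro linearI; simp add: inner_add_left inner_diff_left algebra_simps)
    have B: "(\<lambda>q :: ('v \<times> 'z) \<times> (('v \<times> 'z) \<times> real). br (- fst (fst q)) (fst (fst (snd q))) \<bullet> b) \<in> smooth_alg"
      by (rule smooth_alg_br) (rule lin, intro linearI; simp add: inner_add_left inner_diff_left algebra_simps)+
    show ?thesis unfolding e by (rule smooth_alg.add[OF A smooth_alg.mult[OF smooth_alg.const B]])
  qed
  show ?thesis unfolding DD_def
    by (intro smooth_alg.add smooth_alg_power smooth_alg.mult smooth_alg.const r smooth_alg_normsq 1 2)
qed

text \<open>\<open>DD (\<rho>^2) x\<close> is the fourth power of a homogeneous gauge on
  \<open>N\<close> times the height axis. The cutoff is thus 1 on the gauge ball of radius
  \<open>L\<close>, and its gradient is a multiple of \<open>GD\<close>.\<close>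

definition chi :: "real \<Rightarrow> ('v \<times> 'z) \<times> real \<Rightarrow> real" where
  "chi L p = eta (DD ((snd p)\<^sup>2) (fst p) / L ^ 4)"

definition gchi :: "real \<Rightarrow> ('v \<times> 'z) \<times> real \<Rightarrow> ('v \<times> 'z) \<times> real" where
  "gchi L p = (eta' (DD ((snd p)\<^sup>2) (fst p) / L ^ 4) / L ^ 4) *\<^sub>R GD ((snd p)\<^sup>2) (snd p) (fst p)"

lemma smooth_alg_chi: "(\<lambda>q :: ('v \<times> 'z) \<times> (('v \<times> 'z) \<times> real). chi L (snd q)) \<in> smooth_alg"
proof -
  have lin: "f \<in> smooth_alg" if "linear f" for f :: "('v \<times> 'z) \<times> (('v \<times> 'z) \<times> real) \<Rightarrow> real"
    using that smooth_alg.lin linear_conv_bounded_linear by blast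
  have r: "(\<lambda>q :: ('v \<times> 'z) \<times> (('v \<times> 'z) \<times> real). snd (snd q)) \<in> smooth_alg" by (rule lin) (intro linearI; simp)
  have 1: "(\<lambda>q :: ('v \<times> 'z) \<times> (('v \<times> 'z) \<times> real). fst (fst (snd q)) \<bullet> b) \<in> smooth_alg"
    "(\<lambda>q :: ('v \<times> 'z) \<times> (('v \<times> 'z) \<times> real). snd (fst (snd q)) \<bullet> c) \<in> smooth_alg" for b c
    by (rule lin, intro linearI; simp add: inner_add_left)+
  have D: "(\<lambda>q :: ('v \<times> 'z) \<times> (('v \<times> 'z) \<times> real). DD ((snd (snd q))\<^sup>2) (fst (snd q)) * (1 / L ^ 4)) \<in> smooth_alg"
    unfolding DD_def by (intro smooth_alg.add smooth_alg_power smooth_alg.mult smooth_alg.const r smooth_alg_normsq 1)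
  from smooth_alg_eta[OF this] show ?thesis by (simp add: chi_def)
qed

lemma smooth_alg_slice:
  fixes F :: "('v \<times> 'z) \<times> (('v \<times> 'z) \<times> real) \<Rightarrow> real"
  assumes "F \<in> smooth_alg" shows "(\<lambda>p. F (w, p)) differentiable (at p)"
proof -
  obtain F' where F': "\<forall>x. (F has_derivative F' x) (at x)" using smooth_alg_deriv[OF assms] by blast
  have "((\<lambda>p. (w, p)) has_derivative (\<lambda>d. (0, d))) (at p)" by (auto intro!: derivative_eq_intros)
  from has_derivative_compose[OF this F'[rule_format]] show ?thesis unfolding differentiable_def by blast
qed

lemma chi_differentiable: "chi L differentiable (at p)"
  using smooth_alg_slice[OF smooth_alg_chi[of L], of 0 p] by simp

lemma GD_inner_Basis:
  "i \<in> Basis \<Longrightarrow> GD \<tau> \<rho> x \<bullet> ((i, 0), 0) = XD \<tau> (i, 0) x"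
  "j \<in> Basis \<Longrightarrow> GD \<tau> \<rho> x \<bullet> ((0, j), 0) = 1/2 * \<rho> * XD \<tau> (0, j) x"
  "GD \<tau> \<rho> x \<bullet> (0, 1) = 4 * (\<tau> + (norm (fst x))\<^sup>2) * \<rho>"
proof -
  assume "i \<in> Basis"
  then have Ji: "Jt (fst x) (snd x) \<bullet> i = snd x \<bullet> br (fst x) i" by (simp add: Jt_def)
  show "GD \<tau> \<rho> x \<bullet> ((i, 0), 0) = XD \<tau> (i, 0) x" by (simp add: GD_def XD_def inner_add_left Ji)
next
  show "GD \<tau> \<rho> x \<bullet> ((0, j), 0) = 1/2 * \<rho> * XD \<tau> (0, j) x" by (simp add: GD_def XD_def)
next
  show "GD \<tau> \<rho> x \<bullet> (0, 1) = 4 * (\<tau> + (norm (fst x))\<^sup>2) * \<rho>" by (simp add: GD_def)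
qed

lemma grad_inner_Basis:
  assumes "h differentiable (at p)"
  shows "i \<in> Basis \<Longrightarrow> grad br h p \<bullet> ((i, 0), 0) = hX h (i, 0) p"
    "j \<in> Basis \<Longrightarrow> grad br h p \<bullet> ((0, j), 0) = 1/2 * snd p * hX h (0, j) p"
    "grad br h p \<bullet> (0, 1) = hR h p"
  unfolding grad_eq[OF assms] by (auto simp: inner_sum_left_Basis)

lemma vec_eqI:
  fixes x y :: "('v \<times> 'z) \<times> real"
  assumes "\<And>i. i \<in> Basis \<Longrightarrow> x \<bullet> ((i, 0), 0) = y \<bullet> ((i, 0), 0)"
    "\<And>j. j \<in> Basis \<Longrightarrow> x \<bullet> ((0, j), 0) = y \<bullet> ((0, j), 0)" "x \<bullet> (0, 1) = y \<bullet> (0, 1)"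
  shows "x = y"
proof (rule euclidean_eqI)
  fix b :: "('v \<times> 'z) \<times> real" assume "b \<in> Basis"
  then show "x \<bullet> b = y \<bullet> b" using assms by (auto simp: Basis_prod_def)
qed

text \<open>Left-invariant fields commute with left translation, so a function of \<open>DD\<close>
  at a translated point has as gradient a scalar times the translated \<open>GD\<close>. Kernel and
  cutoff are both instances.\<close>

lemma grad_chain_DD:
  assumes u: "u differentiable (at p)"
    and U: "\<And>y \<rho>. u (y, \<rho>) = f (DD (\<rho>\<^sup>2 + c) (gm z y))"
    and f: "(f has_real_derivative f') (at (DD ((snd p)\<^sup>2 + c) (gm z (fst p))))"
  shows "hX u d p = f' * XD ((snd p)\<^sup>2 + c) d (gm z (fst p))"
    "hR u p = f' * (4 * ((snd p)\<^sup>2 + c + (norm (fst (gm z (fst p))))\<^sup>2) * snd p)"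
    "grad br u p = f' *\<^sub>R GD ((snd p)\<^sup>2 + c) (snd p) (gm z (fst p))"
proof -
  let ?t = "(snd p)\<^sup>2 + c" and ?y = "gm z (fst p)"
  have hx: "hX u d p = f' * XD ?t d ?y" for d
  proof -
    have "(f has_real_derivative f') (at (DD ?t (gm ?y (0 *\<^sub>R d))))" using f by simp
    from DERIV_chain2[OF this DD_deriv]
    have "((\<lambda>t. u (gm (fst p) (t *\<^sub>R d), snd p)) has_real_derivative f' * XD ?t d ?y) (at 0)"
      unfolding U gm_assoc[symmetric] .
    then show ?thesis using hX_deriv[OF u, of d] DERIV_unique by blast
  qed
  show "hX u d p = f' * XD ?t d ?y" by (rule hx)
  show hr: "hR u p = f' * (4 * (?t + (norm (fst ?y))\<^sup>2) * snd p)"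
  proof -
    have D: "((\<lambda>r. DD (r\<^sup>2 + c) ?y) has_real_derivative 4 * (?t + (norm (fst ?y))\<^sup>2) * snd p) (at (snd p))"
      unfolding DD_def by (auto intro!: derivative_eq_intros simp: algebra_simps)
    have "((\<lambda>r. u (fst p, r)) has_real_derivative f' * (4 * (?t + (norm (fst ?y))\<^sup>2) * snd p)) (at (snd p))"
      unfolding U by (rule DERIV_chain2[OF f D])
    moreover have "((\<lambda>r. u (fst p, r)) has_real_derivative hR u p) (at (snd p))"
      using hR_deriv[of u "fst p" "snd p"] u by simp
    ultimately show ?thesis using DERIV_unique by blast
  qed
  show "grad br u p = f' *\<^sub>R GD ?t (snd p) ?y"
    by (rule vec_eqI) (simp_all add: grad_inner_Basis[OF u] GD_inner_Basis hx hr)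
qed

lemma grad_chi: "grad br (chi L) p = gchi L p"
proof -
  have "(eta has_real_derivative eta' (DD ((snd p)\<^sup>2 + 0) (gm 0 (fst p)) / L ^ 4)) (at (DD ((snd p)\<^sup>2 + 0) (gm 0 (fst p)) / L ^ 4))"
    by (rule eta'_deriv)
  moreover have "((\<lambda>t. t / L ^ 4) has_real_derivative 1 / L ^ 4) (at (DD ((snd p)\<^sup>2 + 0) (gm 0 (fst p))))"
    by (rule DERIV_cdivide[OF DERIV_ident])
  ultimately have "((\<lambda>t. eta (t / L ^ 4)) has_real_derivative eta' (DD ((snd p)\<^sup>2 + 0) (gm 0 (fst p)) / L ^ 4) * (1 / L ^ 4)) (at (DD ((snd p)\<^sup>2 + 0) (gm 0 (fst p))))"
    by (rule DERIV_chain2)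
  from grad_chain_DD(3)[OF chi_differentiable _ this, of L] show ?thesis
    by (simp add: gchi_def chi_def)
qed

lemma grad_mult:
  fixes f g :: "('v \<times> 'z) \<times> real \<Rightarrow> real"
  assumes "f differentiable (at p)" "g differentiable (at p)"
  shows "grad br (\<lambda>q. f q * g q) p = f p *\<^sub>R grad br g p + g p *\<^sub>R grad br f p"
proof -
  have D: "((\<lambda>q. f q * g q) has_derivative (\<lambda>d. f p * frechet_derivative g (at p) d + frechet_derivative f (at p) d * g p)) (at p)"
    using assms frechet_derivative_works by (intro has_derivative_mult) blast+
  have F: "frechet_derivative (\<lambda>q. f q * g q) (at p) = (\<lambda>d. f p * frechet_derivative g (at p) d + frechet_derivative f (at p) d * g p)"
    using frechet_derivative_at[OF D] by simp
  have d: "(\<lambda>q. f q * g q) differentiable (at p)" using D differentiable_def by blast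
  show ?thesis
    by (rule vec_eqI)
       (simp_all add: inner_add_left grad_inner_Basis[OF d] grad_inner_Basis[OF assms(1)] grad_inner_Basis[OF assms(2)],
        simp_all add: hX_def hR_def F algebra_simps)
qed

text \<open>The summand \<open>\<delta>^2\<close> keeps \<open>DD\<close> away from 0 and makes the
  potential smooth across \<open>\<rho> = 0\<close>, as test functions live on all heights;
  \<open>\<delta> = 0\<close> is the potential itself.\<close>

definition ud :: "('v \<times> 'z \<Rightarrow> real) \<Rightarrow> real \<Rightarrow> ('v \<times> 'z) \<times> real \<Rightarrow> real" where
  "ud g \<delta> p = UU g ((snd p)\<^sup>2 + \<delta>\<^sup>2) (fst p)"

lemma smooth_alg_KK:
  assumes "\<delta> > 0"
  shows "(\<lambda>q :: ('v \<times> 'z) \<times> (('v \<times> 'z) \<times> real). KK ((snd (snd q))\<^sup>2 + \<delta>\<^sup>2) (gm (ginv (fst q)) (fst (snd q)))) \<in> smooth_alg"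
  unfolding KK_def
proof (rule smooth_alg.powr[OF smooth_alg_DD])
  fix q :: "('v \<times> 'z) \<times> (('v \<times> 'z) \<times> real)"
  have "(snd (snd q))\<^sup>2 + \<delta>\<^sup>2 > 0" using assms by (simp add: add_nonneg_pos)
  then show "DD ((snd (snd q))\<^sup>2 + \<delta>\<^sup>2) (gm (ginv (fst q)) (fst (snd q))) > 0" using DD_pos by blast
qed

lemma ud_grad:
  assumes g: "nice g R B" and \<delta>: "\<delta> > 0"
  shows "ud g \<delta> differentiable (at p)" "grad br (ud g \<delta>) p = VV g ((snd p)\<^sup>2 + \<delta>\<^sup>2) (snd p) (fst p)"
proof -
  define F :: "('v \<times> 'z) \<times> (('v \<times> 'z) \<times> real) \<Rightarrow> real" where
    "F q = KK ((snd (snd q))\<^sup>2 + \<delta>\<^sup>2) (gm (ginv (fst q)) (fst (snd q)))" for q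
  have FA: "F \<in> smooth_alg" unfolding F_def by (rule smooth_alg_KK[OF \<delta>])
  obtain F' where F': "\<forall>x. (F has_derivative F' x) (at x)" "\<forall>d. (\<lambda>x. F' x d) \<in> smooth_alg"
    using smooth_alg_deriv[OF FA] by blast
  have gz: "\<And>w. w \<notin> (hball R) \<Longrightarrow> g w = 0" using niceD(5)[OF g] by auto
  have ud: "ud g \<delta> = (\<lambda>p. \<integral>w. g w * F (w, p) \<partial>lborel)" by (simp add: ud_def UU_def F_def fun_eq_iff)
  have D: "(ud g \<delta> has_derivative (\<lambda>d. \<integral>w. g w * F' (w, p) (0, d) \<partial>lborel)) (at p)" for p
    unfolding ud
    by (rule param_integral_has_derivative(1)[OF F'(1)[rule_format] smooth_alg_continuous[OF F'(2)[rule_format]] nice_integrable[OF g] compact_hnorm_ball gz])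
  show du: "ud g \<delta> differentiable (at p)" for p using D differentiable_def by blast
  have fu: "frechet_derivative (ud g \<delta>) (at p) d = (\<integral>w. g w * F' (w, p) (0, d) \<partial>lborel)" for p d
    by (rule fun_cong[OF frechet_derivative_at[OF D], symmetric])
  have dF: "(\<lambda>p. F (w, p)) differentiable (at p)" for w p by (rule smooth_alg_slice[OF FA])
  have fF: "frechet_derivative (\<lambda>p. F (w, p)) (at p) d = F' (w, p) (0, d)" for w p d
  proof -
    have "((\<lambda>p. (w, p)) has_derivative (\<lambda>d. (0, d))) (at p)" by (auto intro!: derivative_eq_intros)
    from has_derivative_compose[OF this F'(1)[rule_format]]
    have "((\<lambda>p. F (w, p)) has_derivative (\<lambda>d. F' (w, p) (0, d))) (at p)" .
    from fun_cong[OF frechet_derivative_at[OF this], symmetric] show ?thesis .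
  qed
  have hXu: "hX (ud g \<delta>) d p = (\<integral>w. g w * hX (\<lambda>p. F (w, p)) d p \<partial>lborel)" for d p
    unfolding hX_def fu fF ..
  have hRu: "hR (ud g \<delta>) p = (\<integral>w. g w * hR (\<lambda>p. F (w, p)) p \<partial>lborel)" for p
    unfolding hR_def fu fF ..
  let ?t = "(snd p)\<^sup>2 + \<delta>\<^sup>2"
  have t: "?t > 0" using \<delta> by (simp add: add_nonneg_pos)
  have gF: "grad br (\<lambda>p. F (w, p)) p = KG ?t (snd p) (gm (ginv w) (fst p))" for w
  proof -
    have "DD ?t (gm (ginv w) (fst p)) > 0" using DD_pos t by blast
    then have "((\<lambda>t. t powr (- a)) has_real_derivative - a * DD ?t (gm (ginv w) (fst p)) powr (- a - 1)) (at (DD ?t (gm (ginv w) (fst p))))"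
      by (rule has_real_derivative_powr)
    from grad_chain_DD(3)[OF dF _ this] show ?thesis by (simp add: F_def KK_def KG_def)
  qed
  have int: "integrable lborel (\<lambda>w. g w *\<^sub>R KG ?t (snd p) (gm (ginv w) (fst p)))"
    by (rule integrable_continuous_mult[OF _ nice_integrable[OF g] compact_hnorm_ball gz])
       (intro KG_cont continuous_intros, use t in simp)
  have V: "VV g ?t (snd p) (fst p) \<bullet> Y = (\<integral>w. g w * (grad br (\<lambda>p. F (w, p)) p \<bullet> Y) \<partial>lborel)" for Y
    unfolding VV_def gF using integral_inner_left[OF int, of Y] by simp
  show "grad br (ud g \<delta>) p = VV g ?t (snd p) (fst p)"
  proof (rule vec_eqI)
    fix j :: 'z assume j: "j \<in> Basis"
    show "grad br (ud g \<delta>) p \<bullet> ((0, j), 0) = VV g ?t (snd p) (fst p) \<bullet> ((0, j), 0)"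
      unfolding V grad_inner_Basis(2)[OF du j] grad_inner_Basis(2)[OF dF j] hXu
      by (subst integral_mult_right_zero[symmetric]) (simp only: mult.left_commute)
  qed (simp_all add: V grad_inner_Basis(1,3)[OF du] grad_inner_Basis(1,3)[OF dF] hXu hRu)
qed

lemma DD_large:
  assumes "L > 0" "hnorm x > 2 * L \<or> \<bar>\<rho>\<bar> > 2 * L"
  shows "DD (\<rho>\<^sup>2) x > 2 * L ^ 4"
proof -
  have L: "(2 * L) ^ 4 = 16 * L ^ 4" "L ^ 4 > 0" using assms by (simp_all add: power_mult_distrib)
  from assms(2) show ?thesis
  proof
    assume "hnorm x > 2 * L"
    then have "(2 * L) ^ 4 < hnorm x ^ 4" using assms(1) by (intro power_strict_mono) auto
    then have "16 * L ^ 4 < hnorm x ^ 4" unfolding L(1) .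
    moreover have "hnorm x ^ 4 \<le> DD (\<rho>\<^sup>2) x" by (rule DD_ge_hnorm) simp
    ultimately show ?thesis using L(2) by linarith
  next
    assume "\<bar>\<rho>\<bar> > 2 * L"
    then have "(2 * L) ^ 4 < \<bar>\<rho>\<bar> ^ 4" using assms(1) by (intro power_strict_mono) auto
    moreover have "\<bar>\<rho>\<bar> ^ 4 = (\<rho>\<^sup>2)\<^sup>2" by (simp flip: power_mult)
    moreover have "(\<rho>\<^sup>2)\<^sup>2 \<le> DD (\<rho>\<^sup>2) x" by (rule DD_ge_tau) simp
    ultimately show ?thesis using L(2) unfolding L(1) by linarith
  qed
qed

lemma chi_supp: assumes "L > 0" "hnorm x > 2 * L \<or> \<bar>\<rho>\<bar> > 2 * L"
  shows "chi L (x, \<rho>) = 0" "gchi L (x, \<rho>) = 0"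
proof -
  have "DD (\<rho>\<^sup>2) x / L ^ 4 > 2" using DD_large[OF assms] assms(1) by (simp add: less_divide_eq)
  then show "chi L (x, \<rho>) = 0" "gchi L (x, \<rho>) = 0"
    using eta_bounds(4) eta'_zero by (auto simp: chi_def gchi_def)
qed

lemma chi_bounds: "0 \<le> chi L p" "chi L p \<le> 1" by (simp_all add: chi_def eta_bounds)

text \<open>The power of the cutoff is absorbed into the integrand, so smoothness is that of a
  parameter integral. The first function is the approximant of the potential; the one with the
  squared cutoff is the partner that the energy identity asks for.\<close>

lemma test_function_T:
  assumes g: "nice g R B" and "\<delta> > 0" "L > 0"
  shows "test_function (\<lambda>p. chi L p * ud g \<delta> p)" "test_function (\<lambda>p. chi L p * (chi L p * ud g \<delta> p))"
proof -
  define F :: "nat \<Rightarrow> ('v \<times> 'z) \<times> (('v \<times> 'z) \<times> real) \<Rightarrow> real" where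
    "F j q = chi L (snd q) ^ j * KK ((snd (snd q))\<^sup>2 + \<delta>\<^sup>2) (gm (ginv (fst q)) (fst (snd q)))" for j q
  have FA: "F j \<in> smooth_alg" for j
    unfolding F_def by (intro smooth_alg.mult smooth_alg_power smooth_alg_chi smooth_alg_KK assms)
  have gz: "\<And>w. w \<notin> (hball R) \<Longrightarrow> g w = 0" using niceD(5)[OF g] by auto
  have e: "(\<integral>w. g w * F j (w, p) \<partial>lborel) = chi L p ^ j * ud g \<delta> p" for j p
    unfolding F_def ud_def UU_def fst_conv snd_conv
    by (subst integral_mult_right_zero[symmetric]) (simp only: mult.left_commute)
  have sm: "continuously_differentiable k (\<lambda>p. chi L p ^ j * ud g \<delta> p)" for j k
    using param_integral_smooth[OF FA nice_integrable[OF g] compact_hnorm_ball gz] unfolding e .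
  have bd: "bounded {p. chi L p ^ Suc j * ud g \<delta> p \<noteq> 0}" for j
  proof (rule bounded_subset)
    show "bounded ((hball (2 * L)) \<times> {- 2 * L..2 * L})"
      by (rule compact_imp_bounded[OF compact_cyl])
    show "{p. chi L p ^ Suc j * ud g \<delta> p \<noteq> 0} \<subseteq> (hball (2 * L)) \<times> {- 2 * L..2 * L}"
    proof
      fix p :: "('v \<times> 'z) \<times> real" assume p: "p \<in> {p. chi L p ^ Suc j * ud g \<delta> p \<noteq> 0}"
      obtain x \<rho> where xr: "p = (x, \<rho>)" by (cases p)
      have "\<not> (hnorm x > 2 * L \<or> \<bar>\<rho>\<bar> > 2 * L)" using p chi_supp(1)[OF \<open>L > 0\<close>, of x \<rho>] unfolding xr by auto
      then show "p \<in> (hball (2 * L)) \<times> {- 2 * L..2 * L}" unfolding xr by auto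
    qed
  qed
  have tf: "test_function (\<lambda>p. chi L p ^ Suc j * ud g \<delta> p)" for j
    unfolding test_function_def compact_closure using sm bd by blast
  show "test_function (\<lambda>p. chi L p * ud g \<delta> p)" using tf[of 0] by simp
  show "test_function (\<lambda>p. chi L p * (chi L p * ud g \<delta> p))" using tf[of 1] by (simp add: mult.assoc)
qed

lemma grad_T:
  assumes g: "nice g R B" and \<delta>: "\<delta> > 0"
  shows "grad br (\<lambda>p. chi L p * ud g \<delta> p) p = chi L p *\<^sub>R VV g ((snd p)\<^sup>2 + \<delta>\<^sup>2) (snd p) (fst p) + ud g \<delta> p *\<^sub>R gchi L p"
    "grad br (\<lambda>p. chi L p * (chi L p * ud g \<delta> p)) p =
      chi L p *\<^sub>R (chi L p *\<^sub>R VV g ((snd p)\<^sup>2 + \<delta>\<^sup>2) (snd p) (fst p) + ud g \<delta> p *\<^sub>R gchi L p) + (chi L p * ud g \<delta> p) *\<^sub>R gchi L p"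
proof -
  show 1: "grad br (\<lambda>p. chi L p * ud g \<delta> p) p = chi L p *\<^sub>R VV g ((snd p)\<^sup>2 + \<delta>\<^sup>2) (snd p) (fst p) + ud g \<delta> p *\<^sub>R gchi L p"
    unfolding grad_mult[OF chi_differentiable ud_grad(1)[OF assms]] ud_grad(2)[OF assms] grad_chi ..
  have "(\<lambda>p. chi L p * ud g \<delta> p) differentiable (at p)" by (intro derivative_intros chi_differentiable ud_grad(1)[OF assms])
  from grad_mult[OF chi_differentiable this] show "grad br (\<lambda>p. chi L p * (chi L p * ud g \<delta> p)) p =
      chi L p *\<^sub>R (chi L p *\<^sub>R VV g ((snd p)\<^sup>2 + \<delta>\<^sup>2) (snd p) (fst p) + ud g \<delta> p *\<^sub>R gchi L p) + (chi L p * ud g \<delta> p) *\<^sub>R gchi L p"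
    unfolding 1 grad_chi .
qed

section \<open>Energy of potentials\<close>

definition EN :: "(('v \<times> 'z) \<times> real \<Rightarrow> ('v \<times> 'z) \<times> real) \<Rightarrow> ennreal" where
  "EN G = (\<integral>\<^sup>+p. ennreal (wt (snd p) * (norm (G p))\<^sup>2) \<partial>lborel)"

lemma energy_EN: "energy s G = EN G"
  unfolding energy_def EN_def
  by (intro nn_integral_cong) (auto simp: wt_def indicator_def mult.commute)

lemma KK_mono: "x \<noteq> 0 \<Longrightarrow> 0 \<le> \<tau> \<Longrightarrow> \<tau> \<le> \<tau>' \<Longrightarrow> KK \<tau>' x \<le> KK \<tau> x"
  unfolding KK_def using DD_pos[of \<tau> x] DD_mono[of \<tau> \<tau>' x] a_pos by (intro powr_mono2') auto

text \<open>Approaching \<open>\<tau>\<close> from above makes the limit kernel itself a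
  majorant.\<close>

lemma UU_tendsto:
  assumes g: "nice g R B" and t: "0 \<le> \<tau>" "\<And>k. \<tau> \<le> T k" "T \<longlonglongrightarrow> \<tau>"
  shows "(\<lambda>k. UU g (T k) x) \<longlonglongrightarrow> UU g \<tau> x"
  unfolding UU_def
proof (rule integral_dominated_convergence[where w = "\<lambda>w. norm (g w * KK \<tau> (gm (ginv w) x))"])
  have [measurable]: "g \<in> borel_measurable borel" by (rule niceD(1)[OF g])
  show "integrable lborel (\<lambda>w. norm (g w * KK \<tau> (gm (ginv w) x)))" by (intro integrable_norm UU_integrable[OF g t(1)])
  show "AE w in lborel. (\<lambda>k. g w * KK (T k) (gm (ginv w) x)) \<longlonglongrightarrow> g w * KK \<tau> (gm (ginv w) x)"
    using AE_gm_nonzero[of x]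
  proof eventually_elim
    fix w assume w: "gm (ginv w) x \<noteq> 0"
    have "DD \<tau> (gm (ginv w) x) \<noteq> 0" using DD_pos[of \<tau> "gm (ginv w) x"] w t(1) by auto
    moreover have "(\<lambda>k. DD (T k) (gm (ginv w) x)) \<longlonglongrightarrow> DD \<tau> (gm (ginv w) x)"
      unfolding DD_def by (intro tendsto_intros t(3))
    ultimately show "(\<lambda>k. g w * KK (T k) (gm (ginv w) x)) \<longlonglongrightarrow> g w * KK \<tau> (gm (ginv w) x)"
      unfolding KK_def by (intro tendsto_mult tendsto_const tendsto_powr)
  qed
  show "AE w in lborel. norm (g w * KK (T k) (gm (ginv w) x)) \<le> norm (g w * KK \<tau> (gm (ginv w) x))" for k
    using AE_gm_nonzero[of x]
  proof eventually_elim
    fix w assume w: "gm (ginv w) x \<noteq> 0"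
    show "norm (g w * KK (T k) (gm (ginv w) x)) \<le> norm (g w * KK \<tau> (gm (ginv w) x))"
      using KK_mono[OF w t(1) t(2)[of k]] by (simp add: abs_mult mult_left_mono)
  qed
  show "(\<lambda>w. g w * KK \<tau> (gm (ginv w) x)) \<in> borel_measurable lborel" by measurable
  show "(\<lambda>w. g w * KK (T k) (gm (ginv w) x)) \<in> borel_measurable lborel" for k by measurable
qed

text \<open>At a fixed positive height the kernel gradient is bounded, so a constant multiple of the
  modulus of \<open>g\<close> dominates.\<close>

lemma VV_tendsto:
  assumes g: "nice g R B" and r: "\<rho> > 0" and t: "\<rho>\<^sup>2 \<le> \<tau>" "\<And>k. \<rho>\<^sup>2 \<le> T k" "T \<longlonglongrightarrow> \<tau>"
  shows "(\<lambda>k. VV g (T k) \<rho> x) \<longlonglongrightarrow> VV g \<tau> \<rho> x"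
  unfolding VV_def
proof (rule integral_dominated_convergence[where w = "\<lambda>w. \<bar>g w\<bar> * (4 * a * (\<rho> ^ 4) powr (- a - 1/4))"])
  have [measurable]: "g \<in> borel_measurable borel" by (rule niceD(1)[OF g])
  show "integrable lborel (\<lambda>w. \<bar>g w\<bar> * (4 * a * (\<rho> ^ 4) powr (- a - 1/4)))"
    using nice_integrable[OF g] by (intro integrable_mult_left integrable_abs)
  have t0: "\<tau> > 0" "T k > 0" for k using t(1) t(2)[of k] zero_less_power[OF r, of 2] by linarith+
  show "AE w in lborel. (\<lambda>k. g w *\<^sub>R KG (T k) \<rho> (gm (ginv w) x)) \<longlonglongrightarrow> g w *\<^sub>R KG \<tau> \<rho> (gm (ginv w) x)"
  proof (rule AE_I2, rule tendsto_scaleR[OF tendsto_const])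
    fix w
    have c: "continuous_on {0<..} (\<lambda>\<tau>. KG \<tau> \<rho> (gm (ginv w) x))" by (intro KG_cont continuous_intros) auto
    show "(\<lambda>k. KG (T k) \<rho> (gm (ginv w) x)) \<longlonglongrightarrow> KG \<tau> \<rho> (gm (ginv w) x)"
      by (rule continuous_on_tendsto_compose[OF c t(3)]) (use t0 in auto)
  qed
  show "AE w in lborel. norm (g w *\<^sub>R KG (T k) \<rho> (gm (ginv w) x)) \<le> \<bar>g w\<bar> * (4 * a * (\<rho> ^ 4) powr (- a - 1/4))" for k
  proof (rule AE_I2)
    fix w
    have "\<rho> ^ 4 = (\<rho>\<^sup>2)\<^sup>2" by (simp flip: power_mult)
    also have "\<dots> \<le> (T k)\<^sup>2" using t(2)[of k] by (intro power_mono) auto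
    also have "\<dots> \<le> DD (T k) (gm (ginv w) x)" using t0(2)[of k] by (intro DD_ge_tau) simp
    finally have "DD (T k) (gm (ginv w) x) powr (- a - 1/4) \<le> (\<rho> ^ 4) powr (- a - 1/4)"
      using r a_pos by (intro powr_mono2') auto
    then have "4 * a * DD (T k) (gm (ginv w) x) powr (- a - 1/4) \<le> 4 * a * (\<rho> ^ 4) powr (- a - 1/4)"
      using a_pos by (intro mult_left_mono) auto
    then have "norm (KG (T k) \<rho> (gm (ginv w) x)) \<le> 4 * a * (\<rho> ^ 4) powr (- a - 1/4)"
      using KG_norm_le[OF t(2), of k "gm (ginv w) x"] by linarith
    then show "norm (g w *\<^sub>R KG (T k) \<rho> (gm (ginv w) x)) \<le> \<bar>g w\<bar> * (4 * a * (\<rho> ^ 4) powr (- a - 1/4))"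
      by (simp add: mult_left_mono)
  qed
  show "(\<lambda>w. g w *\<^sub>R KG \<tau> \<rho> (gm (ginv w) x)) \<in> borel_measurable lborel" by measurable
  show "(\<lambda>w. g w *\<^sub>R KG (T k) \<rho> (gm (ginv w) x)) \<in> borel_measurable lborel" for k by measurable
qed

text \<open>The derivative of the cutoff is nonzero only where \<open>DD \<le> 2 L^4\<close>, and
  the gradient of \<open>DD\<close> has length at most \<open>4 * DD powr (3/4)\<close>, of order
  \<open>L^3\<close>; division by \<open>L^4\<close> leaves \<open>1 / L\<close>.\<close>

lemma gchi_bound:
  obtains Be where "Be > 0" "\<forall>L>0. \<forall>p. norm (gchi L p) \<le> Be / L"
proof -
  obtain B where B: "B > 0" "\<forall>t. \<bar>eta' t\<bar> \<le> B" by (rule eta'_bounded)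
  have "norm (gchi L p) \<le> (32 * B) / L" if L: "L > 0" for L p
  proof (cases "DD ((snd p)\<^sup>2) (fst p) > 2 * L ^ 4")
    case True
    then have "DD ((snd p)\<^sup>2) (fst p) / L ^ 4 > 2" using L by (simp add: less_divide_eq)
    then show ?thesis using eta'_zero B(1) L by (simp add: gchi_def)
  next
    case False
    have L4: "L ^ 4 > 0" using L by simp
    have "(2 * L) ^ 4 = 16 * L ^ 4" by (simp add: power_mult_distrib)
    then have "DD ((snd p)\<^sup>2) (fst p) \<le> (2 * L) ^ 4" using False L4 by linarith
    then have "DD ((snd p)\<^sup>2) (fst p) powr (3/4) \<le> ((2 * L) ^ 4) powr (3/4)" by (intro powr_mono2) auto
    also have "\<dots> = (2 * L) powr 3" using L by (subst powr_pow4) auto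
    also have "\<dots> = 8 * L ^ 3" using L by (simp add: power_mult_distrib)
    finally have "norm (GD ((snd p)\<^sup>2) (snd p) (fst p)) \<le> 32 * L ^ 3"
      using GD_norm_le[of "snd p" "(snd p)\<^sup>2" "fst p"] by simp
    then have "\<bar>eta' (DD ((snd p)\<^sup>2) (fst p) / L ^ 4)\<bar> * norm (GD ((snd p)\<^sup>2) (snd p) (fst p)) \<le> B * (32 * L ^ 3)"
      using B by (intro mult_mono) auto
    then have "\<bar>eta' (DD ((snd p)\<^sup>2) (fst p) / L ^ 4)\<bar> * norm (GD ((snd p)\<^sup>2) (snd p) (fst p)) / L ^ 4 \<le> B * (32 * L ^ 3) / L ^ 4"
      using L4 by (intro divide_right_mono) auto
    also have "B * (32 * L ^ 3) / L ^ 4 = 32 * B / L" using L by (simp add: eval_nat_numeral)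
    finally show ?thesis using L by (simp add: gchi_def)
  qed
  then show ?thesis using that[of "32 * B"] B(1) by simp
qed

lemma chi_meas [measurable]: "chi L \<in> borel_measurable borel"
  by (intro borel_measurable_continuous_onI continuous_at_imp_continuous_on ballI differentiable_imp_continuous_within chi_differentiable)

lemma gchi_meas [measurable]: "gchi L \<in> borel_measurable borel"
proof -
  have [measurable]: "eta' \<in> borel_measurable borel" by (rule borel_measurable_continuous_onI[OF eta'_cont])
  show ?thesis unfolding gchi_def by measurable
qed

text \<open>By the product rule this is the gradient of \<open>chi L * ud g \<delta>\<close> when
  \<open>\<delta> > 0\<close>; for \<open>\<delta> = 0\<close> the formula serves as the definition
  of the limit field.\<close>

definition AA :: "('v \<times> 'z \<Rightarrow> real) \<Rightarrow> real \<Rightarrow> real \<Rightarrow> ('v \<times> 'z) \<times> real \<Rightarrow> ('v \<times> 'z) \<times> real" where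
  "AA g L \<delta> p = chi L p *\<^sub>R VV g ((snd p)\<^sup>2 + \<delta>\<^sup>2) (snd p) (fst p) + ud g \<delta> p *\<^sub>R gchi L p"

definition Qf :: "('v \<times> 'z \<Rightarrow> real) \<Rightarrow> real" where "Qf g = (\<integral>w. g w * UU g 0 w \<partial>lborel)"

definition dl :: "nat \<Rightarrow> real" where "dl k = 1 / (real k + 1)"

lemma dl: "dl k > 0" "dl \<longlonglongrightarrow> 0" "(\<lambda>k. c + (dl k)\<^sup>2) \<longlonglongrightarrow> c"
proof -
  show "dl k > 0" by (simp add: dl_def)
  show d: "dl \<longlonglongrightarrow> 0" unfolding dl_def using LIMSEQ_inverse_real_of_nat by (simp add: inverse_eq_divide add.commute)
  have "(\<lambda>k. c + (dl k)\<^sup>2) \<longlonglongrightarrow> c + 0\<^sup>2" by (intro tendsto_intros d)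
  then show "(\<lambda>k. c + (dl k)\<^sup>2) \<longlonglongrightarrow> c" by simp
qed

text \<open>The last clause is |grad(chi U)|^2 = grad(chi^2 U) . grad U + U^2 |grad chi|^2, in which
  the cross term has disappeared. The first summand pairs the gradient of a test function with that
  of a potential and falls to \<open>potential_pairing\<close>. The test function contains the
  regularised potential, while the other factor \<open>V\<close> is singular from the start, so that
  one limit in \<open>\<delta>\<close> remains.\<close>

lemma cutoff_energy:
  assumes g: "nice g R B" and L: "L > 0"
  shows "(\<lambda>k. \<integral>p. wt (snd p) * (norm (AA g L (dl k) p))\<^sup>2 \<partial>lborel) \<longlonglongrightarrow> (\<integral>p. wt (snd p) * (norm (AA g L 0 p))\<^sup>2 \<partial>lborel)"
    and "\<And>k. integrable lborel (\<lambda>p. wt (snd p) * (norm (AA g L (dl k) p))\<^sup>2)"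
    and "integrable lborel (\<lambda>p. wt (snd p) * (norm (AA g L 0 p))\<^sup>2)"
    and "integrable lborel (\<lambda>p. wt (snd p) * ((ud g 0 p)\<^sup>2 * (norm (gchi L p))\<^sup>2))"
    and "(\<integral>p. wt (snd p) * (norm (AA g L 0 p))\<^sup>2 \<partial>lborel) = c0 * (\<integral>w. g w * ((chi L (w, 0))\<^sup>2 * UU g 0 w) \<partial>lborel)
      + (\<integral>p. wt (snd p) * ((ud g 0 p)\<^sup>2 * (norm (gchi L p))\<^sup>2) \<partial>lborel)"
proof -
  obtain CU where CU: "CU > 0" "\<forall>x \<tau>. \<tau> \<ge> 0 \<longrightarrow> integrable lborel (\<lambda>w. g w * KK \<tau> (gm (ginv w) x))"
    "\<forall>x \<tau>. \<tau> \<ge> 0 \<longrightarrow> \<bar>UU g \<tau> x\<bar> \<le> CU"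
    by (rule UU_bound[OF g])
  obtain CV where CV: "CV > 0"
    "\<forall>x \<rho> \<tau>. 0 < \<rho> \<longrightarrow> \<rho>\<^sup>2 \<le> \<tau> \<longrightarrow> (\<integral>\<^sup>+w. ennreal (\<bar>g w\<bar> * norm (KG \<tau> \<rho> (gm (ginv w) x))) \<partial>lborel) \<le> ennreal (CV * \<rho> powr ex)"
    "\<forall>x \<rho> \<tau>. 0 < \<rho> \<longrightarrow> \<rho>\<^sup>2 \<le> \<tau> \<longrightarrow> integrable lborel (\<lambda>w. g w *\<^sub>R KG \<tau> \<rho> (gm (ginv w) x))"
    "\<forall>x \<rho> \<tau>. 0 < \<rho> \<longrightarrow> \<rho>\<^sup>2 \<le> \<tau> \<longrightarrow> norm (VV g \<tau> \<rho> x) \<le> CV * \<rho> powr ex"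
    by (rule VV_bound[OF g])
  obtain Be where Be: "Be > 0" "\<forall>L>0. \<forall>p. norm (gchi L p) \<le> Be / L" by (rule gchi_bound)
  have [measurable]: "g \<in> borel_measurable borel" by (rule niceD(1)[OF g])
  have ex0: "ex \<le> 0" using kappa by simp
  \<comment> \<open>The power of \<open>2 * L\<close> converts a constant bound on the cylinder of
    height \<open>2 * L\<close> into a multiple of \<open>\<rho> powr ex\<close>, so that both
    summands of \<open>AA\<close> obey a bound of one shape.\<close>
  define K where "K = CU * (Be / L) * (2 * L) powr (- ex)"
  have K0: "K \<ge> 0" using CU(1) Be(1) L by (simp add: K_def)
  define M where "M = CV + K"
  have M: "M > 0" "CV \<le> M" "K \<le> M" using CV(1) K0 by (auto simp: M_def)
  define IND where "IND p = indicator (hball (2 * L)) (fst p) * (indicator {0<..2 * L} (snd p) * (snd p) powr (2 * s - 1 - 2 * \<kappa>))" for p :: "('v \<times> 'z) \<times> real"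
  have IND_int: "integrable lborel IND" unfolding IND_def using kappa L by (intro cyl_integrable) auto
  have [measurable]: "(\<lambda>p. ud g \<delta> p) \<in> borel_measurable borel" for \<delta> unfolding ud_def by measurable
  have [measurable]: "(\<lambda>p. AA g L \<delta> p) \<in> borel_measurable borel" for \<delta> unfolding AA_def by measurable
  have Ub: "\<bar>ud g \<delta> p\<bar> \<le> CU" for \<delta> p unfolding ud_def by (rule CU(3)[rule_format]) simp
  have Vb: "norm (VV g ((snd p)\<^sup>2 + \<delta>\<^sup>2) (snd p) (fst p)) \<le> CV * (snd p) powr ex" if "snd p > 0" for p \<delta>
    using CV(4)[rule_format, OF that, of "(snd p)\<^sup>2 + \<delta>\<^sup>2" "fst p"] by simp
  have UGb: "\<bar>ud g \<delta> p\<bar> * norm (gchi L p) \<le> K * (snd p) powr ex" if "snd p > 0" "snd p \<le> 2 * L" for \<delta> p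
  proof -
    have "(2 * L) powr ex \<le> (snd p) powr ex" using that ex0 by (intro powr_mono2') auto
    moreover have "(2 * L) powr (- ex) * (2 * L) powr ex = 1" using L by (simp add: powr_add[symmetric])
    ultimately have "1 \<le> (2 * L) powr (- ex) * (snd p) powr ex"
      using mult_left_mono[of "(2 * L) powr ex" "(snd p) powr ex" "(2 * L) powr (- ex)"] by simp
    then have "CU * (Be / L) * 1 \<le> CU * (Be / L) * ((2 * L) powr (- ex) * (snd p) powr ex)"
      using CU(1) Be(1) L by (intro mult_left_mono) auto
    moreover have "\<bar>ud g \<delta> p\<bar> * norm (gchi L p) \<le> CU * (Be / L)"
      using Ub[of \<delta> p] Be(2)[rule_format, OF L, of p] CU(1) by (intro mult_mono) (simp_all only: norm_ge_zero abs_ge_zero less_imp_le)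
    ultimately show ?thesis by (simp add: K_def mult.assoc)
  qed
  have Ab: "norm (AA g L \<delta> p) \<le> M * (snd p) powr ex" if "snd p > 0" "snd p \<le> 2 * L" for \<delta> p
  proof -
    have "norm (AA g L \<delta> p) \<le> norm (chi L p *\<^sub>R VV g ((snd p)\<^sup>2 + \<delta>\<^sup>2) (snd p) (fst p)) + norm (ud g \<delta> p *\<^sub>R gchi L p)"
      unfolding AA_def by (rule norm_triangle_ineq)
    also have "\<dots> \<le> 1 * (CV * (snd p) powr ex) + K * (snd p) powr ex"
    proof (rule add_mono)
      show "norm (chi L p *\<^sub>R VV g ((snd p)\<^sup>2 + \<delta>\<^sup>2) (snd p) (fst p)) \<le> 1 * (CV * (snd p) powr ex)"
        unfolding norm_scaleR using chi_bounds[of L p] Vb[OF that(1), of \<delta>] by (intro mult_mono) auto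
      show "norm (ud g \<delta> p *\<^sub>R gchi L p) \<le> K * (snd p) powr ex" unfolding norm_scaleR by (rule UGb[OF that])
    qed
    finally show ?thesis by (simp add: M_def distrib_right)
  qed
  have out: "chi L p = 0 \<and> gchi L p = 0 \<or> wt (snd p) = 0" if "\<not> (snd p > 0 \<and> snd p \<le> 2 * L \<and> hnorm (fst p) \<le> 2 * L)" for p
  proof (cases "snd p > 0")
    case True
    then have "hnorm (fst p) > 2 * L \<or> \<bar>snd p\<bar> > 2 * L" using that by auto
    from chi_supp[OF L this] show ?thesis by simp
  qed (simp add: wt_def)
  have wtp: "wt (snd p) * (snd p powr ex * snd p powr ex) = IND p" if "snd p > 0 \<and> snd p \<le> 2 * L \<and> hnorm (fst p) \<le> 2 * L" for p
  proof -
    have w: "wt (snd p) = snd p powr (1 - 2 * s)" using that by (simp add: wt_def)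
    have "wt (snd p) * (snd p powr ex * snd p powr ex) = snd p powr ((1 - 2 * s) + (ex + ex))" by (simp only: w powr_add)
    also have "(1 - 2 * s) + (ex + ex) = 2 * s - 1 - 2 * \<kappa>" by simp
    finally show ?thesis using that by (simp add: IND_def)
  qed
  have IND0: "0 \<le> IND p" for p by (simp add: IND_def)
  have dom: "\<bar>wt (snd p) * y\<bar> \<le> c * IND p"
    if "snd p > 0 \<Longrightarrow> snd p \<le> 2 * L \<Longrightarrow> \<bar>y\<bar> \<le> c * (snd p powr ex * snd p powr ex)" "chi L p = 0 \<Longrightarrow> gchi L p = 0 \<Longrightarrow> y = 0" "c \<ge> 0" for p y c
  proof (cases "snd p > 0 \<and> snd p \<le> 2 * L \<and> hnorm (fst p) \<le> 2 * L")
    case True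
    then have "\<bar>y\<bar> \<le> c * (snd p powr ex * snd p powr ex)" using that(1) by blast
    then have "wt (snd p) * \<bar>y\<bar> \<le> wt (snd p) * (c * (snd p powr ex * snd p powr ex))" by (rule mult_left_mono) simp
    also have "\<dots> = c * (wt (snd p) * (snd p powr ex * snd p powr ex))" by (rule mult.left_commute)
    finally show ?thesis unfolding wtp[OF True] by (simp add: abs_mult)
  next
    case False
    have "\<bar>wt (snd p) * y\<bar> = 0" using out[OF False] that(2) by auto
    moreover have "0 \<le> c * IND p" using that(3) IND0[of p] by simp
    ultimately show ?thesis by linarith
  qed
  have sq: "(norm (AA g L \<delta> p))\<^sup>2 \<le> M\<^sup>2 * (snd p powr ex * snd p powr ex)" if "snd p > 0" "snd p \<le> 2 * L" for \<delta> p
    using power_mono[OF Ab[OF that, of \<delta>], of 2] by (simp add: power2_eq_square mult_ac)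
  have A0: "AA g L \<delta> p = 0" if "chi L p = 0" "gchi L p = 0" for \<delta> p using that by (simp add: AA_def)
  have d1: "\<bar>wt (snd p) * (norm (AA g L \<delta> p))\<^sup>2\<bar> \<le> M\<^sup>2 * IND p" for \<delta> p
    by (rule dom) (use sq A0 in auto)
  have i1: "integrable lborel (\<lambda>p. wt (snd p) * (norm (AA g L \<delta> p))\<^sup>2)" for \<delta>
    by (rule Bochner_Integration.integrable_bound[OF integrable_mult_right[OF IND_int, of "M\<^sup>2"]])
       (measurable, rule AE_I2, use d1[of _ \<delta>] IND0 in simp)
  show "\<And>k. integrable lborel (\<lambda>p. wt (snd p) * (norm (AA g L (dl k) p))\<^sup>2)" by (rule i1)
  show "integrable lborel (\<lambda>p. wt (snd p) * (norm (AA g L 0 p))\<^sup>2)" by (rule i1)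
  have Ulim: "(\<lambda>k. ud g (dl k) p) \<longlonglongrightarrow> ud g 0 p" for p
    unfolding ud_def by (simp, rule UU_tendsto[OF g _ _ dl(3)]) auto
  have Vlim: "(\<lambda>k. VV g ((snd p)\<^sup>2 + (dl k)\<^sup>2) (snd p) (fst p)) \<longlonglongrightarrow> VV g ((snd p)\<^sup>2) (snd p) (fst p)" if "snd p > 0" for p
    by (rule VV_tendsto[OF g that _ _ dl(3)]) auto
  have Alim: "(\<lambda>k. AA g L (dl k) p) \<longlonglongrightarrow> AA g L 0 p" if "snd p > 0" for p
  proof -
    have "(\<lambda>k. AA g L (dl k) p) \<longlonglongrightarrow> chi L p *\<^sub>R VV g ((snd p)\<^sup>2) (snd p) (fst p) + ud g 0 p *\<^sub>R gchi L p"
      unfolding AA_def by (intro tendsto_intros Ulim Vlim that)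
    then show ?thesis by (simp add: AA_def)
  qed
  show "(\<lambda>k. \<integral>p. wt (snd p) * (norm (AA g L (dl k) p))\<^sup>2 \<partial>lborel) \<longlonglongrightarrow> (\<integral>p. wt (snd p) * (norm (AA g L 0 p))\<^sup>2 \<partial>lborel)"
  proof (rule integral_dominated_convergence[OF _ _ integrable_mult_right[OF IND_int, of "M\<^sup>2"]])
    show "AE p in lborel. (\<lambda>k. wt (snd p) * (norm (AA g L (dl k) p))\<^sup>2) \<longlonglongrightarrow> wt (snd p) * (norm (AA g L 0 p))\<^sup>2"
    proof (rule AE_I2)
      fix p
      show "(\<lambda>k. wt (snd p) * (norm (AA g L (dl k) p))\<^sup>2) \<longlonglongrightarrow> wt (snd p) * (norm (AA g L 0 p))\<^sup>2"
      proof (cases "snd p > 0")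
        case True
        then show ?thesis by (intro tendsto_intros Alim)
      qed (simp add: wt_def)
    qed
    show "AE p in lborel. norm (wt (snd p) * (norm (AA g L (dl k) p))\<^sup>2) \<le> M\<^sup>2 * IND p" for k
      by (rule AE_I2) (use d1[of _ "dl k"] in simp)
    show "(\<lambda>p. wt (snd p) * (norm (AA g L 0 p))\<^sup>2) \<in> borel_measurable lborel" by measurable
    show "(\<lambda>p. wt (snd p) * (norm (AA g L (dl k) p))\<^sup>2) \<in> borel_measurable lborel" for k by measurable
  qed
  have err_b: "(ud g 0 p)\<^sup>2 * (norm (gchi L p))\<^sup>2 \<le> M\<^sup>2 * (snd p powr ex * snd p powr ex)" if "snd p > 0" "snd p \<le> 2 * L" for p
  proof -
    have "\<bar>ud g 0 p\<bar> * norm (gchi L p) \<le> M * snd p powr ex"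
      using UGb[OF that, of 0] mult_right_mono[OF M(3), of "snd p powr ex"] by simp
    then have "(\<bar>ud g 0 p\<bar> * norm (gchi L p))\<^sup>2 \<le> (M * snd p powr ex)\<^sup>2" by (rule power_mono) simp
    then show ?thesis by (simp add: power_mult_distrib) (simp add: power2_eq_square mult_ac)
  qed
  have d2: "\<bar>wt (snd p) * ((ud g 0 p)\<^sup>2 * (norm (gchi L p))\<^sup>2)\<bar> \<le> M\<^sup>2 * IND p" for p
    by (rule dom) (use err_b in auto)
  show i2: "integrable lborel (\<lambda>p. wt (snd p) * ((ud g 0 p)\<^sup>2 * (norm (gchi L p))\<^sup>2))"
    by (rule Bochner_Integration.integrable_bound[OF integrable_mult_right[OF IND_int, of "M\<^sup>2"]])
       (measurable, rule AE_I2, use d2 IND0 in simp)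
  define V where "V p = VV g ((snd p)\<^sup>2) (snd p) (fst p)" for p
  have [measurable]: "V \<in> borel_measurable borel" unfolding V_def by measurable
  define W where "W \<delta> p = chi L p *\<^sub>R AA g L \<delta> p + (chi L p * ud g \<delta> p) *\<^sub>R gchi L p" for \<delta> p
  have [measurable]: "W \<delta> \<in> borel_measurable borel" for \<delta> unfolding W_def by measurable
  have Wb: "norm (W \<delta> p) \<le> 2 * M * snd p powr ex" if "snd p > 0" "snd p \<le> 2 * L" for \<delta> p
  proof -
    have "norm (W \<delta> p) \<le> norm (chi L p *\<^sub>R AA g L \<delta> p) + norm ((chi L p * ud g \<delta> p) *\<^sub>R gchi L p)"
      unfolding W_def by (rule norm_triangle_ineq)
    also have "\<dots> \<le> 1 * (M * snd p powr ex) + 1 * (M * snd p powr ex)"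
    proof (rule add_mono)
      show "norm (chi L p *\<^sub>R AA g L \<delta> p) \<le> 1 * (M * snd p powr ex)"
        unfolding norm_scaleR using chi_bounds[of L p] Ab[OF that, of \<delta>] by (intro mult_mono) auto
      have "norm ((chi L p * ud g \<delta> p) *\<^sub>R gchi L p) = \<bar>chi L p\<bar> * (\<bar>ud g \<delta> p\<bar> * norm (gchi L p))" by (simp add: abs_mult)
      also have "\<dots> \<le> 1 * (M * snd p powr ex)"
      proof (rule mult_mono)
        show "\<bar>ud g \<delta> p\<bar> * norm (gchi L p) \<le> M * snd p powr ex"
          using UGb[OF that, of \<delta>] mult_right_mono[OF M(3), of "snd p powr ex"] by simp
      qed (use chi_bounds[of L p] in auto)
      finally show "norm ((chi L p * ud g \<delta> p) *\<^sub>R gchi L p) \<le> 1 * (M * snd p powr ex)" .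
    qed
    finally show ?thesis by simp
  qed
  have Vb': "norm (V p) \<le> M * snd p powr ex" if "snd p > 0" for p
    using Vb[OF that, of 0] mult_right_mono[OF M(2), of "snd p powr ex"] by (simp add: V_def)
  have WVb: "\<bar>W \<delta> p \<bullet> V p\<bar> \<le> 2 * M\<^sup>2 * (snd p powr ex * snd p powr ex)" if "snd p > 0" "snd p \<le> 2 * L" for \<delta> p
  proof -
    have "\<bar>W \<delta> p \<bullet> V p\<bar> \<le> norm (W \<delta> p) * norm (V p)" by (rule Cauchy_Schwarz_ineq2)
    also have "\<dots> \<le> (2 * M * snd p powr ex) * (M * snd p powr ex)"
      using M(1) by (intro mult_mono Wb Vb' that) auto
    finally show ?thesis by (simp add: power2_eq_square mult_ac)
  qed
  have d3: "\<bar>wt (snd p) * (W \<delta> p \<bullet> V p)\<bar> \<le> 2 * M\<^sup>2 * IND p" for \<delta> p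
    by (rule dom) (use WVb in \<open>auto simp: W_def\<close>)
  have lim1: "(\<lambda>k. \<integral>p. wt (snd p) * (W (dl k) p \<bullet> V p) \<partial>lborel) \<longlonglongrightarrow> (\<integral>p. wt (snd p) * (W 0 p \<bullet> V p) \<partial>lborel)"
  proof (rule integral_dominated_convergence[OF _ _ integrable_mult_right[OF IND_int, of "2 * M\<^sup>2"]])
    show "AE p in lborel. (\<lambda>k. wt (snd p) * (W (dl k) p \<bullet> V p)) \<longlonglongrightarrow> wt (snd p) * (W 0 p \<bullet> V p)"
    proof (rule AE_I2)
      fix p
      show "(\<lambda>k. wt (snd p) * (W (dl k) p \<bullet> V p)) \<longlonglongrightarrow> wt (snd p) * (W 0 p \<bullet> V p)"
      proof (cases "snd p > 0")
        case True
        then show ?thesis unfolding W_def by (intro tendsto_intros Alim Ulim)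
      qed (simp add: wt_def)
    qed
    show "AE p in lborel. norm (wt (snd p) * (W (dl k) p \<bullet> V p)) \<le> 2 * M\<^sup>2 * IND p" for k
      by (rule AE_I2) (use d3[of _ "dl k"] in simp)
    show "(\<lambda>p. wt (snd p) * (W 0 p \<bullet> V p)) \<in> borel_measurable lborel" by measurable
    show "(\<lambda>p. wt (snd p) * (W (dl k) p \<bullet> V p)) \<in> borel_measurable lborel" for k by measurable
  qed
  \<comment> \<open>For positive \<open>\<delta>\<close> the field \<open>W\<close> is the gradient
    of the test function with squared cutoff, so the pairing with \<open>V\<close> reduces to its
    trace.\<close>
  have pair: "(\<integral>p. wt (snd p) * (W (dl k) p \<bullet> V p) \<partial>lborel) = c0 * (\<integral>w. g w * ((chi L (w, 0))\<^sup>2 * UU g ((dl k)\<^sup>2) w) \<partial>lborel)" for k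
  proof -
    let ?T = "\<lambda>p. chi L p * (chi L p * ud g (dl k) p)"
    obtain R' where h: "C1c ?T R'" using test_function_C1c[OF test_function_T(2)[OF g dl(1) L]] by blast
    have "grad br ?T p = W (dl k) p" for p unfolding grad_T(2)[OF g dl(1)] W_def AA_def ..
    then show ?thesis using potential_pairing(1)[OF h g] by (simp add: V_def ud_def power2_eq_square mult.assoc)
  qed
  have lim2: "(\<lambda>k. \<integral>w. g w * ((chi L (w, 0))\<^sup>2 * UU g ((dl k)\<^sup>2) w) \<partial>lborel) \<longlonglongrightarrow> (\<integral>w. g w * ((chi L (w, 0))\<^sup>2 * UU g 0 w) \<partial>lborel)"
  proof (rule integral_dominated_convergence[where w = "\<lambda>w. \<bar>g w\<bar> * CU"])
    show "integrable lborel (\<lambda>w. \<bar>g w\<bar> * CU)" using nice_integrable[OF g] by (intro integrable_mult_left integrable_abs)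
    have "(\<lambda>k. UU g ((dl k)\<^sup>2) w) \<longlonglongrightarrow> UU g 0 w" for w
      by (rule UU_tendsto[OF g]) (use dl(3)[of 0] in auto)
    then show "AE w in lborel. (\<lambda>k. g w * ((chi L (w, 0))\<^sup>2 * UU g ((dl k)\<^sup>2) w)) \<longlonglongrightarrow> g w * ((chi L (w, 0))\<^sup>2 * UU g 0 w)"
      by (intro AE_I2 tendsto_mult tendsto_const; blast)
    show "AE w in lborel. norm (g w * ((chi L (w, 0))\<^sup>2 * UU g ((dl k)\<^sup>2) w)) \<le> \<bar>g w\<bar> * CU" for k
    proof (rule AE_I2)
      fix w
      have "(chi L (w, 0))\<^sup>2 \<le> 1" using chi_bounds[of L "(w, 0)"] by (simp add: power_le_one)
      then have "(chi L (w, 0))\<^sup>2 * \<bar>UU g ((dl k)\<^sup>2) w\<bar> \<le> 1 * CU" using CU(3)[rule_format, of "(dl k)\<^sup>2" w] by (intro mult_mono) auto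
      then show "norm (g w * ((chi L (w, 0))\<^sup>2 * UU g ((dl k)\<^sup>2) w)) \<le> \<bar>g w\<bar> * CU"
        by (simp add: abs_mult mult_left_mono)
    qed
    have [measurable]: "(\<lambda>w. chi L (w, 0)) \<in> borel_measurable borel"
      by (rule measurable_compose[OF _ chi_meas]) measurable
    show "(\<lambda>w. g w * ((chi L (w, 0))\<^sup>2 * UU g 0 w)) \<in> borel_measurable lborel" by measurable
    show "(\<lambda>w. g w * ((chi L (w, 0))\<^sup>2 * UU g ((dl k)\<^sup>2) w)) \<in> borel_measurable lborel" for k by measurable
  qed
  have id: "(\<integral>p. wt (snd p) * (W 0 p \<bullet> V p) \<partial>lborel) = c0 * (\<integral>w. g w * ((chi L (w, 0))\<^sup>2 * UU g 0 w) \<partial>lborel)"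
    using lim1 tendsto_mult_left[OF lim2, of c0] unfolding pair by (rule LIMSEQ_unique)
  have i3: "integrable lborel (\<lambda>p. wt (snd p) * (W 0 p \<bullet> V p))"
    by (rule Bochner_Integration.integrable_bound[OF integrable_mult_right[OF IND_int, of "2 * M\<^sup>2"]])
       (measurable, rule AE_I2, use d3[of _ 0] IND0 in simp)
  have alg: "(norm (AA g L 0 p))\<^sup>2 = W 0 p \<bullet> V p + (ud g 0 p)\<^sup>2 * (norm (gchi L p))\<^sup>2" for p
  proof -
    have A: "AA g L 0 p = chi L p *\<^sub>R V p + ud g 0 p *\<^sub>R gchi L p" by (simp add: AA_def V_def)
    show ?thesis unfolding W_def A power2_norm_eq_inner
      by (simp add: inner_add_left inner_add_right inner_commute power2_eq_square algebra_simps)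
  qed
  have "(\<integral>p. wt (snd p) * (norm (AA g L 0 p))\<^sup>2 \<partial>lborel) = (\<integral>p. wt (snd p) * (W 0 p \<bullet> V p) + wt (snd p) * ((ud g 0 p)\<^sup>2 * (norm (gchi L p))\<^sup>2) \<partial>lborel)"
    unfolding alg distrib_left ..
  also have "\<dots> = (\<integral>p. wt (snd p) * (W 0 p \<bullet> V p) \<partial>lborel) + (\<integral>p. wt (snd p) * ((ud g 0 p)\<^sup>2 * (norm (gchi L p))\<^sup>2) \<partial>lborel)"
    by (rule Bochner_Integration.integral_add[OF i3 i2])
  finally show "(\<integral>p. wt (snd p) * (norm (AA g L 0 p))\<^sup>2 \<partial>lborel) = c0 * (\<integral>w. g w * ((chi L (w, 0))\<^sup>2 * UU g 0 w) \<partial>lborel)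
      + (\<integral>p. wt (snd p) * ((ud g 0 p)\<^sup>2 * (norm (gchi L p))\<^sup>2) \<partial>lborel)"
    unfolding id .
qed

end

lemma fatou_le:
  fixes u :: "nat \<Rightarrow> 'a \<Rightarrow> ennreal"
  assumes [measurable]: "\<And>k. u k \<in> borel_measurable M"
    and lim: "AE x in M. (\<lambda>k. u k x) \<longlonglongrightarrow> v x" and b: "\<forall>\<^sub>F k in sequentially. (\<integral>\<^sup>+x. u k x \<partial>M) \<le> b k" "b \<longlonglongrightarrow> B"
  shows "(\<integral>\<^sup>+x. v x \<partial>M) \<le> B"
proof -
  have "(\<integral>\<^sup>+x. v x \<partial>M) = (\<integral>\<^sup>+x. liminf (\<lambda>k. u k x) \<partial>M)"
  proof (rule nn_integral_cong_AE, use lim in eventually_elim)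
    fix x assume "(\<lambda>k. u k x) \<longlonglongrightarrow> v x"
    then show "v x = liminf (\<lambda>k. u k x)" by (metis lim_imp_Liminf trivial_limit_sequentially)
  qed
  also have "\<dots> \<le> liminf (\<lambda>k. \<integral>\<^sup>+x. u k x \<partial>M)" by (rule nn_integral_liminf) measurable
  also have "\<dots> \<le> liminf b" using b(1) by (rule Liminf_mono)
  also have "\<dots> = B" using b(2) by (metis lim_imp_Liminf trivial_limit_sequentially)
  finally show ?thesis .
qed

lemma ennreal_tendsto_0I:
  fixes f :: "nat \<Rightarrow> ennreal"
  assumes "\<And>e. e > 0 \<Longrightarrow> \<exists>K. \<forall>k\<ge>K. f k \<le> ennreal e"
  shows "f \<longlonglongrightarrow> 0"
proof (rule order_tendstoI)
  fix y :: ennreal assume "0 < y"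
  then obtain e where e: "e > 0" "ennreal e < y"
  proof (cases y)
    case (real r)
    then have "r / 2 > 0" "ennreal (r / 2) < y" using \<open>0 < y\<close> by (auto simp: ennreal_less_iff)
    then show ?thesis by (rule that)
  next
    case top
    then show ?thesis using that[of 1] by simp
  qed
  obtain K where "\<forall>k\<ge>K. f k \<le> ennreal e" using assms[OF e(1)] by blast
  then have "\<forall>k\<ge>K. f k < y" using e(2) le_less_trans by blast
  then show "\<forall>\<^sub>F k in sequentially. f k < y" unfolding eventually_sequentially by blast
qed simp

context h_type begin

section \<open>Removing the cutoff\<close>

lemma cyl_volume:
  obtains C where "C > 0" "\<forall>L>0. (\<integral>\<^sup>+p. ennreal (indicator (hball (2 * L)) (fst p) * (indicator {0<..2 * L} (snd p) * (snd p) powr (1 - 2 * s))) \<partial>lborel)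
     \<le> ennreal (C * L powr (Q + (2 - 2 * s)))"
proof -
  define A where "A L = (\<integral>\<^sup>+x. indicator (hball (2 * L)) x \<partial>lborel)" for L
  define I where "I L = (\<integral>\<^sup>+\<rho>. ennreal (indicator {0<..2 * L} \<rho> * \<rho> powr (1 - 2 * s)) \<partial>lborel)" for L :: real
  have A: "A L = ennreal (L powr Q) * A 1" if L: "L > 0" for L
  proof -
    have "A L = ennreal (L powr Q) * (\<integral>\<^sup>+x. indicator (hball (2 * L)) (dil L x) \<partial>lborel)"
      unfolding A_def by (rule nn_integral_dil[OF _ L]) measurable
    also have "(\<lambda>x :: 'v \<times> 'z. indicator (hball (2 * L)) (dil L x) :: ennreal) = indicator (hball (2 * 1))"
      using L by (auto simp: fun_eq_iff indicator_def hnorm_dil)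
    finally show ?thesis unfolding A_def .
  qed
  have I: "I L = ennreal (L powr (2 - 2 * s)) * I 1" if L: "L > 0" for L
  proof -
    have "I L = ennreal (L ^ DIM(real)) * (\<integral>\<^sup>+\<rho>. ennreal (indicator {0<..2 * L} (L *\<^sub>R \<rho>) * (L *\<^sub>R \<rho>) powr (1 - 2 * s)) \<partial>lborel)"
      unfolding I_def by (rule nn_integral_scale[OF _ L]) measurable
    also have "(\<lambda>\<rho>. ennreal (indicator {0<..2 * L} (L *\<^sub>R \<rho>) * (L *\<^sub>R \<rho>) powr (1 - 2 * s)))
      = (\<lambda>\<rho>. ennreal (L powr (1 - 2 * s)) * ennreal (indicator {0<..2 * 1} \<rho> * \<rho> powr (1 - 2 * s)))"
      using L by (auto simp: fun_eq_iff indicator_def powr_mult zero_less_mult_iff simp flip: ennreal_mult')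
    also have "(\<integral>\<^sup>+\<rho>. ennreal (L powr (1 - 2 * s)) * ennreal (indicator {0<..2 * 1} \<rho> * \<rho> powr (1 - 2 * s)) \<partial>lborel) = ennreal (L powr (1 - 2 * s)) * I 1"
      unfolding I_def by (rule nn_integral_cmult) measurable
    also have "ennreal (L ^ DIM(real)) * (ennreal (L powr (1 - 2 * s)) * I 1) = ennreal (L powr 1 * L powr (1 - 2 * s)) * I 1"
      using L by (simp add: ennreal_mult mult.assoc)
    also have "L powr 1 * L powr (1 - 2 * s) = L powr (2 - 2 * s)" unfolding powr_add[symmetric] by simp
    finally show ?thesis .
  qed
  have A1: "A 1 < \<top>"
  proof -
    have "A 1 = emeasure lborel (hball 2)" unfolding A_def by simp
    then show ?thesis by (simp only: emeasure_bounded_finite[OF bounded_hnorm_ball, unfolded infinity_ennreal_def])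
  qed
  have I1: "I 1 < \<top>" using nn_integral_powr_0[of "1 - 2 * s" 2] s1 by (simp add: I_def)
  have AI: "A 1 * I 1 = ennreal (enn2real (A 1 * I 1))" using A1 I1 by (simp add: ennreal_mult_less_top)
  show ?thesis
  proof (rule that[of "enn2real (A 1 * I 1) + 1"])
    show "enn2real (A 1 * I 1) + 1 > 0" by (simp add: add_nonneg_pos)
    show "\<forall>L>0. (\<integral>\<^sup>+p. ennreal (indicator (hball (2 * L)) (fst p) * (indicator {0<..2 * L} (snd p) * (snd p) powr (1 - 2 * s))) \<partial>lborel)
     \<le> ennreal ((enn2real (A 1 * I 1) + 1) * L powr (Q + (2 - 2 * s)))"
    proof (intro allI impI)
      fix L :: real assume L: "L > 0"
      have "(\<integral>\<^sup>+p. ennreal (indicator (hball (2 * L)) (fst p) * (indicator {0<..2 * L} (snd p) * (snd p) powr (1 - 2 * s))) \<partial>lborel)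
        = (\<integral>\<^sup>+p. indicator (hball (2 * L)) (fst p) * ennreal (indicator {0<..2 * L} (snd p) * (snd p) powr (1 - 2 * s)) \<partial>lborel)"
        by (rule nn_integral_cong) (auto simp: indicator_def)
      also have "\<dots> = A L * I L" unfolding A_def I_def
        by (rule nn_integral_prod[where f = "indicator (hball (2 * L))" and g = "\<lambda>\<rho>. ennreal (indicator {0<..2 * L} \<rho> * \<rho> powr (1 - 2 * s))"]) measurable
      also have "\<dots> = ennreal (L powr Q * L powr (2 - 2 * s)) * (A 1 * I 1)"
        unfolding A[OF L] I[OF L] by (simp add: ennreal_mult mult_ac)
      also have "\<dots> = ennreal (L powr (Q + (2 - 2 * s)) * enn2real (A 1 * I 1))"
        by (subst AI, subst ennreal_mult'[symmetric]) (simp_all add: powr_add)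
      also have "\<dots> \<le> ennreal ((enn2real (A 1 * I 1) + 1) * L powr (Q + (2 - 2 * s)))"
        by (rule ennreal_leI) (simp add: algebra_simps)
      finally show "(\<integral>\<^sup>+p. ennreal (indicator (hball (2 * L)) (fst p) * (indicator {0<..2 * L} (snd p) * (snd p) powr (1 - 2 * s))) \<partial>lborel)
        \<le> ennreal ((enn2real (A 1 * I 1) + 1) * L powr (Q + (2 - 2 * s)))" .
    qed
  qed
qed

text \<open>Since \<open>DD (\<rho>^2) x\<close> is at most twice the sum of the fourth powers of
  the height and of \<open>hnorm x\<close>, lying beyond gauge radius \<open>L\<close> forces one of
  the two to be at least \<open>L / 2\<close>. In the second case the quasi-triangle inequality
  leaves \<open>L / 4 - R\<close>, and \<open>L \<ge> 8 * R\<close> makes this at least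
  \<open>L / 8\<close>.\<close>

lemma UU_decay:
  assumes g: "nice g R B" and L: "L \<ge> 8 * R" and D: "DD (\<rho>\<^sup>2) x \<ge> L ^ 4"
  shows "\<bar>UU g (\<rho>\<^sup>2) x\<bar> \<le> (\<integral>w. \<bar>g w\<bar> \<partial>lborel) * (L / 8) powr (- (4 * a))"
proof -
  have L0: "L > 0" using niceD(2)[OF g] L by simp
  have big: "DD (\<rho>\<^sup>2) (gm (ginv w) x) \<ge> (L / 8) ^ 4" if w: "hnorm w \<le> R" for w
  proof -
    have "\<bar>\<rho>\<bar> \<ge> L / 2 \<or> hnorm x \<ge> L / 2"
    proof (rule ccontr)
      assume "\<not> ?thesis"
      then have l: "\<bar>\<rho>\<bar> \<le> L / 2" "hnorm x \<le> L / 2" by auto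
      have 1: "\<bar>\<rho>\<bar> ^ 4 \<le> L ^ 4 / 16" "hnorm x ^ 4 \<le> L ^ 4 / 16"
        using power_mono[OF l(1) abs_ge_zero, of 4] power_mono[OF l(2) hnorm_nonneg, of 4] by (simp_all add: power_divide)
      have "DD (\<rho>\<^sup>2) x \<le> 2 * \<bar>\<rho>\<bar> ^ 4 + 2 * hnorm x ^ 4"
      proof -
        have q: "(p + q)\<^sup>2 \<le> 2 * p\<^sup>2 + 2 * q\<^sup>2" for p q :: real using zero_le_power2[of "p - q"] by (simp add: power2_eq_square algebra_simps)
        have e: "(y\<^sup>2)\<^sup>2 = y ^ 4" for y :: real by (simp flip: power_mult)
        have "(\<rho>\<^sup>2 + (norm (fst x))\<^sup>2)\<^sup>2 \<le> 2 * \<rho> ^ 4 + 2 * norm (fst x) ^ 4" using q[of "\<rho>\<^sup>2" "(norm (fst x))\<^sup>2"] unfolding e .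
        moreover have "\<bar>\<rho>\<bar> ^ 4 = \<rho> ^ 4" by simp
        moreover have "0 \<le> (norm (snd x))\<^sup>2" by simp
        ultimately show ?thesis unfolding DD_def hnorm_pow4 distrib_left by linarith
      qed
      moreover have "L ^ 4 > 0" using L0 by simp
      ultimately show False using 1 D by linarith
    qed
    then show ?thesis
    proof
      assume "\<bar>\<rho>\<bar> \<ge> L / 2"
      then have "(L / 8) ^ 4 \<le> \<bar>\<rho>\<bar> ^ 4" using L0 by (intro power_mono) auto
      also have "\<bar>\<rho>\<bar> ^ 4 = (\<rho>\<^sup>2)\<^sup>2" by (simp flip: power_mult)
      also have "\<dots> \<le> DD (\<rho>\<^sup>2) (gm (ginv w) x)" by (rule DD_ge_tau) simp
      finally show ?thesis .
    next
      assume "hnorm x \<ge> L / 2"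
      then have "L / 8 \<le> hnorm (gm (ginv w) x)" using hnorm_quasi[of x w] w L by linarith
      then have "(L / 8) ^ 4 \<le> hnorm (gm (ginv w) x) ^ 4" using L0 by (intro power_mono) auto
      also have "\<dots> \<le> DD (\<rho>\<^sup>2) (gm (ginv w) x)" by (rule DD_ge_hnorm) simp
      finally show ?thesis .
    qed
  qed
  have kb: "KK (\<rho>\<^sup>2) (gm (ginv w) x) \<le> (L / 8) powr (- (4 * a))" if w: "hnorm w \<le> R" for w
  proof -
    have "KK (\<rho>\<^sup>2) (gm (ginv w) x) \<le> ((L / 8) ^ 4) powr (- a)"
      unfolding KK_def using big[OF w] a_pos L0 by (intro powr_mono2') auto
    also have "\<dots> = (L / 8) powr (4 * (- a))" using L0 by (intro powr_pow4) simp
    finally show ?thesis by simp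
  qed
  have "\<bar>UU g (\<rho>\<^sup>2) x\<bar> \<le> (\<integral>w. \<bar>g w\<bar> * (L / 8) powr (- (4 * a)) \<partial>lborel)"
    unfolding UU_def
  proof (rule order_trans[OF integral_abs_bound], rule integral_mono)
    show "integrable lborel (\<lambda>w. \<bar>g w\<bar> * (L / 8) powr (- (4 * a)))" using nice_integrable[OF g] by (intro integrable_mult_left integrable_abs)
    show "integrable lborel (\<lambda>w. \<bar>g w * KK (\<rho>\<^sup>2) (gm (ginv w) x)\<bar>)" by (rule integrable_abs, rule UU_integrable[OF g], simp)
    fix w
    show "\<bar>g w * KK (\<rho>\<^sup>2) (gm (ginv w) x)\<bar> \<le> \<bar>g w\<bar> * (L / 8) powr (- (4 * a))"
    proof (cases "hnorm w \<le> R")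
      case True
      then show ?thesis using kb[OF True] by (simp add: abs_mult mult_left_mono)
    next
      case False
      then show ?thesis using niceD(5)[OF g] by simp
    qed
  qed
  then show ?thesis by simp
qed

text \<open>Where the cutoff varies, the squared potential is of order \<open>L^(- 8 a)\<close>, the
  squared gradient of the cutoff \<open>L^(-2)\<close>, and the weighted volume
  \<open>L^(Q + 2 - 2 s)\<close>. With \<open>4 a = Q - 2 s\<close> the product is
  \<open>L^(- (Q - 2 s))\<close>.\<close>

lemma cutoff_error:
  assumes g: "nice g R B"
  shows "(\<lambda>k. \<integral>p. wt (snd p) * ((ud g 0 p)\<^sup>2 * (norm (gchi (real k + 1) p))\<^sup>2) \<partial>lborel) \<longlonglongrightarrow> 0"
proof -
  obtain Be where Be: "Be > 0" "\<forall>L>0. \<forall>p. norm (gchi L p) \<le> Be / L" by (rule gchi_bound)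
  obtain C where C: "C > 0" "\<forall>L>0. (\<integral>\<^sup>+p. ennreal (indicator (hball (2 * L)) (fst p) * (indicator {0<..2 * L} (snd p) * (snd p) powr (1 - 2 * s))) \<partial>lborel)
     \<le> ennreal (C * L powr (Q + (2 - 2 * s)))" by (rule cyl_volume)
  define I where "I = (\<integral>w. \<bar>g w\<bar> \<partial>lborel)"
  have I0: "I \<ge> 0" by (simp add: I_def)
  define c where "c = (I * (1/8) powr (- (4 * a)) * Be)\<^sup>2 * C"
  define err where "err L = (\<integral>p. wt (snd p) * ((ud g 0 p)\<^sup>2 * (norm (gchi L p))\<^sup>2) \<partial>lborel)" for L
  have err0: "0 \<le> err L" for L unfolding err_def by (rule Bochner_Integration.integral_nonneg) simp
  have errb: "err L \<le> c * L powr (- (Q - 2 * s))" if L: "L \<ge> 8 * R" for L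
  proof -
    have L0: "L > 0" using niceD(2)[OF g] L by simp
    define k where "k = I * (L / 8) powr (- (4 * a)) * (Be / L)"
    have k0: "k \<ge> 0" using I0 Be(1) L0 by (simp add: k_def)
    define J where "J p = indicator (hball (2 * L)) (fst p) * (indicator {0<..2 * L} (snd p) * (snd p) powr (1 - 2 * s))" for p :: "('v \<times> 'z) \<times> real"
    have Ji: "integrable lborel J" unfolding J_def using s1 L0 by (intro cyl_integrable) auto
    have J0: "0 \<le> J p" for p by (simp add: J_def)
    have "ennreal (integral\<^sup>L lborel J) = (\<integral>\<^sup>+p. ennreal (J p) \<partial>lborel)"
      by (rule nn_integral_eq_integral[symmetric, OF Ji]) (simp add: J0)
    also have "\<dots> \<le> ennreal (C * L powr (Q + (2 - 2 * s)))" unfolding J_def by (rule C(2)[rule_format, OF L0])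
    finally have "ennreal (integral\<^sup>L lborel J) \<le> ennreal (C * L powr (Q + (2 - 2 * s)))" .
    then have Jb: "integral\<^sup>L lborel J \<le> C * L powr (Q + (2 - 2 * s))" using C(1) by (simp add: ennreal_le_iff)
    have pt: "wt (snd p) * ((ud g 0 p)\<^sup>2 * (norm (gchi L p))\<^sup>2) \<le> k\<^sup>2 * J p" for p :: "('v \<times> 'z) \<times> real"
    proof (cases "snd p > 0 \<and> gchi L p \<noteq> 0")
      case False
      then have "wt (snd p) = 0 \<or> gchi L p = 0" by (auto simp: wt_def)
      then have z: "wt (snd p) * ((ud g 0 p)\<^sup>2 * (norm (gchi L p))\<^sup>2) = 0" by auto
      show ?thesis unfolding z using J0[of p] by simp
    next
      case True
      then have "\<not> (hnorm (fst p) > 2 * L \<or> \<bar>snd p\<bar> > 2 * L)" using chi_supp(2)[OF L0, of "fst p" "snd p"] by auto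
      then have w: "wt (snd p) = J p" using True by (auto simp: J_def wt_def)
      have "\<not> DD ((snd p)\<^sup>2) (fst p) / L ^ 4 < 1" using True eta'_zero by (auto simp: gchi_def)
      then have "DD ((snd p)\<^sup>2) (fst p) \<ge> L ^ 4" using L0 by (simp add: not_less le_divide_eq)
      from UU_decay[OF g L this] have "\<bar>ud g 0 p\<bar> \<le> I * (L / 8) powr (- (4 * a))" by (simp add: ud_def I_def)
      then have "\<bar>ud g 0 p\<bar> * norm (gchi L p) \<le> k"
        unfolding k_def using Be(2)[rule_format, OF L0, of p] I0 by (intro mult_mono) (simp_all only: norm_ge_zero mult_nonneg_nonneg powr_ge_zero)
      then have "(\<bar>ud g 0 p\<bar> * norm (gchi L p))\<^sup>2 \<le> k\<^sup>2" by (rule power_mono) simp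
      then have "(ud g 0 p)\<^sup>2 * (norm (gchi L p))\<^sup>2 \<le> k\<^sup>2" by (simp add: power_mult_distrib)
      then have "J p * ((ud g 0 p)\<^sup>2 * (norm (gchi L p))\<^sup>2) \<le> J p * k\<^sup>2" by (rule mult_left_mono) (rule J0)
      then show ?thesis unfolding w by (simp add: mult.commute)
    qed
    have "err L \<le> (\<integral>p. k\<^sup>2 * J p \<partial>lborel)" unfolding err_def
      by (rule integral_mono[OF cutoff_energy(4)[OF g L0] integrable_mult_right[OF Ji] pt])
    also have "\<dots> = k\<^sup>2 * integral\<^sup>L lborel J" by simp
    also have "\<dots> \<le> k\<^sup>2 * (C * L powr (Q + (2 - 2 * s)))" by (rule mult_left_mono[OF Jb]) simp
    also have "k = (I * (1/8) powr (- (4 * a)) * Be) * (L powr (- (4 * a)) * L powr (- 1))"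
    proof -
      have "(L / 8) powr (- (4 * a)) = (1/8 * L) powr (- (4 * a))" by simp
      also have "\<dots> = (1/8) powr (- (4 * a)) * L powr (- (4 * a))" by (rule powr_mult)
      finally have e: "(L / 8) powr (- (4 * a)) = (1/8) powr (- (4 * a)) * L powr (- (4 * a))" .
      have e': "Be / L = Be * L powr (- 1)" using L0 by (simp add: powr_minus_divide)
      show ?thesis unfolding k_def e e' by (simp only: mult_ac)
    qed
    also have "((I * (1/8) powr (- (4 * a)) * Be) * (L powr (- (4 * a)) * L powr (- 1)))\<^sup>2 * (C * L powr (Q + (2 - 2 * s)))
      = c * (L powr (- (4 * a)) * L powr (- 1) * (L powr (- (4 * a)) * L powr (- 1)) * L powr (Q + (2 - 2 * s)))"
      unfolding c_def power2_eq_square by (simp only: mult_ac)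
    also have "L powr (- (4 * a)) * L powr (- 1) * (L powr (- (4 * a)) * L powr (- 1)) * L powr (Q + (2 - 2 * s))
      = L powr (- (4 * a) + - 1 + (- (4 * a) + - 1) + (Q + (2 - 2 * s)))" by (simp only: powr_add)
    also have "- (4 * a) + - 1 + (- (4 * a) + - 1) + (Q + (2 - 2 * s)) = - (Q - 2 * s)" unfolding four_a by simp
    finally show ?thesis .
  qed
  have lim: "(\<lambda>k. c * (real k + 1) powr (- (Q - 2 * s))) \<longlonglongrightarrow> 0"
  proof -
    have "filterlim (\<lambda>k. real k + 1) at_top sequentially" by real_asymp
    then have "(\<lambda>k. (real k + 1) powr (- (Q - 2 * s))) \<longlonglongrightarrow> 0" using Q_pos(2) s1 by (intro tendsto_neg_powr) auto
    from tendsto_mult_left[OF this, of c] show ?thesis by simp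
  qed
  have ev: "\<forall>\<^sub>F k in sequentially. err (real k + 1) \<le> c * (real k + 1) powr (- (Q - 2 * s))"
  proof (rule eventually_mono[OF eventually_ge_at_top[of "nat \<lceil>8 * R\<rceil>"]])
    fix k :: nat assume "nat \<lceil>8 * R\<rceil> \<le> k"
    then have "8 * R \<le> real k + 1" by linarith
    then show "err (real k + 1) \<le> c * (real k + 1) powr (- (Q - 2 * s))" by (rule errb)
  qed
  have "(\<lambda>k. err (real k + 1)) \<longlonglongrightarrow> 0"
    by (rule tendsto_sandwich[OF _ ev tendsto_const lim]) (simp add: err0)
  then show ?thesis unfolding err_def .
qed

lemma chi_eq_1: assumes "L > 0" "DD ((snd p)\<^sup>2) (fst p) < L ^ 4" shows "chi L p = 1" "gchi L p = 0"
proof -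
  have "DD ((snd p)\<^sup>2) (fst p) / L ^ 4 < 1" using assms by (simp add: divide_less_eq)
  then show "chi L p = 1" "gchi L p = 0" using eta_bounds(3)[of "DD ((snd p)\<^sup>2) (fst p) / L ^ 4"] eta'_zero[of "DD ((snd p)\<^sup>2) (fst p) / L ^ 4"]
    by (simp_all add: chi_def gchi_def)
qed

lemma eventually_chi: "\<forall>\<^sub>F k in sequentially. chi (real k + 1) p = 1 \<and> gchi (real k + 1) p = 0"
proof -
  have "filterlim (\<lambda>k. (real k + 1) ^ 4) at_top sequentially" by real_asymp
  then have "\<forall>\<^sub>F k in sequentially. DD ((snd p)\<^sup>2) (fst p) < (real k + 1) ^ 4" by (simp add: filterlim_at_top_dense)
  then show ?thesis
  proof (rule eventually_mono)
    fix k assume "DD ((snd p)\<^sup>2) (fst p) < (real k + 1) ^ 4"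
    from chi_eq_1[OF _ this] show "chi (real k + 1) p = 1 \<and> gchi (real k + 1) p = 0" by simp
  qed
qed

text \<open>Beyond the support radius of \<open>g\<close> the cutoff is 1 wherever the density
  lives, so the main term is exactly \<open>c0 * Qf g\<close> and only the error varies.\<close>

lemma cutoff_limit:
  assumes g: "nice g R B"
  shows "(\<lambda>k. \<integral>p. wt (snd p) * (norm (AA g (real k + 1) 0 p))\<^sup>2 \<partial>lborel) \<longlonglongrightarrow> c0 * Qf g"
proof -
  have ev: "\<forall>\<^sub>F k in sequentially. c0 * Qf g + (\<integral>p. wt (snd p) * ((ud g 0 p)\<^sup>2 * (norm (gchi (real k + 1) p))\<^sup>2) \<partial>lborel)
     = (\<integral>p. wt (snd p) * (norm (AA g (real k + 1) 0 p))\<^sup>2 \<partial>lborel)"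
  proof (rule eventually_mono[OF eventually_ge_at_top[of "nat \<lceil>R\<rceil>"]])
    fix k :: nat assume "nat \<lceil>R\<rceil> \<le> k"
    then have k: "R < real k + 1" by linarith
    have "g w * ((chi (real k + 1) (w, 0))\<^sup>2 * UU g 0 w) = g w * UU g 0 w" for w
    proof (cases "hnorm w \<le> R")
      case True
      then have "hnorm w ^ 4 < (real k + 1) ^ 4" using k by (intro power_strict_mono) auto
      then show ?thesis by (subst chi_eq_1) (auto simp: DD_0)
    next
      case False
      then show ?thesis using niceD(5)[OF g] by simp
    qed
    then have e: "(\<integral>w. g w * ((chi (real k + 1) (w, 0))\<^sup>2 * UU g 0 w) \<partial>lborel) = Qf g" unfolding Qf_def by presburger
    show "c0 * Qf g + (\<integral>p. wt (snd p) * ((ud g 0 p)\<^sup>2 * (norm (gchi (real k + 1) p))\<^sup>2) \<partial>lborel)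
     = (\<integral>p. wt (snd p) * (norm (AA g (real k + 1) 0 p))\<^sup>2 \<partial>lborel)"
      using cutoff_energy(5)[OF g, of "real k + 1"] unfolding e by simp
  qed
  have "(\<lambda>k. c0 * Qf g + (\<integral>p. wt (snd p) * ((ud g 0 p)\<^sup>2 * (norm (gchi (real k + 1) p))\<^sup>2) \<partial>lborel)) \<longlonglongrightarrow> c0 * Qf g + 0"
    by (intro tendsto_add tendsto_const cutoff_error[OF g])
  then show ?thesis using tendsto_cong[OF ev] by simp
qed

lemma AA_meas: assumes "nice g R B" shows "AA g L \<delta> \<in> borel_measurable borel"
proof -
  have [measurable]: "g \<in> borel_measurable borel" by (rule niceD(1)[OF assms])
  show ?thesis unfolding AA_def ud_def by measurable
qed

lemma EN_AA:
  assumes g: "nice g R B" and L: "L > 0"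
  shows "EN (AA g L (dl k)) = ennreal (\<integral>p. wt (snd p) * (norm (AA g L (dl k) p))\<^sup>2 \<partial>lborel)"
    "EN (AA g L 0) = ennreal (\<integral>p. wt (snd p) * (norm (AA g L 0 p))\<^sup>2 \<partial>lborel)"
  unfolding EN_def
  by (rule nn_integral_eq_integral[OF cutoff_energy(2)[OF g L]], rule AE_I2, simp)
     (rule nn_integral_eq_integral[OF cutoff_energy(3)[OF g L]], rule AE_I2, simp)

text \<open>Fatou along growing cutoffs, which at each point agree with the full gradient from some
  index on. An upper bound is the direction in which the duality inequality consumes the energy of
  the potential.\<close>

lemma EN_VV_le:
  assumes g: "nice g R B"
  shows "EN (\<lambda>p. VV g ((snd p)\<^sup>2) (snd p) (fst p)) \<le> ennreal (c0 * Qf g)"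
  unfolding EN_def
proof (rule fatou_le)
  let ?V = "\<lambda>p. VV g ((snd p)\<^sup>2) (snd p) (fst p)"
  note [measurable] = AA_meas[OF g]
  show "(\<lambda>p. ennreal (wt (snd p) * (norm (AA g (real k + 1) 0 p))\<^sup>2)) \<in> borel_measurable lborel" for k by measurable
  show "AE p in lborel. (\<lambda>k. ennreal (wt (snd p) * (norm (AA g (real k + 1) 0 p))\<^sup>2)) \<longlonglongrightarrow> ennreal (wt (snd p) * (norm (?V p))\<^sup>2)"
  proof (rule AE_I2)
    fix p :: "('v \<times> 'z) \<times> real"
    have "\<forall>\<^sub>F k in sequentially. ennreal (wt (snd p) * (norm (AA g (real k + 1) 0 p))\<^sup>2) = ennreal (wt (snd p) * (norm (?V p))\<^sup>2)"
      by (rule eventually_mono[OF eventually_chi[of p]]) (simp add: AA_def)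
    then show "(\<lambda>k. ennreal (wt (snd p) * (norm (AA g (real k + 1) 0 p))\<^sup>2)) \<longlonglongrightarrow> ennreal (wt (snd p) * (norm (?V p))\<^sup>2)"
      by (rule tendsto_eventually)
  qed
  show "(\<lambda>k. ennreal (\<integral>p. wt (snd p) * (norm (AA g (real k + 1) 0 p))\<^sup>2 \<partial>lborel)) \<longlonglongrightarrow> ennreal (c0 * Qf g)"
    by (rule tendsto_ennrealI[OF cutoff_limit[OF g]])
  show "\<forall>\<^sub>F k in sequentially. (\<integral>\<^sup>+p. ennreal (wt (snd p) * (norm (AA g (real k + 1) 0 p))\<^sup>2) \<partial>lborel) \<le> ennreal (\<integral>p. wt (snd p) * (norm (AA g (real k + 1) 0 p))\<^sup>2 \<partial>lborel)"
    using EN_AA(2)[OF g] by (simp add: EN_def)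
qed

text \<open>Carries an inequality from test functions to potentials in two limits,
  \<open>\<delta>\<close> to 0 at fixed \<open>L\<close> and then \<open>L\<close> to infinity, with
  Fatou on the left and convergence of the energies on the right. Sharpness applies it to an assumed
  better constant.\<close>

lemma cutoff_limit_inequality:
  assumes g: "nice g R B" and [measurable]: "w \<in> borel_measurable borel"
    and T: "\<And>f. test_function f \<Longrightarrow> (\<integral>\<^sup>+x. ennreal ((f (x, 0))\<^sup>2 * w x) \<partial>lborel) \<le> EN (grad br f)"
  shows "(\<integral>\<^sup>+x. ennreal ((UU g 0 x)\<^sup>2 * w x) \<partial>lborel) \<le> ennreal (c0 * Qf g)"
proof -
  have [measurable]: "g \<in> borel_measurable borel" by (rule niceD(1)[OF g])
  have [measurable]: "(\<lambda>x. chi L (x, 0)) \<in> borel_measurable borel" for L by (rule measurable_compose[OF _ chi_meas]) measurable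
  have 1: "(\<integral>\<^sup>+x. ennreal ((chi L (x, 0) * UU g 0 x)\<^sup>2 * w x) \<partial>lborel) \<le> EN (AA g L 0)" if L: "L > 0" for L
  proof (rule fatou_le)
    show "(\<lambda>x. ennreal ((chi L (x, 0) * UU g ((dl k)\<^sup>2) x)\<^sup>2 * w x)) \<in> borel_measurable lborel" for k by measurable
    have "(\<lambda>k. UU g ((dl k)\<^sup>2) x) \<longlonglongrightarrow> UU g 0 x" for x
      by (rule UU_tendsto[OF g]) (use dl(3)[of 0] in auto)
    then show "AE x in lborel. (\<lambda>k. ennreal ((chi L (x, 0) * UU g ((dl k)\<^sup>2) x)\<^sup>2 * w x)) \<longlonglongrightarrow> ennreal ((chi L (x, 0) * UU g 0 x)\<^sup>2 * w x)"
      by (intro AE_I2 tendsto_ennrealI tendsto_mult tendsto_power tendsto_const; blast)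
    show "(\<lambda>k. EN (AA g L (dl k))) \<longlonglongrightarrow> EN (AA g L 0)"
      unfolding EN_AA[OF g L] by (rule tendsto_ennrealI[OF cutoff_energy(1)[OF g L]])
    show "\<forall>\<^sub>F k in sequentially. (\<integral>\<^sup>+x. ennreal ((chi L (x, 0) * UU g ((dl k)\<^sup>2) x)\<^sup>2 * w x) \<partial>lborel) \<le> EN (AA g L (dl k))"
    proof (rule always_eventually, rule allI)
      fix k
      have "grad br (\<lambda>p. chi L p * ud g (dl k) p) = AA g L (dl k)" unfolding AA_def by (rule ext) (rule grad_T(1)[OF g dl(1)])
      then have e: "AA g L (dl k) = grad br (\<lambda>p. chi L p * ud g (dl k) p)" ..
      have u: "UU g ((dl k)\<^sup>2) x = ud g (dl k) (x, 0)" for x by (simp add: ud_def)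
      show "(\<integral>\<^sup>+x. ennreal ((chi L (x, 0) * UU g ((dl k)\<^sup>2) x)\<^sup>2 * w x) \<partial>lborel) \<le> EN (AA g L (dl k))"
        unfolding e u by (rule T[OF test_function_T(1)[OF g dl(1) L]])
    qed
  qed
  show ?thesis
  proof (rule fatou_le)
    show "(\<lambda>x. ennreal ((chi (real k + 1) (x, 0) * UU g 0 x)\<^sup>2 * w x)) \<in> borel_measurable lborel" for k by measurable
    show "AE x in lborel. (\<lambda>k. ennreal ((chi (real k + 1) (x, 0) * UU g 0 x)\<^sup>2 * w x)) \<longlonglongrightarrow> ennreal ((UU g 0 x)\<^sup>2 * w x)"
    proof (rule AE_I2, rule tendsto_eventually)
      fix x
      show "\<forall>\<^sub>F k in sequentially. ennreal ((chi (real k + 1) (x, 0) * UU g 0 x)\<^sup>2 * w x) = ennreal ((UU g 0 x)\<^sup>2 * w x)"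
        by (rule eventually_mono[OF eventually_chi[of "(x, 0)"]]) simp
    qed
    show "(\<lambda>k. ennreal (\<integral>p. wt (snd p) * (norm (AA g (real k + 1) 0 p))\<^sup>2 \<partial>lborel)) \<longlonglongrightarrow> ennreal (c0 * Qf g)"
      by (rule tendsto_ennrealI[OF cutoff_limit[OF g]])
    show "\<forall>\<^sub>F k in sequentially. (\<integral>\<^sup>+x. ennreal ((chi (real k + 1) (x, 0) * UU g 0 x)\<^sup>2 * w x) \<partial>lborel) \<le> ennreal (\<integral>p. wt (snd p) * (norm (AA g (real k + 1) 0 p))\<^sup>2 \<partial>lborel)"
      using 1 EN_AA(2)[OF g] by simp
  qed
qed

end

section \<open>The energy as an upper bound for the Riesz form\<close>

text \<open>One subsequence and one limit function serve all weights \<open>\<omega> i\<close>,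
  because the rate \<open>N\<close> does not depend on \<open>i\<close>. A single weight yields the
  gradient on the completion; the indicators of growing balls yield the trace.\<close>

lemma L2_limit:
  fixes h :: "nat \<Rightarrow> 'a::euclidean_space \<Rightarrow> 'b::euclidean_space" and \<omega> :: "'i \<Rightarrow> 'a \<Rightarrow> real" and N :: "nat \<Rightarrow> nat \<Rightarrow> real"
  assumes h[measurable]: "\<And>k. h k \<in> borel_measurable borel" and w[measurable]: "\<And>i. \<omega> i \<in> borel_measurable borel" and w0: "\<And>i x. 0 \<le> \<omega> i x"
    and C: "\<And>i. 0 \<le> C i" and b: "\<And>i j k. (\<integral>\<^sup>+x. ennreal (\<omega> i x * (norm (h j x - h k x))\<^sup>2) \<partial>lborel) \<le> ennreal (C i * N j k)"
    and N: "\<forall>e>0. \<exists>K. \<forall>j\<ge>K. \<forall>k\<ge>K. N j k \<le> e"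
  shows "\<exists>G. G \<in> borel_measurable borel \<and> (\<forall>i. (\<lambda>k. \<integral>\<^sup>+x. ennreal (\<omega> i x * (norm (h k x - G x))\<^sup>2) \<partial>lborel) \<longlonglongrightarrow> 0)"
proof -
  have "\<forall>j. \<exists>K. \<forall>a\<ge>K. \<forall>b\<ge>K. N a b \<le> (1/4)^j" using N by simp
  then obtain K where K: "\<forall>j. \<forall>a\<ge>K j. \<forall>b\<ge>K j. N a b \<le> (1/4)^j" using choice[of "\<lambda>j K. \<forall>a\<ge>K. \<forall>b\<ge>K. N a b \<le> (1/4)^j"] by blast
  \<comment> \<open>Adding up the thresholds gives an index at or beyond \<open>K i\<close> for
    every \<open>i \<le> j\<close> without a recursive choice.\<close>
  define r where "r j = (\<Sum>i\<le>j. K i)" for j :: nat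
  have r: "K i \<le> r j" if "i \<le> j" for i j unfolding r_def using that by (intro member_le_sum) auto
  define G where "G x = lim (\<lambda>j. h (r j) x)" for x
  have [measurable]: "G \<in> borel_measurable borel" unfolding G_def by (rule borel_measurable_lim_metric) (rule h)
  have ae: "AE x in lborel. 0 < \<omega> i x \<longrightarrow> (\<lambda>j. h (r j) x) \<longlonglongrightarrow> G x" for i
  proof -
    have "AE x in density lborel (\<lambda>x. ennreal (\<omega> i x)). convergent (\<lambda>j. h (r j) x)"
    proof (rule AE_convergent_of_fast_L2[OF _ _ C[of i]])
      show "h (r j) \<in> borel_measurable (density lborel (\<lambda>x. ennreal (\<omega> i x)))" for j by simp
      fix j
      have "(\<integral>\<^sup>+x. ennreal ((norm (h (r (Suc j)) x - h (r j) x))\<^sup>2) \<partial>density lborel (\<lambda>x. ennreal (\<omega> i x)))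
        = (\<integral>\<^sup>+x. ennreal (\<omega> i x) * ennreal ((norm (h (r (Suc j)) x - h (r j) x))\<^sup>2) \<partial>lborel)"
        by (rule nn_integral_density) measurable
      also have "\<dots> = (\<integral>\<^sup>+x. ennreal (\<omega> i x * (norm (h (r (Suc j)) x - h (r j) x))\<^sup>2) \<partial>lborel)"
        by (rule nn_integral_cong) (simp add: ennreal_mult' w0)
      also have "\<dots> \<le> ennreal (C i * N (r (Suc j)) (r j))" by (rule b)
      also have "\<dots> \<le> ennreal (C i * (1/4)^j)"
        using K[rule_format, of j "r (Suc j)" "r j"] r[of j j] r[of j "Suc j"] C[of i] by (intro ennreal_leI mult_left_mono) auto
      finally show "(\<integral>\<^sup>+x. ennreal ((norm (h (r (Suc j)) x - h (r j) x))\<^sup>2) \<partial>density lborel (\<lambda>x. ennreal (\<omega> i x))) \<le> ennreal (C i * (1/4)^j)" .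
    qed
    then have "AE x in lborel. 0 < ennreal (\<omega> i x) \<longrightarrow> convergent (\<lambda>j. h (r j) x)" by (subst (asm) AE_density) simp_all
    then show ?thesis
    proof eventually_elim
      fix x assume "0 < ennreal (\<omega> i x) \<longrightarrow> convergent (\<lambda>j. h (r j) x)"
      then show "0 < \<omega> i x \<longrightarrow> (\<lambda>j. h (r j) x) \<longlonglongrightarrow> G x" by (simp add: G_def convergent_LIMSEQ_iff)
    qed
  qed
  have "(\<lambda>k. \<integral>\<^sup>+x. ennreal (\<omega> i x * (norm (h k x - G x))\<^sup>2) \<partial>lborel) \<longlonglongrightarrow> 0" for i
  proof (rule ennreal_tendsto_0I)
    fix e :: real assume e: "e > 0"
    have "e / (C i + 1) > 0" using e C[of i] by simp
    then obtain j0 where j0: "(1/4::real) ^ j0 < e / (C i + 1)" using real_arch_pow_inv[of "e / (C i + 1)" "1/4"] by auto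
    have "C i * (1/4) ^ j0 \<le> (C i + 1) * (1/4) ^ j0" by (intro mult_right_mono) auto
    also have "\<dots> \<le> e" using j0 C[of i] by (simp add: field_simps)
    finally have Ce: "C i * (1/4) ^ j0 \<le> e" .
    show "\<exists>K. \<forall>k\<ge>K. (\<integral>\<^sup>+x. ennreal (\<omega> i x * (norm (h k x - G x))\<^sup>2) \<partial>lborel) \<le> ennreal e"
    proof (intro exI[of _ "K j0"] allI impI)
      fix k assume k: "K j0 \<le> k"
      show "(\<integral>\<^sup>+x. ennreal (\<omega> i x * (norm (h k x - G x))\<^sup>2) \<partial>lborel) \<le> ennreal e"
      proof (rule fatou_le[OF _ _ _ tendsto_const])
        show "(\<lambda>x. ennreal (\<omega> i x * (norm (h k x - h (r j) x))\<^sup>2)) \<in> borel_measurable lborel" for j by measurable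
        show "AE x in lborel. (\<lambda>j. ennreal (\<omega> i x * (norm (h k x - h (r j) x))\<^sup>2)) \<longlonglongrightarrow> ennreal (\<omega> i x * (norm (h k x - G x))\<^sup>2)"
          using ae[of i]
        proof eventually_elim
          fix x assume x: "0 < \<omega> i x \<longrightarrow> (\<lambda>j. h (r j) x) \<longlonglongrightarrow> G x"
          show "(\<lambda>j. ennreal (\<omega> i x * (norm (h k x - h (r j) x))\<^sup>2)) \<longlonglongrightarrow> ennreal (\<omega> i x * (norm (h k x - G x))\<^sup>2)"
          proof (cases "\<omega> i x = 0")
            case False
            then have "(\<lambda>j. h (r j) x) \<longlonglongrightarrow> G x" using x w0[of i x] by simp
            then show ?thesis by (intro tendsto_ennrealI tendsto_intros)
          qed simp
        qed
        show "\<forall>\<^sub>F j in sequentially. (\<integral>\<^sup>+x. ennreal (\<omega> i x * (norm (h k x - h (r j) x))\<^sup>2) \<partial>lborel) \<le> ennreal e"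
        proof (rule eventually_mono[OF eventually_ge_at_top[of j0]])
          fix j assume j: "j0 \<le> j"
          have "N k (r j) \<le> (1/4) ^ j0" using K k r[OF j] by blast
          then have "C i * N k (r j) \<le> C i * (1/4) ^ j0" using C[of i] by (rule mult_left_mono)
          then have "C i * N k (r j) \<le> e" using Ce by linarith
          with b[of i k "r j"] show "(\<integral>\<^sup>+x. ennreal (\<omega> i x * (norm (h k x - h (r j) x))\<^sup>2) \<partial>lborel) \<le> ennreal e"
            by (meson ennreal_leI order_trans)
        qed
      qed
    qed
  qed
  then show ?thesis using \<open>G \<in> borel_measurable borel\<close> by blast
qed

lemma mult_young:
  fixes x y e :: real
  assumes "e > 0" shows "2 * (x * y) \<le> e * x\<^sup>2 + (1 / e) * y\<^sup>2"
proof -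
  have "0 \<le> (e * x - y)\<^sup>2 / e" using assms by simp
  also have "(e * x - y)\<^sup>2 / e = e * x\<^sup>2 + (1 / e) * y\<^sup>2 - 2 * (x * y)" using assms by (simp add: power2_eq_square field_simps)
  finally show ?thesis by linarith
qed

text \<open>The parameter keeps the leading coefficient as close to 1 as desired; a plain factor 2
  would spoil the constant in limits of energies.\<close>

lemma norm_add_sq_le:
  fixes x y :: "'a::real_inner"
  assumes e: "e > 0" shows "(norm (x + y))\<^sup>2 \<le> (1 + e) * (norm x)\<^sup>2 + (1 + 1 / e) * (norm y)\<^sup>2"
proof -
  have "(norm (x + y))\<^sup>2 \<le> (norm x + norm y)\<^sup>2" by (intro power_mono norm_triangle_ineq) simp
  also have "\<dots> = (norm x)\<^sup>2 + (norm y)\<^sup>2 + 2 * (norm x * norm y)" by (simp add: power2_sum)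
  also have "\<dots> \<le> (norm x)\<^sup>2 + (norm y)\<^sup>2 + (e * (norm x)\<^sup>2 + (1 / e) * (norm y)\<^sup>2)" using mult_young[OF e] by simp
  also have "\<dots> = (1 + e) * (norm x)\<^sup>2 + (1 + 1 / e) * (norm y)\<^sup>2" by (simp add: distrib_right)
  finally show ?thesis .
qed

lemma nn_integral_weighted_add_sq_le:
  fixes F G :: "'a \<Rightarrow> 'b::euclidean_space"
  assumes [measurable]: "F \<in> borel_measurable M" "G \<in> borel_measurable M" "w \<in> borel_measurable M" and w: "\<And>x. 0 \<le> w x" and e: "e > 0"
  shows "(\<integral>\<^sup>+x. ennreal (w x * (norm (F x + G x))\<^sup>2) \<partial>M)
    \<le> ennreal (1 + e) * (\<integral>\<^sup>+x. ennreal (w x * (norm (F x))\<^sup>2) \<partial>M) + ennreal (1 + 1 / e) * (\<integral>\<^sup>+x. ennreal (w x * (norm (G x))\<^sup>2) \<partial>M)"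
proof -
  have "(\<integral>\<^sup>+x. ennreal (w x * (norm (F x + G x))\<^sup>2) \<partial>M)
    \<le> (\<integral>\<^sup>+x. ennreal (1 + e) * ennreal (w x * (norm (F x))\<^sup>2) + ennreal (1 + 1 / e) * ennreal (w x * (norm (G x))\<^sup>2) \<partial>M)"
  proof (rule nn_integral_mono)
    fix x
    have "w x * (norm (F x + G x))\<^sup>2 \<le> w x * ((1 + e) * (norm (F x))\<^sup>2 + (1 + 1 / e) * (norm (G x))\<^sup>2)"
      by (rule mult_left_mono[OF norm_add_sq_le[OF e] w])
    also have "\<dots> = (1 + e) * (w x * (norm (F x))\<^sup>2) + (1 + 1 / e) * (w x * (norm (G x))\<^sup>2)" by (simp only: distrib_left mult.left_commute)
    finally have "ennreal (w x * (norm (F x + G x))\<^sup>2) \<le> ennreal ((1 + e) * (w x * (norm (F x))\<^sup>2) + (1 + 1 / e) * (w x * (norm (G x))\<^sup>2))"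
      by (rule ennreal_leI)
    also have "\<dots> = ennreal ((1 + e) * (w x * (norm (F x))\<^sup>2)) + ennreal ((1 + 1 / e) * (w x * (norm (G x))\<^sup>2))"
      using e w by (intro ennreal_plus mult_nonneg_nonneg) (simp_all add: add_nonneg_nonneg)
    also have "\<dots> = ennreal (1 + e) * ennreal (w x * (norm (F x))\<^sup>2) + ennreal (1 + 1 / e) * ennreal (w x * (norm (G x))\<^sup>2)"
      using e by (simp add: ennreal_mult' add_nonneg_nonneg)
    finally show "ennreal (w x * (norm (F x + G x))\<^sup>2) \<le> ennreal (1 + e) * ennreal (w x * (norm (F x))\<^sup>2) + ennreal (1 + 1 / e) * ennreal (w x * (norm (G x))\<^sup>2)" .
  qed
  also have "\<dots> = ennreal (1 + e) * (\<integral>\<^sup>+x. ennreal (w x * (norm (F x))\<^sup>2) \<partial>M) + ennreal (1 + 1 / e) * (\<integral>\<^sup>+x. ennreal (w x * (norm (G x))\<^sup>2) \<partial>M)"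
    by (subst nn_integral_add) (simp_all add: nn_integral_cmult)
  finally show ?thesis .
qed

context h_type begin

lemma EN_add_le:
  assumes [measurable]: "F \<in> borel_measurable borel" "G \<in> borel_measurable borel" and e: "e > 0"
  shows "EN (\<lambda>p. F p + G p) \<le> ennreal (1 + e) * EN F + ennreal (1 + 1 / e) * EN G"
  unfolding EN_def by (rule nn_integral_weighted_add_sq_le[OF _ _ _ _ e]) simp_all

lemma EN_diff_commute: "EN (\<lambda>p. F p - G p) = EN (\<lambda>p. G p - F p)"
  unfolding EN_def by (simp add: norm_minus_commute)

lemma C1c_diff:
  assumes f: "C1c f R" and g: "C1c g R'"
  shows "C1c (\<lambda>p. f p - g p) (R + R')" "grad br (\<lambda>q. f q - g q) p = grad br f p - grad br g p"
proof -
  have D: "((\<lambda>q. f q - g q) has_derivative (\<lambda>d. frechet_derivative f (at p) d - frechet_derivative g (at p) d)) (at p)" for p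
    using C1cD(1)[OF f] C1cD(1)[OF g] frechet_derivative_works by (intro has_derivative_diff) blast+
  have F: "frechet_derivative (\<lambda>q. f q - g q) (at p) = (\<lambda>d. frechet_derivative f (at p) d - frechet_derivative g (at p) d)" for p
    using frechet_derivative_at[OF D] by simp
  have d: "(\<lambda>q. f q - g q) differentiable (at p)" for p using D differentiable_def by blast
  show "C1c (\<lambda>p. f p - g p) (R + R')"
    unfolding C1c_def F
  proof (intro conjI allI impI)
    show "(\<lambda>q. f q - g q) differentiable (at p)" for p by (rule d)
    show "continuous_on UNIV (\<lambda>p. frechet_derivative f (at p) d - frechet_derivative g (at p) d)" for d
      by (intro continuous_on_diff C1cD(2)[OF f] C1cD(2)[OF g])
    show "R + R' > 0" using C1cD(3)[OF f] C1cD(3)[OF g] by simp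
    fix x :: "'v \<times> 'z" and \<rho> :: real assume "hnorm x > R + R' \<or> \<bar>\<rho>\<bar> > R + R'"
    then have "hnorm x > R \<or> \<bar>\<rho>\<bar> > R" "hnorm x > R' \<or> \<bar>\<rho>\<bar> > R'" using C1cD(3)[OF f] C1cD(3)[OF g] by auto
    then show "f (x, \<rho>) - g (x, \<rho>) = 0" using C1cD(4)[OF f] C1cD(4)[OF g] by simp
  qed
  show "grad br (\<lambda>q. f q - g q) p = grad br f p - grad br g p"
    by (rule vec_eqI)
       (simp_all add: inner_diff_left grad_inner_Basis[OF d] grad_inner_Basis[OF C1cD(1)[OF f]] grad_inner_Basis[OF C1cD(1)[OF g]] hX_def hR_def F algebra_simps)
qed

lemma grad_meas: assumes "C1c h R" shows "grad br h \<in> borel_measurable borel"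
  by (rule borel_measurable_continuous_onI[OF grad_cont[OF assms]])

lemma trace_meas: fixes h :: "('v \<times> 'z) \<times> real \<Rightarrow> real" assumes "C1c h R" shows "(\<lambda>x. h (x, 0)) \<in> borel_measurable borel"
  by (intro borel_measurable_continuous_onI continuous_on_compose2[OF C1cD(5)[OF assms]] continuous_intros) auto

lemma EN_grad_finite: assumes h: "C1c h R" shows "EN (grad br h) < \<top>"
proof -
  obtain B where B: "B > 0" "\<forall>p. norm (grad br h p) \<le> B" by (rule grad_bounded[OF h]) blast
  define J where "J p = indicator (hball R) (fst p) * (indicator {0<..R} (snd p) * (snd p) powr (1 - 2 * s))" for p :: "('v \<times> 'z) \<times> real"
  have Ji: "integrable lborel J" unfolding J_def using s1 C1cD(3)[OF h] by (intro cyl_integrable) auto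
  have J0: "0 \<le> J p" for p by (simp add: J_def)
  have [measurable]: "grad br h \<in> borel_measurable borel" by (rule grad_meas[OF h])
  have "integrable lborel (\<lambda>p. wt (snd p) * (norm (grad br h p))\<^sup>2)"
  proof (rule Bochner_Integration.integrable_bound[OF integrable_mult_right[OF Ji, of "B\<^sup>2"]])
    show "(\<lambda>p. wt (snd p) * (norm (grad br h p))\<^sup>2) \<in> borel_measurable lborel" by measurable
    show "AE p in lborel. norm (wt (snd p) * (norm (grad br h p))\<^sup>2) \<le> norm (B\<^sup>2 * J p)"
    proof (rule AE_I2)
      fix p :: "('v \<times> 'z) \<times> real"
      have "wt (snd p) * (norm (grad br h p))\<^sup>2 \<le> J p * B\<^sup>2"
      proof (cases "snd p > 0 \<and> grad br h p \<noteq> 0")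
        case False
        then have z: "wt (snd p) * (norm (grad br h p))\<^sup>2 = 0" by (auto simp: wt_def)
        show ?thesis unfolding z using J0[of p] by simp
      next
        case True
        then have "\<not> (hnorm (fst p) > R \<or> \<bar>snd p\<bar> > R)" using grad_supp[OF h, of "fst p" "snd p"] by auto
        then have w: "wt (snd p) = J p" using True by (auto simp: J_def wt_def)
        have "(norm (grad br h p))\<^sup>2 \<le> B\<^sup>2" using B(2)[rule_format, of p] by (intro power_mono) auto
        then show ?thesis unfolding w by (rule mult_left_mono[OF _ J0])
      qed
      then show "norm (wt (snd p) * (norm (grad br h p))\<^sup>2) \<le> norm (B\<^sup>2 * J p)" using J0[of p] by (simp add: mult.commute)
    qed
  qed
  from nn_integral_eq_integral[OF this] show ?thesis unfolding EN_def by simp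
qed

text \<open>Up to the positive factor \<open>c0\<close> the form is a limit of energies, which
  yields positivity of the kernel without Fourier analysis on the group.\<close>

lemma Qf_nonneg: assumes g: "nice g R B" shows "0 \<le> Qf g"
proof -
  have "0 \<le> c0 * Qf g"
    by (rule LIMSEQ_le_const[OF cutoff_limit[OF g]]) (auto intro!: exI[of _ 0] Bochner_Integration.integral_nonneg)
  then show ?thesis using c0_pos by (simp add: zero_le_mult_iff)
qed

text \<open>Young's inequality for twice the pairing of the two gradients; the pairing is evaluated
  by \<open>potential_pairing\<close> and the energy of the potential is bounded by
  \<open>EN_VV_le\<close>. A negative left side is cut to 0 by \<open>ennreal\<close>.\<close>

lemma energy_ge_test:
  assumes h: "C1c h R'" and g: "nice g R B"
  shows "ennreal (2 * c0 * (\<integral>w. g w * h (w, 0) \<partial>lborel) - c0 * Qf g) \<le> EN (grad br h)"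
proof -
  define V where "V p = VV g ((snd p)\<^sup>2) (snd p) (fst p)" for p
  have [measurable]: "g \<in> borel_measurable borel" by (rule niceD(1)[OF g])
  have [measurable]: "V \<in> borel_measurable borel" unfolding V_def by measurable
  have [measurable]: "grad br h \<in> borel_measurable borel" by (rule grad_meas[OF h])
  have EV: "EN V \<le> ennreal (c0 * Qf g)" unfolding V_def by (rule EN_VV_le[OF g])
  have fin: "integrable lborel (\<lambda>p. wt (snd p) * (norm (F p))\<^sup>2) \<and> EN F = ennreal (\<integral>p. wt (snd p) * (norm (F p))\<^sup>2 \<partial>lborel)"
    if "EN F < \<top>" and [measurable]: "F \<in> borel_measurable borel" for F
  proof -
    have i: "integrable lborel (\<lambda>p. wt (snd p) * (norm (F p))\<^sup>2)"
      using that(1) unfolding EN_def by (intro integrableI_nonneg AE_I2) simp_all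
    show ?thesis using i nn_integral_eq_integral[OF i] by (simp add: EN_def)
  qed
  have EVf: "EN V < \<top>" using EV by (rule le_less_trans) simp
  have iV: "integrable lborel (\<lambda>p. wt (snd p) * (norm (V p))\<^sup>2)" "EN V = ennreal (\<integral>p. wt (snd p) * (norm (V p))\<^sup>2 \<partial>lborel)" using fin[OF EVf] by simp_all
  have iG: "integrable lborel (\<lambda>p. wt (snd p) * (norm (grad br h p))\<^sup>2)" "EN (grad br h) = ennreal (\<integral>p. wt (snd p) * (norm (grad br h p))\<^sup>2 \<partial>lborel)"
    using fin[OF EN_grad_finite[OF h]] by simp_all
  have V: "(\<integral>p. wt (snd p) * (norm (V p))\<^sup>2 \<partial>lborel) \<le> c0 * Qf g"
    using EV Qf_nonneg[OF g] c0_pos unfolding iV(2) by (simp add: ennreal_le_iff)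
  have iP: "integrable lborel (\<lambda>p. wt (snd p) * (grad br h p \<bullet> V p))" unfolding V_def by (rule potential_pairing(2)[OF h g])
  have "2 * (c0 * (\<integral>w. g w * h (w, 0) \<partial>lborel)) = (\<integral>p. 2 * (wt (snd p) * (grad br h p \<bullet> V p)) \<partial>lborel)"
    using potential_pairing(1)[OF h g] by (simp add: V_def)
  also have "\<dots> \<le> (\<integral>p. wt (snd p) * (norm (grad br h p))\<^sup>2 + wt (snd p) * (norm (V p))\<^sup>2 \<partial>lborel)"
  proof (rule integral_mono)
    show "integrable lborel (\<lambda>p. 2 * (wt (snd p) * (grad br h p \<bullet> V p)))" by (rule integrable_mult_right[OF iP])
    show "integrable lborel (\<lambda>p. wt (snd p) * (norm (grad br h p))\<^sup>2 + wt (snd p) * (norm (V p))\<^sup>2)" by (rule Bochner_Integration.integrable_add[OF iG(1) iV(1)])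
    fix p
    have "grad br h p \<bullet> V p \<le> norm (grad br h p) * norm (V p)" by (rule norm_cauchy_schwarz)
    then have "2 * (grad br h p \<bullet> V p) \<le> (norm (grad br h p))\<^sup>2 + (norm (V p))\<^sup>2"
      using mult_young[of 1 "norm (grad br h p)" "norm (V p)"] by simp
    then have "wt (snd p) * (2 * (grad br h p \<bullet> V p)) \<le> wt (snd p) * ((norm (grad br h p))\<^sup>2 + (norm (V p))\<^sup>2)" by (rule mult_left_mono) simp
    then show "2 * (wt (snd p) * (grad br h p \<bullet> V p)) \<le> wt (snd p) * (norm (grad br h p))\<^sup>2 + wt (snd p) * (norm (V p))\<^sup>2"
      by (simp only: distrib_left mult.left_commute)
  qed
  also have "\<dots> = (\<integral>p. wt (snd p) * (norm (grad br h p))\<^sup>2 \<partial>lborel) + (\<integral>p. wt (snd p) * (norm (V p))\<^sup>2 \<partial>lborel)"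
    by (rule Bochner_Integration.integral_add[OF iG(1) iV(1)])
  finally show ?thesis unfolding iG(2) using V by (intro ennreal_leI) linarith
qed

abbreviation kx where "kx x w \<equiv> KK 0 (gm (ginv w) x)"

lemma kx_sym: "kx x w = kx w x" by (simp only: KK_0 hnorm_sym[of x w])

text \<open>The quadratic form of the kernel as a weighted \<open>L\<^sup>2\<close> norm minus a Dirichlet-type defect:
  integrate \<open>2 f(x) f(w) = f(x)\<^sup>2 + f(w)\<^sup>2 - (f(x) - f(w))\<^sup>2\<close> against \<open>p(x) p(w) kx(x, w)\<close>.\<close>
lemma ground_state:
  assumes [measurable]: "p \<in> borel_measurable borel" "f \<in> borel_measurable borel" and p0: "\<And>x. 0 \<le> p x"
    and S: "S = (\<integral>\<^sup>+x. ennreal (p x * (f x)\<^sup>2) * (\<integral>\<^sup>+w. ennreal (p w * kx x w) \<partial>lborel) \<partial>lborel)" and Sf: "S < \<top>"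
    and D: "D = (\<integral>\<^sup>+x. (\<integral>\<^sup>+w. ennreal (p x * p w * kx x w * (f x - f w)\<^sup>2) \<partial>lborel) \<partial>lborel)"
  shows "D < \<top>" "Qf (\<lambda>x. p x * f x) = enn2real S - enn2real D / 2"
proof -
  define A where "A y = p (fst y) * p (snd y) * kx (fst y) (snd y) * (f (fst y))\<^sup>2" for y
  define A' where "A' y = p (fst y) * p (snd y) * kx (fst y) (snd y) * (f (snd y))\<^sup>2" for y
  define E where "E y = p (fst y) * p (snd y) * kx (fst y) (snd y) * (f (fst y) - f (snd y))\<^sup>2" for y
  define F where "F y = p (fst y) * f (fst y) * (p (snd y) * f (snd y) * kx (fst y) (snd y))" for y
  have [measurable]: "A \<in> borel_measurable borel" "A' \<in> borel_measurable borel" "E \<in> borel_measurable borel" "F \<in> borel_measurable borel"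
    unfolding A_def A'_def E_def F_def by measurable
  have P0: "0 \<le> p x * p w * kx x w" for x w by (intro mult_nonneg_nonneg p0 KK_nonneg)
  have pos: "0 \<le> A y" "0 \<le> A' y" "0 \<le> E y" for y unfolding A_def A'_def E_def by (intro mult_nonneg_nonneg p0 KK_nonneg zero_le_power2)+
  have alg: "E y = A y + A' y - 2 * F y" for y unfolding E_def A_def A'_def F_def by (simp add: power2_eq_square algebra_simps)
  have nA: "(\<integral>\<^sup>+y. ennreal (A y) \<partial>lborel) = S"
  proof -
    have "(\<integral>\<^sup>+y. ennreal (A y) \<partial>lborel) = (\<integral>\<^sup>+x. (\<integral>\<^sup>+w. ennreal (A (x, w)) \<partial>lborel) \<partial>lborel)" by (rule nn_integral_lborel_pair) measurable
    also have "\<dots> = S" unfolding S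
    proof (rule nn_integral_cong)
      fix x
      have "(\<integral>\<^sup>+w. ennreal (A (x, w)) \<partial>lborel) = (\<integral>\<^sup>+w. ennreal (p x * (f x)\<^sup>2) * ennreal (p w * kx x w) \<partial>lborel)"
        by (rule nn_integral_cong) (simp add: A_def p0 mult_ac flip: ennreal_mult')
      also have "\<dots> = ennreal (p x * (f x)\<^sup>2) * (\<integral>\<^sup>+w. ennreal (p w * kx x w) \<partial>lborel)" by (rule nn_integral_cmult) measurable
      finally show "(\<integral>\<^sup>+w. ennreal (A (x, w)) \<partial>lborel) = ennreal (p x * (f x)\<^sup>2) * (\<integral>\<^sup>+w. ennreal (p w * kx x w) \<partial>lborel)" .
    qed
    finally show ?thesis .
  qed
  have nA': "(\<integral>\<^sup>+y. ennreal (A' y) \<partial>lborel) = S"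
  proof -
    have "(\<integral>\<^sup>+y. ennreal (A' y) \<partial>lborel) = (\<integral>\<^sup>+x. (\<integral>\<^sup>+w. ennreal (A' (x, w)) \<partial>lborel) \<partial>lborel)" by (rule nn_integral_lborel_pair) measurable
    also have "\<dots> = (\<integral>\<^sup>+w. (\<integral>\<^sup>+x. ennreal (A' (x, w)) \<partial>lborel) \<partial>lborel)"
      by (rule lborel_pair.Fubini') (simp add: lborel_prod)
    also have "\<dots> = (\<integral>\<^sup>+w. (\<integral>\<^sup>+x. ennreal (A (w, x)) \<partial>lborel) \<partial>lborel)"
    proof -
      have "A' (x, w) = A (w, x)" for x w unfolding A_def A'_def fst_conv snd_conv by (subst kx_sym) (simp only: mult_ac)
      then show ?thesis by simp
    qed
    also have "\<dots> = (\<integral>\<^sup>+y. ennreal (A y) \<partial>lborel)" by (rule nn_integral_lborel_pair[symmetric]) measurable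
    finally show ?thesis unfolding nA .
  qed
  have iA: "integrable lborel A" "integrable lborel A'"
    by (rule integrableI_nonneg; use nA nA' Sf pos in \<open>simp add: AE_I2\<close>)+
  \<comment> \<open>The same expansion with a plus sign in the square bounds the mixed term from the
    other side. This yields its absolute integrability before the integrals are separated.\<close>
  have Fb: "norm (F y) \<le> norm (A y + A' y)" for y
  proof -
    have "0 \<le> p (fst y) * p (snd y) * kx (fst y) (snd y) * (f (fst y) + f (snd y))\<^sup>2" by (intro mult_nonneg_nonneg p0 KK_nonneg zero_le_power2)
    also have "\<dots> = A y + A' y + 2 * F y" unfolding A_def A'_def F_def by (simp add: power2_eq_square algebra_simps)
    finally show ?thesis using alg[of y] pos[of y] by simp
  qed
  have iF: "integrable lborel F"
    by (rule Bochner_Integration.integrable_bound[OF Bochner_Integration.integrable_add[OF iA]]) (use Fb in \<open>simp_all add: AE_I2\<close>)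
  have iE: "integrable lborel E" unfolding alg by (intro Bochner_Integration.integrable_diff Bochner_Integration.integrable_add iA integrable_mult_right iF)
  have nE: "(\<integral>\<^sup>+y. ennreal (E y) \<partial>lborel) = D" unfolding D by (subst nn_integral_lborel_pair) (simp_all add: E_def)
  then have DE: "D = ennreal (integral\<^sup>L lborel E)" using nn_integral_eq_integral[OF iE] pos(3) by simp
  then show "D < \<top>" by simp
  have iS: "integral\<^sup>L lborel A = enn2real S" "integral\<^sup>L lborel A' = enn2real S"
    by (simp_all add: integral_eq_nn_integral pos nA nA')
  have "integral\<^sup>L lborel F = (\<integral>x. (\<integral>w. F (x, w) \<partial>lborel) \<partial>lborel)" by (rule lborel_fubini(1)[OF iF])
  then have QF: "integral\<^sup>L lborel F = Qf (\<lambda>x. p x * f x)" by (simp add: F_def Qf_def UU_def)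
  have "integral\<^sup>L lborel E = (\<integral>y. A y + A' y - 2 * F y \<partial>lborel)" unfolding alg ..
  also have "\<dots> = enn2real S + enn2real S - 2 * Qf (\<lambda>x. p x * f x)"
    by (subst Bochner_Integration.integral_diff) (simp_all add: iA iF iS QF Bochner_Integration.integrable_add)
  finally have "integral\<^sup>L lborel E = enn2real S + enn2real S - 2 * Qf (\<lambda>x. p x * f x)" .
  moreover have "enn2real D = integral\<^sup>L lborel E" unfolding DE by (simp add: Bochner_Integration.integral_nonneg pos)
  ultimately show "Qf (\<lambda>x. p x * f x) = enn2real S - enn2real D / 2" by linarith
qed

text \<open>The density is the trace on the ball divided by \<open>C\<close>, where \<open>C\<close>
  bounds the potential of the ball. With \<open>T\<close> the squared norm of the trace there, the
  pairing is \<open>T / C\<close> and the form is at most \<open>T / C\<close>, so twice the one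
  minus the other is at least \<open>T / C\<close>. This makes traces converge locally in
  L^2.\<close>

lemma trace_bound:
  assumes R: "R > 0"
  shows "\<exists>C>0. \<forall>h R'. C1c h R' \<longrightarrow> (\<integral>\<^sup>+x. ennreal (indicator (hball R) x * (h (x, 0))\<^sup>2) \<partial>lborel) \<le> ennreal C * EN (grad br h)"
proof -
  have q: "0 \<le> Q - 2 * s" "Q - 2 * s < Q" using Q_pos s0 s1 by auto
  obtain C where C: "C > 0" "\<forall>x. (\<integral>\<^sup>+w. ennreal (indicator (hball R) w * hnorm (gm (ginv w) x) powr (- (Q - 2 * s))) \<partial>lborel) \<le> ennreal C"
    by (rule riesz_unif_bound[OF q, of R]) blast
  define p where "p = (\<lambda>x :: 'v \<times> 'z. indicator (hball R) x :: real)"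
  have [measurable]: "p \<in> borel_measurable borel" unfolding p_def by measurable
  have p01: "0 \<le> p x" "p x * p x = p x" "p x \<le> 1" for x by (simp_all add: p_def indicator_def)
  have psi: "(\<integral>\<^sup>+w. ennreal (p w * kx x w) \<partial>lborel) \<le> ennreal C" for x
    using C(2)[rule_format, of x] by (simp add: p_def KK_0)
  have "(\<integral>\<^sup>+x. ennreal (indicator (hball R) x * (h (x, 0))\<^sup>2) \<partial>lborel) \<le> ennreal (C / c0) * EN (grad br h)" if h: "C1c h R'" for h R'
  proof -
    define f where "f x = h (x, 0) / C" for x
    have [measurable]: "(\<lambda>x. h (x, 0)) \<in> borel_measurable borel" by (rule trace_meas[OF h])
    have [measurable]: "f \<in> borel_measurable borel" unfolding f_def by measurable
    obtain B where B: "B > 0" "\<forall>p. \<bar>h p\<bar> \<le> B" by (rule grad_bounded[OF h]) blast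
    have pb: "p x * f x * f x \<le> p x * (B / C * (B / C))" "\<bar>p x * f x\<bar> \<le> B / C" for x
    proof -
      have fB: "\<bar>f x\<bar> \<le> B / C" using B(2)[rule_format, of "(x, 0)"] C(1) by (simp add: f_def divide_right_mono)
      then have "\<bar>f x\<bar> * \<bar>f x\<bar> \<le> B / C * (B / C)" using B(1) C(1) by (intro mult_mono) auto
      then show "p x * f x * f x \<le> p x * (B / C * (B / C))" unfolding mult.assoc using p01(1) by (intro mult_left_mono) auto
      show "\<bar>p x * f x\<bar> \<le> B / C" using mult_mono[OF p01(3)[of x] fB] p01(1)[of x] by (simp add: abs_mult)
    qed
    have g: "nice (\<lambda>x. p x * f x) R (B / C)" unfolding nice_def using R B(1) C(1) pb(2) by (auto simp: p_def)
    define T where "T = (\<integral>x. p x * (h (x, 0))\<^sup>2 \<partial>lborel)"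
    have iT: "integrable lborel (\<lambda>x. p x * (h (x, 0))\<^sup>2)"
    proof (rule Bochner_Integration.integrable_bound)
      show "integrable lborel (\<lambda>x :: 'v \<times> 'z. indicator (hball R) x *\<^sub>R B\<^sup>2)"
        by (rule borel_integrable_compact[OF compact_hnorm_ball continuous_on_const])
      show "(\<lambda>x. p x * (h (x, 0))\<^sup>2) \<in> borel_measurable lborel" by measurable
      have "(h (x, 0))\<^sup>2 \<le> B\<^sup>2" for x using power_mono[OF B(2)[rule_format, of "(x, 0)"], of 2] by simp
      then show "AE x in lborel. norm (p x * (h (x, 0))\<^sup>2) \<le> norm (indicator (hball R) x *\<^sub>R B\<^sup>2)"
        by (intro AE_I2) (simp add: p_def indicator_def)
    qed
    have T0: "T \<ge> 0" unfolding T_def by (intro Bochner_Integration.integral_nonneg mult_nonneg_nonneg p01 zero_le_power2)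
    have nT: "(\<integral>\<^sup>+x. ennreal (p x * (h (x, 0))\<^sup>2) \<partial>lborel) = ennreal T" unfolding T_def
      by (rule nn_integral_eq_integral[OF iT]) (intro AE_I2 mult_nonneg_nonneg p01 zero_le_power2)
    define S where "S = (\<integral>\<^sup>+x. ennreal (p x * (f x)\<^sup>2) * (\<integral>\<^sup>+w. ennreal (p w * kx x w) \<partial>lborel) \<partial>lborel)"
    have "S \<le> (\<integral>\<^sup>+x. ennreal (1 / C\<^sup>2 * (p x * (h (x, 0))\<^sup>2)) * ennreal C \<partial>lborel)"
      unfolding S_def
    proof (rule nn_integral_mono, rule mult_mono)
      show "ennreal (p x * (f x)\<^sup>2) \<le> ennreal (1 / C\<^sup>2 * (p x * (h (x, 0))\<^sup>2))" for x by (simp add: f_def power_divide)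
      show "(\<integral>\<^sup>+w. ennreal (p w * kx x w) \<partial>lborel) \<le> ennreal C" for x by (rule psi)
    qed simp_all
    also have "\<dots> = (\<integral>\<^sup>+x. ennreal (1 / C) * ennreal (p x * (h (x, 0))\<^sup>2) \<partial>lborel)"
    proof (rule nn_integral_cong)
      fix x
      have "ennreal (1 / C\<^sup>2 * (p x * (h (x, 0))\<^sup>2)) * ennreal C = ennreal (1 / C\<^sup>2 * (p x * (h (x, 0))\<^sup>2) * C)"
        by (rule ennreal_mult''[symmetric]) (use C(1) in simp)
      also have "1 / C\<^sup>2 * (p x * (h (x, 0))\<^sup>2) * C = 1 / C * (p x * (h (x, 0))\<^sup>2)" using C(1) by (simp add: power2_eq_square)
      also have "ennreal \<dots> = ennreal (1 / C) * ennreal (p x * (h (x, 0))\<^sup>2)" by (rule ennreal_mult') (use C(1) in simp)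
      finally show "ennreal (1 / C\<^sup>2 * (p x * (h (x, 0))\<^sup>2)) * ennreal C = ennreal (1 / C) * ennreal (p x * (h (x, 0))\<^sup>2)" .
    qed
    also have "\<dots> = ennreal (1 / C) * ennreal T" unfolding nT[symmetric] by (rule nn_integral_cmult) measurable
    also have "\<dots> = ennreal (T / C)" using C(1) by (simp flip: ennreal_mult')
    finally have SC: "S \<le> ennreal (T / C)" .
    have "Qf (\<lambda>x. p x * f x) \<le> enn2real S"
      using ground_state(2)[OF _ _ p01(1) S_def le_less_trans[OF SC] refl] by simp
    also have "\<dots> \<le> T / C" using SC T0 C(1) by (intro enn2real_leI) auto
    finally have Qb: "Qf (\<lambda>x. p x * f x) \<le> T / C" .
    have "(\<integral>x. p x * f x * h (x, 0) \<partial>lborel) = (\<integral>x. 1 / C * (p x * (h (x, 0))\<^sup>2) \<partial>lborel)"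
      by (intro Bochner_Integration.integral_cong) (simp_all add: f_def power2_eq_square)
    also have "\<dots> = T / C" by (simp add: T_def)
    finally have PT: "(\<integral>x. p x * f x * h (x, 0) \<partial>lborel) = T / C" .
    have le: "y \<le> x \<Longrightarrow> x \<le> 2 * x - y" for x y :: real by simp
    have "c0 * Qf (\<lambda>x. p x * f x) \<le> c0 * (T / C)" using Qb c0_pos by (intro mult_left_mono) auto
    then have "ennreal (c0 * (T / C)) \<le> ennreal (2 * c0 * (T / C) - c0 * Qf (\<lambda>x. p x * f x))"
      unfolding mult.assoc using le by (intro ennreal_leI) blast
    also have "\<dots> \<le> EN (grad br h)" using energy_ge_test[OF h g] unfolding PT .
    finally have fin: "ennreal (c0 * (T / C)) \<le> EN (grad br h)" .
    have "(\<integral>\<^sup>+x. ennreal (indicator (hball R) x * (h (x, 0))\<^sup>2) \<partial>lborel) = ennreal T" using nT by (simp only: p_def)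
    also have "\<dots> = ennreal (C / c0 * (c0 * (T / C)))" using C(1) c0_pos by simp
    also have "\<dots> = ennreal (C / c0) * ennreal (c0 * (T / C))" using C(1) c0_pos by (intro ennreal_mult') simp
    also have "\<dots> \<le> ennreal (C / c0) * EN (grad br h)" by (rule mult_left_mono[OF fin]) simp
    finally show ?thesis .
  qed
  then show ?thesis using C(1) c0_pos by (intro exI[of _ "C / c0"]) auto
qed

section \<open>Gradient and trace on the completion\<close>

abbreviation G0 where "G0 f \<equiv> grad br f"

definition Nd :: "(('v \<times> 'z) \<times> real \<Rightarrow> real) \<Rightarrow> (('v \<times> 'z) \<times> real \<Rightarrow> real) \<Rightarrow> real" where
  "Nd f g = enn2real (EN (\<lambda>p. G0 f p - G0 g p))"

lemma test_grad_meas: assumes "test_function f" shows "G0 f \<in> borel_measurable borel"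
  using test_function_C1c[OF assms] grad_meas by blast

lemma EN_Nd:
  assumes "test_function f" "test_function g"
  shows "EN (\<lambda>p. G0 f p - G0 g p) = ennreal (Nd f g)" "snorm br s (\<lambda>p. f p - g p) = sqrt (Nd f g)"
proof -
  obtain R R' where c: "C1c f R" "C1c g R'" using test_function_C1c assms by metis
  have e: "G0 (\<lambda>p. f p - g p) = (\<lambda>p. G0 f p - G0 g p)" by (rule ext) (rule C1c_diff(2)[OF c])
  show "EN (\<lambda>p. G0 f p - G0 g p) = ennreal (Nd f g)" using EN_grad_finite[OF C1c_diff(1)[OF c]] unfolding e Nd_def by simp
  show "snorm br s (\<lambda>p. f p - g p) = sqrt (Nd f g)" unfolding snorm_def energy_EN e Nd_def ..
qed

lemma Nd_nonneg [simp]: "0 \<le> Nd f g" by (simp add: Nd_def)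

lemma cauchyD:
  assumes "f \<in> cauchy_seqs br s"
  shows "test_function (f k)" "\<forall>e>0. \<exists>K. \<forall>j\<ge>K. \<forall>k\<ge>K. Nd (f j) (f k) \<le> e"
proof -
  show t: "test_function (f k)" for k using assms unfolding cauchy_seqs_def by blast
  show "\<forall>e>0. \<exists>K. \<forall>j\<ge>K. \<forall>k\<ge>K. Nd (f j) (f k) \<le> e"
  proof (intro allI impI)
    fix e :: real assume "e > 0"
    then have "sqrt e > 0" by simp
    then obtain K where K: "\<forall>j\<ge>K. \<forall>k\<ge>K. snorm br s (\<lambda>p. f j p - f k p) < sqrt e" using assms unfolding cauchy_seqs_def by blast
    have "\<forall>j\<ge>K. \<forall>k\<ge>K. Nd (f j) (f k) \<le> e"
    proof (intro allI impI)
      fix j k assume "K \<le> j" "K \<le> k"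
      then have "sqrt (Nd (f j) (f k)) < sqrt e" using K EN_Nd(2)[OF t t] by metis
      then show "Nd (f j) (f k) \<le> e" by simp
    qed
    then show "\<exists>K. \<forall>j\<ge>K. \<forall>k\<ge>K. Nd (f j) (f k) \<le> e" by blast
  qed
qed

text \<open>Replaces the real norm, built with \<open>sqrt\<close> and \<open>enn2real\<close>, by
  the extended energy in which the limits are taken.\<close>

lemma null_rel_iff:
  "(f, g) \<in> null_rel br s \<longleftrightarrow> f \<in> cauchy_seqs br s \<and> g \<in> cauchy_seqs br s \<and> (\<lambda>k. EN (\<lambda>p. G0 (f k) p - G0 (g k) p)) \<longlonglongrightarrow> 0"
proof (cases "f \<in> cauchy_seqs br s \<and> g \<in> cauchy_seqs br s")
  case True
  then have t: "test_function (f k)" "test_function (g k)" for k using cauchyD(1) by blast+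
  have "(\<lambda>k. snorm br s (\<lambda>p. f k p - g k p)) \<longlonglongrightarrow> 0 \<longleftrightarrow> (\<lambda>k. Nd (f k) (g k)) \<longlonglongrightarrow> 0"
    unfolding EN_Nd(2)[OF t]
  proof
    assume "(\<lambda>k. sqrt (Nd (f k) (g k))) \<longlonglongrightarrow> 0"
    from tendsto_power[OF this, of 2] show "(\<lambda>k. Nd (f k) (g k)) \<longlonglongrightarrow> 0" by simp
  next
    assume "(\<lambda>k. Nd (f k) (g k)) \<longlonglongrightarrow> 0"
    from tendsto_real_sqrt[OF this] show "(\<lambda>k. sqrt (Nd (f k) (g k))) \<longlonglongrightarrow> 0" by simp
  qed
  also have "\<dots> \<longleftrightarrow> (\<lambda>k. EN (\<lambda>p. G0 (f k) p - G0 (g k) p)) \<longlonglongrightarrow> 0"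
    unfolding EN_Nd(1)[OF t] ennreal_0[symmetric] by (rule tendsto_ennreal_iff[symmetric]) simp_all
  finally show ?thesis using True by (simp add: null_rel_def)
next
  case False
  then show ?thesis by (auto simp: null_rel_def)
qed

lemma EN_tendsto_0_trans:
  assumes [measurable]: "\<And>k. F k \<in> borel_measurable borel" "\<And>k. G k \<in> borel_measurable borel" "\<And>k. H k \<in> borel_measurable borel"
    and "(\<lambda>k. EN (\<lambda>p. F k p - G k p)) \<longlonglongrightarrow> 0" "(\<lambda>k. EN (\<lambda>p. G k p - H k p)) \<longlonglongrightarrow> 0"
  shows "(\<lambda>k. EN (\<lambda>p. F k p - H k p)) \<longlonglongrightarrow> 0"
proof (rule tendsto_sandwich[OF _ _ tendsto_const])
  have "(\<lambda>k. ennreal (1 + 1) * EN (\<lambda>p. F k p - G k p) + ennreal (1 + 1 / 1) * EN (\<lambda>p. G k p - H k p)) \<longlonglongrightarrow> ennreal (1 + 1) * 0 + ennreal (1 + 1 / 1) * 0"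
    by (intro tendsto_add ennreal_tendsto_cmult assms(4,5)) simp_all
  then show "(\<lambda>k. ennreal (1 + 1) * EN (\<lambda>p. F k p - G k p) + ennreal (1 + 1 / 1) * EN (\<lambda>p. G k p - H k p)) \<longlonglongrightarrow> 0" by simp
  have "EN (\<lambda>p. F k p - H k p) \<le> ennreal (1 + 1) * EN (\<lambda>p. F k p - G k p) + ennreal (1 + 1 / 1) * EN (\<lambda>p. G k p - H k p)" for k
    using EN_add_le[of "\<lambda>p. F k p - G k p" "\<lambda>p. G k p - H k p" 1] by simp
  then show "\<forall>\<^sub>F k in sequentially. EN (\<lambda>p. F k p - H k p) \<le> ennreal (1 + 1) * EN (\<lambda>p. F k p - G k p) + ennreal (1 + 1 / 1) * EN (\<lambda>p. G k p - H k p)"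
    by (rule always_eventually[OF allI])
qed simp

lemma W0E:
  assumes "u \<in> W0 br s"
  obtains f where "f \<in> u" "f \<in> cauchy_seqs br s" "u = null_rel br s `` {f}"
    "\<forall>g\<in>u. g \<in> cauchy_seqs br s \<and> (\<lambda>k. EN (\<lambda>p. G0 (g k) p - G0 (f k) p)) \<longlonglongrightarrow> 0"
proof -
  obtain f where f: "f \<in> cauchy_seqs br s" "u = null_rel br s `` {f}" using assms unfolding W0_def quotient_def by blast
  have z: "EN (\<lambda>p. 0) = 0" by (simp add: EN_def)
  have fu: "f \<in> u" unfolding f(2) using f(1) by (simp add: null_rel_iff z)
  have all: "\<forall>g\<in>u. g \<in> cauchy_seqs br s \<and> (\<lambda>k. EN (\<lambda>p. G0 (g k) p - G0 (f k) p)) \<longlonglongrightarrow> 0"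
  proof
    fix g assume "g \<in> u"
    then have "(f, g) \<in> null_rel br s" unfolding f(2) by blast
    then show "g \<in> cauchy_seqs br s \<and> (\<lambda>k. EN (\<lambda>p. G0 (g k) p - G0 (f k) p)) \<longlonglongrightarrow> 0"
      unfolding null_rel_iff by (subst EN_diff_commute) blast
  qed
  show ?thesis by (rule that[OF fu f all])
qed

text \<open>Completeness of the weighted L^2 space provides a limit and equivalent sequences share
  it, so the choice in the definition picks from a nonempty set.\<close>

lemma W0_grad: assumes u: "u \<in> W0 br s" shows "is_gradient br s u (W0_grad br s u)"
proof -
  obtain f where f: "f \<in> u" "f \<in> cauchy_seqs br s" "u = null_rel br s `` {f}"
    "\<forall>g\<in>u. g \<in> cauchy_seqs br s \<and> (\<lambda>k. EN (\<lambda>p. G0 (g k) p - G0 (f k) p)) \<longlonglongrightarrow> 0" by (rule W0E[OF u])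
  note t = cauchyD(1)[OF f(2)]
  have "\<exists>G. G \<in> borel_measurable borel \<and> (\<forall>i :: unit. (\<lambda>k. \<integral>\<^sup>+p. ennreal (wt (snd p) * (norm (G0 (f k) p - G p))\<^sup>2) \<partial>lborel) \<longlonglongrightarrow> 0)"
  proof (rule L2_limit[where C = "\<lambda>_. 1" and N = "\<lambda>j k. Nd (f j) (f k)"])
    show "(\<integral>\<^sup>+p. ennreal (wt (snd p) * (norm (G0 (f j) p - G0 (f k) p))\<^sup>2) \<partial>lborel) \<le> ennreal (1 * Nd (f j) (f k))" for j k
      using EN_Nd(1)[OF t[of j] t[of k]] unfolding EN_def by simp
    show "\<forall>e>0. \<exists>K. \<forall>j\<ge>K. \<forall>k\<ge>K. Nd (f j) (f k) \<le> e" by (rule cauchyD(2)[OF f(2)])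
    show "G0 (f k) \<in> borel_measurable borel" for k by (rule test_grad_meas[OF t])
  qed simp_all
  then obtain G where G: "G \<in> borel_measurable borel" "(\<lambda>k. EN (\<lambda>p. G0 (f k) p - G p)) \<longlonglongrightarrow> 0" unfolding EN_def by blast
  have "is_gradient br s u G"
    unfolding is_gradient_def energy_EN
  proof (intro conjI ballI)
    show "G \<in> borel_measurable borel" by (rule G(1))
    fix g assume "g \<in> u"
    then have g: "g \<in> cauchy_seqs br s" "(\<lambda>k. EN (\<lambda>p. G0 (g k) p - G0 (f k) p)) \<longlonglongrightarrow> 0" using f(4) by blast+
    show "(\<lambda>k. EN (\<lambda>p. G0 (g k) p - G p)) \<longlonglongrightarrow> 0"
      by (rule EN_tendsto_0_trans[OF test_grad_meas[OF cauchyD(1)[OF g(1)]] test_grad_meas[OF t] G(1) g(2) G(2)])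
  qed
  then show ?thesis unfolding W0_grad_def by (rule someI[of "is_gradient br s u"])
qed

lemma trace_diff_bound:
  assumes "R > 0"
  shows "\<exists>C>0. \<forall>f g. test_function f \<longrightarrow> test_function g \<longrightarrow>
    (\<integral>\<^sup>+x. ennreal (indicator (hball R) x * (norm (f (x, 0) - g (x, 0)))\<^sup>2) \<partial>lborel) \<le> ennreal C * EN (\<lambda>p. G0 f p - G0 g p)"
proof -
  obtain C where C: "C > 0" "\<forall>h R'. C1c h R' \<longrightarrow> (\<integral>\<^sup>+x. ennreal (indicator (hball R) x * (h (x, 0))\<^sup>2) \<partial>lborel) \<le> ennreal C * EN (grad br h)"
    using trace_bound[OF assms] by blast
  have "(\<integral>\<^sup>+x. ennreal (indicator (hball R) x * (norm (f (x, 0) - g (x, 0)))\<^sup>2) \<partial>lborel) \<le> ennreal C * EN (\<lambda>p. G0 f p - G0 g p)"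
    if fg: "test_function f" "test_function g" for f g
  proof -
    obtain R1 R2 where c: "C1c f R1" "C1c g R2" using test_function_C1c fg by metis
    have e: "G0 (\<lambda>p. f p - g p) = (\<lambda>p. G0 f p - G0 g p)" by (rule ext) (rule C1c_diff(2)[OF c])
    show ?thesis using C(2)[rule_format, OF C1c_diff(1)[OF c]] unfolding e by simp
  qed
  then show ?thesis by (intro exI[of _ C] conjI C(1) allI impI)
qed

text \<open>Convergence is obtained on the countably many balls of radius \<open>i + 1\<close>, each
  with its own constant from \<open>trace_bound\<close>. \<open>L2_limit\<close> merges the limits
  into one function, and every compact set lies in one of the balls.\<close>

lemma W0_trace: assumes u: "u \<in> W0 br s" shows "is_trace u (W0_trace u)"
proof -
  obtain f where f: "f \<in> u" "f \<in> cauchy_seqs br s" "u = null_rel br s `` {f}"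
    "\<forall>g\<in>u. g \<in> cauchy_seqs br s \<and> (\<lambda>k. EN (\<lambda>p. G0 (g k) p - G0 (f k) p)) \<longlonglongrightarrow> 0" by (rule W0E[OF u])
  note t = cauchyD(1)[OF f(2)]
  have "\<forall>i :: nat. \<exists>C>0. \<forall>f g. test_function f \<longrightarrow> test_function g \<longrightarrow>
    (\<integral>\<^sup>+x. ennreal (indicator (hball (real i + 1)) x * (norm (f (x, 0) - g (x, 0)))\<^sup>2) \<partial>lborel) \<le> ennreal C * EN (\<lambda>p. G0 f p - G0 g p)"
  proof
    fix i :: nat
    have "real i + 1 > 0" by simp
    then show "\<exists>C>0. \<forall>f g. test_function f \<longrightarrow> test_function g \<longrightarrow>
    (\<integral>\<^sup>+x. ennreal (indicator (hball (real i + 1)) x * (norm (f (x, 0) - g (x, 0)))\<^sup>2) \<partial>lborel) \<le> ennreal C * EN (\<lambda>p. G0 f p - G0 g p)"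
      by (rule trace_diff_bound)
  qed
  from choice[OF this] obtain C where C: "\<forall>i. C i > 0" "\<forall>i :: nat. \<forall>f g. test_function f \<longrightarrow> test_function g \<longrightarrow>
    (\<integral>\<^sup>+x. ennreal (indicator (hball (real i + 1)) x * (norm (f (x, 0) - g (x, 0)))\<^sup>2) \<partial>lborel) \<le> ennreal (C i) * EN (\<lambda>p. G0 f p - G0 g p)"
    by blast
  have tm: "(\<lambda>x. h (x, 0)) \<in> borel_measurable borel" if "test_function h" for h :: "('v \<times> 'z) \<times> real \<Rightarrow> real"
    using test_function_C1c[OF that] trace_meas by blast
  have "\<exists>G. G \<in> borel_measurable borel \<and> (\<forall>i. (\<lambda>k. \<integral>\<^sup>+x. ennreal (indicator (hball (real i + 1)) x * (norm (f k (x, 0) - G x))\<^sup>2) \<partial>lborel) \<longlonglongrightarrow> 0)"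
  proof (rule L2_limit[where C = C and N = "\<lambda>j k. Nd (f j) (f k)"])
    fix i j k :: nat
    have "(\<integral>\<^sup>+x. ennreal (indicator (hball (real i + 1)) x * (norm (f j (x, 0) - f k (x, 0)))\<^sup>2) \<partial>lborel) \<le> ennreal (C i) * EN (\<lambda>p. G0 (f j) p - G0 (f k) p)"
      using C(2) t by blast
    also have "\<dots> = ennreal (C i * Nd (f j) (f k))" unfolding EN_Nd(1)[OF t t] by (rule ennreal_mult''[symmetric]) simp
    finally show "(\<integral>\<^sup>+x. ennreal (indicator (hball (real i + 1)) x * (norm (f j (x, 0) - f k (x, 0)))\<^sup>2) \<partial>lborel) \<le> ennreal (C i * Nd (f j) (f k))" .
  next
    show "\<forall>e>0. \<exists>K. \<forall>j\<ge>K. \<forall>k\<ge>K. Nd (f j) (f k) \<le> e" by (rule cauchyD(2)[OF f(2)])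
    show "(\<lambda>x. f k (x, 0)) \<in> borel_measurable borel" for k by (rule tm[OF t])
    show "(\<lambda>x :: 'v \<times> 'z. indicator (hball (real i + 1)) x :: real) \<in> borel_measurable borel" for i :: nat by measurable
    show "0 \<le> C i" for i using C(1) less_imp_le by blast
  qed simp
  then obtain G where G[measurable]: "G \<in> borel_measurable borel"
    and Gl: "\<forall>i :: nat. (\<lambda>k. \<integral>\<^sup>+x. ennreal (indicator (hball (real i + 1)) x * (norm (f k (x, 0) - G x))\<^sup>2) \<partial>lborel) \<longlonglongrightarrow> 0" by blast
  have "is_trace u G"
    unfolding is_trace_def
  proof (intro conjI ballI allI impI)
    show "G \<in> borel_measurable borel" by (rule G)
    fix g and K :: "('v \<times> 'z) set" assume "g \<in> u" and K: "compact K"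
    then have g: "g \<in> cauchy_seqs br s" "(\<lambda>k. EN (\<lambda>p. G0 (g k) p - G0 (f k) p)) \<longlonglongrightarrow> 0" using f(4) by blast+
    note [measurable] = tm[OF cauchyD(1)[OF g(1)]] tm[OF t]
    obtain R where R: "R > 0" "\<forall>x\<in>K. hnorm x \<le> R" using bounded_imp_hnorm_bounded[OF compact_imp_bounded[OF K]] by metis
    define i where "i = nat \<lceil>R\<rceil>"
    have iR: "R \<le> real i + 1" unfolding i_def by linarith
    let ?I = "\<lambda>x :: 'v \<times> 'z. indicator (hball (real i + 1)) x :: real"
    show "(\<lambda>k. \<integral>\<^sup>+x\<in>K. ennreal ((g k (x, 0) - G x)\<^sup>2) \<partial>lborel) \<longlonglongrightarrow> 0"
    proof (rule tendsto_sandwich[OF _ _ tendsto_const])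
      let ?b = "\<lambda>k. ennreal (1 + 1) * (ennreal (C i) * EN (\<lambda>p. G0 (g k) p - G0 (f k) p))
         + ennreal (1 + 1 / 1) * (\<integral>\<^sup>+x. ennreal (?I x * (norm (f k (x, 0) - G x))\<^sup>2) \<partial>lborel)"
      have "?b \<longlonglongrightarrow> ennreal (1 + 1) * (ennreal (C i) * 0) + ennreal (1 + 1 / 1) * 0"
        by (intro tendsto_add ennreal_tendsto_cmult g(2) Gl[rule_format]) simp_all
      then show "?b \<longlonglongrightarrow> 0" by simp
      have "(\<integral>\<^sup>+x\<in>K. ennreal ((g k (x, 0) - G x)\<^sup>2) \<partial>lborel) \<le> ?b k" for k
      proof -
        have "(\<integral>\<^sup>+x\<in>K. ennreal ((g k (x, 0) - G x)\<^sup>2) \<partial>lborel)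
          \<le> (\<integral>\<^sup>+x. ennreal (?I x * (norm ((g k (x, 0) - f k (x, 0)) + (f k (x, 0) - G x)))\<^sup>2) \<partial>lborel)"
          using R(2) iR by (intro nn_integral_mono) (force simp: indicator_def)
        also have "\<dots> \<le> ennreal (1 + 1) * (\<integral>\<^sup>+x. ennreal (?I x * (norm (g k (x, 0) - f k (x, 0)))\<^sup>2) \<partial>lborel)
           + ennreal (1 + 1 / 1) * (\<integral>\<^sup>+x. ennreal (?I x * (norm (f k (x, 0) - G x))\<^sup>2) \<partial>lborel)"
          by (rule nn_integral_weighted_add_sq_le) simp_all
        also have "\<dots> \<le> ?b k"
          using C(2) cauchyD(1)[OF g(1)] t by (intro add_mono mult_left_mono order_refl) simp_all
        finally show ?thesis .
      qed
      then show "\<forall>\<^sub>F k in sequentially. (\<integral>\<^sup>+x\<in>K. ennreal ((g k (x, 0) - G x)\<^sup>2) \<partial>lborel) \<le> ?b k"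
        by (rule always_eventually[OF allI])
    qed simp
  qed
  then show ?thesis unfolding W0_trace_def by (rule someI[of "is_trace u"])
qed

abbreviation EW where "EW u \<equiv> energy s (W0_grad br s u)"

lemma EN_eq_if_diff_0:
  assumes [measurable]: "F \<in> borel_measurable borel" "G \<in> borel_measurable borel" and "EN (\<lambda>p. F p - G p) = 0"
  shows "EN F = EN G"
proof -
  have "AE p in lborel. ennreal (wt (snd p) * (norm (F p - G p))\<^sup>2) = 0"
    using assms(3) unfolding EN_def by (subst (asm) nn_integral_0_iff_AE) simp_all
  then show ?thesis unfolding EN_def
  proof (intro nn_integral_cong_AE, eventually_elim)
    fix p assume "ennreal (wt (snd p) * (norm (F p - G p))\<^sup>2) = 0"
    then have "wt (snd p) * (norm (F p - G p))\<^sup>2 \<le> 0" by (simp add: ennreal_eq_0_iff)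
    moreover have "0 \<le> wt (snd p) * (norm (F p - G p))\<^sup>2" by simp
    ultimately have "wt (snd p) * (norm (F p - G p))\<^sup>2 = 0" by (rule antisym)
    then have "wt (snd p) = 0 \<or> F p = G p" by auto
    then show "ennreal (wt (snd p) * (norm (F p))\<^sup>2) = ennreal (wt (snd p) * (norm (G p))\<^sup>2)" by auto
  qed
qed

lemma EW_finite: assumes u: "u \<in> W0 br s" shows "EW u < \<top>"
proof -
  obtain f where f: "f \<in> u" "f \<in> cauchy_seqs br s" by (rule W0E[OF u])
  note t = cauchyD(1)[OF f(2)]
  have G: "W0_grad br s u \<in> borel_measurable borel" "(\<lambda>k. EN (\<lambda>p. G0 (f k) p - W0_grad br s u p)) \<longlonglongrightarrow> 0"
    using W0_grad[OF u] f(1) unfolding is_gradient_def energy_EN by blast+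
  have "\<forall>\<^sub>F k in sequentially. EN (\<lambda>p. G0 (f k) p - W0_grad br s u p) < 1" using order_tendstoD(2)[OF G(2), of 1] by simp
  then obtain k where k: "EN (\<lambda>p. G0 (f k) p - W0_grad br s u p) < 1" using eventually_happens by fastforce
  obtain R where R: "C1c (f k) R" using test_function_C1c[OF t] by blast
  note [measurable] = G(1) test_grad_meas[OF t]
  have "EN (W0_grad br s u) = EN (\<lambda>p. G0 (f k) p + (W0_grad br s u p - G0 (f k) p))" by simp
  also have "\<dots> \<le> ennreal (1 + 1) * EN (G0 (f k)) + ennreal (1 + 1 / 1) * EN (\<lambda>p. W0_grad br s u p - G0 (f k) p)"
    by (rule EN_add_le) simp_all
  also have "\<dots> < \<top>"
    using EN_grad_finite[OF R] less_trans[OF k ennreal_one_less_top] unfolding EN_diff_commute[of "W0_grad br s u"]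
    by (simp add: ennreal_mult_less_top)
  finally show ?thesis unfolding energy_EN .
qed

text \<open>If the limiting gradient has zero energy, a representing sequence is at distance tending
  to 0 from the zero sequence. It is this passage that converts vanishing energy into membership in
  the zero class.\<close>

lemma EW_zero: assumes u: "u \<in> W0 br s" and 0: "EW u = 0" shows "u = W0_zero br s"
proof -
  obtain f where f: "f \<in> u" "f \<in> cauchy_seqs br s" "u = null_rel br s `` {f}" by (rule W0E[OF u])
  note t = cauchyD(1)[OF f(2)]
  have G: "W0_grad br s u \<in> borel_measurable borel" "(\<lambda>k. EN (\<lambda>p. G0 (f k) p - W0_grad br s u p)) \<longlonglongrightarrow> 0"
    using W0_grad[OF u] f(1) unfolding is_gradient_def energy_EN by blast+
  have gz: "G0 (\<lambda>p. 0) = (\<lambda>p. 0)" by (simp add: grad_def left_field_def fun_eq_iff zero_prod_def)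
  have cz: "continuously_differentiable k (\<lambda>p :: ('v \<times> 'z) \<times> real. 0)" for k by (induction k) simp_all
  then have tz: "test_function (\<lambda>p :: ('v \<times> 'z) \<times> real. 0)" unfolding test_function_def by simp
  have zc: "(\<lambda>k p. 0) \<in> cauchy_seqs br s"
    unfolding cauchy_seqs_def using tz by (simp add: snorm_def energy_EN gz) (simp add: EN_def)
  have "EN (\<lambda>p. W0_grad br s u p - 0) = 0" using 0 by (simp add: energy_EN)
  then have "(\<lambda>k. EN (\<lambda>p. G0 (f k) p - G0 (\<lambda>p. 0) p)) \<longlonglongrightarrow> 0"
    unfolding gz by (intro EN_tendsto_0_trans[OF test_grad_meas[OF t] G(1) _ G(2)]) simp_all
  note f0 = this
  have "(f, g) \<in> null_rel br s \<longleftrightarrow> ((\<lambda>k p. 0), g) \<in> null_rel br s" for g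
  proof (cases "g \<in> cauchy_seqs br s")
    case True
    note tg = test_grad_meas[OF cauchyD(1)[OF True]] and tf = test_grad_meas[OF t] and t0 = test_grad_meas[OF tz]
    have f0': "(\<lambda>k. EN (\<lambda>p. G0 (\<lambda>p. 0) p - G0 (f k) p)) \<longlonglongrightarrow> 0" using f0 by (subst EN_diff_commute)
    show ?thesis unfolding null_rel_iff using True f(2) zc
      by (auto intro: EN_tendsto_0_trans[OF tf t0 tg f0] EN_tendsto_0_trans[OF t0 tf tg f0'])
  qed (simp add: null_rel_iff)
  then show ?thesis unfolding f(3) W0_zero_def by auto
qed

text \<open>The constant sequence represents \<open>T\<close>. Its trace is prescribed only as a
  local L^2 limit, hence agreement almost everywhere, which is recovered by exhausting
  \<open>N\<close> with balls.\<close>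

lemma test_function_W0:
  assumes T: "test_function T"
  shows "\<exists>u\<in>W0 br s. EW u = EN (G0 T) \<and> (AE x in lborel. W0_trace u x = T (x, 0))"
proof -
  define f where "f = (\<lambda>k :: nat. T)"
  have z: "EN (\<lambda>p. 0) = 0" by (simp add: EN_def)
  have "Nd T T = 0" by (simp add: Nd_def z)
  then have fc: "f \<in> cauchy_seqs br s" unfolding cauchy_seqs_def f_def using T EN_Nd(2)[OF T T] by simp
  define u where "u = null_rel br s `` {f}"
  have u: "u \<in> W0 br s" unfolding W0_def u_def using fc by (rule quotientI)
  have fu: "f \<in> u" unfolding u_def using fc by (simp add: null_rel_iff z)
  have G: "W0_grad br s u \<in> borel_measurable borel" "(\<lambda>k. EN (\<lambda>p. G0 (f k) p - W0_grad br s u p)) \<longlonglongrightarrow> 0"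
    using W0_grad[OF u] fu unfolding is_gradient_def energy_EN by blast+
  have "EN (\<lambda>p. G0 T p - W0_grad br s u p) = 0" using G(2) unfolding f_def by (simp add: LIMSEQ_const_iff)
  then have E: "EW u = EN (G0 T)" unfolding energy_EN using EN_eq_if_diff_0[OF test_grad_meas[OF T] G(1)] by simp
  have [measurable]: "(\<lambda>x. T (x, 0)) \<in> borel_measurable borel" using test_function_C1c[OF T] trace_meas by blast
  have tr: "W0_trace u \<in> borel_measurable borel"
    "\<And>K. compact K \<Longrightarrow> (\<lambda>k. \<integral>\<^sup>+x\<in>K. ennreal ((f k (x, 0) - W0_trace u x)\<^sup>2) \<partial>lborel) \<longlonglongrightarrow> 0"
    using W0_trace[OF u] fu unfolding is_trace_def by blast+
  note [measurable] = tr(1)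
  have "AE x in lborel. \<forall>i :: nat. hnorm x \<le> real i \<longrightarrow> W0_trace u x = T (x, 0)"
    unfolding AE_all_countable
  proof
    fix i :: nat
    have "(\<integral>\<^sup>+x\<in>hball (real i). ennreal ((T (x, 0) - W0_trace u x)\<^sup>2) \<partial>lborel) = 0"
      using tr(2)[OF compact_hnorm_ball[of "real i"]] unfolding f_def by (simp add: LIMSEQ_const_iff)
    then have "AE x in lborel. ennreal ((T (x, 0) - W0_trace u x)\<^sup>2) * indicator (hball (real i)) x = 0"
      by (subst (asm) nn_integral_0_iff_AE) simp_all
    then show "AE x in lborel. hnorm x \<le> real i \<longrightarrow> W0_trace u x = T (x, 0)"
    proof eventually_elim
      fix x assume "ennreal ((T (x, 0) - W0_trace u x)\<^sup>2) * indicator (hball (real i)) x = 0"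
      then show "hnorm x \<le> real i \<longrightarrow> W0_trace u x = T (x, 0)" by (auto simp: ennreal_eq_0_iff)
    qed
  qed
  then have "AE x in lborel. W0_trace u x = T (x, 0)"
  proof eventually_elim
    fix x :: "'v \<times> 'z" assume x: "\<forall>i :: nat. hnorm x \<le> real i \<longrightarrow> W0_trace u x = T (x, 0)"
    have "hnorm x \<le> real (nat \<lceil>hnorm x\<rceil>)" by linarith
    then show "W0_trace u x = T (x, 0)" using x by blast
  qed
  then show ?thesis using u E by blast
qed

text \<open>The pairing passes to the limit because \<open>g\<close> is bounded with bounded support
  and traces converge in L^2 on that ball. The energy of an approximant is compared with that of
  \<open>u\<close> up to a factor \<open>1 + e\<close>, and \<open>e\<close> tends to 0
  last.\<close>

lemma energy_ge:
  assumes u: "u \<in> W0 br s" and g: "nice g R B"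
  shows "integrable lborel (\<lambda>x. g x * W0_trace u x)"
    "ennreal (2 * c0 * (\<integral>x. g x * W0_trace u x \<partial>lborel) - c0 * Qf g) \<le> EW u"
proof -
  obtain f where f: "f \<in> u" "f \<in> cauchy_seqs br s" by (rule W0E[OF u])
  note t = cauchyD(1)[OF f(2)]
  have G: "W0_grad br s u \<in> borel_measurable borel" "(\<lambda>k. EN (\<lambda>p. G0 (f k) p - W0_grad br s u p)) \<longlonglongrightarrow> 0"
    using W0_grad[OF u] f(1) unfolding is_gradient_def energy_EN by blast+
  define w where "w = W0_trace u"
  have [measurable]: "w \<in> borel_measurable borel" using W0_trace[OF u] unfolding is_trace_def w_def by blast
  let ?K = "hball R"
  have wl: "(\<lambda>k. \<integral>\<^sup>+x\<in>?K. ennreal ((f k (x, 0) - w x)\<^sup>2) \<partial>lborel) \<longlonglongrightarrow> 0"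
    using W0_trace[OF u] f(1) compact_hnorm_ball unfolding is_trace_def w_def by blast
  have [measurable]: "g \<in> borel_measurable borel" by (rule niceD(1)[OF g])
  have fm[measurable]: "(\<lambda>x. f k (x, 0)) \<in> borel_measurable borel" for k using test_function_C1c[OF t] trace_meas by blast
  have B0: "B > 0" by (rule niceD(3)[OF g])
  define J where "J k = (\<integral>\<^sup>+x. ennreal \<bar>g x * (f k (x, 0) - w x)\<bar> \<partial>lborel)" for k
  obtain V where V: "emeasure lborel ?K = ennreal V" "V \<ge> 0"
    using emeasure_bounded_finite[OF bounded_hnorm_ball[of R]] by (metis enn2real_nonneg ennreal_enn2real infinity_ennreal_def)
  have Jb: "J k \<le> ennreal (B * e * V) + ennreal (B / e) * (\<integral>\<^sup>+x\<in>?K. ennreal ((f k (x, 0) - w x)\<^sup>2) \<partial>lborel)" if e: "e > 0" for e k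
  proof -
    have "J k \<le> (\<integral>\<^sup>+x. ennreal (B * e) * indicator ?K x + ennreal (B / e) * (ennreal ((f k (x, 0) - w x)\<^sup>2) * indicator ?K x) \<partial>lborel)"
      unfolding J_def
    proof (rule nn_integral_mono)
      fix x
      show "ennreal \<bar>g x * (f k (x, 0) - w x)\<bar> \<le> ennreal (B * e) * indicator ?K x + ennreal (B / e) * (ennreal ((f k (x, 0) - w x)\<^sup>2) * indicator ?K x)"
      proof (cases "hnorm x \<le> R")
        case True
        define d where "d = \<bar>f k (x, 0) - w x\<bar>"
        have d0: "d \<ge> 0" by (simp add: d_def)
        \<comment> \<open>Trades an L^1 bound for the L^2 one available: beyond \<open>e\<close> the
          quotient \<open>d / e\<close> exceeds 1. The term \<open>e\<close> later costs the volume
          \<open>V\<close> of the ball and is made small first.\<close>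
        have "d \<le> e + d\<^sup>2 / e"
        proof (cases "d \<le> e")
          case True then show ?thesis using e by (simp add: add_increasing2)
        next
          case False
          then have "d * e \<le> d * d" using d0 by (intro mult_left_mono) auto
          then have "d \<le> d\<^sup>2 / e" using e by (simp add: le_divide_eq power2_eq_square)
          then show ?thesis using e by linarith
        qed
        then have "B * d \<le> B * (e + d\<^sup>2 / e)" using B0 by (intro mult_left_mono) auto
        moreover have "\<bar>g x\<bar> * d \<le> B * d" using niceD(4)[OF g, of x] d0 by (rule mult_right_mono)
        ultimately have "\<bar>g x * (f k (x, 0) - w x)\<bar> \<le> B * e + B / e * (f k (x, 0) - w x)\<^sup>2"
          unfolding d_def abs_mult distrib_left by simp
        then have "ennreal \<bar>g x * (f k (x, 0) - w x)\<bar> \<le> ennreal (B * e + B / e * (f k (x, 0) - w x)\<^sup>2)" by (rule ennreal_leI)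
        also have "\<dots> = ennreal (B * e) + ennreal (B / e * (f k (x, 0) - w x)\<^sup>2)" using B0 e by (intro ennreal_plus) auto
        also have "ennreal (B / e * (f k (x, 0) - w x)\<^sup>2) = ennreal (B / e) * ennreal ((f k (x, 0) - w x)\<^sup>2)" using B0 e by (intro ennreal_mult') simp
        finally show ?thesis using True by simp
      next
        case False
        then show ?thesis using niceD(5)[OF g] by simp
      qed
    qed
    also have "\<dots> = ennreal (B * e) * emeasure lborel ?K + ennreal (B / e) * (\<integral>\<^sup>+x\<in>?K. ennreal ((f k (x, 0) - w x)\<^sup>2) \<partial>lborel)"
      by (subst nn_integral_add) (simp_all add: nn_integral_cmult nn_integral_cmult_indicator)
    also have "ennreal (B * e) * emeasure lborel ?K = ennreal (B * e * V)" using V B0 e by (simp add: ennreal_mult')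
    finally show ?thesis .
  qed
  have J0: "J \<longlonglongrightarrow> 0"
  proof (rule ennreal_tendsto_0I)
    fix \<epsilon> :: real assume \<epsilon>: "\<epsilon> > 0"
    define e where "e = \<epsilon> / (2 * (B * V + 1))"
    have half: "b > 0 \<Longrightarrow> b * (\<epsilon> / (2 * b)) = \<epsilon> / 2" for b :: real by simp
    have bv: "B * V + 1 > 0" using B0 V(2) by (simp add: add_nonneg_pos)
    have e: "e > 0" using \<epsilon> bv by (simp add: e_def)
    have "B * e * V \<le> (B * V + 1) * e" using e by (simp add: algebra_simps)
    also have "\<dots> = \<epsilon> / 2" unfolding e_def using bv by (rule half)
    finally have 1: "B * e * V \<le> \<epsilon> / 2" .
    have "(\<lambda>k. ennreal (B / e) * (\<integral>\<^sup>+x\<in>?K. ennreal ((f k (x, 0) - w x)\<^sup>2) \<partial>lborel)) \<longlonglongrightarrow> ennreal (B / e) * 0"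
      by (intro ennreal_tendsto_cmult wl) simp
    then have "\<forall>\<^sub>F k in sequentially. ennreal (B / e) * (\<integral>\<^sup>+x\<in>?K. ennreal ((f k (x, 0) - w x)\<^sup>2) \<partial>lborel) < ennreal (\<epsilon> / 2)"
      using \<epsilon> by (intro order_tendstoD(2)[of _ 0]) simp_all
    then obtain k0 where k0: "\<forall>k\<ge>k0. ennreal (B / e) * (\<integral>\<^sup>+x\<in>?K. ennreal ((f k (x, 0) - w x)\<^sup>2) \<partial>lborel) < ennreal (\<epsilon> / 2)"
      unfolding eventually_sequentially by blast
    have "J k \<le> ennreal \<epsilon>" if k: "k \<ge> k0" for k
    proof -
      have "J k \<le> ennreal (\<epsilon> / 2) + ennreal (\<epsilon> / 2)"
        by (rule order_trans[OF Jb[OF e] add_mono[OF ennreal_leI[OF 1] less_imp_le[OF k0[rule_format, OF k]]]])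
      also have "\<dots> = ennreal (\<epsilon> / 2 + \<epsilon> / 2)" using \<epsilon> by (intro ennreal_plus[symmetric]) auto
      finally show ?thesis by simp
    qed
    then show "\<exists>K. \<forall>k\<ge>K. J k \<le> ennreal \<epsilon>" by blast
  qed
  have igf: "integrable lborel (\<lambda>x. g x * f k (x, 0))" for k
  proof -
    obtain R' where h: "C1c (f k) R'" using test_function_C1c[OF t] by blast
    obtain Bh where Bh: "Bh > 0" "\<forall>p. \<bar>f k p\<bar> \<le> Bh" by (rule grad_bounded[OF h]) blast
    show ?thesis
    proof (rule Bochner_Integration.integrable_bound[OF integrable_mult_left[OF integrable_abs[OF nice_integrable[OF g]], of Bh]])
      show "AE x in lborel. norm (g x * f k (x, 0)) \<le> norm (\<bar>g x\<bar> * Bh)"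
        using Bh(2)[rule_format, of "(_, 0)"] Bh(1) by (intro AE_I2) (simp add: abs_mult mult_left_mono)
    qed simp
  qed
  have "\<forall>\<^sub>F k in sequentially. J k < 1" using order_tendstoD(2)[OF J0, of 1] by simp
  then obtain k1 where k1: "\<forall>k\<ge>k1. J k < 1" unfolding eventually_sequentially by blast
  have id: "integrable lborel (\<lambda>x. g x * (f k (x, 0) - w x))" if "k \<ge> k1" for k
    using k1[rule_format, OF that] unfolding J_def
    by (intro integrableI_bounded) (auto intro: less_trans[OF _ ennreal_one_less_top])
  have "integrable lborel (\<lambda>x. g x * f k1 (x, 0) - g x * (f k1 (x, 0) - w x))" by (rule Bochner_Integration.integrable_diff[OF igf id]) simp
  then have igw: "integrable lborel (\<lambda>x. g x * w x)" by (simp add: right_diff_distrib)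
  then show "integrable lborel (\<lambda>x. g x * W0_trace u x)" by (simp add: w_def)
  have "(\<lambda>k. (\<integral>x. g x * f k (x, 0) \<partial>lborel) - (\<integral>x. g x * w x \<partial>lborel)) \<longlonglongrightarrow> 0"
  proof (rule tendsto_rabs_zero_cancel, rule tendsto_sandwich[OF _ _ tendsto_const])
    show "(\<lambda>k. enn2real (J k)) \<longlonglongrightarrow> 0" by (rule tendsto_enn2real; simp add: J0)
    show "\<forall>\<^sub>F k in sequentially. \<bar>(\<integral>x. g x * f k (x, 0) \<partial>lborel) - (\<integral>x. g x * w x \<partial>lborel)\<bar> \<le> enn2real (J k)"
    proof (rule eventually_mono[OF eventually_ge_at_top[of k1]])
      fix k assume k: "k1 \<le> k"
      have "(\<integral>x. g x * f k (x, 0) \<partial>lborel) - (\<integral>x. g x * w x \<partial>lborel) = (\<integral>x. g x * (f k (x, 0) - w x) \<partial>lborel)"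
        by (subst Bochner_Integration.integral_diff[symmetric, OF igf igw]) (simp add: right_diff_distrib)
      also have "\<bar>\<dots>\<bar> \<le> (\<integral>x. \<bar>g x * (f k (x, 0) - w x)\<bar> \<partial>lborel)" by (rule integral_abs_bound)
      also have "\<dots> = enn2real (J k)" unfolding J_def by (rule integral_eq_nn_integral) simp_all
      finally show "\<bar>(\<integral>x. g x * f k (x, 0) \<partial>lborel) - (\<integral>x. g x * w x \<partial>lborel)\<bar> \<le> enn2real (J k)" .
    qed
  qed simp
  then have gl: "(\<lambda>k. \<integral>x. g x * f k (x, 0) \<partial>lborel) \<longlonglongrightarrow> (\<integral>x. g x * w x \<partial>lborel)" by (rule LIM_zero_cancel)
  note [measurable] = G(1) test_grad_meas[OF t]
  have lim: "ennreal (2 * c0 * (\<integral>x. g x * w x \<partial>lborel) - c0 * Qf g) \<le> ennreal (1 + e) * EW u" if e: "e > 0" for e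
  proof (rule LIMSEQ_le)
    show "(\<lambda>k. ennreal (2 * c0 * (\<integral>x. g x * f k (x, 0) \<partial>lborel) - c0 * Qf g)) \<longlonglongrightarrow> ennreal (2 * c0 * (\<integral>x. g x * w x \<partial>lborel) - c0 * Qf g)"
      by (intro tendsto_ennrealI tendsto_diff tendsto_mult tendsto_const gl)
    have "(\<lambda>k. ennreal (1 + e) * EW u + ennreal (1 + 1 / e) * EN (\<lambda>p. G0 (f k) p - W0_grad br s u p)) \<longlonglongrightarrow> ennreal (1 + e) * EW u + ennreal (1 + 1 / e) * 0"
      by (intro tendsto_add tendsto_const ennreal_tendsto_cmult G(2)) simp
    then show "(\<lambda>k. ennreal (1 + e) * EW u + ennreal (1 + 1 / e) * EN (\<lambda>p. G0 (f k) p - W0_grad br s u p)) \<longlonglongrightarrow> ennreal (1 + e) * EW u" by simp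
    have "ennreal (2 * c0 * (\<integral>x. g x * f k (x, 0) \<partial>lborel) - c0 * Qf g) \<le> ennreal (1 + e) * EW u + ennreal (1 + 1 / e) * EN (\<lambda>p. G0 (f k) p - W0_grad br s u p)" for k
    proof -
      obtain R' where h: "C1c (f k) R'" using test_function_C1c[OF t] by blast
      have "EN (\<lambda>p. W0_grad br s u p + (G0 (f k) p - W0_grad br s u p)) \<le> ennreal (1 + e) * EN (W0_grad br s u) + ennreal (1 + 1 / e) * EN (\<lambda>p. G0 (f k) p - W0_grad br s u p)"
        by (rule EN_add_le[OF _ _ e]) simp_all
      then show ?thesis using order_trans[OF energy_ge_test[OF h g]] by (simp add: energy_EN)
    qed
    then show "\<exists>N. \<forall>k\<ge>N. ennreal (2 * c0 * (\<integral>x. g x * f k (x, 0) \<partial>lborel) - c0 * Qf g) \<le> ennreal (1 + e) * EW u + ennreal (1 + 1 / e) * EN (\<lambda>p. G0 (f k) p - W0_grad br s u p)" by blast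
  qed
  obtain r where r: "EW u = ennreal r" "r \<ge> 0" using EW_finite[OF u] by (cases "EW u") auto
  let ?l = "2 * c0 * (\<integral>x. g x * w x \<partial>lborel) - c0 * Qf g"
  have "?l \<le> (1 + e) * r" if e: "e > 0" for e
  proof -
    have "ennreal ?l \<le> ennreal ((1 + e) * r)" using lim[OF e] e unfolding r(1) by (simp add: ennreal_mult' add_nonneg_nonneg)
    then show ?thesis using e r(2) by (simp add: ennreal_le_iff)
  qed
  then have "?l \<le> r + e" if "e > 0" for e
  proof -
    \<comment> \<open>The denominator \<open>r + 1\<close> also covers the case of zero
      energy.\<close>
    have "e / (r + 1) > 0" using that r(2) by simp
    then have "?l \<le> (1 + e / (r + 1)) * r" using \<open>\<And>e. e > 0 \<Longrightarrow> ?l \<le> (1 + e) * r\<close> by blast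
    also have "\<dots> = r + e * (r / (r + 1))" by (simp add: distrib_right)
    also have "\<dots> \<le> r + e * 1" using that r(2) by (intro add_left_mono mult_left_mono) auto
    finally show ?thesis by simp
  qed
  then have "?l \<le> r" by (rule field_le_epsilon)
  then show "ennreal (2 * c0 * (\<integral>x. g x * W0_trace u x \<partial>lborel) - c0 * Qf g) \<le> EW u" unfolding r(1) w_def by (rule ennreal_leI)
qed

end

section \<open>The Hardy inequality with remainder\<close>

lemma ex_of_AE_lborel:
  assumes "AE x in (lborel :: 'a::euclidean_space measure). P x" shows "\<exists>x. P x"
proof (rule ccontr)
  assume "\<nexists>x. P x"
  then have "AE x in (lborel :: 'a measure). False" using assms by simp
  then have "(\<integral>\<^sup>+x. 1 \<partial>(lborel :: 'a measure)) = (\<integral>\<^sup>+x. 0 \<partial>(lborel :: 'a measure))" by (intro nn_integral_cong_AE) simp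
  then show False by (simp add: emeasure_lborel_UNIV)
qed

context h_type begin

text \<open>The exponent of \<open>phi\<close>, equal to \<open>(Q + 2 s) / 2\<close>. Convolution
  with the kernel changes the degree \<open>- bb\<close> into \<open>2 s - bb\<close>, and the two
  add up to \<open>- Q\<close>.\<close>

definition bb where "bb = real n + real m + s"

lemma bb: "Q = 2 * bb - 2 * s" "0 < bb" "bb < Q" "bb + (Q - 2 * s) > Q"
  using n_pos m_pos s0 s1 by (auto simp: bb_def hdim_def)

abbreviation ph :: "'v \<times> 'z \<Rightarrow> real" where "ph \<equiv> phi n m s"

lemma ph_eq: "ph x = hnorm x powr (- bb)" by (simp add: phi_def bb_def)
lemma ph_nonneg [simp]: "0 \<le> ph x" by (simp add: ph_eq)
lemma ph_0 [simp]: "ph 0 = 0" by (simp add: ph_eq)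
lemma ph_pos: "x \<noteq> 0 \<Longrightarrow> 0 < ph x" by (simp add: ph_eq)
lemma ph_meas [measurable]: "ph \<in> borel_measurable borel" unfolding phi_def by measurable
lemma ph_dil: "d > 0 \<Longrightarrow> ph (dil d x) = d powr (- bb) * ph x" by (simp add: ph_eq hnorm_dil powr_mult)

lemma kx_pos: "gm (ginv w) x \<noteq> 0 \<Longrightarrow> 0 < kx x w"
  unfolding KK_0 by simp

lemma kx_dil: "d > 0 \<Longrightarrow> kx (dil d x) (dil d w) = d powr (2 * s - Q) * kx x w"
  unfolding KK_0 by (simp add: dil_ginv[symmetric] dil_gm[symmetric] hnorm_dil powr_mult)

text \<open>The potential of \<open>phi\<close> without the normalisation. \<open>pp\<close> may be
  infinite; \<open>pr\<close> sends infinity to 0, as the Bochner integral in \<open>psi\<close>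
  does, so that \<open>psi_eq\<close> holds at every point.\<close>

definition pp :: "'v \<times> 'z \<Rightarrow> ennreal" where "pp x = (\<integral>\<^sup>+w. ennreal (ph w * kx x w) \<partial>lborel)"
definition pr :: "'v \<times> 'z \<Rightarrow> real" where "pr x = enn2real (pp x)"

lemma pp_meas [measurable]: "pp \<in> borel_measurable borel" unfolding pp_def by measurable
lemma pr_meas [measurable]: "pr \<in> borel_measurable borel" unfolding pr_def by measurable
lemma pr_nonneg [simp]: "0 \<le> pr x" by (simp add: pr_def)

text \<open>The substitution \<open>w = gm x (ginv y)\<close> uses left invariance and invariance
  under inversion, and sends the kernel at \<open>(x, w)\<close> to its value at
  \<open>y\<close>.\<close>

lemma psi_eq: "psi br n m s x = C1 n m s * pr x"
proof -
  have "(\<integral>\<^sup>+w. ennreal (ph w * kx x w) \<partial>lborel) = (\<integral>\<^sup>+w. ennreal (ph (gm x w) * kx x (gm x w)) \<partial>lborel)"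
    by (rule nn_integral_gm_left[symmetric]) measurable
  also have "\<dots> = (\<integral>\<^sup>+y. ennreal (ph (gm x (ginv y)) * kx x (gm x (ginv y))) \<partial>lborel)"
    by (rule nn_integral_ginv[symmetric]) measurable
  finally have e: "pp x = (\<integral>\<^sup>+y. ennreal (ph (gm x (ginv y)) * KK 0 y) \<partial>lborel)" by (simp add: pp_def ginv_gm)
  have "gconv br ph (\<lambda>y. hnorm y powr (- Q + 2 * s)) x = (\<integral>y. ph (gm x (ginv y)) * KK 0 y \<partial>lborel)"
    unfolding gconv_def KK_0 ..
  also have "\<dots> = pr x" unfolding pr_def e by (rule integral_eq_nn_integral) simp_all
  finally show ?thesis by (simp add: psi_def)
qed

lemma pp_dil: assumes d: "d > 0" shows "pp (dil d x) = ennreal (d powr (2 * s - bb)) * pp x"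
proof -
  have "pp (dil d x) = ennreal (d powr Q) * (\<integral>\<^sup>+w. ennreal (ph (dil d w) * kx (dil d x) (dil d w)) \<partial>lborel)"
    unfolding pp_def by (rule nn_integral_dil[OF _ d]) measurable
  also have "(\<lambda>w. ennreal (ph (dil d w) * kx (dil d x) (dil d w))) = (\<lambda>w. ennreal (d powr (- bb) * d powr (2 * s - Q)) * ennreal (ph w * kx x w))"
    unfolding kx_dil[OF d] ph_dil[OF d] by (rule ext) (simp add: mult_ac flip: ennreal_mult')
  also have "(\<integral>\<^sup>+w. ennreal (d powr (- bb) * d powr (2 * s - Q)) * ennreal (ph w * kx x w) \<partial>lborel) = ennreal (d powr (- bb) * d powr (2 * s - Q)) * pp x"
    unfolding pp_def by (rule nn_integral_cmult) measurable
  also have "ennreal (d powr Q) * (ennreal (d powr (- bb) * d powr (2 * s - Q)) * pp x) = ennreal (d powr Q * (d powr (- bb) * d powr (2 * s - Q))) * pp x"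
    by (simp add: ennreal_mult mult.assoc)
  also have "d powr Q * (d powr (- bb) * d powr (2 * s - Q)) = d powr (2 * s - bb)" unfolding powr_add[symmetric] by simp
  finally show ?thesis .
qed

lemma pr_dil: "d > 0 \<Longrightarrow> pr (dil d x) = d powr (2 * s - bb) * pr x"
  by (simp add: pr_def pp_dil enn2real_mult)

lemma weight_eq: "weight br n m s x = 1 / C1 n m s * (ph x / pr x)"
  by (simp add: weight_def psi_eq)

lemma weight_dil: assumes d: "d > 0" shows "weight br n m s (dil d x) = d powr (- 2 * s) * weight br n m s x"
proof -
  have "d powr (- bb) = d powr (- 2 * s) * d powr (2 * s - bb)" unfolding powr_add[symmetric] by simp
  then show ?thesis unfolding weight_eq ph_dil[OF d] pr_dil[OF d] using d by simp
qed

text \<open>Degree \<open>- Q\<close> cancels the Jacobian of the dilation. Two functions are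
  allowed because a truncated potential scales into one with a different truncation.\<close>

lemma annulus_scale:
  assumes [measurable]: "F \<in> borel_measurable borel" and d: "d > 0"
    and FG: "\<And>x. F (dil d x) = ennreal (d powr (- Q)) * G x"
  shows "(\<integral>\<^sup>+x. F x * indicator {x. d \<le> hnorm x \<and> hnorm x < 2 * d} x \<partial>lborel) = (\<integral>\<^sup>+(x :: 'v \<times> 'z). G x * indicator {x. 1 \<le> hnorm x \<and> hnorm x < 2} x \<partial>lborel)"
proof -
  have G: "G x = ennreal (d powr Q) * F (dil d x)" for x
    unfolding FG mult.assoc[symmetric] using d by (simp flip: ennreal_mult' powr_add)
  have "(\<integral>\<^sup>+x. F x * indicator {x. d \<le> hnorm x \<and> hnorm x < 2 * d} x \<partial>lborel)
    = ennreal (d powr Q) * (\<integral>\<^sup>+x. F (dil d x) * indicator {x. d \<le> hnorm x \<and> hnorm x < 2 * d} (dil d x) \<partial>lborel)"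
    by (rule nn_integral_dil[OF _ d]) measurable
  also have "\<dots> = (\<integral>\<^sup>+x. ennreal (d powr Q) * (F (dil d x) * indicator {x. d \<le> hnorm x \<and> hnorm x < 2 * d} (dil d x)) \<partial>lborel)"
    by (rule nn_integral_cmult[symmetric]) measurable
  also have "\<dots> = (\<integral>\<^sup>+(x :: 'v \<times> 'z). G x * indicator {x. 1 \<le> hnorm x \<and> hnorm x < 2} x \<partial>lborel)"
    unfolding G using d by (intro nn_integral_cong) (auto simp: indicator_def hnorm_dil)
  finally show ?thesis .
qed

text \<open>The mass of \<open>phi\<close> times its potential on one dyadic annulus, the unit in
  which both sides are measured for sharpness.\<close>

definition a0 where "a0 = (\<integral>\<^sup>+x. ennreal (ph x) * pp x * indicator {x. 1 \<le> hnorm x \<and> hnorm x < 2} x \<partial>lborel)"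

lemma annulus_a0: "d > 0 \<Longrightarrow> (\<integral>\<^sup>+x. ennreal (ph x) * pp x * indicator {x. d \<le> hnorm x \<and> hnorm x < 2 * d} x \<partial>lborel) = a0"
  unfolding a0_def
proof (rule annulus_scale)
  fix x assume d: "d > 0"
  have "ennreal (ph (dil d x)) * pp (dil d x) = ennreal (d powr (- bb) * d powr (2 * s - bb)) * (ennreal (ph x) * pp x)"
    unfolding ph_dil[OF d] pp_dil[OF d] by (simp add: ennreal_mult mult_ac)
  also have "d powr (- bb) * d powr (2 * s - bb) = d powr (- Q)" unfolding powr_add[symmetric] bb(1) by simp
  finally show "ennreal (ph (dil d x)) * pp (dil d x) = ennreal (d powr (- Q)) * (ennreal (ph x) * pp x)" .
qed simp_all

text \<open>Tonelli moves the kernel onto the annulus. The potential \<open>kA\<close> of the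
  annulus is bounded and decays like \<open>hnorm w powr (- (Q - 2 s))\<close>; against
  \<open>phi\<close> this converges near 0 since \<open>bb < Q\<close>, and at infinity since
  \<open>bb + (Q - 2 s) > Q\<close>.\<close>

lemma a0_finite: "a0 < \<top>"
proof -
  let ?I = "\<lambda>x :: 'v \<times> 'z. indicator {x. 1 \<le> hnorm x \<and> hnorm x < 2} x :: real"
  have q: "0 \<le> Q - 2 * s" "Q - 2 * s < Q" using Q_pos s0 s1 by auto
  obtain C where C: "C > 0" "\<forall>x. (\<integral>\<^sup>+w. ennreal (indicator (hball 2) w * hnorm (gm (ginv w) x) powr (- (Q - 2 * s))) \<partial>lborel) \<le> ennreal C"
    by (rule riesz_unif_bound[OF q, of 2]) blast
  define kA where "kA w = (\<integral>\<^sup>+x. ennreal (?I x * kx x w) \<partial>lborel)" for w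
  have [measurable]: "kA \<in> borel_measurable borel" unfolding kA_def by measurable
  have k1: "kA w \<le> ennreal C" for w
  proof -
    have "kA w \<le> (\<integral>\<^sup>+x. ennreal (indicator (hball 2) x * hnorm (gm (ginv x) w) powr (- (Q - 2 * s))) \<partial>lborel)"
      unfolding kA_def by (intro nn_integral_mono ennreal_leI) (subst kx_sym, simp add: KK_0 indicator_def)
    also have "\<dots> \<le> ennreal C" using C(2) by blast
    finally show ?thesis .
  qed
  obtain V where V: "emeasure lborel (hball 2) = ennreal V" "V \<ge> 0"
    using emeasure_bounded_finite[OF bounded_hnorm_ball[of 2]] by (metis enn2real_nonneg ennreal_enn2real infinity_ennreal_def)
  define C2 where "C2 = C * 8 powr (Q - 2 * s) + V * 4 powr (Q - 2 * s)"
  have C20: "C2 \<ge> 0" using C(1) V(2) by (simp add: C2_def)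
  have k2: "kA w \<le> ennreal (C2 * hnorm w powr (- (Q - 2 * s)))" if w: "hnorm w \<ge> 1" for w
  proof (cases "hnorm w \<le> 8")
    case True
    have "1 = 8 powr (Q - 2 * s) * 8 powr (- (Q - 2 * s))" unfolding powr_add[symmetric] by simp
    also have "\<dots> \<le> 8 powr (Q - 2 * s) * hnorm w powr (- (Q - 2 * s))"
      using True w q(1) by (intro mult_left_mono powr_mono2') auto
    finally have "C * 1 \<le> C * (8 powr (Q - 2 * s) * hnorm w powr (- (Q - 2 * s)))" using C(1) by (intro mult_left_mono) auto
    also have "\<dots> \<le> C2 * hnorm w powr (- (Q - 2 * s))" using V(2) by (simp add: C2_def distrib_right)
    finally show ?thesis using order_trans[OF k1 ennreal_leI] by simp
  next
    case False
    have "kA w \<le> (\<integral>\<^sup>+(x :: 'v \<times> 'z). ennreal ((hnorm w / 4) powr (- (Q - 2 * s))) * indicator (hball 2) x \<partial>lborel)"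
      unfolding kA_def
    proof (rule nn_integral_mono)
      fix x
      show "ennreal (?I x * kx x w) \<le> ennreal ((hnorm w / 4) powr (- (Q - 2 * s))) * indicator (hball 2) x"
      proof (cases "1 \<le> hnorm x \<and> hnorm x < 2")
        case True
        \<comment> \<open>The quasi-triangle inequality leaves \<open>hnorm w / 2 - 2\<close>, which
          exceeds \<open>hnorm w / 4\<close> for \<open>hnorm w > 8\<close>.\<close>
        then have h: "hnorm w / 4 \<le> hnorm (gm (ginv x) w)" using hnorm_quasi[of w x] False by linarith
        have "kx w x = hnorm (gm (ginv x) w) powr (- (Q - 2 * s))" by (simp add: KK_0)
        also have "\<dots> \<le> (hnorm w / 4) powr (- (Q - 2 * s))" using h False q(1) by (intro powr_mono2') auto
        finally show ?thesis using True by (subst kx_sym) (simp add: ennreal_leI)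
      qed simp
    qed
    also have "\<dots> = ennreal ((hnorm w / 4) powr (- (Q - 2 * s))) * ennreal V" unfolding V(1)[symmetric] by (rule nn_integral_cmult_indicator) measurable
    also have "\<dots> = ennreal ((hnorm w / 4) powr (- (Q - 2 * s)) * V)" using V(2) by (simp add: ennreal_mult)
    also have "\<dots> \<le> ennreal (C2 * hnorm w powr (- (Q - 2 * s)))"
    proof (rule ennreal_leI)
      have "(hnorm w / 4) powr (- (Q - 2 * s)) = (1/4 * hnorm w) powr (- (Q - 2 * s))" by simp
      also have "\<dots> = (1/4) powr (- (Q - 2 * s)) * hnorm w powr (- (Q - 2 * s))" by (rule powr_mult)
      also have "(1/4 :: real) powr (- (Q - 2 * s)) = 4 powr (Q - 2 * s)" unfolding powr_minus by (simp add: powr_divide)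
      finally have "(hnorm w / 4) powr (- (Q - 2 * s)) * V = V * 4 powr (Q - 2 * s) * hnorm w powr (- (Q - 2 * s))" by (simp only: mult_ac)
      also have "\<dots> \<le> C2 * hnorm w powr (- (Q - 2 * s))" using C(1) by (intro mult_right_mono) (simp_all add: C2_def)
      finally show "(hnorm w / 4) powr (- (Q - 2 * s)) * V \<le> C2 * hnorm w powr (- (Q - 2 * s))" .
    qed
    finally show ?thesis .
  qed
  have "a0 \<le> (\<integral>\<^sup>+x. (\<integral>\<^sup>+w. ennreal (?I x * (ph w * kx x w)) \<partial>lborel) \<partial>lborel)"
    unfolding a0_def
  proof (rule nn_integral_mono)
    fix x :: "'v \<times> 'z"
    show "ennreal (ph x) * pp x * indicator {x. 1 \<le> hnorm x \<and> hnorm x < 2} x \<le> (\<integral>\<^sup>+w. ennreal (?I x * (ph w * kx x w)) \<partial>lborel)"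
    proof (cases "1 \<le> hnorm x \<and> hnorm x < 2")
      case True
      then have "hnorm x powr (- bb) \<le> 1 powr (- bb)" using bb(2) by (intro powr_mono2') auto
      then have "ph x \<le> 1" by (simp add: ph_eq)
      then have "ennreal (ph x) * pp x \<le> 1 * pp x" by (intro mult_right_mono) (simp_all add: ennreal_le_1)
      then show ?thesis using True by (simp add: pp_def)
    qed simp
  qed
  also have "\<dots> = (\<integral>\<^sup>+w. (\<integral>\<^sup>+x. ennreal (?I x * (ph w * kx x w)) \<partial>lborel) \<partial>lborel)"
    by (rule lborel_pair.Fubini') (simp add: lborel_prod)
  also have "\<dots> = (\<integral>\<^sup>+w. ennreal (ph w) * kA w \<partial>lborel)"
  proof (rule nn_integral_cong)
    fix w :: "'v \<times> 'z"
    have "(\<integral>\<^sup>+x. ennreal (?I x * (ph w * kx x w)) \<partial>lborel) = (\<integral>\<^sup>+x. ennreal (ph w) * ennreal (?I x * kx x w) \<partial>lborel)"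
      by (intro nn_integral_cong) (simp add: mult_ac flip: ennreal_mult')
    also have "\<dots> = ennreal (ph w) * kA w" unfolding kA_def by (rule nn_integral_cmult) measurable
    finally show "(\<integral>\<^sup>+x. ennreal (?I x * (ph w * kx x w)) \<partial>lborel) = ennreal (ph w) * kA w" .
  qed
  also have "\<dots> \<le> (\<integral>\<^sup>+w. ennreal C * ennreal (indicator {x :: 'v \<times> 'z. hnorm x < 1} w * hnorm w powr (- bb))
      + ennreal C2 * ennreal (indicator {x. hnorm x \<ge> 1} w * hnorm w powr (- (bb + (Q - 2 * s)))) \<partial>lborel)"
  proof (rule nn_integral_mono)
    fix w :: "'v \<times> 'z"
    show "ennreal (ph w) * kA w \<le> ennreal C * ennreal (indicator {x :: 'v \<times> 'z. hnorm x < 1} w * hnorm w powr (- bb))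
      + ennreal C2 * ennreal (indicator {x. hnorm x \<ge> 1} w * hnorm w powr (- (bb + (Q - 2 * s))))"
    proof (cases "hnorm w < 1")
      case True
      have "ennreal (ph w) * kA w \<le> ennreal (ph w) * ennreal C" by (intro mult_left_mono k1) simp
      then show ?thesis using True by (simp add: ph_eq mult.commute)
    next
      case False
      then have "ennreal (ph w) * kA w \<le> ennreal (ph w) * ennreal (C2 * hnorm w powr (- (Q - 2 * s)))" by (intro mult_left_mono k2) simp_all
      also have "\<dots> = ennreal (ph w * (C2 * hnorm w powr (- (Q - 2 * s))))" by (rule ennreal_mult'[symmetric]) simp
      also have "ph w * (C2 * hnorm w powr (- (Q - 2 * s))) = C2 * hnorm w powr (- (bb + (Q - 2 * s)))"
        unfolding ph_eq minus_add_distrib powr_add by (simp only: mult_ac)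
      also have "ennreal \<dots> = ennreal C2 * ennreal (hnorm w powr (- (bb + (Q - 2 * s))))" by (rule ennreal_mult'[OF C20])
      finally show ?thesis using False by simp
    qed
  qed
  also have "\<dots> = ennreal C * (\<integral>\<^sup>+w. ennreal (indicator {x :: 'v \<times> 'z. hnorm x < 1} w * hnorm w powr (- bb)) \<partial>lborel)
     + ennreal C2 * (\<integral>\<^sup>+w. ennreal (indicator {x :: 'v \<times> 'z. hnorm x \<ge> 1} w * hnorm w powr (- (bb + (Q - 2 * s)))) \<partial>lborel)"
    by (subst nn_integral_add) (simp_all add: nn_integral_cmult)
  also have "\<dots> < \<top>"
    using nn_integral_hnorm_near[of bb] nn_integral_hnorm_far[of "bb + (Q - 2 * s)"] bb by (simp add: ennreal_mult_less_top)
  finally show ?thesis .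
qed

lemma AE_nonzero: "AE x :: 'v \<times> 'z in lborel. x \<noteq> 0" by (rule AE_lborel_singleton)

lemma pp_pos: "pp x > 0"
proof (rule ccontr)
  assume "\<not> ?thesis"
  then have "(\<integral>\<^sup>+w. ennreal (ph w * kx x w) \<partial>lborel) = 0" by (simp add: pp_def)
  then have "AE w in lborel. ennreal (ph w * kx x w) = 0" by (subst (asm) nn_integral_0_iff_AE) simp_all
  then have "AE w :: 'v \<times> 'z in lborel. False"
    using AE_nonzero AE_gm_nonzero[of x]
  proof eventually_elim
    fix w assume "ennreal (ph w * kx x w) = 0" "w \<noteq> 0" "gm (ginv w) x \<noteq> 0"
    moreover from this have "0 < ph w * kx x w" by (intro mult_pos_pos ph_pos kx_pos)
    ultimately show False by (simp add: ennreal_eq_0_iff)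
  qed
  then show False using ex_of_AE_lborel by blast
qed

text \<open>The integrand is strictly positive on an open set that contains a dilate of a unit
  horizontal vector, and a nonempty open set is not negligible.\<close>

lemma a0_pos: "a0 > 0"
proof (rule ccontr)
  assume "\<not> ?thesis"
  then have "AE x in lborel. ennreal (ph x) * pp x * indicator {x. 1 \<le> hnorm x \<and> hnorm x < 2} x = 0"
    unfolding a0_def by (subst nn_integral_0_iff_AE[symmetric]) simp_all
  then have "AE x in lborel. x \<notin> {x :: 'v \<times> 'z. 1 < hnorm x \<and> hnorm x < 2}"
  proof eventually_elim
    fix x :: "'v \<times> 'z" assume z: "ennreal (ph x) * pp x * indicator {x. 1 \<le> hnorm x \<and> hnorm x < 2} x = 0"
    show "x \<notin> {x. 1 < hnorm x \<and> hnorm x < 2}"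
    proof
      assume "x \<in> {x. 1 < hnorm x \<and> hnorm x < 2}"
      then have "ph x > 0" "indicator {x. 1 \<le> hnorm x \<and> hnorm x < 2} x = (1 :: ennreal)" by (auto intro!: ph_pos)
      then show False using z pp_pos[of x] by (simp add: ennreal_eq_0_iff)
    qed
  qed
  then have "{x :: 'v \<times> 'z. 1 < hnorm x \<and> hnorm x < 2} \<in> null_sets lborel" by (subst (asm) AE_iff_null_sets[symmetric]) simp_all
  then have "negligible {x :: 'v \<times> 'z. 1 < hnorm x \<and> hnorm x < 2}" using negligible_iff_null_sets null_sets_completionI by blast
  moreover have "open {x :: 'v \<times> 'z. 1 < hnorm x \<and> hnorm x < 2}"
    by (intro open_Collect_conj open_Collect_less hnorm_continuous continuous_on_const)
  moreover obtain i :: 'v where "i \<in> Basis" using nonempty_Basis by blast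
  then have "hnorm (i, 0 :: 'z) = 1" by (simp add: hnorm_def)
  then have "dil (3/2) (i, 0) \<in> {x :: 'v \<times> 'z. 1 < hnorm x \<and> hnorm x < 2}" by (simp add: hnorm_dil)
  ultimately show False using open_not_negligible by blast
qed

text \<open>All annuli with integer exponent have the same finite mass, and \<open>phi\<close> is
  positive away from the origin, so an infinite potential is confined to a null set.\<close>

lemma AE_pp_finite: "AE x in lborel. pp x < \<top>"
proof -
  have "AE x :: 'v \<times> 'z in lborel. \<forall>i :: int. 2 powr i \<le> hnorm x \<and> hnorm x < 2 * 2 powr i \<longrightarrow> pp x < \<top>"
    unfolding AE_all_countable
  proof
    fix i :: int
    have "(\<integral>\<^sup>+x. ennreal (ph x) * pp x * indicator {x. 2 powr i \<le> hnorm x \<and> hnorm x < 2 * 2 powr i} x \<partial>lborel) \<noteq> \<infinity>"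
      using annulus_a0[of "2 powr i"] a0_finite by simp
    then have "AE x in lborel. ennreal (ph x) * pp x * indicator {x. 2 powr i \<le> hnorm x \<and> hnorm x < 2 * 2 powr i} x \<noteq> \<infinity>"
      by (rule nn_integral_PInf_AE[rotated]) simp
    with AE_nonzero show "AE x :: 'v \<times> 'z in lborel. 2 powr i \<le> hnorm x \<and> hnorm x < 2 * 2 powr i \<longrightarrow> pp x < \<top>"
    proof eventually_elim
      fix x :: "'v \<times> 'z" assume x: "x \<noteq> 0" "ennreal (ph x) * pp x * indicator {x. 2 powr i \<le> hnorm x \<and> hnorm x < 2 * 2 powr i} x \<noteq> \<infinity>"
      show "2 powr i \<le> hnorm x \<and> hnorm x < 2 * 2 powr i \<longrightarrow> pp x < \<top>"
      proof
        assume "2 powr i \<le> hnorm x \<and> hnorm x < 2 * 2 powr i"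
        then have "ennreal (ph x) * pp x \<noteq> \<top>" using x(2) by simp
        then show "pp x < \<top>" using ph_pos[OF x(1)] by (auto simp: ennreal_mult_eq_top_iff top.not_eq_extremum)
      qed
    qed
  qed
  with AE_nonzero show ?thesis
  proof eventually_elim
    fix x :: "'v \<times> 'z" assume x: "x \<noteq> 0" "\<forall>i :: int. 2 powr i \<le> hnorm x \<and> hnorm x < 2 * 2 powr i \<longrightarrow> pp x < \<top>"
    have h: "hnorm x > 0" using x(1) by simp
    define i where "i = \<lfloor>log 2 (hnorm x)\<rfloor>"
    have "real_of_int i \<le> log 2 (hnorm x)" "log 2 (hnorm x) < real_of_int i + 1" unfolding i_def by linarith+
    then have "2 powr i \<le> 2 powr (log 2 (hnorm x))" "2 powr (log 2 (hnorm x)) < 2 powr (real_of_int i + 1)"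
      by (intro powr_mono powr_less_mono; simp)+
    moreover have "2 powr (log 2 (hnorm x)) = hnorm x" using h by simp
    ultimately have "2 powr i \<le> hnorm x \<and> hnorm x < 2 powr (real_of_int i + 1)" by metis
    then have "2 powr i \<le> hnorm x \<and> hnorm x < 2 * 2 powr i" by (simp only: powr_add) (simp add: mult.commute)
    then show "pp x < \<top>" using x(2) by blast
  qed
qed

lemma AE_pp_pr: "AE x in lborel. pp x = ennreal (pr x)"
  using AE_pp_finite by eventually_elim (simp add: pr_def)

lemma shells_eq: "(\<integral>\<^sup>+x. ennreal (ph x) * pp x * indicator {x. 1 \<le> hnorm x \<and> hnorm x < 2 ^ j} x \<partial>lborel) = of_nat j * a0"
proof (induction j)
  case 0
  have "{x :: 'v \<times> 'z. 1 \<le> hnorm x \<and> hnorm x < 2 ^ 0} = {}" by auto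
  then show ?case by simp
next
  case (Suc j)
  have one: "(1::real) \<le> 2 ^ j" by simp
  have "(\<integral>\<^sup>+x. ennreal (ph x) * pp x * indicator {x. 1 \<le> hnorm x \<and> hnorm x < 2 ^ Suc j} x \<partial>lborel)
    = (\<integral>\<^sup>+x. ennreal (ph x) * pp x * indicator {x. 1 \<le> hnorm x \<and> hnorm x < 2 ^ j} x + ennreal (ph x) * pp x * indicator {x. 2 ^ j \<le> hnorm x \<and> hnorm x < 2 * 2 ^ j} x \<partial>lborel)"
    by (intro nn_integral_cong) (auto simp: indicator_def dest: order_trans[OF one])
  also have "\<dots> = of_nat j * a0 + a0"
    by (subst nn_integral_add) (simp_all add: Suc annulus_a0)
  finally show ?case by (simp add: distrib_right add.commute)
qed

text \<open>Arbitrarily many annuli of equal positive mass. The divergence excludes nonzero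
  multiples of \<open>psi\<close> as traces of finite weighted norm.\<close>

lemma ph_pr_infinite: "(\<integral>\<^sup>+x. ennreal (ph x * pr x) \<partial>lborel) = \<top>"
proof -
  have "(\<integral>\<^sup>+x. ennreal (ph x * pr x) \<partial>lborel) = (\<integral>\<^sup>+x. ennreal (ph x) * pp x \<partial>lborel)"
    by (rule nn_integral_cong_AE, use AE_pp_pr in eventually_elim) (simp add: ennreal_mult')
  moreover have "of_nat j * a0 \<le> (\<integral>\<^sup>+x. ennreal (ph x) * pp x \<partial>lborel)" for j
    unfolding shells_eq[symmetric] by (intro nn_integral_mono) (simp add: indicator_def)
  moreover obtain r where r: "a0 = ennreal r" "r > 0" using a0_pos a0_finite by (cases a0) (auto simp: top.not_eq_extremum[symmetric])
  moreover have "y = \<top>" if y: "\<And>j :: nat. of_nat j * ennreal r \<le> y" for y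
  proof (rule ccontr)
    assume "y \<noteq> \<top>"
    then obtain q where q: "y = ennreal q" "q \<ge> 0" by (cases y) auto
    obtain j :: nat where j: "q < real j * r" using reals_Archimedean3[OF r(2)] by blast
    have "ennreal (real j * r) \<le> ennreal q" using y[of j] unfolding q(1) by (simp add: ennreal_mult' ennreal_of_nat_eq_real_of_nat)
    then show False using j q(2) by (simp add: ennreal_le_iff)
  qed
  ultimately show ?thesis by metis
qed

text \<open>With \<open>f\<close> the trace over the potential of \<open>phi\<close> and
  \<open>hk k\<close>, \<open>D k\<close> the pairing and the defect of its truncations,
  \<open>ground_state\<close> turns the duality bound \<open>2 c0 hk - c0 Qf\<close> into
  \<open>c0 hk + c0 D / 2\<close>. The defect enters with the favourable sign and is what settles
  the case of equality.\<close>

lemma hardy: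
  assumes u: "u \<in> W0 br s"
  defines "Hc \<equiv> \<integral>\<^sup>+x. ennreal ((W0_trace u x)\<^sup>2 * (ph x / pr x)) \<partial>lborel"
  shows "ennreal c0 * Hc \<le> EW u" "EW u = ennreal c0 * Hc \<Longrightarrow> EW u = 0"
proof -
  define t where "t = W0_trace u"
  have [measurable]: "t \<in> borel_measurable borel" using W0_trace[OF u] unfolding is_trace_def t_def by blast
  define f where "f x = (if x = 0 then 0 else t x / pr x)" for x
  have [measurable]: "f \<in> borel_measurable borel" unfolding f_def by measurable
  \<comment> \<open>Truncation away from infinity, from the origin, from large traces and from small
    potentials; the first clause gives the support of the density, the others its bound. Positive
    \<open>pr\<close> also rules out points of infinite potential, where \<open>pr\<close> is
    0.\<close>
  define X where "X k = {x. hnorm x \<le> real k + 1 \<and> 1 / (real k + 1) \<le> hnorm x \<and> \<bar>t x\<bar> \<le> real k + 1 \<and> 1 / (real k + 1) \<le> pr x}" for k :: nat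
  have [measurable]: "X k \<in> sets borel" for k unfolding X_def by measurable
  define fk where "fk k x = f x * indicator (X k) x" for k x
  have [measurable]: "fk k \<in> borel_measurable borel" for k unfolding fk_def by measurable
  have XD: "x \<noteq> 0" "pr x > 0" "pp x = ennreal (pr x)" if "x \<in> X k" for x k
  proof -
    have p: "0 < 1 / (real k + 1)" by simp
    have "1 / (real k + 1) \<le> hnorm x" "1 / (real k + 1) \<le> pr x" using that by (auto simp: X_def)
    then have "hnorm x > 0" "pr x > 0" using p by linarith+
    then show "x \<noteq> 0" "pr x > 0" by simp_all
    then have "pp x \<noteq> \<top>" by (auto simp: pr_def)
    then show "pp x = ennreal (pr x)" by (simp add: pr_def top.not_eq_extremum)
  qed
  have fkl: "(\<lambda>k. fk k x) \<longlonglongrightarrow> f x" for x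
  proof (cases "x = 0 \<or> pr x = 0")
    case True
    then have "fk k x = f x" for k by (auto simp: fk_def f_def)
    then show ?thesis by simp
  next
    case False
    then have pos: "hnorm x > 0" "pr x > 0" using pr_nonneg[of x] by (auto simp: less_le)
    have "(\<lambda>k. 1 / (real k + 1)) \<longlonglongrightarrow> 0" using dl(2) unfolding dl_def .
    then have "\<forall>\<^sub>F k in sequentially. 1 / (real k + 1) < hnorm x" "\<forall>\<^sub>F k in sequentially. 1 / (real k + 1) < pr x"
      using pos order_tendstoD(2) by blast+
    moreover have "\<forall>\<^sub>F k in sequentially. nat \<lceil>hnorm x\<rceil> \<le> k" "\<forall>\<^sub>F k in sequentially. nat \<lceil>\<bar>t x\<bar>\<rceil> \<le> k" by (rule eventually_ge_at_top)+
    ultimately have "\<forall>\<^sub>F k in sequentially. fk k x = f x"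
    proof eventually_elim
      fix k assume "1 / (real k + 1) < hnorm x" "1 / (real k + 1) < pr x" "nat \<lceil>hnorm x\<rceil> \<le> k" "nat \<lceil>\<bar>t x\<bar>\<rceil> \<le> k"
      then have "1 / (real k + 1) \<le> hnorm x" "1 / (real k + 1) \<le> pr x" "hnorm x \<le> real k + 1" "\<bar>t x\<bar> \<le> real k + 1" by linarith+
      then have "x \<in> X k" by (simp add: X_def)
      then show "fk k x = f x" by (simp add: fk_def)
    qed
    then show ?thesis by (rule tendsto_eventually)
  qed
  define g where "g k x = ph x * fk k x" for k x
  have ng: "nice (g k) (real k + 1) ((1 / (real k + 1)) powr (- bb) * ((real k + 1) * (real k + 1)))" for k
    unfolding nice_def
  proof (intro conjI allI impI)
    show "g k \<in> borel_measurable borel" unfolding g_def by measurable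
    fix x
    show "\<bar>g k x\<bar> \<le> (1 / (real k + 1)) powr (- bb) * ((real k + 1) * (real k + 1))"
    proof (cases "x \<in> X k")
      case True
      then have x: "1 / (real k + 1) \<le> hnorm x" "\<bar>t x\<bar> \<le> real k + 1" "1 / (real k + 1) \<le> pr x" by (auto simp: X_def)
      have "ph x \<le> (1 / (real k + 1)) powr (- bb)" unfolding ph_eq using x(1) bb(2) by (intro powr_mono2') auto
      moreover have "\<bar>t x\<bar> / pr x \<le> (real k + 1) / (1 / (real k + 1))" by (rule frac_le) (use x in auto)
      then have "\<bar>fk k x\<bar> \<le> (real k + 1) * (real k + 1)" using True XD[OF True] by (simp add: fk_def f_def abs_divide)
      ultimately show ?thesis unfolding g_def abs_mult by (intro mult_mono) auto
    qed (simp add: g_def fk_def)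
    show "g k x = 0" if "hnorm x > real k + 1" using that by (simp add: g_def fk_def X_def)
  qed (simp_all add: mult_pos_pos)
  have gt: "g k x * t x = (t x)\<^sup>2 * (ph x / pr x) * indicator (X k) x" for k x
    using XD(1)[of x k] by (cases "x \<in> X k") (auto simp: g_def fk_def f_def power2_eq_square)
  have gt0: "0 \<le> g k x * t x" for k x unfolding gt by simp
  have igt: "integrable lborel (\<lambda>x. g k x * t x)" for k unfolding t_def by (rule energy_ge(1)[OF u ng])
  define hk where "hk k = (\<integral>x. g k x * t x \<partial>lborel)" for k
  have nhk: "(\<integral>\<^sup>+x. ennreal (g k x * t x) \<partial>lborel) = ennreal (hk k)" for k
    unfolding hk_def by (rule nn_integral_eq_integral[OF igt]) (simp add: gt0)
  have hk0: "hk k \<ge> 0" for k unfolding hk_def by (intro Bochner_Integration.integral_nonneg gt0)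
  define D where "D k = (\<integral>\<^sup>+x. (\<integral>\<^sup>+w. ennreal (ph x * ph w * kx x w * (fk k x - fk k w)\<^sup>2) \<partial>lborel) \<partial>lborel)" for k
  \<comment> \<open>On \<open>X k\<close> the inner integral is \<open>pr x\<close>, which cancels
    one of the two divisions in the square of \<open>fk k x\<close>; the diagonal term of
    \<open>ground_state\<close> thus coincides with the pairing of \<open>g k\<close> with the
    trace.\<close>
  have S: "(\<integral>\<^sup>+x. ennreal (ph x * (fk k x)\<^sup>2) * (\<integral>\<^sup>+w. ennreal (ph w * kx x w) \<partial>lborel) \<partial>lborel) = ennreal (hk k)" for k
    unfolding nhk[symmetric] pp_def[symmetric]
  proof (rule nn_integral_cong)
    fix x
    show "ennreal (ph x * (fk k x)\<^sup>2) * pp x = ennreal (g k x * t x)"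
    proof (cases "x \<in> X k")
      case True
      have "ennreal (ph x * (fk k x)\<^sup>2) * pp x = ennreal (ph x * (fk k x)\<^sup>2 * pr x)" unfolding XD(3)[OF True] by (simp add: ennreal_mult')
      also have "ph x * (fk k x)\<^sup>2 * pr x = g k x * t x"
        using XD[OF True] True by (simp add: g_def fk_def f_def power2_eq_square)
      finally show ?thesis .
    qed (simp add: g_def fk_def)
  qed
  have gk: "g k = (\<lambda>x. ph x * fk k x)" for k by (simp add: g_def fun_eq_iff)
  have Dk: "D k < \<top>" "Qf (g k) = hk k - enn2real (D k) / 2" for k
    using ground_state[OF ph_meas \<open>fk k \<in> borel_measurable borel\<close> ph_nonneg S[symmetric] _ D_def[of k]] hk0[of k] unfolding gk by simp_all
  obtain e where e: "EW u = ennreal e" "e \<ge> 0" using EW_finite[OF u] by (cases "EW u") auto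
  have main: "c0 * hk k + c0 * (enn2real (D k) / 2) \<le> e" for k
  proof -
    have "ennreal (2 * c0 * hk k - c0 * Qf (g k)) \<le> ennreal e" using energy_ge(2)[OF u ng[of k]] unfolding e(1) hk_def t_def .
    then have "2 * c0 * hk k - c0 * Qf (g k) \<le> e" using e(2) by (simp add: ennreal_le_iff)
    then show ?thesis unfolding Dk(2) right_diff_distrib mult.assoc by linarith
  qed
  have gl: "(\<lambda>k. g k x * t x) \<longlonglongrightarrow> (t x)\<^sup>2 * (ph x / pr x)" for x
  proof -
    have "(\<lambda>k. g k x * t x) \<longlonglongrightarrow> ph x * f x * t x" unfolding g_def by (intro tendsto_mult tendsto_const fkl)
    also have "ph x * f x * t x = (t x)\<^sup>2 * (ph x / pr x)" by (simp add: f_def power2_eq_square)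
    finally show ?thesis .
  qed
  have Hle: "Hc \<le> ennreal (e / c0)"
    unfolding Hc_def t_def[symmetric]
  proof (rule fatou_le[OF _ _ _ tendsto_const])
    show "(\<lambda>x. ennreal (g k x * t x)) \<in> borel_measurable lborel" for k unfolding g_def by measurable
    show "AE x in lborel. (\<lambda>k. ennreal (g k x * t x)) \<longlonglongrightarrow> ennreal ((t x)\<^sup>2 * (ph x / pr x))"
      by (intro AE_I2 tendsto_ennrealI gl)
    have "hk k \<le> e / c0" for k
    proof -
      have "0 \<le> c0 * (enn2real (D k) / 2)" using c0_pos by simp
      then have "hk k * c0 \<le> e" using main[of k] by (simp add: mult.commute)
      then show ?thesis using c0_pos by (simp add: le_divide_eq)
    qed
    then show "\<forall>\<^sub>F k in sequentially. (\<integral>\<^sup>+x. ennreal (g k x * t x) \<partial>lborel) \<le> ennreal (e / c0)"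
      unfolding nhk by (intro always_eventually allI ennreal_leI; blast)
  qed
  have "ennreal c0 * Hc \<le> ennreal c0 * ennreal (e / c0)" by (rule mult_left_mono[OF Hle]) simp
  also have "\<dots> = ennreal e" using c0_pos by (simp flip: ennreal_mult')
  finally show "ennreal c0 * Hc \<le> EW u" unfolding e(1) .
  assume eq: "EW u = ennreal c0 * Hc"
  obtain h where h: "Hc = ennreal h" "h \<ge> 0" using le_less_trans[OF Hle ennreal_less_top] by (cases Hc) auto
  have eh: "e = c0 * h" using eq h(2) e(2) c0_pos unfolding e(1) h(1) by (simp flip: ennreal_mult')
  have iH: "integrable lborel (\<lambda>x. (t x)\<^sup>2 * (ph x / pr x))"
    using h(1) unfolding Hc_def t_def[symmetric] by (intro integrableI_nonneg AE_I2) simp_all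
  have hI: "(\<integral>x. (t x)\<^sup>2 * (ph x / pr x) \<partial>lborel) = h"
    using h unfolding Hc_def t_def[symmetric] by (subst integral_eq_nn_integral) simp_all
  have hl: "hk \<longlonglongrightarrow> h"
    unfolding hk_def hI[symmetric]
  proof (rule integral_dominated_convergence[OF _ _ iH])
    show "(\<lambda>x. (t x)\<^sup>2 * (ph x / pr x)) \<in> borel_measurable lborel" by measurable
    show "(\<lambda>x. g k x * t x) \<in> borel_measurable lborel" for k unfolding g_def by measurable
    show "AE x in lborel. (\<lambda>k. g k x * t x) \<longlonglongrightarrow> (t x)\<^sup>2 * (ph x / pr x)" by (intro AE_I2 gl)
    show "AE x in lborel. norm (g k x * t x) \<le> (t x)\<^sup>2 * (ph x / pr x)" for k
      unfolding gt by (intro AE_I2) (simp add: indicator_def)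
  qed
  \<comment> \<open>Equality forces \<open>D k \<le> 2 (h - hk k)\<close>, which tends to 0; Fatou
    then shows that the defect of the untruncated \<open>f\<close> vanishes.\<close>
  define E where "E F y = ph (fst y) * ph (snd y) * kx (fst y) (snd y) * (F (fst y) - F (snd y))\<^sup>2" for F :: "'v \<times> 'z \<Rightarrow> real" and y
  have [measurable]: "E F \<in> borel_measurable borel" if [measurable]: "F \<in> borel_measurable borel" for F unfolding E_def by measurable
  have "(\<integral>\<^sup>+y. ennreal (E f y) \<partial>lborel) \<le> 0"
  proof (rule fatou_le)
    show "(\<lambda>y. ennreal (E (fk k) y)) \<in> borel_measurable lborel" for k by measurable
    show "AE y in lborel. (\<lambda>k. ennreal (E (fk k) y)) \<longlonglongrightarrow> ennreal (E f y)"
      unfolding E_def by (intro AE_I2 tendsto_ennrealI tendsto_mult tendsto_power tendsto_diff tendsto_const fkl)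
    have "(\<lambda>k. ennreal (2 * (h - hk k))) \<longlonglongrightarrow> ennreal (2 * (h - h))" by (intro tendsto_ennrealI tendsto_intros hl)
    then show "(\<lambda>k. ennreal (2 * (h - hk k))) \<longlonglongrightarrow> 0" by simp
    have "(\<integral>\<^sup>+y. ennreal (E (fk k) y) \<partial>lborel) \<le> ennreal (2 * (h - hk k))" for k
    proof -
      have "(\<integral>\<^sup>+y. ennreal (E (fk k) y) \<partial>lborel) = D k" unfolding D_def by (subst nn_integral_lborel_pair) (simp_all add: E_def)
      also have "\<dots> = ennreal (enn2real (D k))" using Dk(1) by simp
      also have "\<dots> \<le> ennreal (2 * (h - hk k))"
      proof (rule ennreal_leI)
        have "c0 * (hk k + enn2real (D k) / 2) \<le> c0 * h" using main[of k] unfolding eh distrib_left .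
        then have "hk k + enn2real (D k) / 2 \<le> h" using c0_pos by simp
        then show "enn2real (D k) \<le> 2 * (h - hk k)" by simp
      qed
      finally show ?thesis .
    qed
    then show "\<forall>\<^sub>F k in sequentially. (\<integral>\<^sup>+y. ennreal (E (fk k) y) \<partial>lborel) \<le> ennreal (2 * (h - hk k))" by (rule always_eventually[OF allI])
  qed
  then have "(\<integral>\<^sup>+x. (\<integral>\<^sup>+w. ennreal (E f (x, w)) \<partial>lborel) \<partial>lborel) = 0" by (subst (asm) nn_integral_lborel_pair) simp_all
  then have "AE x in lborel. (\<integral>\<^sup>+w. ennreal (E f (x, w)) \<partial>lborel) = 0" by (subst (asm) nn_integral_0_iff_AE) simp_all
  with AE_nonzero have "AE x in lborel. x \<noteq> 0 \<and> (\<integral>\<^sup>+w. ennreal (E f (x, w)) \<partial>lborel) = 0" by eventually_elim simp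
  from ex_of_AE_lborel[OF this] obtain x0 where x0: "x0 \<noteq> 0" "(\<integral>\<^sup>+w. ennreal (E f (x0, w)) \<partial>lborel) = 0" by blast
  \<comment> \<open>At almost every \<open>w\<close> the factors before the square are positive, so
    \<open>f w = f x0\<close>. The weighted norm becomes the square of \<open>f x0\<close> times a
    divergent integral, and its finiteness leaves \<open>f x0 = 0\<close>.\<close>
  have "AE w in lborel. ennreal (E f (x0, w)) = 0" using x0(2) by (subst (asm) nn_integral_0_iff_AE) simp_all
  then have "AE w in lborel. ennreal ((t w)\<^sup>2 * (ph w / pr w)) = ennreal ((f x0)\<^sup>2) * ennreal (ph w * pr w)"
    using AE_nonzero AE_gm_nonzero[of x0]
  proof eventually_elim
    fix w assume w: "ennreal (E f (x0, w)) = 0" "w \<noteq> 0" "gm (ginv w) x0 \<noteq> 0"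
    have pos: "0 < ph x0 * ph w * kx x0 w" using x0(1) w(2,3) by (intro mult_pos_pos ph_pos kx_pos)
    have "ph x0 * ph w * kx x0 w * (f x0 - f w)\<^sup>2 \<le> 0" using w(1) by (simp add: E_def ennreal_eq_0_iff)
    then have "\<not> 0 < (f x0 - f w)\<^sup>2" using mult_pos_pos[OF pos] by (meson not_less)
    then have "f x0 = f w" by simp
    then have "(t w)\<^sup>2 * (ph w / pr w) = (f x0)\<^sup>2 * (ph w * pr w)" using w(2) by (simp add: f_def power2_eq_square)
    then show "ennreal ((t w)\<^sup>2 * (ph w / pr w)) = ennreal ((f x0)\<^sup>2) * ennreal (ph w * pr w)" by (simp add: ennreal_mult')
  qed
  then have "Hc = (\<integral>\<^sup>+w. ennreal ((f x0)\<^sup>2) * ennreal (ph w * pr w) \<partial>lborel)" unfolding Hc_def t_def[symmetric] by (rule nn_integral_cong_AE)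
  also have "\<dots> = ennreal ((f x0)\<^sup>2) * \<top>" unfolding ph_pr_infinite[symmetric] by (rule nn_integral_cmult) measurable
  finally have HT: "Hc = ennreal ((f x0)\<^sup>2) * \<top>" .
  have "f x0 = 0"
  proof (rule ccontr)
    assume "f x0 \<noteq> 0"
    then have "Hc = \<top>" unfolding HT by (simp add: ennreal_mult_top)
    then show False using h(1) by simp
  qed
  then show "EW u = 0" unfolding eq HT by simp
qed

end

section \<open>Sharpness\<close>

lemma ennreal_enn2real_le: "ennreal (enn2real x) \<le> x" by (cases x) auto

context h_type begin

text \<open>Cutting \<open>phi\<close> to an annulus gives a bounded density of bounded support,
  whose potential is the trial function.\<close>

definition gw :: "real \<Rightarrow> real \<Rightarrow> 'v \<times> 'z \<Rightarrow> real" where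
  "gw \<alpha> \<beta> w = ph w * indicator {w. \<alpha> \<le> hnorm w \<and> hnorm w < \<beta>} w"

definition ug :: "real \<Rightarrow> real \<Rightarrow> 'v \<times> 'z \<Rightarrow> real" where "ug \<alpha> \<beta> x = UU (gw \<alpha> \<beta>) 0 x"

lemma gw_meas [measurable]: "gw \<alpha> \<beta> \<in> borel_measurable borel" unfolding gw_def by measurable
lemma ug_meas [measurable]: "ug \<alpha> \<beta> \<in> borel_measurable borel" unfolding ug_def by measurable
lemma gw_nonneg [simp]: "0 \<le> gw \<alpha> \<beta> w" by (simp add: gw_def)
lemma gw_le: "gw \<alpha> \<beta> w \<le> ph w" by (simp add: gw_def indicator_def)

lemma gw_nice: assumes "\<alpha> > 0" "\<beta> > 0" shows "nice (gw \<alpha> \<beta>) \<beta> (\<alpha> powr (- bb))"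
  unfolding nice_def
proof (intro conjI allI impI)
  show "gw \<alpha> \<beta> \<in> borel_measurable borel" by (rule gw_meas)
  fix x
  have "\<alpha> \<le> hnorm x \<Longrightarrow> ph x \<le> \<alpha> powr (- bb)" unfolding ph_eq using assms bb(2) by (intro powr_mono2') auto
  then show "\<bar>gw \<alpha> \<beta> x\<bar> \<le> \<alpha> powr (- bb)" by (simp add: gw_def indicator_def)
  show "gw \<alpha> \<beta> x = 0" if "hnorm x > \<beta>" using that by (simp add: gw_def indicator_def)
qed (use assms in simp_all)

lemma gw_integrable: assumes "\<alpha> > 0" "\<beta> > 0" shows "integrable lborel (\<lambda>w. gw \<alpha> \<beta> w * kx x w)"
  by (rule UU_integrable[OF gw_nice[OF assms]]) simp

lemma ug_nonneg: "0 \<le> ug \<alpha> \<beta> x" unfolding ug_def UU_def by (intro Bochner_Integration.integral_nonneg mult_nonneg_nonneg) simp_all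

lemma ug_mono:
  assumes "0 < \<alpha>'" "\<alpha>' \<le> \<alpha>" "0 < \<beta>" "\<beta> \<le> \<beta>'" shows "ug \<alpha> \<beta> x \<le> ug \<alpha>' \<beta>' x"
  unfolding ug_def UU_def
proof (rule integral_mono)
  show "integrable lborel (\<lambda>w. gw \<alpha> \<beta> w * kx x w)" "integrable lborel (\<lambda>w. gw \<alpha>' \<beta>' w * kx x w)"
    using assms by (intro gw_integrable; simp)+
  fix w
  have "gw \<alpha> \<beta> w \<le> gw \<alpha>' \<beta>' w" using assms by (simp add: gw_def indicator_def)
  then show "gw \<alpha> \<beta> w * kx x w \<le> gw \<alpha>' \<beta>' w * kx x w" by (rule mult_right_mono) simp
qed

lemma ug_dil: assumes d: "d > 0" shows "ug (d * \<alpha>) (d * \<beta>) (dil d x) = d powr (2 * s - bb) * ug \<alpha> \<beta> x"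
proof -
  have g: "gw (d * \<alpha>) (d * \<beta>) (dil d w) = d powr (- bb) * gw \<alpha> \<beta> w" for w
    using d by (simp add: gw_def ph_dil hnorm_dil indicator_def)
  have "ug (d * \<alpha>) (d * \<beta>) (dil d x) = d powr Q * (\<integral>w. gw (d * \<alpha>) (d * \<beta>) (dil d w) * kx (dil d x) (dil d w) \<partial>lborel)"
    unfolding ug_def UU_def by (rule integral_dil[OF _ d]) measurable
  also have "\<dots> = d powr Q * (\<integral>w. d powr (- bb) * d powr (2 * s - Q) * (gw \<alpha> \<beta> w * kx x w) \<partial>lborel)"
    unfolding g kx_dil[OF d] by (simp only: mult_ac)
  also have "\<dots> = d powr Q * (d powr (- bb) * d powr (2 * s - Q)) * ug \<alpha> \<beta> x" by (simp add: ug_def UU_def)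
  also have "d powr Q * (d powr (- bb) * d powr (2 * s - Q)) = d powr (2 * s - bb)" unfolding powr_add[symmetric] by simp
  finally show ?thesis .
qed

lemma ug_le_pp: "ennreal (ug \<alpha> \<beta> x) \<le> pp x"
proof -
  have "ug \<alpha> \<beta> x = enn2real (\<integral>\<^sup>+w. ennreal (gw \<alpha> \<beta> w * kx x w) \<partial>lborel)"
    unfolding ug_def UU_def by (rule integral_eq_nn_integral) simp_all
  also have "ennreal \<dots> \<le> (\<integral>\<^sup>+w. ennreal (gw \<alpha> \<beta> w * kx x w) \<partial>lborel)" by (rule ennreal_enn2real_le)
  also have "\<dots> \<le> pp x" unfolding pp_def by (intro nn_integral_mono ennreal_leI mult_right_mono gw_le) simp
  finally show ?thesis .
qed

text \<open>The potential of the cut density lies below the full one, so the form is at most the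
  mass of \<open>j\<close> dyadic annuli.\<close>

lemma Qf_gw_le: "ennreal (Qf (gw 1 (2 ^ j))) \<le> of_nat j * a0"
proof -
  have "Qf (gw 1 (2 ^ j)) = enn2real (\<integral>\<^sup>+x. ennreal (gw 1 (2 ^ j) x * ug 1 (2 ^ j) x) \<partial>lborel)"
    unfolding Qf_def ug_def[symmetric] by (rule integral_eq_nn_integral) (simp_all add: ug_nonneg)
  also have "ennreal \<dots> \<le> (\<integral>\<^sup>+x. ennreal (gw 1 (2 ^ j) x * ug 1 (2 ^ j) x) \<partial>lborel)" by (rule ennreal_enn2real_le)
  also have "\<dots> \<le> (\<integral>\<^sup>+x. ennreal (ph x) * pp x * indicator {x. 1 \<le> hnorm x \<and> hnorm x < 2 ^ j} x \<partial>lborel)"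
  proof (rule nn_integral_mono)
    fix x :: "'v \<times> 'z"
    have "ennreal (ph x * ug 1 (2 ^ j) x) \<le> ennreal (ph x) * pp x"
      using mult_left_mono[OF ug_le_pp, of "ennreal (ph x)" 1 "2 ^ j" x] by (simp add: ennreal_mult')
    then show "ennreal (gw 1 (2 ^ j) x * ug 1 (2 ^ j) x) \<le> ennreal (ph x) * pp x * indicator {x. 1 \<le> hnorm x \<and> hnorm x < 2 ^ j} x"
      by (simp add: gw_def indicator_def)
  qed
  also have "\<dots> = of_nat j * a0" by (rule shells_eq)
  finally show ?thesis .
qed

lemma ug_tendsto:
  assumes x: "pp x < \<top>" shows "(\<lambda>M. ug (1 / 2 ^ M) (2 ^ M) x) \<longlonglongrightarrow> pr x"
proof -
  have i: "integrable lborel (\<lambda>w. ph w * kx x w)" using x unfolding pp_def by (intro integrableI_nonneg AE_I2) simp_all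
  have p: "pr x = (\<integral>w. ph w * kx x w \<partial>lborel)" unfolding pr_def pp_def by (rule integral_eq_nn_integral[symmetric]) simp_all
  show ?thesis unfolding p ug_def UU_def
  proof (rule integral_dominated_convergence[OF _ _ i])
    show "(\<lambda>w. ph w * kx x w) \<in> borel_measurable lborel" by measurable
    show "(\<lambda>w. gw (1 / 2 ^ M) (2 ^ M) w * kx x w) \<in> borel_measurable lborel" for M by measurable
    show "AE w in lborel. (\<lambda>M. gw (1 / 2 ^ M) (2 ^ M) w * kx x w) \<longlonglongrightarrow> ph w * kx x w"
      using AE_nonzero
    proof eventually_elim
      fix w :: "'v \<times> 'z" assume "w \<noteq> 0"
      then have h: "hnorm w > 0" by simp
      have "(\<lambda>M. 1 / 2 ^ M :: real) \<longlonglongrightarrow> 0" by real_asymp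
      then have "\<forall>\<^sub>F M in sequentially. 1 / 2 ^ M < hnorm w" using h by (rule order_tendstoD)
      moreover have "filterlim (\<lambda>M. 2 ^ M :: real) at_top sequentially" by real_asymp
      then have "\<forall>\<^sub>F M in sequentially. hnorm w < 2 ^ M" by (simp add: filterlim_at_top_dense)
      ultimately have "\<forall>\<^sub>F M in sequentially. gw (1 / 2 ^ M) (2 ^ M) w * kx x w = ph w * kx x w"
        by eventually_elim (simp add: gw_def)
      then show "(\<lambda>M. gw (1 / 2 ^ M) (2 ^ M) w * kx x w) \<longlonglongrightarrow> ph w * kx x w" by (rule tendsto_eventually)
    qed
    show "AE w in lborel. norm (gw (1 / 2 ^ M) (2 ^ M) w * kx x w) \<le> ph w * kx x w" for M
      by (intro AE_I2) (simp add: abs_mult mult_right_mono gw_le)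
  qed
qed

text \<open>The weighted norm on the unit annulus of the potential whose density is cut
  \<open>M\<close> dyadic steps away on either side; for large \<open>M\<close> it approximates
  \<open>a0\<close>.\<close>

definition IM :: "nat \<Rightarrow> ennreal" where
  "IM M = (\<integral>\<^sup>+x. ennreal ((ug (1 / 2 ^ M) (2 ^ M) x)\<^sup>2 * (ph x / pr x)) * indicator {x. 1 \<le> hnorm x \<and> hnorm x < 2} x \<partial>lborel)"

text \<open>Rescaled to shell \<open>i\<close>, the window of \<open>M\<close> steps on either side
  lies within \<open>1 \<le> hnorm w < 2^j\<close> by the two index conditions, and a larger density
  has a larger potential.\<close>

lemma shell_IM:
  assumes "M \<le> i" "i + M \<le> j"
  shows "IM M \<le> (\<integral>\<^sup>+x. ennreal ((ug 1 (2 ^ j) x)\<^sup>2 * (ph x / pr x)) * indicator {x. 2 ^ i \<le> hnorm x \<and> hnorm x < 2 * 2 ^ i} x \<partial>lborel)"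
proof -
  define d :: real where "d = 2 ^ i"
  have d: "d > 0" by (simp add: d_def)
  have "IM M = (\<integral>\<^sup>+x. ennreal ((ug (d * (1 / 2 ^ M)) (d * 2 ^ M) x)\<^sup>2 * (ph x / pr x)) * indicator {x. d \<le> hnorm x \<and> hnorm x < 2 * d} x \<partial>lborel)"
    unfolding IM_def
  proof (rule annulus_scale[symmetric, OF _ d])
    fix x
    have e: "d powr (2 * s - bb) > 0" using d by simp
    have "(ug (d * (1 / 2 ^ M)) (d * 2 ^ M) (dil d x))\<^sup>2 * (ph (dil d x) / pr (dil d x))
      = (d powr (2 * s - bb) * d powr (- bb)) * ((ug (1 / 2 ^ M) (2 ^ M) x)\<^sup>2 * (ph x / pr x))"
      unfolding ug_dil[OF d] ph_dil[OF d] pr_dil[OF d] using e by (simp add: power2_eq_square)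
    also have "d powr (2 * s - bb) * d powr (- bb) = d powr (- Q)" unfolding powr_add[symmetric] bb(1) by simp
    finally have eq: "(ug (d * (1 / 2 ^ M)) (d * 2 ^ M) (dil d x))\<^sup>2 * (ph (dil d x) / pr (dil d x))
      = d powr (- Q) * ((ug (1 / 2 ^ M) (2 ^ M) x)\<^sup>2 * (ph x / pr x))" .
    show "ennreal ((ug (d * (1 / 2 ^ M)) (d * 2 ^ M) (dil d x))\<^sup>2 * (ph (dil d x) / pr (dil d x)))
      = ennreal (d powr (- Q)) * ennreal ((ug (1 / 2 ^ M) (2 ^ M) x)\<^sup>2 * (ph x / pr x))"
      unfolding eq by (rule ennreal_mult') simp
  qed measurable
  also have "\<dots> \<le> (\<integral>\<^sup>+x. ennreal ((ug 1 (2 ^ j) x)\<^sup>2 * (ph x / pr x)) * indicator {x. d \<le> hnorm x \<and> hnorm x < 2 * d} x \<partial>lborel)"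
  proof (intro nn_integral_mono mult_right_mono)
    fix x :: "'v \<times> 'z"
    have "(2::real) ^ M \<le> 2 ^ i" "(2::real) ^ (i + M) \<le> 2 ^ j" using assms by (intro power_increasing; simp)+
    then have "ug (d * (1 / 2 ^ M)) (d * 2 ^ M) x \<le> ug 1 (2 ^ j) x"
      unfolding d_def by (intro ug_mono) (simp_all add: le_divide_eq power_add)
    then have "(ug (d * (1 / 2 ^ M)) (d * 2 ^ M) x)\<^sup>2 \<le> (ug 1 (2 ^ j) x)\<^sup>2" using ug_nonneg by (rule power_mono)
    then show "ennreal ((ug (d * (1 / 2 ^ M)) (d * 2 ^ M) x)\<^sup>2 * (ph x / pr x)) \<le> ennreal ((ug 1 (2 ^ j) x)\<^sup>2 * (ph x / pr x))"
      by (intro ennreal_leI mult_right_mono) simp_all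
  qed simp_all
  finally show ?thesis unfolding d_def .
qed

text \<open>The index condition keeps each of the \<open>k\<close> shells starting at
  \<open>2^M\<close> at a distance of \<open>M\<close> dyadic steps from both ends of the density,
  so each contributes at least \<open>IM M\<close>.\<close>

lemma shells_IM:
  "M + k + M \<le> j \<Longrightarrow> of_nat k * IM M \<le> (\<integral>\<^sup>+x. ennreal ((ug 1 (2 ^ j) x)\<^sup>2 * (ph x / pr x)) * indicator {x. 2 ^ M \<le> hnorm x \<and> hnorm x < 2 ^ (M + k)} x \<partial>lborel)"
proof (induction k)
  case (Suc k)
  let ?F = "\<lambda>x. ennreal ((ug 1 (2 ^ j) x)\<^sup>2 * (ph x / pr x))"
  have p: "(2::real) ^ M \<le> 2 ^ (M + k)" by (intro power_increasing) simp_all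
  have "of_nat (Suc k) * IM M = of_nat k * IM M + IM M" by (simp add: distrib_right add.commute)
  also have "\<dots> \<le> (\<integral>\<^sup>+x. ?F x * indicator {x. 2 ^ M \<le> hnorm x \<and> hnorm x < 2 ^ (M + k)} x \<partial>lborel)
    + (\<integral>\<^sup>+x. ?F x * indicator {x. 2 ^ (M + k) \<le> hnorm x \<and> hnorm x < 2 * 2 ^ (M + k)} x \<partial>lborel)"
    using Suc by (intro add_mono Suc.IH shell_IM) simp_all
  also have "\<dots> = (\<integral>\<^sup>+x. ?F x * indicator {x. 2 ^ M \<le> hnorm x \<and> hnorm x < 2 ^ (M + k)} x
      + ?F x * indicator {x. 2 ^ (M + k) \<le> hnorm x \<and> hnorm x < 2 * 2 ^ (M + k)} x \<partial>lborel)"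
    by (rule nn_integral_add[symmetric]) measurable
  also have "\<dots> = (\<integral>\<^sup>+x. ?F x * indicator {x. 2 ^ M \<le> hnorm x \<and> hnorm x < 2 ^ (M + Suc k)} x \<partial>lborel)"
  proof (rule nn_integral_cong)
    fix x :: "'v \<times> 'z"
    have p0: "0 < (2::real) ^ (M + k)" by simp
    show "?F x * indicator {x. 2 ^ M \<le> hnorm x \<and> hnorm x < 2 ^ (M + k)} x + ?F x * indicator {x. 2 ^ (M + k) \<le> hnorm x \<and> hnorm x < 2 * 2 ^ (M + k)} x
      = ?F x * indicator {x. 2 ^ M \<le> hnorm x \<and> hnorm x < 2 ^ (M + Suc k)} x"
    proof (cases "hnorm x < 2 ^ (M + k)")
      case True
      then have "hnorm x < 2 * 2 ^ (M + k)" using p0 by linarith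
      with True show ?thesis by (simp add: indicator_def)
    next
      case False
      then have "2 ^ M \<le> hnorm x" using p by linarith
      with False show ?thesis by (simp add: indicator_def)
    qed
  qed
  finally show ?case .
qed simp

abbreviation HW where "HW u \<equiv> \<integral>\<^sup>+x. ennreal ((W0_trace u x)\<^sup>2 * weight br n m s x) \<partial>lborel"

text \<open>With \<open>j = k + 2 M\<close> the trial potential gives
  \<open>b * k * IM M \<le> c0 * (k + 2 M) * a0\<close>. Letting \<open>k\<close> tend to infinity
  at fixed \<open>M\<close> removes the \<open>2 M\<close> boundary shells; then \<open>M\<close>
  tends to infinity, Fatou replaces \<open>IM M\<close> by \<open>a0\<close>, and this positive
  number cancels.\<close>

lemma sharp:
  assumes c': "\<And>u. u \<in> W0 br s \<Longrightarrow> ennreal c' * HW u \<le> EW u"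
  shows "c' \<le> c0 * C1 n m s"
proof (cases "c' > 0")
  case False
  have "0 < c0 * C1 n m s" using c0_pos C1_pos by simp
  with False show ?thesis by linarith
next
  case True
  note C1 = C1_pos
  \<comment> \<open>The competing constant relative to the weight \<open>ph / pr\<close>, freed from
    the normalisation of \<open>psi\<close>.\<close>
  define b where "b = c' / C1 n m s"
  have b: "b > 0" using True C1 by (simp add: b_def)
  have [measurable]: "weight br n m s \<in> borel_measurable borel" unfolding weight_eq[abs_def] by measurable
  have w0: "0 \<le> weight br n m s x" for x unfolding weight_eq using C1 by simp
  have T: "(\<integral>\<^sup>+x. ennreal ((f (x, 0))\<^sup>2 * (c' * weight br n m s x)) \<partial>lborel) \<le> EN (G0 f)" if f: "test_function f" for f
  proof -
    obtain u where u: "u \<in> W0 br s" "EW u = EN (G0 f)" "AE x in lborel. W0_trace u x = f (x, 0)" using test_function_W0[OF f] by blast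
    have [measurable]: "W0_trace u \<in> borel_measurable borel" using W0_trace[OF u(1)] unfolding is_trace_def by blast
    have "(\<integral>\<^sup>+x. ennreal ((f (x, 0))\<^sup>2 * (c' * weight br n m s x)) \<partial>lborel) = (\<integral>\<^sup>+x. ennreal c' * ennreal ((W0_trace u x)\<^sup>2 * weight br n m s x) \<partial>lborel)"
    proof (rule nn_integral_cong_AE, use u(3) in eventually_elim)
      fix x assume x: "W0_trace u x = f (x, 0)"
      show "ennreal ((f (x, 0))\<^sup>2 * (c' * weight br n m s x)) = ennreal c' * ennreal ((W0_trace u x)\<^sup>2 * weight br n m s x)"
        unfolding x using True by (simp add: mult_ac flip: ennreal_mult')
    qed
    also have "\<dots> = ennreal c' * HW u" by (rule nn_integral_cmult) measurable
    also have "\<dots> \<le> EW u" by (rule c'[OF u(1)])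
    finally show ?thesis unfolding u(2) .
  qed
  obtain q where q: "a0 = ennreal q" "q > 0" using a0_pos a0_finite by (cases a0) (auto simp: top.not_eq_extremum[symmetric])
  have main: "ennreal b * (of_nat k * IM M) \<le> ennreal (c0 * (real (k + 2 * M) * q))" for k M
  proof -
    define j where "j = k + 2 * M"
    let ?F = "\<lambda>x. ennreal ((ug 1 (2 ^ j) x)\<^sup>2 * (ph x / pr x))"
    have "of_nat k * IM M \<le> (\<integral>\<^sup>+x. ?F x * indicator {x. 2 ^ M \<le> hnorm x \<and> hnorm x < 2 ^ (M + k)} x \<partial>lborel)"
      by (rule shells_IM) (simp add: j_def)
    also have "\<dots> \<le> (\<integral>\<^sup>+x. ?F x \<partial>lborel)" by (intro nn_integral_mono) (simp add: indicator_def)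
    finally have "ennreal b * (of_nat k * IM M) \<le> ennreal b * (\<integral>\<^sup>+x. ?F x \<partial>lborel)" by (rule mult_left_mono) simp
    also have "\<dots> = (\<integral>\<^sup>+x. ennreal b * ?F x \<partial>lborel)" by (rule nn_integral_cmult[symmetric]) measurable
    also have "\<dots> = (\<integral>\<^sup>+x. ennreal ((UU (gw 1 (2 ^ j)) 0 x)\<^sup>2 * (c' * weight br n m s x)) \<partial>lborel)"
    proof (rule nn_integral_cong)
      fix x
      have "ennreal b * ?F x = ennreal (b * ((ug 1 (2 ^ j) x)\<^sup>2 * (ph x / pr x)))" by (rule ennreal_mult'[symmetric]) (use b in simp)
      also have "b * ((ug 1 (2 ^ j) x)\<^sup>2 * (ph x / pr x)) = (UU (gw 1 (2 ^ j)) 0 x)\<^sup>2 * (c' * weight br n m s x)"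
        by (simp add: b_def ug_def weight_eq)
      finally show "ennreal b * ?F x = ennreal ((UU (gw 1 (2 ^ j)) 0 x)\<^sup>2 * (c' * weight br n m s x))" .
    qed
    also have "\<dots> \<le> ennreal (c0 * Qf (gw 1 (2 ^ j)))"
      by (rule cutoff_limit_inequality[OF gw_nice _ T]) simp_all
    also have "\<dots> = ennreal c0 * ennreal (Qf (gw 1 (2 ^ j)))" using c0_pos by (intro ennreal_mult') simp
    also have "\<dots> \<le> ennreal c0 * (of_nat j * a0)" by (rule mult_left_mono[OF Qf_gw_le]) simp
    also have "\<dots> = ennreal (c0 * (real j * q))" unfolding q(1) using q(2) c0_pos by (simp add: ennreal_mult' ennreal_of_nat_eq_real_of_nat)
    finally show ?thesis unfolding j_def .
  qed
  have IMb: "IM M \<le> ennreal (c0 * q / b)" for M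
  proof -
    \<comment> \<open>The instance \<open>k = 1\<close> shows that \<open>IM M\<close> is finite,
      after which real arithmetic applies.\<close>
    have "ennreal b * IM M \<le> ennreal (c0 * (real (1 + 2 * M) * q))" using main[of 1 M] by simp
    then have "ennreal b * IM M < \<top>" by (rule le_less_trans) simp
    then have "IM M \<noteq> \<top>" using b by (auto simp: ennreal_mult_top)
    then obtain r where r: "IM M = ennreal r" "r \<ge> 0" by (cases "IM M") auto
    have k: "b * (real k * r) \<le> c0 * (real (k + 2 * M) * q)" for k
    proof -
      have "ennreal (b * (real k * r)) \<le> ennreal (c0 * (real (k + 2 * M) * q))"
        using main[of k M] b r(2) unfolding r(1) by (simp add: ennreal_mult' ennreal_of_nat_eq_real_of_nat)
      then show ?thesis using c0_pos q(2) by (simp add: ennreal_le_iff)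
    qed
    have "b * r \<le> c0 * q"
    proof (rule ccontr)
      assume "\<not> ?thesis"
      then have "0 < b * r - c0 * q" by simp
      then obtain k :: nat where "2 * real M * (c0 * q) < real k * (b * r - c0 * q)" using reals_Archimedean3 by blast
      moreover have "real k * (b * r - c0 * q) \<le> 2 * real M * (c0 * q)" using k[of k] by (simp add: algebra_simps)
      ultimately show False by linarith
    qed
    then have "r \<le> c0 * q / b" using b by (simp add: le_divide_eq mult.commute)
    then show ?thesis unfolding r(1) by (rule ennreal_leI)
  qed
  have "a0 = (\<integral>\<^sup>+x. ennreal (ph x * pr x) * indicator {x. 1 \<le> hnorm x \<and> hnorm x < 2} x \<partial>lborel)"
    unfolding a0_def by (rule nn_integral_cong_AE, use AE_pp_pr in eventually_elim) (simp add: ennreal_mult')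
  also have "\<dots> \<le> ennreal (c0 * q / b)"
  proof (rule fatou_le[OF _ _ _ tendsto_const])
    let ?I = "\<lambda>x :: 'v \<times> 'z. indicator {x. 1 \<le> hnorm x \<and> hnorm x < 2} x :: ennreal"
    show "(\<lambda>x. ennreal ((ug (1 / 2 ^ M) (2 ^ M) x)\<^sup>2 * (ph x / pr x)) * ?I x) \<in> borel_measurable lborel" for M by measurable
    show "AE x in lborel. (\<lambda>M. ennreal ((ug (1 / 2 ^ M) (2 ^ M) x)\<^sup>2 * (ph x / pr x)) * ?I x) \<longlonglongrightarrow> ennreal (ph x * pr x) * ?I x"
      using AE_pp_finite
    proof eventually_elim
      fix x assume "pp x < \<top>"
      then have "(\<lambda>M. (ug (1 / 2 ^ M) (2 ^ M) x)\<^sup>2 * (ph x / pr x)) \<longlonglongrightarrow> (pr x)\<^sup>2 * (ph x / pr x)"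
        by (intro tendsto_mult tendsto_power tendsto_const ug_tendsto)
      also have "(pr x)\<^sup>2 * (ph x / pr x) = ph x * pr x" by (simp add: power2_eq_square)
      finally have l: "(\<lambda>M. ennreal ((ug (1 / 2 ^ M) (2 ^ M) x)\<^sup>2 * (ph x / pr x))) \<longlonglongrightarrow> ennreal (ph x * pr x)" by (rule tendsto_ennrealI)
      show "(\<lambda>M. ennreal ((ug (1 / 2 ^ M) (2 ^ M) x)\<^sup>2 * (ph x / pr x)) * ?I x) \<longlonglongrightarrow> ennreal (ph x * pr x) * ?I x"
        using l by (cases "1 \<le> hnorm x \<and> hnorm x < 2") simp_all
    qed
    show "\<forall>\<^sub>F M in sequentially. (\<integral>\<^sup>+x. ennreal ((ug (1 / 2 ^ M) (2 ^ M) x)\<^sup>2 * (ph x / pr x)) * ?I x \<partial>lborel) \<le> ennreal (c0 * q / b)"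
      using IMb unfolding IM_def by (intro always_eventually allI; blast)
  qed
  finally have "q \<le> c0 * q / b" unfolding q(1) using q(2) c0_pos b by (simp add: ennreal_le_iff)
  then have "q * b \<le> q * c0" using b by (simp add: le_divide_eq mult.commute)
  then have "b \<le> c0" using q(2) by simp
  then show ?thesis using C1 by (simp add: b_def divide_le_eq)
qed

text \<open>The normalisation inside \<open>psi\<close> cancels against the factor \<open>C1\<close>
  of the constant, so the inequality can be proved with \<open>ph / pr\<close> and \<open>c0\<close>
  alone.\<close>

lemma weighted_trace_integral:
  assumes u: "u \<in> W0 br s"
  shows "ennreal (c0 * C1 n m s) * HW u
    = ennreal c0 * (\<integral>\<^sup>+x. ennreal ((W0_trace u x)\<^sup>2 * (ph x / pr x)) \<partial>lborel)"
proof -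
  note C1 = C1_pos
  have [measurable]: "W0_trace u \<in> borel_measurable borel" using W0_trace[OF u] unfolding is_trace_def by blast
  have "HW u = (\<integral>\<^sup>+x. ennreal (1 / C1 n m s) * ennreal ((W0_trace u x)\<^sup>2 * (ph x / pr x)) \<partial>lborel)"
    unfolding weight_eq using C1 by (intro nn_integral_cong) (simp add: mult_ac flip: ennreal_mult')
  also have "\<dots> = ennreal (1 / C1 n m s) * (\<integral>\<^sup>+x. ennreal ((W0_trace u x)\<^sup>2 * (ph x / pr x)) \<partial>lborel)" by (rule nn_integral_cmult) measurable
  also have "ennreal (c0 * C1 n m s) * \<dots> = ennreal (c0 * C1 n m s * (1 / C1 n m s)) * (\<integral>\<^sup>+x. ennreal ((W0_trace u x)\<^sup>2 * (ph x / pr x)) \<partial>lborel)"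
    unfolding mult.assoc[symmetric] using C1 c0_pos by (subst ennreal_mult[symmetric]) simp_all
  also have "c0 * C1 n m s * (1 / C1 n m s) = c0" using C1 by simp
  finally show ?thesis .
qed

end

theorem theorem1p5:
  fixes br :: "'v::euclidean_space \<Rightarrow> 'v \<Rightarrow> 'z::euclidean_space"
    and n m :: nat and s :: real
  assumes "H_type br" and "DIM('v) = 2 * n" and "DIM('z) = m"
    and "0 < s" and "s < 1"
  shows
    "let c = 2 powr (1 - 2 * s) * (Gamma (1 - s) / Gamma s) * C2 n m s;
         E = (\<lambda>u. energy s (W0_grad br s u));
         H = (\<lambda>u. \<integral>\<^sup>+x. ennreal ((W0_trace u x)\<^sup>2 * weight br n m s x) \<partial>lborel)
     in (\<forall>\<delta>>0. \<forall>x. weight br n m s (dil \<delta> x) = \<delta> powr (- 2 * s) * weight br n m s x) \<and>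
        (\<forall>u \<in> W0 br s. E u \<ge> ennreal c * H u) \<and>
        (\<forall>c'. (\<forall>u \<in> W0 br s. E u \<ge> ennreal c' * H u) \<longrightarrow> c' \<le> c) \<and>
        (\<forall>u \<in> W0 br s. u \<noteq> W0_zero br s \<longrightarrow> E u \<noteq> ennreal c * H u)"
proof -
  interpret h_type br n m s by unfold_locales (rule assms)+
  show ?thesis unfolding Let_def c0_C1[symmetric]
  proof (intro conjI ballI allI impI)
    fix \<delta> :: real and x assume "\<delta> > 0"
    then show "weight br n m s (dil \<delta> x) = \<delta> powr (- 2 * s) * weight br n m s x" by (rule weight_dil)
  next
    fix u assume u: "u \<in> W0 br s"
    show "ennreal (c0 * C1 n m s) * HW u \<le> EW u"
      unfolding weighted_trace_integral[OF u] by (rule hardy(1)[OF u])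
  next
    fix c' assume "\<forall>u \<in> W0 br s. ennreal c' * HW u \<le> EW u"
    then show "c' \<le> c0 * C1 n m s" by (intro sharp) blast
  next
    fix u assume u: "u \<in> W0 br s" and "u \<noteq> W0_zero br s"
    then have "EW u \<noteq> 0" using EW_zero by blast
    then show "EW u \<noteq> ennreal (c0 * C1 n m s) * HW u"
      unfolding weighted_trace_integral[OF u] using hardy(2)[OF u] by blast
  qed
qed

end
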